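(* Let $\varphi$ be a growth function and $(\varphi,q,s)$ an admissible triplet. Suppose $T$ is a linear or positive sublinear operator which is bounded on $L^2(\mathbb{R}^n)$. If there exists $C>0$ such that for every $\lambda\in(0,\infty)$ and every multiple $b$ of a $(\varphi,q,s)$-atom associated with a ball $B\subset\mathbb{R}^n$, $$\int_{\mathbb{R}^n}\varphi\Big(x,\frac{|T(b)(x)|}{\lambda}\Big)dx\le C\,\varphi\Big(B,\frac{\|b\|_{L^q_\varphi(B)}}{\lambda}\Big),$$ then $T$ extends uniquely to a bounded operator from $H^\varphi(\mathbb{R}^n)$ to $L^\varphi(\mathbb{R}^n)$.
   Context: Musielak–Orlicz function: $\varphi:\mathbb{R}^n\times[0,\infty)\to[0,\infty)$ with $\varphi(x,\cdot)$ an Orlicz function (nondecreasing, vanishing only at $0$, tending to $\infty$) for each $x$ and $\varphi(\cdot,t)$ measurable for each $t$. Uniformly lower/upper type $p$: $\varphi(x,st)\le Cs^p\varphi(x,t)$ for all $x,t$ and $s\in(0,1]$ / $s\in[1,\infty)$. $\varphi\in\mathbb{A}_q$ ($q>1$): $\sup_{B,\,t>0}\frac{1}{|B|}\int_B\varphi(x,t)dx\,(\frac1{|B|}\int_B\varphi(x,t)^{-1/(q-1)}dx)^{q-1}<\infty$ over balls $B$; $\varphi\in\mathbb{A}_1$: $\sup_{B,t}\frac{1}{|B|}\int_B\varphi(x,t)dx\cdot\operatorname{ess\,sup}_B\varphi(\cdot,t)^{-1}<\infty$; $\mathbb{A}_\infty=\bigcup_{q\ge1}\mathbb{A}_q$.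 A growth function is a Musielak–Orlicz function in $\mathbb{A}_\infty$, of uniformly lower type $p$ for some $p\in(0,1]$ and uniformly upper type $1$. $\varphi(E,t):=\int_E\varphi(x,t)dx$. $L^\varphi$: measurable $f$ with finite $\|f\|_{L^\varphi}:=\inf\{\lambda>0:\int\varphi(x,|f(x)|/\lambda)dx\le1\}$. Let $i(\varphi)$ be the supremum of $p$ such that $\varphi$ is of uniformly lower type $p$, $q(\varphi):=\inf\{q\ge1:\varphi\in\mathbb{A}_q\}$, $m(\varphi):=\lfloor n(q(\varphi)/i(\varphi)-1)\rfloor$. For $m\in\mathbb{N}$ let $\mathcal{S}_m$ be the set of Schwartz functions $\psi$ with $\sup_{|\alpha|\le m+1}\sup_x(1+|x|)^{(m+2)(n+1)}|\partial^\alpha\psi(x)|\le1$; for $f\in\mathcal{S}'$, $f^*(x):=\sup_{\psi\in\mathcal{S}_{m(\varphi)}}\sup_{|y-x|<t,\,t>0}|f*\psi_t(y)|$ with $\psi_t=t^{-n}\psi(\cdot/t)$. $H^\varphi:=\{f\in\mathcal{S}':f^*\in L^\varphi\}$, $\|f\|_{H^\varphi}:=\|f^*\|_{L^\varphi}$. A triplet $(\varphi,q,s)$ is admissible if $q\in(q(\varphi),\infty]$ and $s\in[m(\varphi),\infty)\cap\mathbb{N}$. A $(\varphi,q,s)$-atom is a measurable $a$ supported in a ball $B$ with $\|a\|_{L^q_\varphi(B)}\le\|\chi_B\|_{L^\varphi}^{-1}$ and $\int a(x)x^\gamma dx=0$ for all multi-indices $|\gamma|\le s$, where $\|a\|_{L^q_\varphi(B)}:=\sup_{t>0}[\varphi(B,t)^{-1}\int_B|a(x)|^q\varphi(x,t)dx]^{1/q}$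 if $q<\infty$ and $\|a\|_{L^\infty(B)}$ if $q=\infty$; a multiple of an atom associated with $B$ is $ca$ with $c$ a constant. A positive sublinear operator satisfies $T(f)\ge0$, $T(af)\le|a|T(f)$, $T(f+g)\le T(f)+T(g)$ pointwise. *)

theory Defs
  imports "HOL-Analysis.Analysis"
begin

type_synonym 'n fn = "real^'n \<Rightarrow> complex"

definition MO_function :: "(real^'n \<Rightarrow> real \<Rightarrow> real) \<Rightarrow> bool" where
  "MO_function \<phi> \<longleftrightarrow>
     (\<forall>x. (\<forall>t\<ge>0. \<phi> x t \<ge> 0) \<and> mono_on {0..} (\<phi> x)
        \<and> (\<forall>t\<ge>0. \<phi> x t = 0 \<longleftrightarrow> t = 0)
        \<and> filterlim (\<phi> x) at_top at_top)
   \<and> (\<forall>t\<ge>0. (\<lambda>x. \<phi> x t) \<in> borel_measurable lebesgue)"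

definition unif_lower_type :: "(real^'n \<Rightarrow> real \<Rightarrow> real) \<Rightarrow> real \<Rightarrow> bool" where
  "unif_lower_type \<phi> p \<longleftrightarrow> (\<exists>C. \<forall>x t s. t \<ge> 0 \<longrightarrow> 0 < s \<longrightarrow> s \<le> 1 \<longrightarrow>
      \<phi> x (s * t) \<le> C * s powr p * \<phi> x t)"

definition unif_upper_type :: "(real^'n \<Rightarrow> real \<Rightarrow> real) \<Rightarrow> real \<Rightarrow> bool" where
  "unif_upper_type \<phi> p \<longleftrightarrow> (\<exists>C. \<forall>x t s. t \<ge> 0 \<longrightarrow> s \<ge> 1 \<longrightarrow>
      \<phi> x (s * t) \<le> C * s powr p * \<phi> x t)"

definition avg_ball :: "(real^'n \<Rightarrow> real) \<Rightarrow> (real^'n) set \<Rightarrow> real" where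
  "avg_ball f B = (LINT x:B|lebesgue. f x) / measure lebesgue B"

text \<open>Muckenhoupt-type classes; finiteness of the supremum forces the integrals to be finite.
  For q = 1 the essential supremum condition is written out (ess sup g <= K iff g <= K a.e.).\<close>
definition A_class :: "(real^'n \<Rightarrow> real \<Rightarrow> real) \<Rightarrow> real \<Rightarrow> bool" where
  "A_class \<phi> q \<longleftrightarrow>
    (q = 1 \<and> (\<exists>K. \<forall>c r t. r > 0 \<longrightarrow> t > 0 \<longrightarrow>
        set_integrable lebesgue (ball c r) (\<lambda>x. \<phi> x t) \<and>
        (AE x in lebesgue. x \<in> ball c r \<longrightarrow>
           avg_ball (\<lambda>y. \<phi> y t) (ball c r) * inverse (\<phi> x t) \<le> K)))
  \<or> (q > 1 \<and> (\<exists>K. \<forall>c r t. r > 0 \<longrightarrow> t > 0 \<longrightarrow>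
        set_integrable lebesgue (ball c r) (\<lambda>x. \<phi> x t) \<and>
        set_integrable lebesgue (ball c r) (\<lambda>x. \<phi> x t powr (- 1 / (q - 1))) \<and>
        avg_ball (\<lambda>y. \<phi> y t) (ball c r) *
          avg_ball (\<lambda>y. \<phi> y t powr (- 1 / (q - 1))) (ball c r) powr (q - 1) \<le> K))"

definition A_infty :: "(real^'n \<Rightarrow> real \<Rightarrow> real) \<Rightarrow> bool" where
  "A_infty \<phi> \<longleftrightarrow> (\<exists>q\<ge>1. A_class \<phi> q)"

definition growth_function :: "(real^'n \<Rightarrow> real \<Rightarrow> real) \<Rightarrow> bool" where
  "growth_function \<phi> \<longleftrightarrow> MO_function \<phi> \<and> A_infty \<phi>
     \<and> (\<exists>p. 0 < p \<and> p \<le> 1 \<and> unif_lower_type \<phi> p) \<and> unif_upper_type \<phi> 1"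

definition i_phi :: "(real^'n \<Rightarrow> real \<Rightarrow> real) \<Rightarrow> real" where
  "i_phi \<phi> = Sup {p. unif_lower_type \<phi> p}"

definition q_phi :: "(real^'n \<Rightarrow> real \<Rightarrow> real) \<Rightarrow> real" where
  "q_phi \<phi> = Inf {q. q \<ge> 1 \<and> A_class \<phi> q}"

definition m_phi :: "(real^'n \<Rightarrow> real \<Rightarrow> real) \<Rightarrow> nat" where
  "m_phi \<phi> = nat \<lfloor>real CARD('n) * (q_phi \<phi> / i_phi \<phi> - 1)\<rfloor>"

definition phi_set :: "(real^'n \<Rightarrow> real \<Rightarrow> real) \<Rightarrow> (real^'n) set \<Rightarrow> real \<Rightarrow> real" where
  "phi_set \<phi> E t = enn2real (\<integral>\<^sup>+ x. ennreal (\<phi> x t) * indicator E x \<partial>lebesgue)"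

text \<open>phi extended to [0,infinity] by phi(x,infinity) = infinity (used for possibly infinite maximal functions).\<close>
definition phi_ext :: "(real^'n \<Rightarrow> real \<Rightarrow> real) \<Rightarrow> real^'n \<Rightarrow> ennreal \<Rightarrow> ennreal" where
  "phi_ext \<phi> x v = (if v = \<infinity> then \<infinity> else ennreal (\<phi> x (enn2real v)))"

definition modular_E :: "(real^'n \<Rightarrow> real \<Rightarrow> real) \<Rightarrow> (real^'n \<Rightarrow> ennreal) \<Rightarrow> real \<Rightarrow> ennreal" where
  "modular_E \<phi> g lam = (\<integral>\<^sup>+ x. phi_ext \<phi> x (g x / ennreal lam) \<partial>lebesgue)"

definition Lphi_E :: "(real^'n \<Rightarrow> real \<Rightarrow> real) \<Rightarrow> (real^'n \<Rightarrow> ennreal) \<Rightarrow> bool" where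
  "Lphi_E \<phi> g \<longleftrightarrow> g \<in> borel_measurable lebesgue \<and> (\<exists>lam>0. modular_E \<phi> g lam \<le> 1)"

definition Lnorm_E :: "(real^'n \<Rightarrow> real \<Rightarrow> real) \<Rightarrow> (real^'n \<Rightarrow> ennreal) \<Rightarrow> real" where
  "Lnorm_E \<phi> g = Inf {lam. lam > 0 \<and> modular_E \<phi> g lam \<le> 1}"

definition Lphi :: "(real^'n \<Rightarrow> real \<Rightarrow> real) \<Rightarrow> 'n fn \<Rightarrow> bool" where
  "Lphi \<phi> f \<longleftrightarrow> f \<in> borel_measurable lebesgue \<and> Lphi_E \<phi> (\<lambda>x. ennreal (cmod (f x)))"

definition Lphi_norm :: "(real^'n \<Rightarrow> real \<Rightarrow> real) \<Rightarrow> 'n fn \<Rightarrow> real" where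
  "Lphi_norm \<phi> f = Lnorm_E \<phi> (\<lambda>x. ennreal (cmod (f x)))"

definition L2 :: "'n::finite fn \<Rightarrow> bool" where
  "L2 f \<longleftrightarrow> f \<in> borel_measurable lebesgue \<and> integrable lebesgue (\<lambda>x. (cmod (f x))\<^sup>2)"

definition L2_norm :: "'n::finite fn \<Rightarrow> real" where
  "L2_norm f = sqrt (\<integral>x. (cmod (f x))\<^sup>2 \<partial>lebesgue)"

definition pdir :: "'n::finite \<Rightarrow> 'n fn \<Rightarrow> 'n fn" where
  "pdir i f = (\<lambda>x. vector_derivative (\<lambda>t::real. f (x + t *\<^sub>R axis i 1)) (at 0))"

text \<open>Iterated partial derivative along a list of directions (a multi-index alpha
  corresponds to any list containing i exactly alpha(i) times; |alpha| = length).\<close>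
fun pdl :: "'n::finite list \<Rightarrow> 'n fn \<Rightarrow> 'n fn" where
  "pdl [] f = f"
| "pdl (i # is) f = pdir i (pdl is f)"

definition schwartz :: "'n::finite fn \<Rightarrow> bool" where
  "schwartz \<psi> \<longleftrightarrow>
     (\<forall>ds. continuous_on UNIV (pdl ds \<psi>)) \<and>
     (\<forall>ds i x. (\<lambda>t::real. pdl ds \<psi> (x + t *\<^sub>R axis i 1)) differentiable (at 0)) \<and>
     (\<forall>ds (N::nat). \<exists>C. \<forall>x. (1 + norm x) ^ N * cmod (pdl ds \<psi> x) \<le> C)"

definition schwartz_seminorm :: "nat \<Rightarrow> 'n::finite fn \<Rightarrow> real" where
  "schwartz_seminorm N \<psi> = Sup {(1 + norm x) ^ N * cmod (pdl ds \<psi> x) | x ds. length ds \<le> N}"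

text \<open>Tempered distributions, represented canonically (value 0 off the Schwartz class).\<close>
definition tempered :: "('n::finite fn \<Rightarrow> complex) \<Rightarrow> bool" where
  "tempered u \<longleftrightarrow>
     (\<forall>\<psi>. \<not> schwartz \<psi> \<longrightarrow> u \<psi> = 0) \<and>
     (\<forall>\<psi> \<zeta>. schwartz \<psi> \<longrightarrow> schwartz \<zeta> \<longrightarrow> u (\<lambda>x. \<psi> x + \<zeta> x) = u \<psi> + u \<zeta>) \<and>
     (\<forall>c \<psi>. schwartz \<psi> \<longrightarrow> u (\<lambda>x. c * \<psi> x) = c * u \<psi>) \<and>
     (\<exists>C (N::nat). \<forall>\<psi>. schwartz \<psi> \<longrightarrow> cmod (u \<psi>) \<le> C * schwartz_seminorm N \<psi>)"

definition dist_of :: "'n::finite fn \<Rightarrow> ('n fn \<Rightarrow> complex)" where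
  "dist_of f = (\<lambda>\<psi>. if schwartz \<psi> then (\<integral>x. f x * \<psi> x \<partial>lebesgue) else 0)"

definition dist_add :: "('n::finite fn \<Rightarrow> complex) \<Rightarrow> ('n fn \<Rightarrow> complex) \<Rightarrow> ('n fn \<Rightarrow> complex)" where
  "dist_add u v = (\<lambda>\<psi>. u \<psi> + v \<psi>)"

definition dist_scale :: "complex \<Rightarrow> ('n::finite fn \<Rightarrow> complex) \<Rightarrow> ('n fn \<Rightarrow> complex)" where
  "dist_scale c u = (\<lambda>\<psi>. c * u \<psi>)"

definition S_m :: "nat \<Rightarrow> 'n::finite fn set" where
  "S_m m = {\<psi>. schwartz \<psi> \<and> (\<forall>ds x. length ds \<le> m + 1 \<longrightarrow>
      (1 + norm x) ^ ((m + 2) * (CARD('n) + 1)) * cmod (pdl ds \<psi> x) \<le> 1)}"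

text \<open>(f * psi_t)(y) = f(psi_t(y - .)), psi_t = t^-n psi(./t); grand maximal function.\<close>
definition grand_max :: "(real^'n \<Rightarrow> real \<Rightarrow> real) \<Rightarrow> ('n fn \<Rightarrow> complex) \<Rightarrow> real^'n \<Rightarrow> ennreal" where
  "grand_max \<phi> u x = Sup {ennreal (cmod (u (\<lambda>z. \<psi> ((1 / t) *\<^sub>R (y - z)) / complex_of_real (t ^ CARD('n)))))
      | \<psi> t y. \<psi> \<in> S_m (m_phi \<phi>) \<and> t > 0 \<and> dist y x < t}"

definition Hphi :: "(real^'n \<Rightarrow> real \<Rightarrow> real) \<Rightarrow> ('n fn \<Rightarrow> complex) set" where
  "Hphi \<phi> = {u. tempered u \<and> Lphi_E \<phi> (grand_max \<phi> u)}"

definition Hphi_norm :: "(real^'n \<Rightarrow> real \<Rightarrow> real) \<Rightarrow> ('n fn \<Rightarrow> complex) \<Rightarrow> real" where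
  "Hphi_norm \<phi> u = Lnorm_E \<phi> (grand_max \<phi> u)"

definition admissible :: "(real^'n \<Rightarrow> real \<Rightarrow> real) \<Rightarrow> ereal \<Rightarrow> nat \<Rightarrow> bool" where
  "admissible \<phi> q s \<longleftrightarrow> q > ereal (q_phi \<phi>) \<and> s \<ge> m_phi \<phi>"

definition is_ball :: "(real^'n) set \<Rightarrow> bool" where
  "is_ball B \<longleftrightarrow> (\<exists>c r. r > 0 \<and> B = ball c r)"

definition Lq_phi_norm :: "(real^'n \<Rightarrow> real \<Rightarrow> real) \<Rightarrow> ereal \<Rightarrow> (real^'n) set \<Rightarrow> 'n fn \<Rightarrow> real" where
  "Lq_phi_norm \<phi> q B a =
    (if q = \<infinity> then Inf {M. M \<ge> 0 \<and> (AE x in lebesgue. x \<in> B \<longrightarrow> cmod (a x) \<le> M)}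
     else Sup {(enn2real (\<integral>\<^sup>+ x. ennreal (cmod (a x) powr real_of_ereal q * \<phi> x t) * indicator B x \<partial>lebesgue)
                 / phi_set \<phi> B t) powr (1 / real_of_ereal q) | t. t > 0})"

text \<open>(phi,q,s)-atom associated with the ball B. The size condition
  sup_t [phi(B,t)^-1 int_B |a|^q phi(x,t) dx]^(1/q) <= beta is written out as
  int_B |a|^q phi(.,t) <= beta^q phi(B,t) for all t > 0.\<close>
definition atom :: "(real^'n \<Rightarrow> real \<Rightarrow> real) \<Rightarrow> ereal \<Rightarrow> nat \<Rightarrow> 'n fn \<Rightarrow> (real^'n) set \<Rightarrow> bool" where
  "atom \<phi> q s a B \<longleftrightarrow>
     is_ball B \<and> a \<in> borel_measurable lebesgue \<and> (\<forall>x. x \<notin> B \<longrightarrow> a x = 0) \<and>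
     (let \<beta> = inverse (Lphi_norm \<phi> (indicator B)) in
       (if q = \<infinity> then (AE x in lebesgue. x \<in> B \<longrightarrow> cmod (a x) \<le> \<beta>)
        else (\<forall>t>0. (\<integral>\<^sup>+ x. ennreal (cmod (a x) powr real_of_ereal q * \<phi> x t) * indicator B x \<partial>lebesgue)
                 \<le> ennreal (\<beta> powr real_of_ereal q * phi_set \<phi> B t)))) \<and>
     (\<forall>\<gamma>::'n \<Rightarrow> nat. sum \<gamma> UNIV \<le> s \<longrightarrow>
        integrable lebesgue (\<lambda>x. a x * complex_of_real (\<Prod>i\<in>UNIV. (x $ i) ^ \<gamma> i)) \<and>
        (\<integral>x. a x * complex_of_real (\<Prod>i\<in>UNIV. (x $ i) ^ \<gamma> i) \<partial>lebesgue) = 0)"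

definition linear_L2 :: "('n::finite fn \<Rightarrow> 'n fn) \<Rightarrow> bool" where
  "linear_L2 T \<longleftrightarrow>
     (\<forall>f g. L2 f \<longrightarrow> L2 g \<longrightarrow> (AE x in lebesgue. T (\<lambda>y. f y + g y) x = T f x + T g x)) \<and>
     (\<forall>c f. L2 f \<longrightarrow> (AE x in lebesgue. T (\<lambda>y. c * f y) x = c * T f x))"

definition pos_sublinear_L2 :: "('n::finite fn \<Rightarrow> 'n fn) \<Rightarrow> bool" where
  "pos_sublinear_L2 T \<longleftrightarrow>
     (\<forall>f x. L2 f \<longrightarrow> Im (T f x) = 0 \<and> Re (T f x) \<ge> 0) \<and>
     (\<forall>c f x. L2 f \<longrightarrow> Re (T (\<lambda>y. c * f y) x) \<le> cmod c * Re (T f x)) \<and>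
     (\<forall>f g x. L2 f \<longrightarrow> L2 g \<longrightarrow> Re (T (\<lambda>y. f y + g y) x) \<le> Re (T f x) + Re (T g x))"

definition bounded_L2 :: "('n::finite fn \<Rightarrow> 'n fn) \<Rightarrow> bool" where
  "bounded_L2 T \<longleftrightarrow> (\<exists>C. \<forall>f. L2 f \<longrightarrow> L2 (T f) \<and> L2_norm (T f) \<le> C * L2_norm f)"

definition bounded_extension ::
  "(real^'n \<Rightarrow> real \<Rightarrow> real) \<Rightarrow> ('n fn \<Rightarrow> 'n fn) \<Rightarrow> (('n fn \<Rightarrow> complex) \<Rightarrow> 'n fn) \<Rightarrow> bool" where
  "bounded_extension \<phi> T Tt \<longleftrightarrow>
     (\<forall>f. L2 f \<longrightarrow> dist_of f \<in> Hphi \<phi> \<longrightarrow> (AE x in lebesgue. Tt (dist_of f) x = T f x)) \<and>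
     (\<forall>u \<in> Hphi \<phi>. Lphi \<phi> (Tt u)) \<and>
     (\<exists>C. \<forall>u \<in> Hphi \<phi>. Lphi_norm \<phi> (Tt u) \<le> C * Hphi_norm \<phi> u) \<and>
     (linear_L2 T \<longrightarrow>
        (\<forall>u \<in> Hphi \<phi>. \<forall>v \<in> Hphi \<phi>. AE x in lebesgue. Tt (dist_add u v) x = Tt u x + Tt v x) \<and>
        (\<forall>c. \<forall>u \<in> Hphi \<phi>. AE x in lebesgue. Tt (dist_scale c u) x = c * Tt u x)) \<and>
     (pos_sublinear_L2 T \<longrightarrow>
        (\<forall>u \<in> Hphi \<phi>. AE x in lebesgue. Im (Tt u x) = 0 \<and> Re (Tt u x) \<ge> 0) \<and>
        (\<forall>c. \<forall>u \<in> Hphi \<phi>. AE x in lebesgue. Re (Tt (dist_scale c u) x) \<le> cmod c * Re (Tt u x)) \<and>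
        (\<forall>u \<in> Hphi \<phi>. \<forall>v \<in> Hphi \<phi>. AE x in lebesgue.
            Re (Tt (dist_add u v) x) \<le> Re (Tt u x) + Re (Tt v x)))"

end

theory Submission
 imports Defs
begin

text \<open>
Every u in H^phi is decomposed by the Calderon--Zygmund method: on a Whitney covering of each level
set of the grand maximal function, smooth bumps corrected to preserve moments cut u into bounded
functions with bounded support and vanishing moments. These are multiples of atoms, and the modular
of their sizes is controlled by that of the grand maximal function, because the level sets are summed
against the powers of two. The hypothesis on T, quasi-subadditivity of the modular and doubling of the
Muckenhoupt weights make T of the partial sums converge almost everywhere. For u given by an L2
function the partial sums converge dominatedly in L2 (Hardy--Littlewood), so the limit agrees with T.
Linearity, sublinearity and uniqueness pass to the limit because the remainders tend to zero in H^phi.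
\<close>

abbreviation nn_leb :: "('a::euclidean_space => ennreal) => ennreal" (binder "NN" 10) where
 "nn_leb f == integral\<^sup>N lebesgue f"

abbreviation int_leb :: "('a::euclidean_space => 'b::{banach, second_countable_topology}) => 'b" (binder "LI" 10) where
 "int_leb f == integral\<^sup>L lebesgue f"

abbreviation AE_leb :: "('a::euclidean_space => bool) => bool" (binder "AL" 10) where
 "AE_leb P == eventually P (ae_filter lebesgue)"

abbreviation "en == ennreal"
abbreviation "idr == indicator"
abbreviation "lbg == lebesgue"
abbreviation "bml == borel_measurable lebesgue"
abbreviation "cr == complex_of_real"
notation scaleR (infixr "*!" 75) and LIMSEQ (infix "~~>" 60)

subsection \<open>Smooth functions and their iterated partial derivatives\<close>

definition has_partial :: "'n::finite => 'n fn => 'n fn => bool" where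
 "has_partial i f f' \<longleftrightarrow> (ALL x. ((%t::real. f (x + t *! axis i 1)) has_vector_derivative f' x) (at 0))"

primrec class_C :: "nat => 'n::finite fn => bool" where
 "class_C 0 f \<longleftrightarrow> continuous_on UNIV f"
 | "class_C (Suc k) f \<longleftrightarrow> continuous_on UNIV f & (ALL i. EX f'. has_partial i f f' & class_C k f')"

definition smooth :: "'n::finite fn => bool" where
 "smooth f \<longleftrightarrow> (ALL k. class_C k f)"

lemma has_partial_at:
 assumes "has_partial i f f'"
 shows "((%t. f (x + t *! axis i 1)) has_vector_derivative f' (x + s *! axis i 1)) (at s)"
proof -
 let ?g = "%t. f ((x + s *! axis i 1) + t *! axis i 1)"
 have "(?g has_vector_derivative f' (x + s *! axis i 1)) (at (s - s))"
  using assms by (auto simp: has_partial_def)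
 moreover have "((%t::real. t - s) has_vector_derivative 1) (at s)"
  by (auto intro!: derivative_eq_intros)
 ultimately have "((?g \<circ> (%t. t - s)) has_vector_derivative 1 *! f' (x + s *! axis i 1)) (at s)"
  by (intro vector_diff_chain_at)
 moreover have "?g \<circ> (%t. t - s) = (%t. f (x + t *! axis i 1))"
  by (auto simp: fun_eq_iff algebra_simps)
 ultimately show ?thesis by simp
qed

lemma has_partial_pdir: "has_partial i f f' ==> pdir i f = f'"
 by (auto simp: has_partial_def pdir_def fun_eq_iff intro: vector_derivative_at)

lemma has_partial_const: "has_partial i (%x. c) (%x. 0)"
 by (simp add: has_partial_def)

lemma has_partial_add: "has_partial i f f' ==> has_partial i g g' ==> has_partial i (%x. f x + g x) (%x. f' x + g' x)"
 unfolding has_partial_def by (auto intro!: derivative_intros)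

lemma has_partial_mult:
 "has_partial i f f' ==> has_partial i g g' ==> has_partial i (%x. f x * g x) (%x. f x * g' x + f' x * g x)"
 unfolding has_partial_def using has_vector_derivative_mult[of "%t. f (_ + t *! axis i 1)" _ 0 UNIV "%t. g (_ + t *! axis i 1)"] by simp

lemma has_partial_affine:
 fixes f :: "'n::finite fn"
 assumes "has_partial i f f'"
 shows "has_partial i (%x. f (y + c *! x)) (%x. cr c * f' (y + c *! x))"
 unfolding has_partial_def
proof
 fix x
 have "((%t::real. c*t) has_vector_derivative c) (at 0)"
  by (auto intro!: derivative_eq_intros simp: has_real_derivative_iff_has_vector_derivative[symmetric])
 moreover have "((%t. f ((y + c *! x) + t *! axis i 1)) has_vector_derivative f' (y + c *! x)) (at (c*0))"
  using assms by (simp add: has_partial_def)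
 ultimately have "((%t. f (y + c *! x + (c*t) *! axis i 1)) has_vector_derivative c *! f' (y + c *! x)) (at 0)"
  using vector_diff_chain_at[of "%t. c*t" c 0] by (simp add: o_def)
 thus "((%t. f (y + c *! (x + t *! axis i 1))) has_vector_derivative cr c * f' (y + c *! x)) (at 0)"
  by (simp add: algebra_simps scaleR_conv_of_real)
qed

lemma class_C_continuous: "class_C k f ==> continuous_on UNIV f"
 by (cases k) auto

lemma class_C_SucD: "class_C (Suc k) f ==> class_C k f"
proof (induction k arbitrary: f)
 case (Suc k)
 thus ?case unfolding class_C.simps(2)[of "Suc k"] class_C.simps(2)[of k] by meson
qed simp

lemma class_C_const: "class_C k (%x. c)"
proof (induction k arbitrary: c)
 case (Suc k)
 thus ?case using has_partial_const by auto
qed simp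

lemma class_C_add: "class_C k f ==> class_C k g ==> class_C k (%x. f x + g x)"
proof (induction k arbitrary: f g)
 case (Suc k)
 have "EX h. has_partial i (%x. f x + g x) h & class_C k h" for i
  using Suc.prems Suc.IH has_partial_add[of i f _ g] by (meson class_C.simps(2))
 thus ?case using Suc.prems by (simp add: continuous_on_add)
qed (simp add: continuous_on_add)

lemma class_C_mult: "class_C k f ==> class_C k g ==> class_C k (%x. f x * g x)"
proof (induction k arbitrary: f g)
 case (Suc k)
 have "EX h. has_partial i (%x. f x * g x) h & class_C k h" for i
 proof -
  obtain f' g' where "has_partial i f f'" "class_C k f'" "has_partial i g g'" "class_C k g'"
   using Suc.prems by (meson class_C.simps(2))
  moreover from this have "class_C k (%x. f x * g' x + f' x * g x)"
   using class_C_SucD[OF Suc.prems(1)] class_C_SucD[OF Suc.prems(2)] by (intro class_C_add Suc.IH)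
  ultimately show ?thesis using has_partial_mult by blast
 qed
 thus ?case using Suc.prems by (simp add: continuous_on_mult)
qed (simp add: continuous_on_mult)

lemma class_C_affine:
 fixes f :: "'n::finite fn"
 assumes "class_C k f"
 shows "class_C k (%x. f (y + c *! x))"
proof -
 have cont: "continuous_on UNIV (%x. f (y + c *! x))" if "continuous_on UNIV f" for f :: "'n fn"
  by (rule continuous_on_compose2[OF that]) (auto intro!: continuous_intros)
 show ?thesis using assms
 proof (induction k arbitrary: f)
  case (Suc k)
  have "EX h. has_partial i (%x. f (y + c *! x)) h & class_C k h" for i
  proof -
   obtain f' where "has_partial i f f'" "class_C k f'" using Suc.prems by (meson class_C.simps(2))
   thus ?thesis using class_C_mult[OF class_C_const Suc.IH[of f']] has_partial_affine by blast
  qed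
  thus ?case using Suc.prems by (simp add: cont)
 qed (simp add: cont)
qed

lemma smooth_const: "smooth (%x. c)"
 and smooth_add: "smooth f ==> smooth g ==> smooth (%x. f x + g x)"
 and smooth_mult: "smooth f ==> smooth g ==> smooth (%x. f x * g x)"
 and smooth_affine: "smooth f ==> smooth (%x. f (y + r *! x))"
 by (auto simp: smooth_def intro: class_C_const class_C_add class_C_mult class_C_affine)

lemma smooth_cmult: "smooth f ==> smooth (%x. c * f x)"
 by (rule smooth_mult[OF smooth_const])

lemma smooth_diff: "smooth f ==> smooth g ==> smooth (%x. f x - g x)"
 using smooth_add[OF _ smooth_cmult[of g "-1"]] by simp

lemma smooth_sum: "(!!p. p:S ==> smooth (f p)) ==> smooth (%x. SUM p:S. f p x)"
 by (induction S rule: infinite_finite_induct) (auto intro: smooth_const smooth_add)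

lemma smooth_prod: "(!!p. p:S ==> smooth (f p)) ==> smooth (%x. PROD p:S. f p x)"
 by (induction S rule: infinite_finite_induct) (auto intro: smooth_const smooth_mult)

lemma smooth_has_partial:
 assumes "smooth f" shows "has_partial i f (pdir i f)" "smooth (pdir i f)"
proof -
 have "class_C (Suc k) f" for k using assms by (simp add: smooth_def)
 hence "EX f'. has_partial i f f' & class_C k f'" for k by simp
 thus "has_partial i f (pdir i f)" "smooth (pdir i f)"
  unfolding smooth_def by (metis has_partial_pdir)+
qed

lemma smooth_pdl: "smooth f ==> smooth (pdl ds f)"
 by (induction ds) (auto intro: smooth_has_partial)

lemma smooth_has_partial_pdl: "smooth f ==> has_partial i (pdl ds f) (pdl (i # ds) f)"
 using smooth_has_partial(1)[OF smooth_pdl] by simp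

lemma smooth_continuous: "smooth f ==> continuous_on UNIV f"
 unfolding smooth_def using class_C_continuous by blast

lemma schwartz_iff:
 "schwartz psi \<longleftrightarrow> smooth psi & (ALL ds (N::nat). EX C. ALL x. (1 + norm x)^N * cmod (pdl ds psi x) <= C)"
 (is "_ \<longleftrightarrow> _ & ?decay")
proof
 assume schwartz: "schwartz psi"
 have "has_partial i (pdl ds psi) (pdl (i # ds) psi)" for i ds
  using schwartz by (auto simp: schwartz_def has_partial_def pdir_def vector_derivative_works)
 moreover have "continuous_on UNIV (pdl ds psi)" for ds using schwartz by (simp add: schwartz_def)
 ultimately have "class_C k (pdl ds psi)" for k ds
  by (induction k arbitrary: ds) (simp, metis class_C.simps(2))
 from this[of _ "[]"] schwartz show "smooth psi & ?decay" by (simp add: smooth_def schwartz_def)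
next
 assume "smooth psi & ?decay"
 moreover from this have "(%t::real. pdl ds psi (x + t *! axis i 1)) differentiable at 0" for ds i x
  using smooth_has_partial_pdl[of psi i ds] unfolding has_partial_def by (blast intro: differentiableI_vector)
 ultimately show "schwartz psi" by (simp add: schwartz_def smooth_continuous smooth_pdl)
qed

lemma pdl_append: "pdl (xs @ ys) f = pdl xs (pdl ys f)"
 by (induction xs) auto

lemma pdl_const: "pdl ds (%x. c) = (%x. if ds = [] then c else 0)"
proof (induction ds)
 case (Cons i ds)
 thus ?case using has_partial_pdir[OF has_partial_const] by (cases "ds = []") auto
qed simp

lemma pdl_add:
 assumes "smooth f" "smooth g"
 shows "pdl ds (%x. f x + g x) = (%x. pdl ds f x + pdl ds g x)"
proof (induction ds)
 case (Cons i ds)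
 thus ?case
  using has_partial_pdir[OF has_partial_add[OF smooth_has_partial_pdl smooth_has_partial_pdl]] assms by simp
qed simp

lemma pdl_affine:
 fixes f :: "'n::finite fn"
 assumes "smooth f"
 shows "pdl ds (%x. f (y + c *! x)) = (%x. of_real c^length ds * pdl ds f (y + c *! x))"
proof (induction ds)
 case (Cons i ds)
 have "has_partial i (%x. cr c^length ds * pdl ds f (y + c *! x)) (%x. cr c^length ds * (cr c * pdl (i # ds) f (y + c *! x)) + 0 * pdl ds f (y + c *! x))"
  by (intro has_partial_mult has_partial_const has_partial_affine smooth_has_partial_pdl assms)
 from has_partial_pdir[OF this] show ?case by (simp add: Cons algebra_simps)
qed simp

lemma pdl_cmult:
 assumes "smooth f"
 shows "pdl ds (%x. c * f x) = (%x. c * pdl ds f x)"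
proof (induction ds)
 case (Cons i ds)
 have "has_partial i (%x. c * pdl ds f x) (%x. c * pdl (i # ds) f x + 0 * pdl ds f x)"
  by (intro has_partial_mult has_partial_const smooth_has_partial_pdl assms)
 from has_partial_pdir[OF this] show ?case by (simp add: Cons)
qed simp

lemma pdl_diff: "smooth f ==> smooth g ==> pdl ds (%x. f x - g x) = (%x. pdl ds f x - pdl ds g x)"
 using pdl_add[OF _ smooth_cmult[of g "-1"], of f ds] pdl_cmult[of g ds "-1"] by simp

lemma pdl_sum:
 assumes "!!p. p:S ==> smooth (f p)"
 shows "pdl ds (%x. SUM p:S. f p x) = (%x. SUM p:S. pdl ds (f p) x)"
 using assms
proof (induction S rule: infinite_finite_induct)
 case (insert a S)
 thus ?case using pdl_add[of "f a" "%x. SUM p:S. f p x" ds] smooth_sum[of S f] by simp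
qed (auto simp: pdl_const)

lemma pdl_cong_open:
 assumes "open S" "!!x. x:S ==> f x = g x" "x:S"
 shows "pdl ds f x = pdl ds g x"
 using assms(3)
proof (induction ds arbitrary: x)
 case (Cons i ds)
 have "open ((%t::real. x + t *! axis i 1) -` S)"
  by (intro open_vimage assms(1) continuous_intros)
 from eventually_nhds_in_open[OF this, of 0] have "\<forall>\<^sub>F t in nhds 0. x + t *! axis i 1:S"
  using Cons.prems by simp
 hence "\<forall>\<^sub>F t in nhds 0. pdl ds f (x + t *! axis i 1) = pdl ds g (x + t *! axis i 1)"
  by eventually_elim (rule Cons.IH)
 thus ?case
  by (simp add: pdir_def) (rule vector_derivative_cong_eq, auto)
qed (use assms in auto)

lemma pdl_zero_outside_cball:
 assumes "!!x. x~:cball c r ==> f x = 0" "x~:cball c r"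
 shows "pdl ds f x = 0"
 using pdl_cong_open[of "- cball c r" f "%x. 0" x ds] assms by (auto simp: pdl_const)

lemma norm_diff_le_vector_derivative_bound:
 fixes f :: "real => 'b::real_normed_vector"
 assumes "!!t. (f has_vector_derivative f' t) (at t)" "!!t. t:closed_segment a b ==> norm (f' t) <= B"
 shows "norm (f b - f a) <= B * \<bar>b-a\<bar>"
proof -
 have "norm (f b - f a) <= B * norm (b-a)"
 proof (rule differentiable_bound[where S = "closed_segment a b" and f' = "%t h. h *! f' t"])
  show "(f has_derivative (%h. h *! f' x)) (at x within closed_segment a b)" for x
   using assms(1)[of x] unfolding has_vector_derivative_def by (rule has_derivative_at_withinI)
  show "onorm (%h. h *! f' x) <= B" if "x:closed_segment a b" for x
   using assms(2)[OF that] order_trans[OF norm_ge_zero]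
   by (auto intro!: onorm_bound simp: mult.commute[of B] mult_left_mono)
 qed auto
 thus ?thesis by simp
qed

lemma smooth_diff_bound_cball:
 fixes f :: "'n::finite fn"
 assumes "smooth f" and partial_bound: "!!i x. x:cball c r ==> cmod (pdir i f x) <= D" and z: "z:cball c r" and "D >= 0"
 shows "cmod (f z - f c) <= real CARD('n) * D * norm (z-c)"
proof -
 let ?mix = "%S. (\<chi> i. if i:S then z $ i else c $ i)"
 have mix_in_cball: "(\<chi> i. if i:S then z $ i else if i = k then t else c $ i):cball c r" (is "?w:_")
  if "k~:S" "t:closed_segment (c $ k) (z $ k)" for S k t
 proof -
  have "norm ((?w-c) $ i) <= norm ((z-c) $ i)" for i
   using that by (auto simp: closed_segment_eq_real_ivl split: if_splits)
  hence "norm (?w-c) <= norm (z-c)" by (rule norm_le_componentwise_cart)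
  thus ?thesis using z by (simp add: dist_norm norm_minus_commute)
 qed
 have "cmod (f (?mix S) - f c) <= real (card S) * (D * norm (z-c))" for S :: "'n set"
  using finite[of S]
 proof (induction S)
  case empty
  have "?mix {} = c" by (simp add: vec_eq_iff)
  thus ?case by simp
 next
  case (insert k S)
  let ?b = "\<chi> i. if i:S then z $ i else if i = k then 0 else c $ i"
  have line: "?b + t *! axis k 1 = (\<chi> i. if i:S then z $ i else if i = k then t else c $ i)" for t
   using insert.hyps by (auto simp: vec_eq_iff axis_def)
  have "cmod (f (?b + (z $ k) *! axis k 1) - f (?b + (c $ k) *! axis k 1)) <= D * \<bar>z $ k - c $ k\<bar>"
  proof (rule norm_diff_le_vector_derivative_bound)
   show "((%t. f (?b + t *! axis k 1)) has_vector_derivative pdir k f (?b + t *! axis k 1)) (at t)" for t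
    by (rule has_partial_at[OF smooth_has_partial(1)[OF assms(1)]])
   show "cmod (pdir k f (?b + t *! axis k 1)) <= D" if "t:closed_segment (c $ k) (z $ k)" for t
    unfolding line using mix_in_cball[OF insert.hyps(2) that] partial_bound by blast
  qed
  also have "... <= D * norm (z-c)"
   using component_le_norm_cart[of "z-c" k] assms(4) by (auto intro: mult_left_mono)
  also have "?b + (z $ k) *! axis k 1 = ?mix (insert k S)"
   unfolding line by (auto simp: vec_eq_iff)
  also have "?b + (c $ k) *! axis k 1 = ?mix S"
   unfolding line using insert.hyps by (auto simp: vec_eq_iff)
  finally have "cmod (f (?mix (insert k S)) - f c) <= D * norm (z-c) + cmod (f (?mix S) - f c)"
   using norm_triangle_ineq[of "f (?mix (insert k S)) - f (?mix S)" "f (?mix S) - f c"] by simp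
  thus ?case using insert by (simp add: algebra_simps)
 qed
 from this[of UNIV] show ?thesis by (simp add: mult.assoc)
qed

lemma second_difference_approx:
 fixes f :: "'n::finite fn"
 assumes "smooth f" "eps > 0"
 shows "\<forall>\<^sub>F h in at_right 0. cmod (f (x + h *! axis i 1 + h *! axis j 1) - f (x + h *! axis i 1) - f (x + h *! axis j 1) + f x - (h*h) *! pdl [j, i] f x) <= eps*(h*h)"
proof -
 obtain d where "d > 0" and near: "!!z. dist z x < d ==> dist (pdl [j, i] f z) (pdl [j, i] f x) < eps"
  using smooth_continuous[OF smooth_pdl[OF assms(1)], of "[j, i]"] assms(2) unfolding continuous_on_iff
  by (simp del: pdl.simps) blast
 moreover have "cmod (f (x + h *! axis i 1 + h *! axis j 1) - f (x + h *! axis i 1) - f (x + h *! axis j 1) + f x - (h*h) *! pdl [j, i] f x) <= eps*(h*h)" if h: "0 < h" "h < d/2" for h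
 proof -
  define F where "F s t = x + s *! axis i 1 + t *! (axis j 1::real^'n)" for s t :: real
  have dist_F: "dist (F s t) x < d" if "s:closed_segment 0 h" "t:closed_segment 0 h" for s t
  proof -
   have "dist (F s t) x = norm (s *! axis i 1 + t *! (axis j 1::real^'n))" by (simp add: F_def dist_norm)
   also have "... <= abs s + abs t" by (rule norm_triangle_le) simp
   finally show ?thesis using that h by (auto simp: closed_segment_eq_real_ivl)
  qed
  have inner: "cmod (pdl [i] f (F s h) - pdl [i] f (F s 0) - h *! pdl [j, i] f x) <= eps*h"
   if s: "s:closed_segment 0 h" for s
  proof -
   have "cmod ((pdl [i] f (F s h) - h *! pdl [j, i] f x)-(pdl [i] f (F s 0) - 0 *! pdl [j, i] f x)) <= eps * \<bar>h-0\<bar>"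
   proof (rule norm_diff_le_vector_derivative_bound)
    show "((%t. pdl [i] f (F s t) - t *! pdl [j, i] f x) has_vector_derivative pdl [j, i] f (F s t) - pdl [j, i] f x) (at t)" for t
     using has_partial_at[OF smooth_has_partial_pdl[OF assms(1), of j "[i]"], of "x + s *! axis i 1" t] unfolding F_def
     by (auto intro!: derivative_eq_intros)
    show "cmod (pdl [j, i] f (F s t) - pdl [j, i] f x) <= eps" if "t:closed_segment 0 h" for t
     using near[OF dist_F[OF s that]] by (simp add: dist_norm)
   qed
   thus ?thesis using h by (simp add: algebra_simps)
  qed
  have "cmod ((f (F h h) - f (F h 0) - h *! h *! pdl [j, i] f x)-(f (F 0 h) - f (F 0 0) - 0 *! h *! pdl [j, i] f x)) <= (eps*h) * \<bar>h-0\<bar>"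
  proof (rule norm_diff_le_vector_derivative_bound)
   have F_eq: "F s t = (x + t *! axis j 1) + s *! axis i 1" for s t by (simp add: F_def)
   show "((%s. f (F s h) - f (F s 0) - s *! h *! pdl [j, i] f x) has_vector_derivative pdl [i] f (F s h) - pdl [i] f (F s 0) - h *! pdl [j, i] f x) (at s)" for s
    using has_partial_at[OF smooth_has_partial_pdl[OF assms(1), of i "[]"], of "x + h *! axis j 1" s]
    has_partial_at[OF smooth_has_partial_pdl[OF assms(1), of i "[]"], of "x + 0 *! axis j 1" s]
    unfolding F_eq pdl.simps(1) by (auto intro!: derivative_eq_intros)
  qed (rule inner)
  thus ?thesis using h by (simp add: F_def algebra_simps)
 qed
 ultimately show ?thesis by (auto simp: eventually_at_right_field intro!: exI[of _ "d/2"])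
qed

lemma pdl_swap:
 fixes f :: "'n::finite fn"
 assumes "smooth f"
 shows "pdl [i, j] f x = pdl [j, i] f x"
proof -
 have "cmod (pdl [i, j] f x - pdl [j, i] f x) <= eps" if "eps > 0" for eps
 proof -
  let ?D = "%h. f (x + h *! axis i 1 + h *! axis j 1) - f (x + h *! axis i 1) - f (x + h *! axis j 1) + f x"
  have "\<forall>\<^sub>F h in at_right 0. cmod (?D h - (h*h) *! pdl [j, i] f x) <= eps/2*(h*h)"
   "\<forall>\<^sub>F h in at_right 0. cmod (?D h - (h*h) *! pdl [i, j] f x) <= eps/2*(h*h)"
   using second_difference_approx[OF assms, of "eps/2" x i j] second_difference_approx[OF assms, of "eps/2" x j i] \<open>eps > 0\<close>
   by (simp_all del: pdl.simps add: algebra_simps)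
  hence "\<forall>\<^sub>F h in at_right (0::real). h > 0 & cmod ((h*h) *! (pdl [i, j] f x - pdl [j, i] f x)) <= eps*(h*h)"
   using eventually_at_right_less
  proof eventually_elim
   case (elim h)
   thus ?case using norm_triangle_ineq4[of "?D h - (h*h) *! pdl [j, i] f x" "?D h - (h*h) *! pdl [i, j] f x"]
    by (simp del: pdl.simps add: algebra_simps)
  qed
  then obtain h :: real where "h > 0" "cmod ((h*h) *! (pdl [i, j] f x - pdl [j, i] f x)) <= eps*(h*h)"
   using eventually_happens'[OF trivial_limit_at_right_real] by blast
  thus ?thesis by simp
 qed
 hence "cmod (pdl [i, j] f x - pdl [j, i] f x) <= 0"
  by (rule field_le_epsilon[where y = 0, simplified])
 thus ?thesis by simp
qed

lemma pdl_permute: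
 assumes "smooth f" "mset xs = mset ys"
 shows "pdl xs f = pdl ys f"
proof -
 have move: "pdl (ys @ x # zs) f = pdl (x # ys @ zs) f" for x ys zs
 proof (induction ys)
  case (Cons y ys)
  have "pdl (y # x # (ys @ zs)) f = pdl (x # y # (ys @ zs)) f"
   using pdl_swap[OF smooth_pdl[OF assms(1)], of y x "ys @ zs"] by (auto simp: fun_eq_iff)
  with Cons show ?case by simp
 qed auto
 show ?thesis using assms(2)
 proof (induction xs arbitrary: ys)
  case (Cons x xs)
  hence "x:set ys" by (metis list.set_intros(1) mset_eq_setD)
  then obtain as bs where ys: "ys = as @ x # bs" by (meson split_list)
  with Cons.prems have "mset xs = mset (as @ bs)" by simp
  from Cons.IH[OF this] move[of as x bs] show ?case unfolding ys by simp
 qed auto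
qed

subsection \<open>Derivative bounds adapted to a scale\<close>

definition pd_bound :: "nat => real => real => (real^'n) set => 'n::finite fn => bool" where
 "pd_bound K A e X f \<longleftrightarrow> (ALL ds. length ds <= K --> (ALL x:X. cmod (pdl ds f x) <= A/e^length ds))"

lemma pd_boundD: "pd_bound K A e X f ==> length ds <= K ==> x:X ==> cmod (pdl ds f x) <= A/e^length ds"
 unfolding pd_bound_def by blast

lemma pd_bound_const: "e > 0 ==> pd_bound K (cmod c) e X (%x. c)"
 unfolding pd_bound_def by (auto simp: pdl_const)

lemma norm_pdl_mult_le:
 assumes "smooth f" "smooth g"
 "!!as. length as <= length ds ==> cmod (pdl as f x) <= A/e^length as"
 "!!as. length as <= length ds ==> cmod (pdl as g x) <= B/e^length as"
 shows "cmod (pdl ds (%x. f x * g x) x) <= 2^length ds * A*B/e^length ds"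
 using assms
proof (induction ds arbitrary: f g A B rule: rev_induct)
 case Nil
 thus ?case using mult_mono'[of "cmod (f x)" A "cmod (g x)" B] by (simp add: norm_mult)
next
 case (snoc i ds)
 let ?k = "length ds"
 note smooth = smooth_has_partial[OF snoc.prems(1), of i] smooth_has_partial[OF snoc.prems(2), of i]
 have "pdl (ds @ [i]) (%x. f x * g x) = pdl ds (%x. f x * pdir i g x + pdir i f x * g x)"
  using has_partial_pdir[OF has_partial_mult[OF smooth(1,3)]] by (simp add: pdl_append)
 also have "... = (%x. pdl ds (%x. f x * pdir i g x) x + pdl ds (%x. pdir i f x * g x) x)"
  by (intro pdl_add smooth_mult smooth snoc.prems)
 finally have "cmod (pdl (ds @ [i]) (%x. f x * g x) x) <= cmod (pdl ds (%x. f x * pdir i g x) x) + cmod (pdl ds (%x. pdir i f x * g x) x)"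
  by (simp add: norm_triangle_ineq)
 moreover have "cmod (pdl as (pdir i f) x) <= (A/e)/e^length as" "cmod (pdl as (pdir i g) x) <= (B/e)/e^length as"
  if "length as <= ?k" for as
  using snoc.prems(3,4)[of "as @ [i]"] that by (simp_all add: pdl_append)
 hence "cmod (pdl ds (%x. f x * pdir i g x) x) <= 2^?k*A*(B/e)/e^?k"
  "cmod (pdl ds (%x. pdir i f x * g x) x) <= 2^?k*(A/e)*B/e^?k"
  using snoc.prems by (intro snoc.IH smooth; simp)+
 moreover have "2^?k*(A/e)*B/e^?k = 2^?k*A*(B/e)/e^?k" by simp
 ultimately have "cmod (pdl (ds @ [i]) (%x. f x * g x) x) <= 2*(2^?k*A*(B/e)/e^?k)" by linarith
 thus ?case by simp
qed

lemma pd_bound_mult: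
 assumes "smooth f" "smooth g" "pd_bound K A e X f" "pd_bound K B e X g" "e > 0" "A >= 0" "B >= 0"
 shows "pd_bound K (2^K*A*B) e X (%x. f x * g x)"
 unfolding pd_bound_def
proof (intro allI impI ballI)
 fix ds :: "'a list" and x assume "length ds <= K" "x:X"
 hence "cmod (pdl ds (%x. f x * g x) x) <= 2^length ds * A*B/e^length ds"
  using assms(1,2) by (intro norm_pdl_mult_le) (auto intro: pd_boundD[OF assms(3)] pd_boundD[OF assms(4)])
 also have "... <= 2^K*A*B/e^length ds"
  using assms \<open>length ds <= K\<close> by (intro divide_right_mono mult_right_mono power_increasing) auto
 finally show "cmod (pdl ds (%x. f x * g x) x) <= 2^K*A*B/e^length ds" .
qed

lemma pd_bound_mono:
 assumes "pd_bound K A e X f" "A <= A'" "K' <= K" "X' <= X" "e > 0"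
 shows "pd_bound K' A' e X' f"
 unfolding pd_bound_def
proof (intro allI impI ballI)
 fix ds :: "'a list" and x assume "length ds <= K'" "x:X'"
 hence "cmod (pdl ds f x) <= A/e^length ds" using assms by (intro pd_boundD[OF assms(1)]) auto
 also have "... <= A'/e^length ds" using assms by (intro divide_right_mono) auto
 finally show "cmod (pdl ds f x) <= A'/e^length ds" .
qed

lemma pd_bound_rescale:
 assumes "pd_bound K A e X f" "e > 0" "e' > 0" "e' <= c*e" "c >= 1" "A >= 0"
 shows "pd_bound K (c^K*A) e' X f"
 unfolding pd_bound_def
proof (intro allI impI ballI)
 fix ds :: "'a list" and x assume ds: "length ds <= K" and "x:X"
 have "e'^length ds <= c^length ds * e^length ds"
  using power_mono[OF assms(4), of "length ds"] assms by (simp add: power_mult_distrib)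
 hence "1/e^length ds <= c^length ds / e'^length ds" using assms by (simp add: field_simps)
 also have "... <= c^K/e'^length ds" using assms ds by (intro divide_right_mono power_increasing) auto
 finally have "A*(1/e^length ds) <= A*(c^K/e'^length ds)" by (rule mult_left_mono) fact
 thus "cmod (pdl ds f x) <= c^K*A/e'^length ds"
  using pd_boundD[OF assms(1) ds \<open>x : X\<close>] by (simp add: mult.commute)
qed

lemma pd_bound_add:
 assumes "smooth f" "smooth g" "pd_bound K A e X f" "pd_bound K B e X g"
 shows "pd_bound K (A+B) e X (%x. f x + g x)"
 using assms(3,4) unfolding pd_bound_def pdl_add[OF assms(1,2)]
 by (auto simp: add_divide_distrib intro!: norm_triangle_le add_mono)

lemma pd_bound_cmult:
 assumes "smooth f" "pd_bound K A e X f"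
 shows "pd_bound K (cmod c * A) e X (%x. c * f x)"
 using pd_boundD[OF assms(2)] unfolding pd_bound_def
 by (auto simp: pdl_cmult[OF assms(1)] norm_mult mult_left_mono simp flip: times_divide_eq_right)

lemma pd_bound_diff:
 assumes "smooth f" "smooth g" "pd_bound K A e X f" "pd_bound K B e X g"
 shows "pd_bound K (A+B) e X (%x. f x - g x)"
 using pd_bound_add[OF assms(1) smooth_cmult[OF assms(2), of "-1"] assms(3) pd_bound_cmult[OF assms(2,4), of "-1"]]
 by simp

lemma pd_bound_prod:
 assumes "finite S" "!!p. p:S ==> smooth (f p)" "!!p. p:S ==> pd_bound K A e X (f p)" "e > 0" "A >= 0"
 shows "pd_bound K ((2^K*A)^card S) e X (%x. PROD p:S. f p x)"
 using assms(1-3)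
proof (induction S)
 case empty
 thus ?case using pd_bound_const[OF assms(4), of K 1] by simp
next
 case (insert p S)
 have "pd_bound K (2^K*A*(2^K*A)^card S) e X (%x. f p x * (PROD p:S. f p x))"
  using insert by (intro pd_bound_mult smooth_prod) (auto simp: assms)
 thus ?case using insert by simp
qed

lemma pd_bound_extend:
 assumes "pd_bound K A e (cball c r) f" "!!x. x~:cball c r ==> f x = 0" "e > 0" "A >= 0"
 shows "pd_bound K A e UNIV f"
 unfolding pd_bound_def
proof (intro allI impI ballI)
 fix ds :: "'a list" and x assume "length ds <= K"
 thus "cmod (pdl ds f x) <= A/e^length ds"
  using pd_boundD[OF assms(1)] pdl_zero_outside_cball[of c r f x ds] assms
  by (cases "x:cball c r") auto
qed

subsection \<open>Test functions\<close>

definition test_fn :: "'n::finite fn => bool" where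
 "test_fn f \<longleftrightarrow> smooth f & (EX R. ALL x. norm x > R --> f x = 0)"

lemma test_fn_smooth: "test_fn f ==> smooth f"
 by (simp add: test_fn_def)

lemma test_fn_support:
 assumes "test_fn f" obtains R where "R > 0" "!!x. x~:cball 0 R ==> f x = 0"
proof -
 obtain R where "!!x. norm x > R ==> f x = 0" using assms by (auto simp: test_fn_def)
 hence "!!x. x~:cball 0 (max R 1) ==> f x = 0" by auto
 thus ?thesis using that[of "max R 1"] by auto
qed

lemma test_fnI:
 assumes "smooth f" "!!x. x~:cball c r ==> f x = 0" shows "test_fn f"
proof -
 have "f x = 0" if "norm x > norm c + r" for x
  using that norm_triangle_ineq[of c "x-c"] by (intro assms(2)) (auto simp: dist_norm norm_minus_commute)
 thus ?thesis using assms(1) by (auto simp: test_fn_def)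
qed

lemma test_fn_mult_right: "test_fn f ==> smooth g ==> test_fn (%x. f x * g x)"
 unfolding test_fn_def using smooth_mult[of f g] by auto

lemma test_fn_mult_left: "smooth f ==> test_fn g ==> test_fn (%x. f x * g x)"
 using test_fn_mult_right[of g f] by (simp add: mult.commute)

lemma test_fn_cmult: "test_fn f ==> test_fn (%x. c * f x)"
 by (rule test_fn_mult_left[OF smooth_const])

lemma test_fn_zero: "test_fn (%x. 0)"
 by (simp add: test_fn_def smooth_const)

lemma test_fn_add:
 assumes "test_fn f" "test_fn g" shows "test_fn (%x. f x + g x)"
proof -
 obtain R S where "!!x. x~:cball 0 R ==> f x = 0" "!!x. x~:cball 0 S ==> g x = 0"
  using assms test_fn_support by metis
 thus ?thesis
  using assms by (intro test_fnI[where c = 0 and r = "max R S"]) (auto intro: smooth_add test_fn_smooth)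
qed

lemma test_fn_diff: "test_fn f ==> test_fn g ==> test_fn (%x. f x - g x)"
 using test_fn_add[OF _ test_fn_cmult[of g "-1"]] by simp

lemma test_fn_sum: "(!!p. p:S ==> test_fn (f p)) ==> test_fn (%x. SUM p:S. f p x)"
 by (induction S rule: infinite_finite_induct) (auto intro: test_fn_zero test_fn_add)

lemma test_fn_pdl_support:
 assumes "test_fn f" obtains R where "R > 0" "!!x ds. x~:cball 0 R ==> pdl ds f x = 0"
proof -
 obtain R where "R > 0" "!!x. x~:cball 0 R ==> f x = 0" using test_fn_support[OF assms] by blast
 thus ?thesis using that pdl_zero_outside_cball[of 0 R f] by blast
qed

lemma test_fn_pdl_bounded:
 assumes "test_fn f" shows "EX C>=0. ALL x. cmod (pdl ds f x) <= C"
proof -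
 obtain R where R: "R > 0" "!!x ds. x~:cball 0 R ==> pdl ds f x = 0" using test_fn_pdl_support[OF assms] by blast
 have "compact (pdl ds f ` cball 0 R)"
  using smooth_continuous[OF smooth_pdl[OF test_fn_smooth[OF assms]], of ds]
  by (intro compact_continuous_image) (auto intro: continuous_on_subset)
 then obtain C where "C > 0" "ALL y:pdl ds f ` cball 0 R. norm y <= C"
  using compact_imp_bounded bounded_pos by metis
 thus ?thesis using R(2) by (intro exI[of _ C]) (metis imageI less_imp_le norm_zero)
qed

lemma test_fn_bounded: assumes "test_fn f" obtains C where "C >= 0" "!!x. cmod (f x) <= C"
 using test_fn_pdl_bounded[OF assms, of "[]"] by auto

lemma test_fn_pd_bound:
 assumes "test_fn (f::'n::finite fn)" obtains D where "D > 0" "pd_bound K D 1 UNIV f"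
proof -
 obtain C where C: "!!ds. C ds >= 0" "!!ds x. cmod (pdl ds f x) <= C ds" using test_fn_pdl_bounded[OF assms] by metis
 let ?L = "{ds::'n list. length ds <= K}"
 have "finite ?L" using finite_lists_length_le[of "UNIV::'n set" K] by simp
 hence "C ds <= sum C ?L" if "length ds <= K" for ds using that C by (intro member_le_sum) auto
 hence "cmod (pdl ds f x) <= 1 + sum C ?L" if "length ds <= K" for ds x
  using that C(2)[of ds x] by fastforce
 thus ?thesis using that[of "1 + sum C ?L"] C(1) by (auto simp: pd_bound_def sum_nonneg add_pos_nonneg)
qed

lemma test_fn_schwartz: assumes "test_fn f" shows "schwartz f"
 unfolding schwartz_iff
proof (intro conjI allI)
 fix ds N
 obtain R where R: "R > 0" "!!x ds. x~:cball 0 R ==> pdl ds f x = 0" using test_fn_pdl_support[OF assms] by blast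
 obtain C where C: "C >= 0" "!!x. cmod (pdl ds f x) <= C" using test_fn_pdl_bounded[OF assms] by blast
 have "(1 + norm x)^N * cmod (pdl ds f x) <= (1+R)^N * C" for x
  using C R by (cases "x:cball 0 R") (auto intro!: mult_mono power_mono)
 thus "EX C. ALL x. (1 + norm x)^N * cmod (pdl ds f x) <= C" by blast
qed (rule test_fn_smooth[OF assms])

subsection \<open>A smooth cut-off function\<close>

primrec real_C :: "nat => (real => real) => bool" where
 "real_C 0 f \<longleftrightarrow> True"
 | "real_C (Suc k) f \<longleftrightarrow> (EX f'. (ALL x. (f has_real_derivative f' x) (at x)) & real_C k f')"

lemma real_C_SucI: "(!!x. (f has_real_derivative f' x) (at x)) ==> real_C k f' ==> real_C (Suc k) f"
 by auto

lemma real_C_SucD: "real_C (Suc k) f ==> real_C k f"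
proof (induction k arbitrary: f)
 case (Suc k)
 thus ?case unfolding real_C.simps(2)[of "Suc k"] real_C.simps(2)[of k] by meson
qed simp

lemma real_C_const: "real_C k (%x. c)"
proof (induction k arbitrary: c)
 case (Suc k)
 thus ?case by (auto intro!: exI[of _ "%x. 0"])
qed simp

lemma real_C_add: "real_C k f ==> real_C k g ==> real_C k (%x. f x + g x)"
proof (induction k arbitrary: f g)
 case (Suc k)
 thus ?case by (fastforce intro: DERIV_add)
qed simp

lemma real_C_mult: "real_C k f ==> real_C k g ==> real_C k (%x. f x * g x)"
proof (induction k arbitrary: f g)
 case (Suc k)
 obtain f' g' where derivs: "!!x. (f has_real_derivative f' x) (at x)" "real_C k f'"
  "!!x. (g has_real_derivative g' x) (at x)" "real_C k g'"
  using Suc.prems by auto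
 show ?case
  using derivs Suc.prems[THEN real_C_SucD] by (intro real_C_SucI[OF DERIV_mult[OF derivs(1,3)]] real_C_add Suc.IH)
qed simp

lemma real_C_inverse: "real_C k f ==> (!!x. f x ~= 0) ==> real_C k (%x. inverse (f x))"
proof (induction k arbitrary: f)
 case (Suc k)
 obtain f' where deriv: "!!x. (f has_real_derivative f' x) (at x)" "real_C k f'"
  using Suc.prems(1) by auto
 have "real_C k (%x. (- 1)*(inverse (f x) * f' x * inverse (f x)))"
  by (intro real_C_mult real_C_const deriv Suc.IH real_C_SucD[OF Suc.prems(1)] Suc.prems(2))
 moreover have "((%x. inverse (f x)) has_real_derivative (- 1) * (inverse (f x) * f' x * inverse (f x))) (at x)" for x
  using DERIV_inverse_fun[OF deriv(1) Suc.prems(2)] by (simp add: mult_ac)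
 ultimately show ?case by (intro real_C_SucI)
qed simp

lemma real_C_affine: "real_C k f ==> real_C k (%x. f (a + c*x))"
proof (induction k arbitrary: f)
 case (Suc k)
 obtain f' where deriv: "!!x. (f has_real_derivative f' x) (at x)" "real_C k f'"
  using Suc.prems by auto
 have "((%x. f (a + c*x)) has_real_derivative f' (a + c*x) * c) (at x)" for x
  by (rule DERIV_chain2[OF deriv(1)]) (auto intro!: derivative_eq_intros)
 moreover have "real_C k (%x. f' (a + c*x) * c)" by (intro real_C_mult real_C_const Suc.IH deriv)
 ultimately show ?case by (intro real_C_SucI)
qed simp

definition flat_exp :: "real poly => real => real" where
 "flat_exp P x = (if x > 0 then poly P (1/x) * exp (- (1/x)) else 0)"

lemma poly_exp_decay: "((%y. poly P y * exp (- y)) \<longlongrightarrow> (0::real)) at_top"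
proof -
 have "((%y. \<Sum>i\<le>degree P. coeff P i * (y^i / exp y)) \<longlongrightarrow> (\<Sum>i\<le>degree P. coeff P i * 0)) at_top"
  by (intro tendsto_intros tendsto_power_div_exp_0)
 thus ?thesis
  by (simp add: poly_altdef sum_distrib_right exp_minus divide_inverse mult.assoc)
qed

lemma flat_exp_has_derivative_at_0: "(flat_exp P has_real_derivative 0) (at 0)"
proof -
 have "((%h. poly (P * monom 1 1) (inverse h) * exp (- inverse h)) \<longlongrightarrow> 0) (at_right 0)"
  using filterlim_compose[OF poly_exp_decay[of "P * monom 1 1"] filterlim_inverse_at_top_right] .
 hence "((%h. (flat_exp P (0+h) - flat_exp P 0)/h) \<longlongrightarrow> 0) (at_right 0)"
  by (rule Lim_transform_eventually)
  (auto simp: eventually_at_right_field flat_exp_def poly_monom divide_simps intro!: exI[of _ 1])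
 moreover have "((%h. (flat_exp P (0+h) - flat_exp P 0)/h) \<longlongrightarrow> 0) (at_left 0)"
  by (rule tendsto_eventually) (auto simp: eventually_at_left_field flat_exp_def intro!: exI[of _ "-1"])
 ultimately show ?thesis
  unfolding DERIV_def by (metis filterlim_split_at)
qed

lemma flat_exp_has_derivative: "(flat_exp P has_real_derivative flat_exp ((P - pderiv P) * monom 1 2) x) (at x)"
proof -
 consider (pos) "x > 0" | (neg) "x < 0" | (zero) "x = 0" by linarith
 thus ?thesis
 proof cases
  case pos
  have "((%x. poly P (1/x) * exp (- (1/x))) has_real_derivative poly ((P - pderiv P) * monom 1 2) (1/x) * exp (- (1/x))) (at x)"
   using pos by (auto intro!: derivative_eq_intros DERIV_chain2[OF poly_DERIV] simp: poly_monom field_simps power2_eq_square)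
  hence "(flat_exp P has_real_derivative poly ((P - pderiv P) * monom 1 2) (1/x) * exp (- (1/x))) (at x)"
   by (rule has_field_derivative_transform_within_open[where S = "{0<..}"]) (use pos in "auto simp: flat_exp_def")
  thus ?thesis using pos by (simp add: flat_exp_def)
 next
  case neg
  have "((%x::real. 0::real) has_real_derivative 0) (at x)" by simp
  hence "(flat_exp P has_real_derivative 0) (at x)"
   by (rule has_field_derivative_transform_within_open[where S = "{..<0}"]) (use neg in "auto simp: flat_exp_def")
  thus ?thesis using neg by (simp add: flat_exp_def)
 next
  case zero
  thus ?thesis using flat_exp_has_derivative_at_0 by (simp add: flat_exp_def)
 qed
qed

lemma real_C_flat_exp: "real_C k (flat_exp P)"
 by (induction k arbitrary: P) (auto intro: flat_exp_has_derivative)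

definition smooth_step :: "real => real" where
 "smooth_step x = flat_exp 1 x * inverse (flat_exp 1 x + flat_exp 1 (1-x))"

lemma smooth_step_eq_0: "x <= 0 ==> smooth_step x = 0"
 and smooth_step_eq_1: "x >= 1 ==> smooth_step x = 1"
 by (auto simp: smooth_step_def flat_exp_def)

lemma real_C_smooth_step: "real_C k smooth_step"
proof -
 have "flat_exp 1 x + flat_exp 1 (1 + (-1)*x) > 0" for x
  by (cases "x > 0") (auto simp: flat_exp_def intro: add_pos_nonneg)
 hence "real_C k (%x. flat_exp 1 x * inverse (flat_exp 1 x + flat_exp 1 (1 + (-1)*x)))"
  by (intro real_C_mult real_C_inverse real_C_add real_C_affine real_C_flat_exp) (simp add: less_imp_neq[symmetric])
 thus ?thesis by (simp add: smooth_step_def[abs_def])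
qed

lemma class_C_coordinate:
 fixes i :: "'n::finite"
 shows "real_C (Suc k) f ==> class_C k (%x. cr (f (x $ i)))"
proof (induction k arbitrary: f)
 case (Suc k)
 obtain f' where deriv: "!!x. (f has_real_derivative f' x) (at x)" "real_C (Suc k) f'" using Suc.prems by auto
 have "has_partial j (%x. cr (f (x $ i))) (%x. if j = i then cr (f' (x $ i)) else 0)" for j
  unfolding has_partial_def
 proof
  fix x :: "real^'n"
  have "((%t. f (x $ i+t)) has_real_derivative f' (x $ i+0) * 1) (at 0)"
   by (rule DERIV_chain2[OF deriv(1)]) (auto intro!: derivative_eq_intros)
  hence "((%t. cr (f (x $ i+t))) has_vector_derivative cr (f' (x $ i))) (at 0)"
   using has_vector_derivative_of_real by fastforce
  thus "((%t. cr (f ((x + t *! axis j 1) $ i))) has_vector_derivative (if j = i then cr (f' (x $ i)) else 0)) (at 0)"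
   by (simp add: axis_def)
 qed
 moreover have "class_C k (%x::real^'n. if j = i then cr (f' (x $ i)) else 0)" for j
  using Suc.IH[OF deriv(2)] by (cases "j = i") (auto intro: class_C_const)
 ultimately show ?case using class_C_continuous[OF Suc.IH[OF real_C_SucD[OF Suc.prems]]] by auto
next
 case 0
 then obtain f' where "!!x. (f has_real_derivative f' x) (at x)" by auto
 hence "continuous_on UNIV f" by (intro DERIV_continuous_on) (auto intro: has_field_derivative_at_within)
 thus ?case by (auto intro!: continuous_intros intro: continuous_on_compose2)
qed

definition cutoff :: "'n::finite fn" where
 "cutoff x = (PROD i:UNIV. cr (smooth_step (2 + 1 * x $ i) * smooth_step (2 + (-1) * x $ i)))"

lemma cutoff_smooth: "smooth cutoff"
 unfolding cutoff_def[abs_def] smooth_def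
 by (intro smooth_prod[unfolded smooth_def] allI class_C_coordinate real_C_mult real_C_affine real_C_smooth_step)

lemma cutoff_eq_1:
 assumes "!!i. \<bar>x $ i\<bar> <= 1" shows "cutoff x = 1"
proof -
 have "2 + 1 * x $ i >= 1" "2 + (-1) * x $ i >= 1" for i using assms[of i] by auto
 thus ?thesis by (simp only: cutoff_def smooth_step_eq_1) simp
qed

lemma cutoff_eq_1_unit_ball: "norm x <= 1 ==> cutoff x = 1"
 by (rule cutoff_eq_1) (meson component_le_norm_cart order_trans)

lemma norm_le_CARD_mult:
 fixes x :: "real^'n::finite"
 assumes "!!i. \<bar>x $ i\<bar> <= b" shows "norm x <= real CARD('n) * b"
proof -
 have "norm x <= (SUM i:UNIV. \<bar>x $ i\<bar>)" by (rule norm_le_l1_cart)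
 also have "... <= (SUM i:(UNIV::'n set). b)" by (intro sum_mono assms)
 finally show ?thesis by simp
qed

lemma cutoff_eq_0:
 fixes x :: "real^'n::finite"
 assumes "norm x > 2 * real CARD('n)" shows "cutoff x = 0"
proof -
 obtain i where "\<bar>x $ i\<bar> > 2" using norm_le_CARD_mult[of x 2] assms by (metis linorder_not_le mult.commute)
 hence "smooth_step (2 + 1 * x $ i) * smooth_step (2 + (-1) * x $ i) = 0"
  using smooth_step_eq_0[of "2 + x $ i"] smooth_step_eq_0[of "2 - x $ i"] by (cases "x $ i > 0") auto
 thus ?thesis unfolding cutoff_def by (intro prod_zero) auto
qed

lemma cutoff_test_fn: "test_fn cutoff"
 unfolding test_fn_def using cutoff_smooth cutoff_eq_0 by blast

subsection \<open>Polynomials and Taylor approximation\<close>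

definition monom_fn :: "('n::finite => nat) => 'n fn" where
 "monom_fn mu x = cr (PROD i:UNIV. (x $ i)^mu i)"

inductive poly_fn :: "nat => 'n::finite fn => bool" for k where
 monomial: "sum mu UNIV <= k ==> poly_fn k (monom_fn mu)"
 | add: "poly_fn k f ==> poly_fn k g ==> poly_fn k (%x. f x + g x)"
 | cmult: "poly_fn k f ==> poly_fn k (%x. c * f x)"

lemma finite_multi_index: "finite {mu::'n::finite => nat. sum mu UNIV <= k}"
proof (rule finite_subset)
 show "{mu::'n => nat. sum mu UNIV <= k} <= PiE UNIV (%_. {..k})"
  by (auto simp: PiE_def Pi_def) (meson UNIV_I finite member_le_sum order_trans zero_le)
qed (auto intro: finite_PiE)

lemma multi_index_count: "EX ds::'n::finite list. count (mset ds) = mu"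
proof -
 have "EX M. count M = mu" using count_Abs_multiset[of mu] by (metis finite)
 thus ?thesis by (metis ex_mset)
qed

lemma sum_count_mset: "sum (count (mset ds)) UNIV = length (ds::'n::finite list)"
proof -
 have "length ds = size (mset ds)" by simp
 also have "... = sum (count (mset ds)) (set_mset (mset ds))" by (simp add: size_multiset_overloaded_eq)
 also have "... = sum (count (mset ds)) UNIV"
  by (rule sum.mono_neutral_left) (auto simp: count_eq_zero_iff)
 finally show ?thesis ..
qed

lemma sum_multi_index_Suc: "sum (mu (i := Suc (mu i))) UNIV = Suc (sum mu (UNIV::'n::finite set))"
proof -
 have "(SUM j:UNIV - {i}. (mu (i := Suc (mu i))) j) = (SUM j:UNIV - {i}. mu j)"
  by (rule sum.cong) auto
 thus ?thesis by (simp add: sum.remove[of UNIV i])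
qed

lemma poly_fn_mono: "poly_fn k f ==> k <= l ==> poly_fn l f"
 by (induction rule: poly_fn.induct) (auto intro: poly_fn.intros)

lemma poly_fn_sum: "(!!a. a:S ==> poly_fn k (f a)) ==> poly_fn k (%x. SUM a:S. f a x)"
proof (induction S rule: infinite_finite_induct)
 have "poly_fn k (%x. 0::complex)" using poly_fn.cmult[OF poly_fn.monomial[of "%_. 0"], of k 0] by simp
 thus "poly_fn k (%x. SUM a:{}. f a x)" "!!A. infinite A ==> poly_fn k (%x. SUM a:A. f a x)" by auto
qed (auto intro: poly_fn.add)

lemma monom_fn_Suc: "monom_fn (mu (i := Suc (mu i))) x = cr (x $ i) * monom_fn mu x"
proof -
 have "(PROD j:UNIV - {i}. (x $ j)^(mu (i := Suc (mu i))) j) = (PROD j:UNIV - {i}. (x $ j)^mu j)"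
  by (rule prod.cong) auto
 thus ?thesis by (simp add: monom_fn_def prod.remove[of UNIV i])
qed

lemma monom_fn_at_0: "monom_fn mu 0 = (if mu = (%_. 0) then 1 else 0)"
 by (auto simp: monom_fn_def fun_eq_iff prod_zero_iff power_0_left)

lemma poly_fn_coordinate_mult: "poly_fn k f ==> poly_fn (Suc k) (%x. cr (x $ i) * f x)"
proof (induction rule: poly_fn.induct)
 case (monomial mu)
 have "poly_fn (Suc k) (monom_fn (mu (i := Suc (mu i))))"
  by (rule poly_fn.monomial) (use monomial in "simp only: sum_multi_index_Suc")
 thus ?case by (simp add: monom_fn_Suc[abs_def])
next
 case (add f g)
 from poly_fn.add[OF add.IH] show ?case by (simp add: algebra_simps)
next
 case (cmult f c)
 from poly_fn.cmult[OF cmult.IH, of c] show ?case by (simp add: algebra_simps)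
qed

lemma poly_fn_monom_affine:
 fixes mu :: "'n::finite => nat"
 shows "poly_fn (sum mu UNIV) (%x. monom_fn mu (y + c *! x))"
proof (induction "sum mu UNIV" arbitrary: mu)
 case 0
 hence "mu = (%_. 0)" by auto
 moreover have "(%x. monom_fn (%_. 0) (y + c *! x)) = (monom_fn (%_. 0)::'n fn)" by (auto simp: monom_fn_def)
 ultimately show ?case using poly_fn.monomial[of "%_. 0" 0] by simp
next
 case (Suc l)
 then obtain i where "mu i ~= 0" by (metis sum.neutral Zero_not_Suc)
 then obtain nu where mu: "mu = nu (i := Suc (nu i))"
  by (metis fun_upd_triv fun_upd_upd fun_upd_same not0_implies_Suc)
 hence sum_de: "l = sum nu UNIV" using Suc.hyps(2) unfolding mu sum_multi_index_Suc by simp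
 have "poly_fn (Suc (sum nu UNIV)) (%x. cr (y $ i) * monom_fn nu (y + c *! x) + cr c * (cr (x $ i) * monom_fn nu (y + c *! x)))"
  using Suc.hyps(1)[OF sum_de]
  by (intro poly_fn.add poly_fn.cmult poly_fn_coordinate_mult) (auto intro: poly_fn_mono)
 thus ?case unfolding mu monom_fn_Suc sum_multi_index_Suc by (simp add: algebra_simps)
qed

lemma poly_fn_affine:
 fixes f :: "'n::finite fn"
 assumes "poly_fn k f" shows "poly_fn k (%x. f (y + c *! x))"
 using assms by (induction rule: poly_fn.induct) (auto intro: poly_fn.intros poly_fn_mono[OF poly_fn_monom_affine])

lemma has_partial_coordinate: "has_partial j (%x. cr (x $ i)) (%x. if j = i then 1 else 0)"
proof -
 have "((%t::real. cr (y+t)) has_vector_derivative 1) (at 0)" for y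
  by (auto intro!: derivative_eq_intros)
 thus ?thesis by (simp add: has_partial_def axis_def)
qed

lemma smooth_coordinate: "smooth (%x. cr (x $ i))"
 unfolding smooth_def
proof
 fix k show "class_C k (%x. cr (x $ i))"
 proof (cases k)
  case (Suc l)
  have "class_C l (%x. if j = i then 1 else 0)" for j by (rule class_C_const)
  thus ?thesis using has_partial_coordinate unfolding Suc by (auto intro!: continuous_intros)
 qed (auto intro!: continuous_intros)
qed

lemma smooth_monom: "smooth (monom_fn mu)"
proof -
 have "smooth (%x. PROD i:UNIV. \<Prod>_\<in>{..<mu i}. cr (x $ i))" by (intro smooth_prod smooth_coordinate)
 thus ?thesis by (simp add: monom_fn_def[abs_def])
qed

lemma smooth_poly_fn: "poly_fn k f ==> smooth f"
 by (induction rule: poly_fn.induct) (auto intro: smooth_monom smooth_add smooth_cmult)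

lemma pdir_monom:
 fixes mu :: "'n::finite => nat"
 shows "pdir j (monom_fn mu) = (%x. of_nat (mu j) * monom_fn (mu (j := mu j - 1)) x)"
proof (rule has_partial_pdir, unfold has_partial_def, rule allI)
 fix x :: "real^'n"
 let ?rest = "PROD i:UNIV - {j}. (x $ i)^mu i"
 have "(PROD i:UNIV - {j}. ((x + t *! axis j 1) $ i)^mu i) = ?rest" for t
  by (rule prod.cong) (auto simp: axis_def)
 hence along: "monom_fn mu (x + t *! axis j 1) = cr ((x $ j+t)^mu j * ?rest)" for t
  by (simp add: monom_fn_def prod.remove[of UNIV j] axis_def)
 have "(PROD i:UNIV - {j}. (x $ i)^(mu (j := mu j - 1)) i) = ?rest"
  by (rule prod.cong) auto
 hence deriv: "of_nat (mu j) * monom_fn (mu (j := mu j - 1)) x = cr (real (mu j) * (x $ j)^(mu j - 1)*?rest)"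
  by (simp add: monom_fn_def prod.remove[of UNIV j])
 have "((%t. (x $ j+t)^mu j * ?rest) has_real_derivative real (mu j) * (x $ j)^(mu j - 1)*?rest) (at 0)"
  by (auto intro!: derivative_eq_intros)
 from has_vector_derivative_of_real[OF this]
 show "((%t. monom_fn mu (x + t *! axis j 1)) has_vector_derivative of_nat (mu j) * monom_fn (mu (j := mu j - 1)) x) (at 0)"
  unfolding along deriv .
qed

lemma pdl_snoc_monom: "pdl (ds @ [j]) (monom_fn mu) = (%x. of_nat (mu j) * pdl ds (monom_fn (mu (j := mu j - 1))) x)"
 by (simp add: pdl_append pdir_monom pdl_cmult smooth_monom)

lemma pdl_monom_at_0:
 fixes mu :: "'n::finite => nat"
 shows "pdl ds (monom_fn mu) 0 = (if count (mset ds) = mu then of_nat (PROD i:UNIV. fact (mu i)) else 0)"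
proof (induction ds arbitrary: mu rule: rev_induct)
 case (snoc j ds)
 let ?nu = "mu (j := mu j - 1)"
 show ?case
 proof (cases "mu j")
  case 0
  hence "count (mset (ds @ [j])) j ~= mu j" by simp
  hence "count (mset (ds @ [j])) ~= mu" by metis
  thus ?thesis by (simp only: pdl_snoc_monom 0 if_False) simp
 next
  case (Suc k)
  have "(PROD i:UNIV - {j}. fact (?nu i)) = (PROD i:UNIV - {j}. fact (mu i)::nat)" by (rule prod.cong) auto
  hence fact_mult: "mu j * (PROD i:UNIV. fact (?nu i)) = (PROD i:UNIV. fact (mu i)::nat)"
   using Suc by (simp add: prod.remove[of UNIV j] fact_reduce algebra_simps)
  have count_iff: "count (mset ds) = ?nu \<longleftrightarrow> count (mset (ds @ [j])) = mu"
   using Suc by (auto simp: fun_eq_iff)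
  show ?thesis unfolding pdl_snoc_monom snoc.IH count_iff fact_mult[symmetric]
   by (cases "count (mset (ds @ [j])) = mu") (simp_all only: simp_thms if_True if_False of_nat_mult mult_zero_right)
 qed
qed (auto simp: monom_fn_at_0 fun_eq_iff)

lemma pdl_monom_eq_0: "length ds > sum mu UNIV ==> pdl ds (monom_fn mu) = (%x. 0)"
proof (induction ds arbitrary: mu rule: rev_induct)
 case (snoc j ds)
 show ?case
 proof (cases "mu j")
  case (Suc k)
  have "(mu (j := k)) (j := Suc ((mu (j := k)) j)) = mu" using Suc by auto
  hence "sum mu UNIV = Suc (sum (mu (j := k)) UNIV)" using sum_multi_index_Suc[of "mu (j := k)" j] by simp
  thus ?thesis using snoc Suc by (simp add: pdl_snoc_monom)
 qed (simp add: pdl_snoc_monom)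
qed simp

lemma taylor_polynomial_exists:
 fixes F :: "'n::finite fn"
 assumes "smooth F"
 obtains P where "poly_fn m P" "!!ds. length ds <= m ==> pdl ds P c = pdl ds F c"
 "!!ds x. length ds = Suc m ==> pdl ds P x = 0"
proof -
 obtain dirs where dirs: "!!mu. count (mset (dirs mu::'n list)) = mu" using multi_index_count by metis
 define G where "G = {mu::'n => nat. sum mu UNIV <= m}"
 define A where "A mu = pdl (dirs mu) F c / of_nat (PROD i:UNIV. fact (mu i))" for mu
 define P where "P x = (SUM mu:G. A mu * monom_fn mu (- c + 1 *! x))" for x
 have pdl_P: "pdl ds P x = (SUM mu:G. A mu * pdl ds (monom_fn mu) (- c+x))" for ds x
  unfolding P_def pdl_sum[OF smooth_cmult[OF smooth_affine[OF smooth_monom]]]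
  pdl_cmult[OF smooth_affine[OF smooth_monom]] pdl_affine[OF smooth_monom] by simp
 show ?thesis
 proof
  show "poly_fn m P" unfolding P_def
   by (intro poly_fn_sum poly_fn.cmult poly_fn_affine poly_fn.monomial) (auto simp: G_def)
  show "pdl ds P c = pdl ds F c" if "length ds <= m" for ds
  proof -
   let ?mu = "count (mset ds)"
   have "pdl ds P c = (SUM mu:G. if mu = ?mu then A mu * of_nat (PROD i:UNIV. fact (mu i)) else 0)"
    unfolding pdl_P by (rule sum.cong) (auto simp: pdl_monom_at_0)
   also have "... = A ?mu * of_nat (PROD i:UNIV. fact (?mu i))"
    using that by (subst sum.delta) (auto simp: G_def sum_count_mset finite_multi_index)
   also have "... = pdl (dirs ?mu) F c" by (simp add: A_def)
   also have "... = pdl ds F c"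
    using pdl_permute[OF assms, of "dirs ?mu" ds] dirs[of ?mu] by (simp add: count_inject)
   finally show ?thesis .
  qed
  show "pdl ds P x = 0" if "length ds = Suc m" for ds x
   unfolding pdl_P by (rule sum.neutral) (use that in "auto simp: G_def pdl_monom_eq_0")
 qed
qed

lemma taylor_remainder_bound:
 fixes F :: "'n::finite fn"
 assumes "smooth F" "r > 0" "D >= 0" "!!ds z. length ds = Suc m ==> z:cball c r ==> cmod (pdl ds F z) <= D"
 obtains P where "poly_fn m P"
 "pd_bound (Suc m) (D*(real CARD('n) * r)^Suc m) (real CARD('n) * r) (cball c r) (%x. F x - P x)"
proof -
 obtain P where P: "poly_fn m P" "!!ds. length ds <= m ==> pdl ds P c = pdl ds F c"
  "!!ds x. length ds = Suc m ==> pdl ds P x = 0" using taylor_polynomial_exists[OF assms(1)] by metis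
 let ?R = "%x. F x - P x" and ?n = "real CARD('n)"
 note smooth_P = smooth_poly_fn[OF P(1)]
 have smooth_R: "smooth ?R" by (rule smooth_diff[OF assms(1) smooth_P])
 have remainder: "cmod (pdl ds ?R z) <= D*(?n*r)^j" if "length ds + j = Suc m" "z:cball c r" for j ds z
  using that
 proof (induction j arbitrary: ds z)
  case 0
  thus ?case using assms(4)[of ds z] P(3)[of ds] by (simp add: pdl_diff[OF assms(1) smooth_P])
 next
  case (Suc j)
  have "cmod (pdl ds ?R z - pdl ds ?R c) <= ?n*(D*(?n*r)^j) * norm (z-c)"
  proof (rule smooth_diff_bound_cball[OF smooth_pdl[OF smooth_R] _ Suc.prems(2)])
   show "cmod (pdir i (pdl ds ?R) x) <= D*(?n*r)^j" if "x:cball c r" for i x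
    using Suc.IH[of "i # ds" x] that Suc.prems by simp
   show "0 <= D*(?n*r)^j" using assms by simp
  qed
  also have "... <= ?n*(D*(?n*r)^j)*r"
   using Suc.prems(2) assms by (intro mult_left_mono) (auto simp: dist_norm norm_minus_commute)
  finally show ?case using P(2)[of ds] Suc.prems by (simp add: pdl_diff[OF assms(1) smooth_P] algebra_simps)
 qed
 have "cmod (pdl ds ?R x) <= D*(?n*r)^Suc m / (?n*r)^length ds" if "length ds <= Suc m" "x:cball c r" for ds x
  using remainder[of ds "Suc m - length ds" x] that assms(2) by (simp add: power_diff)
 thus ?thesis using that[OF P(1)] by (auto simp: pd_bound_def)
qed

subsection \<open>Functions dual to the monomials\<close>

lemma dual_vectors_exist:
 fixes l :: "'i => 'a::real_vector => real"
 assumes "finite G" "!!g. g:G ==> linear (l g)"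
 "!!c. (!!v. (SUM g:G. c g * l g v) = 0) ==> ALL g:G. c g = 0"
 shows "EX w. ALL g:G. ALL h:G. l h (w g) = (if g = h then 1 else 0)"
 using assms
proof (induction G)
 case (insert d G)
 have "ALL g:G. c g = 0" if "!!v. (SUM g:G. c g * l g v) = 0" for c
 proof -
  have "(SUM g:insert d G. (c (d := 0)) g * l g v) = (SUM g:G. c g * l g v)" for v
   using insert.hyps by (auto intro: sum.cong)
  hence "ALL g:insert d G. (c (d := 0)) g = 0" using that by (intro insert.prems(2)) simp
  thus ?thesis using insert.hyps by (metis fun_upd_other insertI2)
 qed
 then obtain w where "ALL g:G. ALL h:G. l h (w g) = (if g = h then 1 else 0)"
  using insert.IH insert.prems(1) by auto
 hence w: "l h (w g) = (if g = h then 1 else 0)" if "g:G" "h:G" for g h using that by blast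
 note linear = insert.prems(1)[THEN linear_diff] insert.prems(1)[THEN linear_sum] insert.prems(1)[THEN linear_cmul]
 define res where "res v = v-(SUM g:G. l g v *! w g)" for v
 have res_G: "l h (res v) = 0" if "h:G" for h v
 proof -
  have "(SUM g:G. l g v * l h (w g)) = (SUM g:G. if g = h then l g v else 0)"
   by (rule sum.cong) (use that w in auto)
  thus ?thesis using that insert.hyps by (simp add: res_def linear)
 qed
 have res_d: "l d (res v) = l d v + (SUM g:G. - l d (w g) * l g v)" for v
  by (simp add: res_def linear mult.commute sum_negf)
 have "EX v. l d (res v) ~= 0"
 proof (rule ccontr)
  assume "~(EX v. l d (res v) ~= 0)"
  moreover have "(SUM g:G. (if g = d then 1 else - l d (w g)) * l g v) = (SUM g:G. - l d (w g) * l g v)" for v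
   by (rule sum.cong) (use insert.hyps in auto)
  ultimately have "(SUM g:insert d G. (if g = d then 1 else - l d (w g)) * l g v) = 0" for v
   using res_d[of v] insert.hyps by simp
  from insert.prems(2)[OF this] show False by auto
 qed
 then obtain v where v: "l d (res v) ~= 0" by blast
 define u where "u = (1 / l d (res v)) *! res v"
 have u: "l d u = 1" "!!h. h:G ==> l h u = 0" using v res_G by (auto simp: u_def linear)
 show ?case
 proof (intro exI[of _ "%g. if g = d then u else w g - l d (w g) *! u"] ballI)
  fix g h assume "g:insert d G" "h:insert d G"
  thus "l h (if g = d then u else w g - l d (w g) *! u) = (if g = h then 1 else 0)"
   using u w insert.hyps by (auto simp: linear)
 qed
qed auto

lemma monomials_independent:
 fixes c :: "('n::finite => nat) => real"
 assumes "finite G" "!!x. x:ball 0 1 ==> (SUM g:G. c g * (PROD i:UNIV. (x $ i)^g i)) = 0" "g:G"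
 shows "c g = 0"
proof -
 obtain ds :: "'n list" where ds: "count (mset ds) = g" using multi_index_count by blast
 let ?f = "%x. SUM g:G. of_real (c g) * monom_fn g x"
 have "?f x = 0" if "x:ball 0 1" for x
 proof -
  have "?f x = of_real (SUM g:G. c g * (PROD i:UNIV. (x $ i)^g i))" by (simp add: monom_fn_def)
  thus ?thesis using assms(2)[OF that] by simp
 qed
 hence "pdl ds ?f 0 = pdl ds (%x. 0) 0" by (intro pdl_cong_open[where S = "ball 0 1"]) auto
 also have "... = 0" by (simp add: pdl_const)
 finally have "0 = (SUM h:G. of_real (c h) * pdl ds (monom_fn h) 0)"
  by (simp add: pdl_sum[OF smooth_cmult[OF smooth_monom]] pdl_cmult[OF smooth_monom])
 also have "... = (SUM h:G. if h = g then of_real (c h) * of_nat (PROD i:UNIV. fact (h i)) else 0)"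
  by (rule sum.cong) (auto simp: pdl_monom_at_0 ds)
 also have "... = of_real (c g) * of_nat (PROD i:UNIV. fact (g i))" using assms by simp
 finally show ?thesis by simp
qed

lemma continuous_zero_if_AE_zero:
 fixes f :: "real^'n::finite => real"
 assumes "continuous_on UNIV f" "AL x. x:ball c r --> f x = 0" "x:ball c r"
 shows "f x = 0"
proof -
 have "closed (f -` {0})" by (intro closed_vimage assms) auto
 moreover have "AE x\<in>ball c r in lbg. x:f -` {0}" using assms(2) by eventually_elim auto
 ultimately have "x:f -` {0}" by (intro mem_closed_if_AE_lebesgue_open[OF open_ball _ _ assms(3)])
 thus ?thesis by simp
qed

definition moment :: "('n::finite => nat) => (real^'n, real) bcontfun => real" where
 "moment mu f = (LI x. idr (ball 0 1) x * (apply_bcontfun f x * (PROD i:UNIV. (x $ i)^mu i)))"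

lemma integrable_ball_continuous:
 fixes f :: "real^'n::finite => real"
 assumes "continuous_on UNIV f"
 shows "integrable lbg (%x. idr (ball c r) x * f x)"
proof -
 have "set_integrable lborel (cball c r) f"
  unfolding set_integrable_def
  by (rule borel_integrable_compact) (auto intro: continuous_on_subset[OF assms])
 hence "set_integrable lbg (cball c r) f"
  by (simp add: set_integrable_def integrable_completion)
 hence "set_integrable lbg (ball c r) f" by (rule set_integrable_subset) auto
 thus ?thesis by (simp add: set_integrable_def)
qed

lemma moment_linear: "linear (moment (mu::'n::finite => nat))"
proof -
 have "integrable lbg (%x. idr (ball 0 1) x * (apply_bcontfun f x * (PROD i:UNIV. (x $ i)^mu i)))"
  for f :: "(real^'n, real) bcontfun"
  by (rule integrable_ball_continuous) (intro continuous_intros continuous_on_apply_bcontfun)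
 thus ?thesis
  by (intro linearI) (simp_all add: moment_def plus_bcontfun.rep_eq scaleR_bcontfun.rep_eq algebra_simps flip: Bochner_Integration.integral_add)
qed

lemma moments_independent:
 fixes c :: "('n::finite => nat) => real"
 assumes "finite G" "!!f. (SUM g:G. c g * moment g f) = 0" "g:G"
 shows "c g = 0"
proof -
 define P where "P x = (SUM g:G. c g * (PROD i:UNIV. (x $ i)^g i))" for x :: "real^'n"
 define Q where "Q x = P x / (1+(P x)^2)" for x
 have cont_P: "continuous_on UNIV P" unfolding P_def by (intro continuous_intros)
 have pos: "1+(P x)^2 > 0" for x by (simp add: add_pos_nonneg)
 hence nonzero: "1+(P x)^2 ~= 0" for x by (metis less_irrefl)
 have cont_Q: "continuous_on UNIV Q" unfolding Q_def using nonzero by (intro continuous_intros cont_P) simp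
 have "\<bar>Q x\<bar> <= 1" for x
 proof -
  have "\<bar>P x\<bar> <= 1+(P x)^2" using sum_squares_bound[of "\<bar>P x\<bar>" 1] abs_ge_zero[of "P x"] by simp
  thus ?thesis using pos[of x] by (simp add: Q_def abs_divide)
 qed
 hence "Q:bcontfun" using cont_Q by (auto simp: bcontfun_def bounded_iff)
 then obtain q where q: "Q = apply_bcontfun q" by (rule bcontfunE)
 have "(LI x. idr (ball 0 1) x * (Q x * P x)) = (LI x. SUM g:G. c g * (idr (ball 0 1) x * (apply_bcontfun q x * (PROD i:UNIV. (x $ i)^g i))))"
  by (simp add: P_def q sum_distrib_left mult_ac)
 also have "... = (SUM g:G. c g * moment g q)"
  unfolding moment_def
  by (subst Bochner_Integration.integral_sum) (auto intro!: integrable_ball_continuous continuous_intros)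
 finally have "(LI x. idr (ball 0 1) x * (Q x * P x)) = 0" using assms(2) by simp
 moreover have nonneg: "0 <= idr (ball 0 1) x * (Q x * P x)" for x
  using pos[of x] by (simp add: Q_def power2_eq_square[symmetric] less_imp_le)
 moreover have "integrable lbg (%x. idr (ball 0 1) x * (Q x * P x))"
  by (intro integrable_ball_continuous continuous_intros cont_P cont_Q)
 ultimately have "AL x. idr (ball 0 1) x * (Q x * P x) = 0"
  by (simp add: integral_nonneg_eq_0_iff_AE)
 hence "AL x. x:ball 0 1 --> P x = 0"
  by eventually_elim (auto simp: Q_def nonzero)
 hence "P x = 0" if "x:ball 0 1" for x
  using continuous_zero_if_AE_zero[OF cont_P _ that] by blast
 thus ?thesis unfolding P_def by (rule monomials_independent[OF assms(1) _ assms(3)])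
qed

lemma moment_dual_functions_exist:
 "EX theta::('n::finite => nat) => 'n fn. EX C>0. ALL mu. sum mu UNIV <= s --> theta mu:borel_measurable borel & (ALL x. cmod (theta mu x) <= C) & (ALL x. x~:ball 0 1 --> theta mu x = 0) & (ALL nu. sum nu UNIV <= s --> (LI x. theta mu x * monom_fn nu x) = (if mu = nu then 1 else 0))"
proof -
 define G where "G = {mu::'n => nat. sum mu UNIV <= s}"
 have finite: "finite G" unfolding G_def by (rule finite_multi_index)
 then obtain w where w: "!!g h. g:G ==> h:G ==> moment h (w g) = (if g = h then 1 else 0)"
  using dual_vectors_exist[of G moment] moment_linear moments_independent[OF finite] by blast
 define theta where "theta g x = cr (idr (ball 0 1) x * apply_bcontfun (w g) x)" for g x
 let ?C = "1+(SUM g:G. norm (w g))"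
 show ?thesis
 proof (intro exI[of _ theta] exI[of _ ?C] conjI allI impI)
  show "?C > 0" by (simp add: add_pos_nonneg sum_nonneg)
  fix g :: "'n => nat" assume "sum g UNIV <= s"
  hence g: "g:G" by (simp add: G_def)
  have "(%x. idr (ball 0 1) x * apply_bcontfun (w g) x):borel_measurable borel"
   by (intro borel_measurable_times borel_measurable_continuous_onI borel_measurable_indicator) auto
  thus "theta g:borel_measurable borel" unfolding theta_def[abs_def] by measurable
  show "theta g x = 0" if "x~:ball 0 1" for x using that by (simp add: theta_def)
  show "cmod (theta g x) <= ?C" for x
  proof -
   have "norm (w g) <= (SUM g:G. norm (w g))" by (rule member_le_sum) (use g finite in auto)
   thus ?thesis using norm_bounded[of "w g" x] by (auto simp: theta_def indicator_def sum_nonneg add_nonneg_nonneg)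
  qed
  fix h :: "'n => nat" assume "sum h UNIV <= s"
  hence "h:G" by (simp add: G_def)
  have "(LI x. theta g x * monom_fn h x) = cr (moment h (w g))"
   unfolding moment_def integral_complex_of_real[symmetric]
   by (rule Bochner_Integration.integral_cong) (auto simp: theta_def monom_fn_def)
  thus "(LI x. theta g x * monom_fn h x) = (if g = h then 1 else 0)" using w[OF g \<open>h : G\<close>] by simp
 qed
qed

subsection \<open>Whitney balls and a smooth partition of unity\<close>

text \<open>The dyadic lattice points whose scale is comparable to the value of a 1-Lipschitz
function \<open>rho\<close> are the centres of a Whitney decomposition of \<open>{rho > 0}\<close>.\<close>

type_synonym 'n dyadic = "int \<times> (int^'n)"

definition scl :: "'n::finite dyadic => real" where
 "scl a = 2 powi (fst a)"

definition ctr :: "'n::finite dyadic => real^'n" where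
 "ctr a = (\<chi> i. scl a * of_int (snd a $ i))"

definition rad :: "'n::finite dyadic => real" where
 "rad a = real CARD('n) * scl a"

definition wball :: "'n::finite dyadic => (real^'n) set" where
 "wball a = cball (ctr a) (2 * rad a)"

abbreviation lip1 :: "(real^'n::finite => real) => bool" where
 "lip1 rho == lipschitz_on 1 UNIV rho"

definition whitney :: "(real^'n::finite => real) => 'n dyadic set" where
 "whitney rho = {a. 100 * rad a <= rho (ctr a) & rho (ctr a) <= 500 * rad a}"

definition near :: "(real^'n::finite => real) => real^'n => 'n dyadic set" where
 "near rho x = {a:whitney rho. dist x (ctr a) <= 50 * rad a}"

definition overlap :: "'n::finite itself => nat" where
 "overlap t = 7*(100 * CARD('n) + 1)^CARD('n)"

definition bump :: "'n::finite dyadic => 'n fn" where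
 "bump a x = cutoff (- (1 / scl a) *! ctr a + (1 / scl a) *! x)"

definition earlier :: "(real^'n::finite => real) => 'n dyadic => 'n dyadic set" where
 "earlier rho a = {b:whitney rho. to_nat b < to_nat a & wball b Int wball a ~= {}}"

definition zeta :: "(real^'n::finite => real) => 'n dyadic => 'n fn" where
 "zeta rho a x = (if a:whitney rho then bump a x * (PROD b:earlier rho a. 1 - bump b x) else 0)"

lemma scl_pos [simp]: "scl a > 0"
 by (simp add: scl_def)

lemma scl_nonneg [simp]: "scl a >= 0" and scl_nonzero [simp]: "scl a ~= 0" and abs_scl [simp]: "\<bar>scl a\<bar> = scl a"
 using scl_pos[of a] by linarith+

lemma CARD_ge_1 [simp]: "real CARD('n::finite) >= 1"
 by (simp add: Suc_leI)

lemma rad_pos [simp]: "rad a > 0" and rad_nonneg [simp]: "rad a >= 0" and scl_le_rad: "scl a <= rad a"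
 using mult_right_mono[OF CARD_ge_1, of "scl a"] by (auto simp: rad_def)

lemma rad_mono: "scl (a::'n::finite dyadic) <= c * scl b ==> rad a <= c * rad (b::'n dyadic)"
 using mult_left_mono[of "scl a" "c * scl b" "real CARD('n)"] by (simp add: rad_def mult.left_commute)

lemma rad_cancel: "k * rad (a::'n::finite dyadic) <= l * rad (b::'n dyadic) \<longleftrightarrow> k * scl a <= l * scl b"
 by (simp add: rad_def mult.left_commute)

lemma lip1D: "lip1 rho ==> rho x <= rho y + dist x y"
 using lipschitz_onD[of 1 UNIV rho x y] by (simp add: dist_real_def)

lemma lip1_infdist: "lip1 (%x. infdist x A)"
 by (intro lipschitz_onI) (auto simp: dist_real_def infdist_triangle_abs)

lemma whitney_bounds:
 assumes "lip1 rho" "a:whitney rho" "dist x (ctr a) <= k * rad a"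
 shows "(100-k) * rad a <= rho x" "rho x <= (500+k) * rad a"
 using lip1D[OF assms(1), of x "ctr a"] lip1D[OF assms(1), of "ctr a" x] assms(2,3)
 by (auto simp: whitney_def algebra_simps dist_commute)

lemma whitney_pos:
 assumes "lip1 rho" "a:whitney rho" "dist x (ctr a) <= 50 * rad a" shows "rho x > 0"
 by (rule less_le_trans[of 0 "50 * rad a"]) (use whitney_bounds(1)[OF assms] in auto)

lemma fst_less_of_scl_less: "scl a < 2 powi k * scl b ==> fst a < k + fst b"
proof (rule ccontr)
 assume less: "scl a < 2 powi k * scl b" and "~fst a < k + fst b"
 hence "(2::real) powi (k + fst b) <= 2 powi fst a" by (intro power_int_increasing) auto
 with less show False by (simp add: scl_def power_int_add)
qed

lemma finite_card_vec_box:
 fixes A :: "'n::finite => int set"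
 assumes "!!i. finite (A i)" "!!i. card (A i) <= N"
 shows "finite {l::int^'n. ALL i. l $ i:A i}" "card {l::int^'n. ALL i. l $ i:A i} <= N^CARD('n)"
proof -
 have box: "{l::int^'n. ALL i. l $ i:A i} = vec_lambda ` (PiE UNIV A)"
 proof safe
  fix l :: "int^'n" assume "ALL i. l $ i:A i"
  hence "($) l:PiE UNIV A" by auto
  thus "l:vec_lambda ` (PiE UNIV A)" by (metis image_eqI vec_nth_inverse)
 qed auto
 have finite: "finite (PiE UNIV A)" using assms by (intro finite_PiE) auto
 thus "finite {l::int^'n. ALL i. l $ i:A i}" by (simp add: box)
 have "card {l::int^'n. ALL i. l $ i:A i} <= card (PiE UNIV A)" unfolding box by (rule card_image_le[OF finite])
 also have "... = (PROD i:UNIV. card (A i))" by (simp add: card_PiE)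
 also have "... <= (PROD i:(UNIV::'n set). N)" by (intro prod_mono) (auto simp: assms)
 finally show "card {l::int^'n. ALL i. l $ i:A i} <= N^CARD('n)" by simp
qed

lemma lattice_points_near:
 fixes x :: "real^'n::finite" and j :: int
 defines "S == {l. dist x (ctr (j, l)) <= 50 * rad (j, l)}"
 shows "finite S" "card S <= (100 * CARD('n) + 1)^CARD('n)"
proof -
 define A where "A i = {\<lceil>x $ i/2 powi j - 50 * real CARD('n)\<rceil>..\<lfloor>x $ i/2 powi j + 50 * real CARD('n)\<rfloor>}" for i
 have card_A: "card (A i) <= 100 * CARD('n) + 1" for i
 proof -
  have "\<lfloor>x $ i/2 powi j + 50 * real CARD('n)\<rfloor> - \<lceil>x $ i/2 powi j - 50 * real CARD('n)\<rceil> <= 100 * int CARD('n)" by linarith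
  thus ?thesis by (simp add: A_def)
 qed
 have "l $ i:A i" if "l:S" for l i
 proof -
  have "\<bar>x $ i-2 powi j * of_int (l $ i)\<bar> <= 50 * real CARD('n) * 2 powi j"
   using component_le_norm_cart[of "x - ctr (j, l)" i] that by (auto simp: S_def ctr_def scl_def rad_def dist_norm)
  moreover have "x $ i/2 powi j - of_int (l $ i) = (x $ i-2 powi j * of_int (l $ i))/2 powi j"
   by (simp add: diff_divide_distrib)
  ultimately have "\<bar>x $ i/2 powi j - of_int (l $ i)\<bar> <= 50 * real CARD('n)"
   by (simp add: abs_divide divide_le_eq)
  thus ?thesis unfolding A_def atLeastAtMost_iff ceiling_le_iff le_floor_iff by linarith
 qed
 hence "S <= {l. ALL i. l $ i:A i}" by blast
 moreover have "finite {l::int^'n. ALL i. l $ i:A i}" "card {l::int^'n. ALL i. l $ i:A i} <= (100 * CARD('n) + 1)^CARD('n)"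
  using finite_card_vec_box[of A, OF _ card_A] by (auto simp: A_def)
 ultimately show "finite S" "card S <= (100 * CARD('n) + 1)^CARD('n)"
  by (auto intro: finite_subset order_trans[OF card_mono])
qed

lemma near_levels:
 assumes "lip1 rho" "a:near rho x" "b:near rho x"
 shows "fst a <= fst b + 3"
proof -
 have "50 * rad a <= rho x" "rho x <= 550 * rad b"
  using whitney_bounds(1)[of rho a x 50] whitney_bounds(2)[of rho b x 50] assms by (auto simp: near_def)
 hence "50 * rad a <= 550 * rad b" by linarith
 hence "50 * scl a <= 550 * scl b" by (simp only: rad_cancel)
 moreover have "0 < scl b" by simp
 ultimately have "scl a < 16 * scl b" by linarith
 thus ?thesis using fst_less_of_scl_less[of a 4 b] by simp
qed

lemma
 fixes rho :: "real^'n::finite => real"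
 assumes "lip1 rho"
 shows finite_near: "finite (near rho x)" and card_near: "card (near rho x) <= overlap TYPE('n)"
proof -
 have "finite (near rho x) & card (near rho x) <= overlap TYPE('n)"
 proof (cases "near rho x = {}")
  case False
  then obtain b where b: "b:near rho x" by blast
  let ?J = "{fst b - 3..fst b + 3}" and ?L = "%j. {l. dist x (ctr (j, l)) <= 50 * rad (j, l)}"
  have "near rho x <= Sigma ?J ?L"
   using near_levels[OF assms _ b] near_levels[OF assms b] by (fastforce simp: near_def)
  moreover have "finite (Sigma ?J ?L)" using lattice_points_near(1) by auto
  moreover have "card (Sigma ?J ?L) <= overlap TYPE('n)"
  proof -
   have "card (Sigma ?J ?L) = (SUM j:?J. card (?L j))" using lattice_points_near(1) by (intro card_SigmaI) auto
   also have "... <= (SUM j:?J. (100 * CARD('n) + 1)^CARD('n))" by (intro sum_mono lattice_points_near)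
   finally show ?thesis by (simp add: overlap_def)
  qed
  ultimately show ?thesis by (auto intro: finite_subset order_trans[OF card_mono])
 qed simp
 thus "finite (near rho x)" "card (near rho x) <= overlap TYPE('n)" by auto
qed

lemma nearI: "a:whitney rho ==> dist x (ctr a) <= k * rad a ==> k <= 50 ==> a:near rho x"
 by (auto simp: near_def intro: order_trans mult_right_mono)

lemma wball_subset_near: "{a:whitney rho. x:wball a} <= near rho x"
 by (auto simp: wball_def dist_commute intro: nearI[where k = 2])

lemma finite_wballs_at: "lip1 rho ==> finite {a:whitney rho. (x::real^'n::finite):wball a}"
 by (rule finite_subset[OF wball_subset_near finite_near])

text \<open>Whitney balls of two levels \<open>rho' \<le> rho\<close> are compared as well as those of one level.\<close>

lemma touching_wballs:
 fixes a b :: "'n::finite dyadic"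
 assumes "lip1 rho" "lip1 rho'" "!!x. rho' x <= rho x" "a:whitney rho" "b:whitney rho'" "wball a Int wball b ~= {}"
 shows "scl b <= 6 * scl a" "dist (ctr b) (ctr a) <= 14 * rad a" "wball b <= cball (ctr a) (26 * rad a)"
proof -
 obtain z where "dist z (ctr a) <= 2 * rad a" "dist z (ctr b) <= 2 * rad b"
  using assms(6) by (auto simp: wball_def dist_commute)
 moreover from this have "98 * rad b <= rho' z" "rho z <= 502 * rad a"
  using whitney_bounds(1)[OF assms(2,5), of z 2] whitney_bounds(2)[OF assms(1,4), of z 2] by simp_all
 hence "98 * scl b <= 502 * scl a" using assms(3)[of z] rad_cancel[of 98 b 502 a] by linarith
 hence "scl b <= 6 * scl a" using scl_pos[of a] by linarith
 moreover from this have "rad b <= 6 * rad a" by (rule rad_mono)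
 moreover have "dist (ctr b) (ctr a) <= dist z (ctr b) + dist z (ctr a)" by (rule dist_triangle3)
 ultimately show "scl b <= 6 * scl a" and centres: "dist (ctr b) (ctr a) <= 14 * rad a" by linarith+
 show "wball b <= cball (ctr a) (26 * rad a)"
 proof
  fix y assume "y:wball b"
  hence "dist (ctr b) y <= 2 * rad b" by (simp add: wball_def)
  thus "y:cball (ctr a) (26 * rad a)"
   using dist_triangle[of "ctr a" y "ctr b"] centres \<open>rad b <= 6 * rad a\<close> by (simp add: dist_commute)
 qed
qed

lemma bump_smooth: "smooth (bump a)"
 unfolding bump_def[abs_def] by (rule smooth_affine[OF cutoff_smooth])

lemma bump_alt: "bump a x = cutoff ((1 / scl a) *! (x - ctr a))"
 by (simp add: bump_def algebra_simps)

lemma bump_eq_0: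
 assumes "x~:wball a" shows "bump a x = 0"
proof -
 have "norm ((1 / scl a) *! (x - ctr a)) > 2 * real CARD('a)"
  unfolding norm_scaleR using assms by (simp add: wball_def rad_def dist_norm norm_minus_commute pos_less_divide_eq)
 thus ?thesis by (simp add: bump_alt cutoff_eq_0)
qed

lemma
 fixes a :: "'n::finite dyadic"
 assumes "lip1 rho" "a:whitney rho"
 shows finite_earlier: "finite (earlier rho a)" and card_earlier: "card (earlier rho a) <= overlap TYPE('n)"
proof -
 have sub: "earlier rho a <= near rho (ctr a)"
 proof
  fix b assume b: "b:earlier rho a"
  have "dist (ctr a) (ctr b) <= 14 * rad b"
   by (rule touching_wballs(2)[OF assms(1,1)]) (use b assms in "auto simp: earlier_def")
  thus "b:near rho (ctr a)" using b by (intro nearI[where k = 14]) (auto simp: earlier_def)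
 qed
 show "finite (earlier rho a)" "card (earlier rho a) <= overlap TYPE('n)"
  using finite_subset[OF sub] order_trans[OF card_mono[OF _ sub]] finite_near card_near assms(1) by blast+
qed

lemma zeta_not_whitney: "a~:whitney rho ==> zeta rho a = (%x. 0)"
 and zeta_whitney: "a:whitney rho ==> zeta rho a = (%x. bump a x * (PROD b:earlier rho a. 1 - bump b x))"
 by (auto simp: zeta_def)

lemma zeta_smooth: "smooth (zeta rho a)"
 by (cases "a:whitney rho")
 (auto simp: zeta_whitney zeta_not_whitney intro!: smooth_const smooth_mult smooth_prod smooth_diff bump_smooth)

lemma zeta_eq_0: "x~:wball a ==> zeta rho a x = 0"
 by (simp add: zeta_def bump_eq_0)

lemma zeta_test_fn: "test_fn (zeta rho a)"
 by (rule test_fnI[OF zeta_smooth, of "ctr a"]) (auto intro: zeta_eq_0 simp: wball_def)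

lemma bump_pd_bound:
 assumes "pd_bound K C 1 UNIV (cutoff::'n::finite fn)"
 shows "pd_bound K C (scl a) UNIV (bump (a::'n dyadic))"
 unfolding pd_bound_def
proof (intro allI impI ballI)
 fix ds :: "'n list" and x assume "length ds <= K"
 have "cmod (pdl ds (bump a) x) = (1 / scl a)^length ds * cmod (pdl ds cutoff (- (1 / scl a) *! ctr a + (1 / scl a) *! x))"
  unfolding bump_def[abs_def] pdl_affine[OF cutoff_smooth] by (simp add: norm_mult norm_power norm_divide)
 also have "... <= (1 / scl a)^length ds * C"
  using pd_boundD[OF assms \<open>length ds <= K\<close> UNIV_I] by (intro mult_left_mono) auto
 finally show "cmod (pdl ds (bump a) x) <= C / scl a^length ds" by (simp add: power_divide)
qed

lemma zeta_pd_bound: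
 "EX C>0. ALL rho (a::'n::finite dyadic). lip1 rho --> pd_bound K C (scl a) UNIV (zeta rho a)"
proof -
 obtain D where D: "D > 0" and cutoff: "pd_bound K D 1 UNIV (cutoff::'n fn)"
  using test_fn_pd_bound[OF cutoff_test_fn] by blast
 let ?B = "2^K*(6^K*(1+D))"
 let ?C = "2^K*D*?B^overlap TYPE('n)"
 have "pd_bound K ?C (scl a) UNIV (zeta rho a)" if lip: "lip1 rho" for rho and a :: "'n dyadic"
 proof (cases "a:whitney rho")
  case True
  have factor: "pd_bound K (6^K*(1+D)) (scl a) UNIV (%x. 1 - bump b x)" if "b:earlier rho a" for b
  proof (rule pd_bound_rescale[where e = "scl b" and c = 6])
   show "pd_bound K (1+D) (scl b) UNIV (%x. 1 - bump b x)"
    using pd_bound_diff[OF smooth_const bump_smooth pd_bound_const[where c = 1] bump_pd_bound[OF cutoff]] by simp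
   show "scl a <= 6 * scl b"
    by (rule touching_wballs(1)[OF lip lip]) (use that True in "auto simp: earlier_def")
  qed (use D in auto)
  have "1*(1*1) <= ?B" using D by (intro mult_mono) auto
  moreover have "pd_bound K (?B^card (earlier rho a)) (scl a) UNIV (%x. PROD b:earlier rho a. 1 - bump b x)"
   using finite_earlier[OF lip True] D by (intro pd_bound_prod factor smooth_diff smooth_const bump_smooth) auto
  ultimately have "pd_bound K (?B^overlap TYPE('n)) (scl a) UNIV (%x. PROD b:earlier rho a. 1 - bump b x)"
   by (elim pd_bound_mono) (use card_earlier[OF lip True] in "auto intro!: power_increasing")
  thus ?thesis unfolding zeta_whitney[OF True] using D
   by (intro pd_bound_mult bump_pd_bound cutoff bump_smooth smooth_prod smooth_diff smooth_const) auto
 next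
  case False
  moreover have "0 <= ?C / scl a^k" for k using D by (intro divide_nonneg_nonneg mult_nonneg_nonneg zero_le_power) auto
  ultimately show ?thesis unfolding pd_bound_def by (auto simp: zeta_not_whitney pdl_const)
 qed
 moreover have "?C > 0" using D by simp
 ultimately show ?thesis by blast
qed

lemma dyadic_level_exists:
 assumes "t > (0::real)" shows "EX j::int. 2 powi j <= t & t < 2*2 powi j"
proof -
 let ?j = "\<lfloor>log 2 t\<rfloor>"
 have "2 powr of_int ?j <= t" using assms by (simp add: le_log_iff[symmetric])
 moreover have "t < 2 powr (of_int ?j + 1)" using assms by (simp add: log_less_iff[symmetric])
 ultimately show ?thesis by (intro exI[of _ ?j]) (simp add: powr_add powr_real_of_int')
qed

lemma dyadic_centre_near:
 fixes x :: "real^'n::finite"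
 obtains a where "scl a = 2 powi j" "!!i. \<bar>(x - ctr a) $ i\<bar> <= scl a / 2"
proof -
 define a :: "'n dyadic" where "a = (j, \<chi> i. round (x $ i/2 powi j))"
 have scl_a: "scl a = 2 powi j" by (simp add: a_def scl_def)
 have "\<bar>(x - ctr a) $ i\<bar> <= scl a / 2" for i
 proof -
  have "(x - ctr a) $ i = 2 powi j*(x $ i/2 powi j - of_int (round (x $ i/2 powi j)))"
   by (simp add: ctr_def scl_a right_diff_distrib) (simp add: a_def)
  moreover have "\<bar>x $ i/2 powi j - of_int (round (x $ i/2 powi j))\<bar> <= 1/2"
   using of_int_round_abs_le[of "x $ i/2 powi j"] by (simp add: abs_minus_commute)
  ultimately show ?thesis by (simp add: scl_a abs_mult)
 qed
 thus ?thesis using that scl_a by blast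
qed

lemma whitney_cover:
 fixes x :: "real^'n::finite"
 assumes "lip1 rho" "rho x > 0"
 shows "EX a:whitney rho. x:wball a & bump a x = 1"
proof -
 let ?t = "rho x / (200 * real CARD('n))"
 obtain j :: int where j: "2 powi j <= ?t" "?t < 2*2 powi j"
  using dyadic_level_exists[of ?t] assms(2) by auto
 obtain a :: "'n dyadic" where scl_a: "scl a = 2 powi j" and comp: "!!i. \<bar>(x - ctr a) $ i\<bar> <= scl a / 2"
  using dyadic_centre_near[of j x] by blast
 have "norm (x - ctr a) <= real CARD('n) * (scl a / 2)" by (rule norm_le_CARD_mult[OF comp])
 hence "norm (x - ctr a) <= rad a / 2" by (simp add: rad_def)
 hence dist: "dist x (ctr a) <= rad a" using rad_pos[of a] unfolding dist_norm by linarith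
 have "200 * rad a <= rho x" "rho x <= 400 * rad a"
  using j by (auto simp: scl_a[symmetric] rad_def field_simps)
 hence "a:whitney rho"
  using lip1D[OF assms(1), of x "ctr a"] lip1D[OF assms(1), of "ctr a" x] dist rad_pos[of a]
  by (auto simp: whitney_def dist_commute)
 moreover have "x:wball a" using dist rad_pos[of a] unfolding wball_def mem_cball dist_commute[of "ctr a"] by linarith
 moreover have "bump a x = 1" unfolding bump_alt
 proof (rule cutoff_eq_1)
  fix i
  have "\<bar>((1 / scl a) *! (x - ctr a)) $ i\<bar> = \<bar>(x - ctr a) $ i\<bar> / scl a" by (simp add: abs_mult)
  also have "... <= (scl a / 2) / scl a" by (intro divide_right_mono comp) auto
  also have "... <= 1" by simp
  finally show "\<bar>((1 / scl a) *! (x - ctr a)) $ i\<bar> <= 1" .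
 qed
 ultimately show ?thesis by blast
qed

lemma sum_prod_complement:
 fixes f :: "'a => complex" and rank :: "'a => nat"
 assumes "finite S" "inj_on rank S"
 shows "(SUM a:S. f a * (PROD b:{b \<in> S. rank b < rank a}. 1 - f b)) = 1-(PROD a:S. 1 - f a)"
 using assms
proof (induction "card S" arbitrary: S)
 case (Suc k)
 hence "S ~= {}" by auto
 then obtain m where m: "m:S" "rank m = Max (rank ` S)"
  using Max_in[of "rank ` S"] Suc.prems by fastforce
 have less_m: "rank b < rank m" if "b:S" "b ~= m" for b
  using that Max_ge[of "rank ` S" "rank b"] Suc.prems m by (metis finite_imageI imageI inj_onD le_neq_implies_less)
 let ?T = "S - {m}"
 have IH: "(SUM a:?T. f a * (PROD b:{b \<in> ?T. rank b < rank a}. 1 - f b)) = 1-(PROD a:?T. 1 - f a)"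
  by (rule Suc.hyps(1)) (use Suc m in "auto intro: inj_on_subset")
 have below_m: "{b \<in> S. rank b < rank m} = ?T" using less_m by auto
 have below: "{b \<in> S. rank b < rank a} = {b \<in> ?T. rank b < rank a}" if "a:?T" for a
  using less_m[of a] that by auto
 have "(SUM a:S. f a * (PROD b:{b \<in> S. rank b < rank a}. 1 - f b)) = f m * (PROD b:?T. 1 - f b) + (SUM a:?T. f a * (PROD b:{b \<in> ?T. rank b < rank a}. 1 - f b))"
  unfolding sum.remove[OF Suc.prems(1) m(1)] below_m by (intro arg_cong2[where f = "(+)"] sum.cong refl) (simp only: below)
 also have "... = 1-(PROD a:S. 1 - f a)"
  unfolding IH using Suc.prems m by (simp add: prod.remove[of S m] algebra_simps)
 finally show ?case .
qed auto

lemma sum_zeta: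
 fixes x :: "real^'n::finite"
 assumes "lip1 rho" "rho x > 0" "finite F" "{a:whitney rho. x:wball a} <= F"
 shows "(SUM a:F. zeta rho a x) = 1"
proof -
 let ?S = "{a:whitney rho. x:wball a}"
 have finite: "finite ?S" by (rule finite_wballs_at[OF assms(1)])
 have "(SUM a:F. zeta rho a x) = (SUM a:?S. zeta rho a x)"
  by (rule sum.mono_neutral_right) (use assms(3,4) in "auto simp: zeta_def bump_eq_0")
 also have "... = (SUM a:?S. bump a x * (PROD b:{b \<in> ?S. to_nat b < to_nat a}. 1 - bump b x))"
 proof (rule sum.cong[OF refl])
  fix a assume a: "a:?S"
  have "1 - bump b x = 1" if "b:earlier rho a - {b \<in> ?S. to_nat b < to_nat a}" for b
   using that by (cases "x:wball b") (auto simp: earlier_def bump_eq_0)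
  moreover have "{b \<in> ?S. to_nat b < to_nat a} <= earlier rho a" using a by (auto simp: earlier_def)
  ultimately have "(PROD b:earlier rho a. 1 - bump b x) = (PROD b:{b \<in> ?S. to_nat b < to_nat a}. 1 - bump b x)"
   using a finite_earlier[OF assms(1)] by (intro prod.mono_neutral_right) blast+
  thus "zeta rho a x = bump a x * (PROD b:{b \<in> ?S. to_nat b < to_nat a}. 1 - bump b x)"
   using a by (simp add: zeta_def)
 qed
 also have "... = 1-(PROD a:?S. 1 - bump a x)"
  by (rule sum_prod_complement[OF finite]) (auto simp: inj_on_def)
 also have "(PROD a:?S. 1 - bump a x) = 0"
  using whitney_cover[OF assms(1,2)] finite by (auto intro!: prod_zero)
 finally show ?thesis by simp
qed

lemma sum_indicator_whitney_le:
 fixes x :: "real^'n::finite"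
 assumes "lip1 rho" "finite F" "F <= whitney rho" "!!a. a:F ==> B a <= cball (ctr a) (50 * rad a)"
 shows "(SUM a:F. idr (B a) x) <= real (overlap TYPE('n))"
proof -
 have "(SUM a:F. idr (B a) x::real) = real (card {a \<in> F. x:B a})"
  using assms(2) by (simp add: sum.If_cases indicator_def Int_def if_distrib cong: if_cong)
 also have "card {a \<in> F. x:B a} <= card (near rho x)"
  by (rule card_mono[OF finite_near[OF assms(1)]]) (use assms in "auto simp: near_def dist_commute subset_iff")
 also have "... <= overlap TYPE('n)" by (rule card_near[OF assms(1)])
 finally show ?thesis by simp
qed

lemma sum_integral_whitney_le:
 fixes g :: "real^'n::finite => real"
 assumes "lip1 rho" "finite F" "F <= whitney rho" "!!a. a:F ==> B a <= cball (ctr a) (50 * rad a)"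
 "!!a. a:F ==> B a:sets lbg" "integrable lbg g" "!!x. g x >= 0"
 shows "(SUM a:F. (LI x. idr (B a) x * g x)) <= real (overlap TYPE('n)) * (LI x. g x)"
proof -
 have intg: "integrable lbg (%x. idr (B a) x * g x)" if "a:F" for a
  using integrable_mult_indicator[OF assms(5)[OF that] assms(6)] by simp
 hence "(SUM a:F. (LI x. idr (B a) x * g x)) = (LI x. (SUM a:F. idr (B a) x) * g x)"
  by (simp add: Bochner_Integration.integral_sum sum_distrib_right)
 also have "... <= (LI x. real (overlap TYPE('n)) * g x)"
  using intg assms(6) mult_right_mono[OF sum_indicator_whitney_le[OF assms(1-4)] assms(7)]
  by (intro integral_mono) (auto simp: sum_distrib_right)
 finally show ?thesis by simp
qed

lemma measure_cball_ge:
 fixes c :: "real^'n::finite"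
 assumes "e > 0" "k >= 1"
 shows "unit_ball_vol (real CARD('n)) * e^CARD('n) <= measure lbg (cball c (k*e))"
proof -
 have "measure lbg (cball c (k*e)) = unit_ball_vol (real CARD('n)) * (k*e)^CARD('n)"
  using content_cball[of "k*e" c] assms by simp
 moreover have "e^CARD('n) <= (k*e)^CARD('n)" using assms by (intro power_mono) auto
 ultimately show ?thesis by (simp add: mult_left_mono)
qed

lemma sum_scl_power_le:
 fixes X :: "(real^'n::finite) set"
 assumes "lip1 rho" "finite F" "F <= whitney rho" "!!a. a:F ==> wball a <= X" "X:lmeasurable"
 shows "(SUM a:F. scl a^CARD('n)) <= real (overlap TYPE('n)) / unit_ball_vol (real CARD('n)) * measure lbg X"
proof -
 let ?v = "unit_ball_vol (real CARD('n))"
 have "(SUM a:F. ?v * scl a^CARD('n)) <= (SUM a:F. (LI x. idr (wball a) x * idr X x))"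
 proof (rule sum_mono)
  fix a assume a: "a:F"
  have "(LI x. idr (wball a) x * idr X x) = (LI x. (idr (wball a) x::real))"
   by (rule Bochner_Integration.integral_cong) (use assms(4)[OF a] in "auto split: split_indicator")
  also have "... = measure lbg (wball a)" by (simp add: wball_def)
  finally have "(LI x. idr (wball a) x * idr X x) = measure lbg (wball a)" .
  moreover have "1 <= 2 * real CARD('n)" using CARD_ge_1[where 'n = 'n] by linarith
  ultimately show "?v * scl a^CARD('n) <= (LI x. idr (wball a) x * idr X x)"
   using measure_cball_ge[of "scl a" "2 * real CARD('n)" "ctr a"] by (simp add: wball_def rad_def mult.assoc)
 qed
 also have "... <= real (overlap TYPE('n)) * (LI x. idr X x)"
 proof (rule sum_integral_whitney_le[OF assms(1-3)])
  show "wball a <= cball (ctr a) (50 * rad a)" for a :: "'n dyadic"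
   unfolding wball_def by (intro subset_cball mult_right_mono) auto
 qed (use assms(5) in "auto simp: wball_def fmeasurable_def integrable_indicator_iff")
 also have "(LI x. idr X x) = measure lbg X" using assms(5) by (simp add: fmeasurable_def)
 finally show ?thesis by (simp add: sum_distrib_left[symmetric] field_simps)
qed

subsection \<open>Muckenhoupt weights\<close>

lemma measure_ball_pos: "r > 0 ==> measure lbg (ball (c::real^'n::finite) r) > 0"
 using content_ball_gt_0_iff[of c r] by simp

lemma measure_ball_scale:
 fixes c :: "real^'n::finite"
 assumes "r >= 0" "k >= 0" shows "measure lbg (ball c (k*r)) = k^CARD('n) * measure lbg (ball c r)"
 using assms content_ball[of r c] content_ball[of "k*r" c] by (simp add: power_mult_distrib)

lemma set_integral_pos:
 fixes f :: "real^'n::finite => real"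
 assumes "set_integrable lbg X f" "!!x. f x > 0" "X:sets lbg" "measure lbg X > 0"
 shows "(LINT x:X|lbg. f x) > 0"
proof (rule ccontr)
 assume "~?thesis"
 moreover have "(LINT x:X|lbg. f x) >= 0" unfolding set_lebesgue_integral_def
  using assms(2) by (auto intro!: Bochner_Integration.integral_nonneg simp: less_imp_le)
 ultimately have "(LINT x:X|lbg. f x) = 0" by simp
 hence "AL x. idr X x *! f x = 0"
  unfolding set_lebesgue_integral_def
  by (subst (asm) integral_nonneg_eq_0_iff_AE) (use assms in "auto simp: set_integrable_def less_imp_le")
 hence "AL x. x~:X"
  by eventually_elim (use assms(2) in "auto simp: indicator_def less_imp_neq[symmetric] split: if_splits")
 hence "X:null_sets lbg" using assms(3) by (simp add: AE_iff_null_sets)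
 thus False using assms(4) by (simp add: null_sets_def measure_def)
qed

lemma measure_le_dual_weight:
 fixes w :: "real^'n::finite => real"
 assumes q: "q > 1" and E: "E:lmeasurable" and w: "!!x. w x > 0"
 and intg: "set_integrable lbg E w" "set_integrable lbg E (%x. w x powr (- 1/(q-1)))"
 shows "measure lbg E powr q <= (LINT x:E|lbg. w x)*(LINT x:E|lbg. w x powr (- 1/(q-1))) powr (q-1)"
proof (cases "measure lbg E = 0")
 case False
 hence pos: "measure lbg E > 0" by (simp add: zero_less_measure_iff)
 define I J where "I = (LINT x:E|lbg. w x)" and "J = (LINT x:E|lbg. w x powr (- 1/(q-1)))"
 have I_J_pos: "I > 0" "J > 0"
  unfolding I_def J_def using E w set_integral_pos[OF intg(1) w _ pos] set_integral_pos[OF intg(2) _ _ pos]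
  by (auto simp: less_imp_neq[symmetric] fmeasurable_def)
 let ?c = "(1/I) powr (1/q)*(1/J) powr (1 - 1/q)"
 have young: "?c <= 1/q*(1/I) * w x + (1 - 1/q)*(1/J) * w x powr (- 1/(q-1))" for x
 proof -
  have "- 1/(q-1)*(1 - 1/q) = - (1/q)" using q by (simp add: field_simps)
  hence "w x powr (1/q)*(w x powr (- 1/(q-1))) powr (1 - 1/q) = w x powr (1/q + - (1/q))"
   by (simp only: powr_powr powr_add)
  hence "?c = (w x / I) powr (1/q)*(w x powr (- 1/(q-1))/J) powr (1 - 1/q)"
   using w[of x] I_J_pos by (simp add: powr_divide field_simps)
  also have "... <= 1/q*(w x / I) + (1 - 1/q)*(w x powr (- 1/(q-1))/J)"
   by (rule Youngs_inequality_0) (use q w[of x] I_J_pos in "auto simp: less_imp_le")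
  finally show ?thesis by simp
 qed
 have "measure lbg E * ?c = (LINT x:E|lbg. ?c)"
  using E by (simp add: set_lebesgue_integral_def fmeasurable_def)
 also have "... <= (LINT x:E|lbg. 1/q*(1/I) * w x + (1 - 1/q)*(1/J) * w x powr (- 1/(q-1)))"
  using E by (intro set_integral_mono young set_integral_add set_integrable_mult_right intg)
  (auto simp: set_integrable_def fmeasurable_def integrable_indicator_iff)
 also have "... = 1/q*(1/I)*I + (1 - 1/q)*(1/J)*J"
  unfolding I_def J_def using intg by (simp add: set_integral_add set_integrable_mult_right)
 also have "... = 1" using q I_J_pos by (simp add: field_simps)
 finally have "measure lbg E <= I powr (1/q)*J powr (1 - 1/q)"
  using I_J_pos by (simp add: powr_divide field_simps)
 hence "measure lbg E powr q <= (I powr (1/q)*J powr (1 - 1/q)) powr q"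
  using pos q by (intro powr_mono2) auto
 also have "(1 - 1/q)*q = q-1" using q by (simp add: field_simps)
 hence "(I powr (1/q)*J powr (1 - 1/q)) powr q = I*J powr (q-1)"
  using I_J_pos q by (simp add: powr_mult powr_powr)
 finally show ?thesis by (simp add: I_def J_def)
qed (use w in "auto simp: set_lebesgue_integral_def less_imp_le intro!: Bochner_Integration.integral_nonneg")

lemma A1_measure_ratio:
 fixes w :: "real^'n::finite => real"
 assumes r: "r > 0" and E: "E:sets lbg" "E <= ball c r" and w: "!!x. w x > 0"
 and intg: "set_integrable lbg (ball c r) w"
 and bound: "AL x. x:ball c r --> avg_ball w (ball c r) * inverse (w x) <= K"
 shows "measure lbg E / measure lbg (ball c r) * (LINT x:ball c r|lbg. w x) <= max K 0 * (LINT x:E|lbg. w x)"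
proof -
 have E_lmeasurable: "E:lmeasurable" by (rule fmeasurableI2[OF lmeasurable_ball E(2,1)])
 have "(LINT x:E|lbg. avg_ball w (ball c r)) <= (LINT x:E|lbg. max K 0 * w x)"
  unfolding set_lebesgue_integral_def
 proof (rule integral_mono_AE)
  show "integrable lbg (%x. idr E x *! avg_ball w (ball c r))"
   using E_lmeasurable by (auto simp: fmeasurable_def integrable_indicator_iff)
  show "integrable lbg (%x. idr E x *! (max K 0 * w x))"
   using set_integrable_mult_right[of "max K 0", OF set_integrable_subset[OF intg E]] by (simp add: set_integrable_def)
  show "AL x. idr E x *! avg_ball w (ball c r) <= idr E x *! (max K 0 * w x)"
   using bound
  proof eventually_elim
   case (elim x)
   hence "avg_ball w (ball c r) * inverse (w x) <= max K 0" if "x:E" using that E by auto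
   thus ?case using w[of x] by (auto simp: field_simps split: split_indicator)
  qed
 qed
 thus ?thesis using E_lmeasurable by (simp add: set_lebesgue_integral_def fmeasurable_def avg_ball_def)
qed

lemma Aq_measure_ratio:
 fixes w :: "real^'n::finite => real"
 assumes q: "q > 1" and r: "r > 0" and E: "E:sets lbg" "E <= ball c r" and pos: "!!x. w x > 0"
 and intg: "set_integrable lbg (ball c r) w" "set_integrable lbg (ball c r) (%x. w x powr (- 1/(q-1)))"
 and average: "avg_ball w (ball c r) * avg_ball (%x. w x powr (- 1/(q-1))) (ball c r) powr (q-1) <= K"
 shows "(measure lbg E / measure lbg (ball c r)) powr q*(LINT x:ball c r|lbg. w x) <= max K 0 * (LINT x:E|lbg. w x)"
proof -
 let ?B = "ball c r" and ?dual = "%x. w x powr (- 1/(q-1))"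
 define b W D I where "b = measure lbg ?B" and "W = (LINT x:?B|lbg. w x)"
  and "D = (LINT x:?B|lbg. ?dual x) powr (q-1)" and "I = (LINT x:E|lbg. w x)"
 note intg_E = set_integrable_subset[OF intg(1) E] set_integrable_subset[OF intg(2) E]
 have b: "b > 0" unfolding b_def by (rule measure_ball_pos[OF r])
 have nonneg: "W >= 0" "I >= 0" "(LINT x:E|lbg. ?dual x) >= 0" unfolding W_def I_def set_lebesgue_integral_def
  using pos by (auto intro!: Bochner_Integration.integral_nonneg simp: less_imp_le)
 have "(LINT x:E|lbg. ?dual x) <= (LINT x:?B|lbg. ?dual x)" unfolding set_lebesgue_integral_def
  by (rule integral_mono) (use intg intg_E E in "auto simp: set_integrable_def split: split_indicator")
 hence "(LINT x:E|lbg. ?dual x) powr (q-1) <= D"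
  unfolding D_def using q nonneg by (intro powr_mono2) auto
 moreover have "measure lbg E powr q <= I*(LINT x:E|lbg. ?dual x) powr (q-1)"
  unfolding I_def by (intro measure_le_dual_weight q fmeasurableI2[OF lmeasurable_ball E(2,1)] pos intg_E)
 ultimately have E_le: "measure lbg E powr q <= I*D" using mult_left_mono nonneg(2) order_trans by blast
 have "W/b*(D/b powr (q-1)) <= K"
  using average unfolding avg_ball_def W_def D_def b_def by (simp add: powr_divide)
 hence "W/b*(D/b powr (q-1)) <= max K 0" by linarith
 hence "W*D <= max K 0 * (b*b powr (q-1))" using b by (simp add: field_simps)
 also have "b*b powr (q-1) = b powr q" using b by (simp add: powr_mult_base)
 finally have "I*(W*D) <= I*(max K 0 * b powr q)" using nonneg(2) by (rule mult_left_mono)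
 with mult_right_mono[OF E_le nonneg(1)] have "measure lbg E powr q*W <= I*(max K 0 * b powr q)" by (simp add: mult_ac)
 thus ?thesis unfolding W_def[symmetric] I_def[symmetric] b_def[symmetric]
  using b by (simp add: powr_divide field_simps)
qed

lemma A_class_measure_ratio:
 fixes phi :: "real^'n::finite => real => real"
 assumes MO: "MO_function phi" and A: "A_class phi q"
 shows "EX K>=0. ALL c r t E. r > 0 --> t > 0 --> E:sets lbg --> E <= ball c r --> set_integrable lbg (ball c r) (%x. phi x t) & (measure lbg E / measure lbg (ball c r)) powr q*(LINT x:ball c r|lbg. phi x t) <= K*(LINT x:E|lbg. phi x t)"
proof -
 have pos: "phi x t > 0" if "t > 0" for x t
  using MO that unfolding MO_function_def by (auto simp: less_le)
 consider (one) K where "q = 1" "!!c r t. r > 0 ==> t > 0 ==> set_integrable lbg (ball c r) (%x. phi x t) & (AL x. x:ball c r --> avg_ball (%y. phi y t) (ball c r) * inverse (phi x t) <= K)"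
  | (gt) K where "q > 1" "!!c r t. r > 0 ==> t > 0 ==> set_integrable lbg (ball c r) (%x. phi x t) & set_integrable lbg (ball c r) (%x. phi x t powr (- 1/(q-1))) & avg_ball (%y. phi y t) (ball c r) * avg_ball (%y. phi y t powr (- 1/(q-1))) (ball c r) powr (q-1) <= K"
  using A unfolding A_class_def by blast
 thus ?thesis
 proof cases
  case one
  hence "(measure lbg E / measure lbg (ball c r)) powr q*(LINT x:ball c r|lbg. phi x t) <= max K 0 * (LINT x:E|lbg. phi x t)"
   if "r > 0" "t > 0" "E:sets lbg" "E <= ball c r" for c r t E
   using A1_measure_ratio[OF that(1,3,4) pos[OF that(2)]] that by (simp add: powr_one')
  with one(2) show ?thesis by (intro exI[of _ "max K 0"]) auto
 next
  case gt
  hence "(measure lbg E / measure lbg (ball c r)) powr q*(LINT x:ball c r|lbg. phi x t) <= max K 0 * (LINT x:E|lbg. phi x t)"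
   if "r > 0" "t > 0" "E:sets lbg" "E <= ball c r" for c r t E
   by (intro Aq_measure_ratio[OF gt(1) that(1,3,4) pos[OF that(2)]]) (use gt(2)[OF that(1,2), of c] in simp_all)
  with gt(2) show ?thesis by (intro exI[of _ "max K 0"]) auto
 qed
qed

lemma nn_set_integral_eq:
 assumes "set_integrable lbg E f" "!!x. f x >= 0"
 shows "(NN x. en (f x) * idr E x) = en (LINT x:E|lbg. f x)"
proof -
 have "(NN x. en (f x) * idr E x) = (NN x. en (idr E x *! f x))"
  by (intro nn_integral_cong) (auto split: split_indicator)
 also have "... = en (LINT x:E|lbg. f x)"
  unfolding set_lebesgue_integral_def
  by (rule nn_integral_eq_integral) (use assms in "auto simp: set_integrable_def")
 finally show ?thesis .
qed

subsection \<open>The regularised growth function\<close>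

text \<open>The condition \<open>gap\<close> is the way in which the definition of \<open>m_phi\<close> enters: molecules with
\<open>m_phi phi\<close> vanishing moments decay fast enough to be \<open>phi\<close>-integrable.\<close>

locale growth =
 fixes phi :: "real^'n::finite => real => real" and K p q0 :: real
 assumes MO: "MO_function phi"
 and K_ge_1: "K >= 1" and p_pos: "p > 0" and q0_ge_1: "q0 >= 1"
 and lower_type: "!!x t s. t >= 0 ==> 0 < s ==> s <= 1 ==> phi x (s*t) <= K * s powr p * phi x t"
 and upper_type: "!!x t s. t >= 0 ==> s >= 1 ==> phi x (s*t) <= K * s * phi x t"
 and ball_finite: "!!c r t. r > 0 ==> t > 0 ==> (NN x. en (phi x t) * idr (ball c r) x) < \<infinity>"
 and muckenhoupt: "!!c r t E. r > 0 ==> t > 0 ==> E:sets lbg ==> E <= ball c r ==> en ((measure lbg E / measure lbg (ball c r)) powr q0) * (NN x. en (phi x t) * idr (ball c r) x) <= en K * (NN x. en (phi x t) * idr E x)"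
 and gap: "real (CARD('n) + m_phi phi + 1) * p > real CARD('n) * q0"

lemma unif_lower_type_le_1:
 assumes "growth_function phi" "unif_lower_type phi q" shows "q <= 1"
proof (rule ccontr)
 assume "~q <= 1"
 hence q: "q > 1" by simp
 let ?f = "phi undefined"
 obtain C where upper: "!!t s. t >= 0 ==> s >= 1 ==> ?f (s*t) <= C * s powr 1 * ?f t"
  using assms by (auto simp: growth_function_def unif_upper_type_def)
 obtain D where lower: "!!t s. t >= 0 ==> 0 < s ==> s <= 1 ==> ?f (s*t) <= D * s powr q * ?f t"
  using assms by (auto simp: unif_lower_type_def)
 have pos: "?f t > 0" if "t > 0" for t
  using assms that unfolding growth_function_def MO_function_def by (metis less_le)
 have const_bound: "1 <= C*D * s powr (q-1)" if s: "0 < s" "s <= 1" for s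
 proof -
  have f_1_bound: "?f 1 <= C*(1 / s) * ?f s" using upper[of s "1 / s"] s by simp
  have "0 < C*(1 / s) * ?f s" using less_le_trans[OF pos[of 1] f_1_bound] by simp
  hence "C > 0" using s pos[OF s(1)] by (simp add: zero_less_mult_iff zero_less_divide_iff)
  hence "?f 1 <= C*(1 / s)*(D * s powr q * ?f 1)"
   using lower[of 1 s] s by (intro order_trans[OF f_1_bound] mult_left_mono) auto
  also have "... = (C*D * s powr (q-1)) * ?f 1" using s by (simp add: powr_diff)
  finally show ?thesis using pos[of 1] by simp
 qed
 have "((%s. s powr (q-1)) \<longlongrightarrow> 0 powr (q-1)) (at_right (0::real))"
  using q by (intro tendsto_powr') (auto simp: eventually_at_right_field intro!: exI[of _ 1])
 hence "((%s. C*D * s powr (q-1)) \<longlongrightarrow> C*D*0) (at_right 0)"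
  by (intro tendsto_intros) simp
 hence "\<forall>\<^sub>F s in at_right 0. C*D * s powr (q-1) < 1"
  by (rule order_tendstoD) simp
 moreover have "\<forall>\<^sub>F s::real in at_right 0. 0 < s & s <= 1"
  by (auto simp: eventually_at_right_field intro!: exI[of _ 1])
 ultimately have "\<forall>\<^sub>F s::real in at_right 0. False" by eventually_elim (use const_bound in "auto simp: not_less[symmetric]")
 thus False by simp
qed

lemma i_phi_pos:
 assumes "growth_function phi" shows "i_phi phi > 0"
proof -
 obtain p where "unif_lower_type phi p" "p > 0" using assms by (auto simp: growth_function_def)
 moreover have "bdd_above {p. unif_lower_type phi p}" using unif_lower_type_le_1[OF assms] by (auto simp: bdd_above_def)
 ultimately show ?thesis using cSup_upper[of p "{p. unif_lower_type phi p}"] by (simp add: i_phi_def)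
qed

lemma growth_exponents_exist:
 fixes phi :: "real^'n::finite => real => real"
 assumes growth: "growth_function phi"
 obtains p q where "p > 0" "unif_lower_type phi p" "q >= 1" "A_class phi q"
 "real (CARD('n) + m_phi phi + 1) * p > real CARD('n) * q"
proof -
 let ?n = "real CARD('n)" and ?N = "real CARD('n) + real (m_phi phi) + 1"
 note i_pos = i_phi_pos[OF growth]
 have "?n*(q_phi phi / i_phi phi - 1) < real (m_phi phi) + 1"
  unfolding m_phi_def by linarith
 hence "?n * q_phi phi / i_phi phi < ?N" by (simp add: algebra_simps)
 hence "?n * q_phi phi / ?N < i_phi phi" using i_pos by (simp add: field_simps)
 then obtain v where v: "?n * q_phi phi / ?N < v" "v < i_phi phi" using dense by blast
 have nonempty: "{q. q >= 1 & A_class phi q} ~= {}" "{p. unif_lower_type phi p} ~= {}"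
  using growth by (auto simp: growth_function_def A_infty_def)
 have "q_phi phi < ?N * v/?n" using v(1) by (simp add: pos_divide_less_eq pos_less_divide_eq mult_ac)
 then obtain q where q: "q >= 1" "A_class phi q" "q < ?N * v/?n"
  using cInf_lessD[OF nonempty(1), of "?N * v/?n"] by (auto simp: q_phi_def)
 obtain p where p: "p > v" "unif_lower_type phi p"
  using less_cSupD[OF nonempty(2)] v(2) by (auto simp: i_phi_def)
 have q_less: "?n*q < ?N * v" using q(3) by (simp add: pos_less_divide_eq mult_ac)
 moreover have "0 < ?n*q" using q(1) by simp
 ultimately have "v > 0" using zero_less_mult_pos[of ?N v] by simp
 moreover have "?n*q < ?N*p" using q_less mult_strict_left_mono[OF p(1), of ?N] by linarith
 ultimately show ?thesis using that[OF _ p(2) q(1,2)] p(1) by (simp add: add_ac)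
qed

lemma growth_locale_exists:
 fixes phi :: "real^'n::finite => real => real"
 assumes growth: "growth_function phi"
 shows "EX K p q0. growth phi K p q0"
proof -
 have MO: "MO_function phi" using growth by (simp add: growth_function_def)
 have nonneg: "phi x t >= 0" if "t >= 0" for x t using MO that unfolding MO_function_def by blast
 obtain p q0 where exps: "p > 0" "unif_lower_type phi p" "q0 >= 1" "A_class phi q0"
  "real (CARD('n) + m_phi phi + 1) * p > real CARD('n) * q0" by (rule growth_exponents_exist[OF growth])
 obtain Cl where lower: "!!x t s. t >= 0 ==> 0 < s ==> s <= 1 ==> phi x (s*t) <= Cl * s powr p * phi x t"
  using exps(2) by (auto simp: unif_lower_type_def)
 obtain Cu where upper: "!!x t s. t >= 0 ==> s >= 1 ==> phi x (s*t) <= Cu * s powr 1 * phi x t"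
  using growth by (auto simp: growth_function_def unif_upper_type_def)
 obtain Ca where ratio: "!!c r t E. r > 0 ==> t > 0 ==> E:sets lbg ==> E <= ball c r ==> set_integrable lbg (ball c r) (%x. phi x t) & (measure lbg E / measure lbg (ball c r)) powr q0*(LINT x:ball c r|lbg. phi x t) <= Ca*(LINT x:E|lbg. phi x t)"
  using A_class_measure_ratio[OF MO exps(4)] by blast
 define K where "K = max 1 (max Cl (max Cu Ca))"
 have K: "1 <= K" "Cl <= K" "Cu <= K" "Ca <= K" by (auto simp: K_def)
 have "growth phi K p q0"
 proof
  show "phi x (s*t) <= K * s powr p * phi x t" if "t >= 0" "0 < s" "s <= 1" for x t s
  proof -
   have "Cl*(s powr p * phi x t) <= K*(s powr p * phi x t)" using K(2) nonneg[OF that(1)] by (intro mult_right_mono) auto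
   thus ?thesis using lower[OF that, of x] by (simp add: mult.assoc)
  qed
  show "phi x (s*t) <= K * s * phi x t" if "t >= 0" "s >= 1" for x t s
  proof -
   have "Cu*(s * phi x t) <= K*(s * phi x t)" using K(3) nonneg[OF that(1)] that by (intro mult_right_mono) auto
   moreover have "phi x (s*t) <= Cu*(s * phi x t)" using upper[OF that, of x] that by (simp add: mult.assoc)
   ultimately show ?thesis by (simp only: mult.assoc)
  qed
  show "(NN x. en (phi x t) * idr (ball c r) x) < \<infinity>" if "r > 0" "t > 0" for c r t
   using ratio[OF that, of "{}" c] nn_set_integral_eq[of "ball c r" "%x. phi x t"] nonneg[of t] that by simp
  show "en ((measure lbg E / measure lbg (ball c r)) powr q0) * (NN x. en (phi x t) * idr (ball c r) x) <= en K * (NN x. en (phi x t) * idr E x)"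
   if ball: "r > 0" "t > 0" "E:sets lbg" "E <= ball c r" for c r t E
  proof -
   have t: "phi x t >= 0" for x using nonneg that by simp
   note intg = ratio[OF ball, THEN conjunct1]
   note intg_E = set_integrable_subset[OF intg ball(3,4)]
   have integral_nonneg: "(LINT x:X|lbg. phi x t) >= 0" for X unfolding set_lebesgue_integral_def
    using t by (auto intro!: Bochner_Integration.integral_nonneg)
   have "(measure lbg E / measure lbg (ball c r)) powr q0*(LINT x:ball c r|lbg. phi x t) <= K*(LINT x:E|lbg. phi x t)"
    using ratio[OF ball] mult_right_mono[OF K(4) integral_nonneg[of E]] by linarith
   thus ?thesis
    unfolding nn_set_integral_eq[OF intg t] nn_set_integral_eq[OF intg_E t] using integral_nonneg K(1)
    by (simp only: ennreal_mult[symmetric] powr_ge_zero ennreal_leI)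
  qed
 qed (use MO K(1) exps in auto)
 thus ?thesis by blast
qed

lemma ball_sets_lebesgue [measurable]: "ball (c::real^'n::finite) r:sets lbg"
 and cball_sets_lebesgue [measurable]: "cball (c::real^'n::finite) r:sets lbg"
 by simp_all

lemma dyadic_shell_of_point:
 assumes "r > (0::real)" "d >= 0"
 obtains j where "d < 2^j*r" "r/(r+d) <= 2*2 powr (- real j)"
proof -
 define j where "j = (LEAST j. d < 2^j*r)"
 obtain i where "d/r < 2^i" using real_arch_pow[of 2 "d/r"] by auto
 hence "d < 2^i*r" using assms(1) by (simp add: field_simps)
 hence j: "d < 2^j*r" unfolding j_def by (rule LeastI)
 have "r/(r+d) <= 2*2 powr (- real j)"
 proof (cases j)
  case 0
  thus ?thesis using assms by (simp add: divide_le_eq)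
 next
  case (Suc i)
  hence "~d < 2^i*r" unfolding j_def using not_less_Least[of i] by (metis lessI)
  hence "r/(r+d) <= r/(2^i*r)" using assms by (intro divide_left_mono) (auto intro!: mult_pos_pos add_pos_nonneg)
  also have "... = 2*2 powr (- real j)" using assms(1) Suc by (simp add: powr_minus_divide powr_realpow del: of_nat_Suc)
  finally show ?thesis .
 qed
 thus ?thesis using that j by blast
qed

lemma nn_integral_dyadic_shells:
 fixes g :: "real^'n::finite => ennreal"
 assumes "r > 0" "b >= 0" and [measurable]: "g:bml"
 shows "(NN x. g x * en ((r/(r + dist x c)) powr b)) <= (\<Sum>j. en (2 powr b*2 powr (- b * real j)) * (NN x. g x * idr (ball c (2^j*r)) x))"
proof -
 let ?shell = "%j x. en (2 powr b*2 powr (- b * real j)) * (g x * idr (ball c (2^j*r)) x)"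
 have "g x * en ((r/(r + dist x c)) powr b) <= (\<Sum>j. ?shell j x)" for x
 proof -
  obtain j where j: "dist x c < 2^j*r" "r/(r + dist x c) <= 2*2 powr (- real j)"
   using dyadic_shell_of_point[OF assms(1) zero_le_dist] by blast
  have "(r/(r + dist x c)) powr b <= (2*2 powr (- real j)) powr b"
   using j(2) assms by (intro powr_mono2) auto
  hence "(r/(r + dist x c)) powr b <= 2 powr b*2 powr (- b * real j)" by (simp add: powr_mult powr_powr mult.commute)
  hence "g x * en ((r/(r + dist x c)) powr b) <= ?shell j x"
   using j(1) by (simp add: dist_commute mult.commute mult_left_mono ennreal_leI)
  thus ?thesis using sum_le_suminf[of "%j. ?shell j x" "{j}"] by simp
 qed
 hence "(NN x. g x * en ((r/(r + dist x c)) powr b)) <= (NN x. (\<Sum>j. ?shell j x))"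
  by (intro nn_integral_mono)
 also have "... = (\<Sum>j. en (2 powr b*2 powr (- b * real j)) * (NN x. g x * idr (ball c (2^j*r)) x))"
  by (simp add: nn_integral_suminf nn_integral_cmult)
 finally show ?thesis .
qed

lemma nn_integral_decay_le:
 fixes g :: "real^'n::finite => ennreal" and b d :: real
 assumes "b > d" "d >= 0" "r > 0" "D >= 0" "g:bml"
 and doubling: "!!j. (NN x. g x * idr (ball c (2^j*r)) x) <= en (D*2 powr (d * real j)) * G"
 shows "(NN x. g x * en ((r/(r + dist x c)) powr b)) <= en (2 powr b/(1-2 powr (d-b))*D) * G"
proof -
 define z where "z = 2 powr (d-b)"
 have z: "0 < z" "z < 1" using assms(1) powr_less_mono[of "d-b" 0 2] by (auto simp: z_def)
 have "(NN x. g x * en ((r/(r + dist x c)) powr b)) <= (\<Sum>j. en (2 powr b*2 powr (- b * real j)) * (NN x. g x * idr (ball c (2^j*r)) x))"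
  using assms by (intro nn_integral_dyadic_shells) auto
 also have "... <= (\<Sum>j. en (2 powr b*D*z^j) * G)"
 proof (intro suminf_le summableI)
  fix j
  have "en (2 powr b*2 powr (- b * real j)) * (NN x. g x * idr (ball c (2^j*r)) x) <= en (2 powr b*2 powr (- b * real j)) * (en (D*2 powr (d * real j)) * G)"
   by (intro mult_left_mono doubling) auto
  also have "... = en (2 powr b*2 powr (- b * real j)*(D*2 powr (d * real j))) * G"
   using assms(4) by (simp add: ennreal_mult mult_ac)
  also have "2 powr b*2 powr (- b * real j)*(D*2 powr (d * real j)) = 2 powr b*D*z^j"
   by (simp add: z_def powr_realpow[symmetric] powr_powr powr_add[symmetric] algebra_simps)
  finally show "en (2 powr b*2 powr (- b * real j)) * (NN x. g x * idr (ball c (2^j*r)) x) <= en (2 powr b*D*z^j) * G" .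
 qed
 also have "... = (\<Sum>j. en (2 powr b*D*z^j))*G" by (rule ennreal_suminf_multc)
 also have "(\<Sum>j. en (2 powr b*D*z^j)) = en (\<Sum>j. 2 powr b*D*z^j)"
  using assms(4) z by (intro suminf_ennreal2 summable_mult summable_geometric) auto
 also have "(\<Sum>j. 2 powr b*D*z^j) = 2 powr b/(1-z)*D"
  using z by (simp add: suminf_mult suminf_geometric summable_geometric)
 finally show ?thesis unfolding z_def .
qed

lemma nn_integral_geometric_int:
 assumes "0 < z" "z < 1"
 shows "(\<integral>\<^sup>+k. en (z^nat (k0-k)) * idr {..k0} k \<partial>count_space (UNIV::int set)) = en (1/(1-z))"
proof -
 have "(\<integral>\<^sup>+k. en (z^nat (k0-k)) * idr {..k0} k \<partial>count_space UNIV) = (\<integral>\<^sup>+k. en (z^nat (k0-k)) \<partial>count_space {..k0})"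
  by (simp add: nn_integral_count_space_indicator)
 also have "bij_betw (%k. nat (k0-k)) {..k0} UNIV"
  by (rule bij_betw_byWitness[where f' = "%j. k0 - int j"]) auto
 hence "(\<integral>\<^sup>+k. en (z^nat (k0-k)) \<partial>count_space {..k0}) = (\<integral>\<^sup>+j. en (z^j) \<partial>count_space (UNIV::nat set))"
  by (rule nn_integral_bij_count_space)
 also have "... = (\<Sum>j. en (z^j))" by (rule nn_integral_count_space_nat)
 also have "... = en (1/(1-z))"
  using assms by (simp add: suminf_ennreal2 summable_geometric suminf_geometric)
 finally show ?thesis .
qed

abbreviation dyadic_sum :: "(int => ennreal) => ennreal => ennreal" where
 "dyadic_sum F v == (\<integral>\<^sup>+k. (if en (2 powi k) < v then F k else 0) \<partial>count_space UNIV)"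

context growth begin

text \<open>Since \<open>phi\<close> need not be continuous in its second argument, \<open>x \<mapsto> phi x (g x)\<close> may fail to be
measurable. Its left-continuous version \<open>Phi\<close> is measurable and comparable to it.\<close>

definition Phi :: "real^'n => ennreal => ennreal" where
 "Phi x v = (SUP r\<in>{r \<in> \<rat>. 0 < r}. if en r < v then en (phi x r) else 0)"

abbreviation modular :: "(real^'n => ennreal) => ennreal" where
 "modular g == (NN x. Phi x (g x))"

lemma phi_nonneg: "t >= 0 ==> phi x t >= 0"
 and phi_mono: "0 <= s ==> s <= t ==> phi x s <= phi x t"
 and phi_pos: "t > 0 ==> phi x t > 0"
 and phi_0: "phi x 0 = 0"
 and phi_at_top: "filterlim (phi x) at_top at_top"
 and phi_measurable: "t >= 0 ==> (%x. phi x t):bml"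
 using MO unfolding MO_function_def mono_on_def by (auto simp: less_le)

lemma Phi_mono: "v <= w ==> Phi x v <= Phi x w"
 unfolding Phi_def by (intro SUP_mono) (auto intro: less_le_trans)

lemma Phi_measurable [measurable]:
 assumes [measurable]: "g:bml"
 shows "(%x. Phi x (g x)):bml"
 unfolding Phi_def
proof (rule borel_measurable_SUP)
 show "countable {r \<in> \<rat>. 0 < (r::real)}" by (rule countable_subset[OF _ countable_rat]) auto
 fix r :: real assume "r:{r \<in> \<rat>. 0 < r}"
 hence [measurable]: "(%x. phi x r):bml" by (intro phi_measurable) auto
 show "(%x. if en r < g x then en (phi x r) else 0):bml" by measurable
qed

lemma Phi_le_phi_ext: "Phi x v <= phi_ext phi x v"
 unfolding Phi_def
proof (rule SUP_least)
 fix r :: real assume r: "r:{r \<in> \<rat>. 0 < r}"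
 show "(if en r < v then en (phi x r) else 0) <= phi_ext phi x v"
 proof (cases v)
  case (real t)
  thus ?thesis using r by (auto simp: phi_ext_def ennreal_less_iff intro!: ennreal_leI phi_mono)
 qed (auto simp: phi_ext_def)
qed

lemma phi_le_Phi: "r:\<rat> ==> 0 < r ==> en r < v ==> en (phi x r) <= Phi x v"
 unfolding Phi_def by (rule SUP_upper2[of r]) auto

lemma Phi_top: "Phi x top = top"
proof (rule ccontr)
 assume "Phi x top ~= top"
 then obtain b where b: "Phi x top = en b" "b >= 0" by (cases "Phi x top") auto
 obtain N where N: "!!t. t >= N ==> phi x t > b"
  using phi_at_top[of x] unfolding filterlim_at_top_dense eventually_at_top_linorder by blast
 define r where "r = real (nat \<lceil>max N 1\<rceil>)"
 have "r:\<rat>" "r >= N" "r > 0" unfolding r_def by (auto simp: less_max_iff_disj) linarith+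
 thus False using phi_le_Phi[of r top x] N[of r] b phi_nonneg[of r x] by (simp add: ennreal_le_iff)
qed

lemma phi_ext_le_Phi: "phi_ext phi x v <= en (2*K) * Phi x v"
proof (cases v)
 case (real t)
 show ?thesis
 proof (cases "t = 0")
  case False
  hence t: "t > 0" using real by simp
  obtain r where r: "r:\<rat>" "t/2 < r" "r < t" using Rats_dense_in_real[of "t/2" t] t by auto
  have "phi x t <= phi x (2*r)" using r t by (intro phi_mono) auto
  also have "... <= K*2 * phi x r" using upper_type[of r 2 x] r t by simp
  finally have "en (phi x t) <= en (2*K) * en (phi x r)"
   using K_ge_1 phi_nonneg[of r x] r t by (simp add: ennreal_mult[symmetric] ennreal_leI mult_ac)
  also have "en (phi x r) <= Phi x v" using r t real by (intro phi_le_Phi) (auto simp: ennreal_less_iff)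
  finally show ?thesis using real by (simp add: phi_ext_def mult_left_mono)
 qed (use real in "simp add: phi_ext_def phi_0")
qed (use K_ge_1 in "simp add: Phi_top ennreal_mult_top")

lemma Phi_0 [simp]: "Phi x 0 = 0"
 by (auto simp: Phi_def intro!: antisym SUP_least)

lemma Phi_eq_0: assumes "Phi x v = 0" shows "v = 0"
proof (rule ccontr)
 assume "v ~= 0"
 hence "0 < v" by (simp add: zero_less_iff_neq_zero)
 then obtain s where s: "0 < s" "s < v" using dense by blast
 then obtain t where t: "s = en t" "t > 0" by (cases s) auto
 obtain r where r: "r:\<rat>" "0 < r" "r < t" using Rats_dense_in_real[of 0 t] t by auto
 have "en r < v" using r t s by (metis ennreal_less_iff less_imp_le less_trans)
 hence "en (phi x r) <= Phi x v" by (rule phi_le_Phi[OF r(1,2)])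
 thus False using assms phi_pos[OF r(2), of x] by simp
qed

definition L where "L = 2*K*K"

lemma L_ge_1: "L >= 1"
 unfolding L_def using K_ge_1 mult_mono[of 1 K 1 K] by simp

lemma Phi_scale_type:
 assumes "s > 0" "k >= 0" "!!t. t >= 0 ==> phi x (s*t) <= K*k * phi x t" "k = 0 ==> v < top"
 shows "Phi x (en s * v) <= en (L*k) * Phi x v"
proof -
 have "phi_ext phi x (en s * v) <= en (K*k) * phi_ext phi x v"
 proof (cases v)
  case (real t)
  hence "en s * v = en (s*t)" using assms by (simp add: ennreal_mult)
  thus ?thesis using assms(3)[of t] real assms phi_nonneg[of t x] K_ge_1
   by (simp add: phi_ext_def ennreal_mult[symmetric] ennreal_leI)
 qed (use assms K_ge_1 in "auto simp: phi_ext_def ennreal_mult_top")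
 also have "... <= en (K*k) * (en (2*K) * Phi x v)" by (intro mult_left_mono phi_ext_le_Phi) auto
 also have "... = en (L*k) * Phi x v" using K_ge_1 assms by (simp add: L_def ennreal_mult mult_ac)
 finally show ?thesis using order_trans[OF Phi_le_phi_ext] by blast
qed

lemma Phi_scale_up: "s >= 1 ==> Phi x (en s * v) <= en (L * s) * Phi x v"
 using upper_type by (intro Phi_scale_type) auto

lemma Phi_scale_down: "0 < s ==> s <= 1 ==> Phi x (en s * v) <= en (L * s powr p) * Phi x v"
 using lower_type by (intro Phi_scale_type) auto

lemma Phi_add: "Phi x (v+w) <= en (2*L) * (Phi x v + Phi x w)"
proof -
 have "v+w <= max v w + max v w" by (intro add_mono) auto
 also have "... = en 2 * max v w" by (simp flip: mult_2)
 finally have "Phi x (v+w) <= Phi x (en 2 * max v w)" by (rule Phi_mono)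
 also have "... <= en (L*2) * Phi x (max v w)" by (rule Phi_scale_up) simp
 also have "... <= en (2*L) * (Phi x v + Phi x w)"
  by (rule mult_mono) (auto simp: max_def mult.commute)
 finally show ?thesis .
qed

text \<open>Uniform upper type 1 makes \<open>phi x t / t\<close> quasi-decreasing.\<close>

lemma phi_sum_le:
 assumes "finite F" "!!j. j:F ==> t j >= 0"
 shows "phi x (sum t F) <= K*(SUM j:F. phi x (t j))"
proof (cases "sum t F = 0")
 case False
 hence pos: "sum t F > 0" using sum_nonneg[of F t] assms by force
 have "t j / sum t F * phi x (sum t F) <= K * phi x (t j)" if "j:F" for j
 proof (cases "t j = 0")
  case False
  hence "t j > 0" using assms that by force
  moreover have "t j <= sum t F" using that assms by (intro member_le_sum) auto
  ultimately have "phi x (sum t F) <= K*(sum t F / t j) * phi x (t j)"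
   using upper_type[of "t j" "sum t F / t j" x] by simp
  thus ?thesis using \<open>t j > 0\<close> pos by (simp add: field_simps)
 qed (simp add: phi_0)
 hence "(SUM j:F. t j / sum t F * phi x (sum t F)) <= (SUM j:F. K * phi x (t j))" by (rule sum_mono)
 moreover have "(SUM j:F. t j / sum t F * phi x (sum t F)) = phi x (sum t F)"
  using pos by (simp flip: sum_distrib_right sum_divide_distrib)
 ultimately show ?thesis by (simp add: sum_distrib_left)
qed (use assms K_ge_1 in "auto simp: phi_0 phi_nonneg intro!: mult_nonneg_nonneg sum_nonneg")

lemma Phi_suminf: "Phi x (\<Sum>j. v j) <= en L * (\<Sum>j. Phi x (v j))"
proof (cases "EX j. v j = top")
 case True
 then obtain j where "v j = top" by blast
 hence "Phi x (v j) = top" by (simp add: Phi_top)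
 hence "(\<Sum>j. Phi x (v j)) = top"
  using sum_le_suminf[of "%j. Phi x (v j)" "{j}"] by (simp add: top_unique)
 thus ?thesis using L_ge_1 by (simp add: ennreal_mult_top)
next
 case False
 define t where "t j = enn2real (v j)" for j
 have v: "v j = en (t j)" "t j >= 0" for j using False by (auto simp: t_def less_top[symmetric])
 show ?thesis unfolding Phi_def[of x "\<Sum>j. v j"]
 proof (rule SUP_least)
  fix r :: real assume r: "r:{r \<in> \<rat>. 0 < r}"
  show "(if en r < (\<Sum>j. v j) then en (phi x r) else 0) <= en L * (\<Sum>j. Phi x (v j))"
  proof (cases "en r < (\<Sum>j. v j)")
   case True
   then obtain n where "en r < (\<Sum>j<n. v j)" by (auto simp: suminf_eq_SUP less_SUP_iff)
   hence "r < (\<Sum>j<n. t j)" using r v by (simp add: sum_ennreal ennreal_less_iff)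
   hence "phi x r <= K*(\<Sum>j<n. phi x (t j))"
    using r v by (intro order_trans[OF phi_mono phi_sum_le]) auto
   hence "en (phi x r) <= en (K*(\<Sum>j<n. phi x (t j)))" by (rule ennreal_leI)
   also have "... = en K * (\<Sum>j<n. phi_ext phi x (v j))"
    using K_ge_1 v phi_nonneg by (simp add: ennreal_mult sum_nonneg phi_ext_def v(1) flip: sum_ennreal)
   also have "... <= en K * (\<Sum>j<n. en (2*K) * Phi x (v j))" by (intro mult_left_mono sum_mono phi_ext_le_Phi) auto
   also have "... = en L * (\<Sum>j<n. Phi x (v j))"
    using K_ge_1 by (simp add: L_def ennreal_mult mult_ac flip: sum_distrib_left)
   also have "... <= en L * (\<Sum>j. Phi x (v j))" by (intro mult_left_mono sum_le_suminf) auto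
   finally show ?thesis using True by simp
  qed simp
 qed
qed

lemma Phi_sum:
 assumes "finite F" shows "Phi x (SUM a:F. v a) <= en L * (SUM a:F. Phi x (v a))"
proof -
 obtain h where h: "bij_betw h {..<card F} F" using ex_bij_betw_nat_finite[OF assms] by (auto simp: atLeast0LessThan)
 have suminf: "(\<Sum>j. if j < card F then w (h j) else 0) = (SUM a:F. w a)" for w :: "_ => ennreal"
  by (subst suminf_finite[of "{..<card F}"]) (auto simp: sum.reindex_bij_betw[OF h])
 show ?thesis
  using Phi_suminf[of x "%j. if j < card F then v (h j) else 0"] suminf[of v] suminf[of "%a. Phi x (v a)"]
  by (simp add: if_distrib[of "Phi x"] cong: if_cong)
qed

definition Phi_int :: "(real^'n) set => real => ennreal" where
 "Phi_int E t = (NN x. Phi x (en t) * idr E x)"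

lemma phi_ext_ennreal: "t >= 0 ==> phi_ext phi x (en t) = en (phi x t)"
 by (simp add: phi_ext_def)

lemma Phi_int_le: "t >= 0 ==> Phi_int E t <= (NN x. en (phi x t) * idr E x)"
 unfolding Phi_int_def using Phi_le_phi_ext[of _ "en t"] phi_ext_ennreal[of t] by (intro nn_integral_mono mult_right_mono) auto

lemma le_Phi_int:
 assumes "t >= 0" and [measurable]: "E:sets lbg"
 shows "(NN x. en (phi x t) * idr E x) <= en (2*K) * Phi_int E t"
proof -
 have "(NN x. en (phi x t) * idr E x) <= (NN x. en (2*K) * (Phi x (en t) * idr E x))"
  using phi_ext_le_Phi[of _ "en t"] phi_ext_ennreal[OF assms(1)]
  by (intro nn_integral_mono) (auto split: split_indicator)
 also have "... = en (2*K) * Phi_int E t"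
  unfolding Phi_int_def by (intro nn_integral_cmult) measurable
 finally show ?thesis .
qed

lemma Phi_int_Muckenhoupt:
 assumes "r > 0" "t > 0" "E:sets lbg" "E <= ball c r"
 shows "en ((measure lbg E / measure lbg (ball c r)) powr q0) * Phi_int (ball c r) t <= en L * Phi_int E t"
proof -
 have "en ((measure lbg E / measure lbg (ball c r)) powr q0) * Phi_int (ball c r) t <= en ((measure lbg E / measure lbg (ball c r)) powr q0) * (NN x. en (phi x t) * idr (ball c r) x)"
  using assms by (intro mult_left_mono Phi_int_le) auto
 also have "... <= en K * (NN x. en (phi x t) * idr E x)" by (rule muckenhoupt[OF assms])
 also have "... <= en K * (en (2*K) * Phi_int E t)" using assms by (intro mult_left_mono le_Phi_int) auto
 also have "... = en L * Phi_int E t" using K_ge_1 by (simp add: L_def ennreal_mult mult_ac)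
 finally show ?thesis .
qed

lemma Phi_int_finite: "r > 0 ==> t > 0 ==> Phi_int (ball c r) t < \<infinity>"
 using Phi_int_le[of t "ball c r"] ball_finite[of r t c] by (auto intro: le_less_trans)

lemma Phi_int_mono: "E <= F ==> Phi_int E t <= Phi_int F t"
 unfolding Phi_int_def by (intro nn_integral_mono mult_left_mono) (auto split: split_indicator)

lemma Phi_int_doubling:
 assumes "r > 0" "t > 0"
 shows "Phi_int (ball c (2^j*r)) t <= en (L*2 powr (real CARD('n) * q0 * real j)) * Phi_int (ball c r) t"
proof -
 let ?R = "2^j*r" and ?d = "real CARD('n) * q0 * real j"
 have R: "?R > 0" and sub: "ball c r <= ball c ?R" using assms by (auto intro!: subset_ball)
 have "measure lbg (ball c r) / measure lbg (ball c ?R) = 1/(2^j)^CARD('n)"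
  using measure_ball_scale[of r "2^j" c] measure_ball_pos[OF assms(1), of c] assms by simp
 hence "(measure lbg (ball c r) / measure lbg (ball c ?R)) powr q0 = 1/2 powr ?d"
  by (simp add: powr_divide powr_realpow[symmetric] powr_powr powr_power mult_ac)
 hence "en (1/2 powr ?d) * Phi_int (ball c ?R) t <= en L * Phi_int (ball c r) t"
  using Phi_int_Muckenhoupt[OF R assms(2) _ sub] by simp
 hence "en (2 powr ?d) * (en (1/2 powr ?d) * Phi_int (ball c ?R) t) <= en (2 powr ?d) * (en L * Phi_int (ball c r) t)"
  by (intro mult_left_mono) auto
 moreover have "en (2 powr ?d) * (en (1/2 powr ?d) * Phi_int (ball c ?R) t) = Phi_int (ball c ?R) t"
  by (simp add: mult.assoc[symmetric] ennreal_mult[symmetric])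
 moreover have "en (2 powr ?d) * (en L * Phi_int (ball c r) t) = en (L*2 powr ?d) * Phi_int (ball c r) t"
  using L_ge_1 by (simp add: ennreal_mult mult_ac)
 ultimately show ?thesis by simp
qed

lemma Phi_int_pos:
 assumes "r > 0" "t > 0" shows "Phi_int (ball c r) t > 0"
proof (rule ccontr)
 assume "~Phi_int (ball c r) t > 0"
 hence "(NN x. Phi x (en t) * idr (ball c r) x) = 0" by (simp add: Phi_int_def)
 hence "AL x. Phi x (en t) * idr (ball c r) x = 0"
  by (subst (asm) nn_integral_0_iff_AE) auto
 hence "AL x. x~:ball c r"
  by eventually_elim (use assms(2) in "auto dest: Phi_eq_0 split: split_indicator_asm")
 hence "ball c r:null_sets lbg" by (simp add: AE_iff_null_sets)
 thus False using measure_ball_pos[OF assms(1), of c] by (simp add: null_sets_def measure_def)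
qed

lemma Phi_int_growth:
 assumes "r > 0" "t > 0"
 shows "en (1 + 1/(L*2 powr q0)) * Phi_int (ball c r) t <= Phi_int (ball c (2*r)) t"
proof -
 let ?B = "ball c (2*r)" and ?b = "ball c r" and ?th = "1/(L*2 powr q0)"
 have sub: "?b <= ?B" using assms(1) by (intro subset_ball) simp
 have meas: "measure lbg (?B-?b) = 2^CARD('n) * measure lbg ?b - measure lbg ?b"
  using measure_ball_scale[of r 2 c] assms(1) sub emeasure_lborel_ball_finite[of c "2*r"]
  by (subst measure_Diff) auto
 have "(2::real)^CARD('n) >= 2" using power_increasing[of 1 "CARD('n)" "2::real"] by (simp add: Suc_leI)
 hence "1/2 <= measure lbg (?B-?b) / measure lbg ?B"
  unfolding meas using measure_ball_scale[of r 2 c] measure_ball_pos[OF assms(1), of c] assms(1) by (simp add: field_simps)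
 hence "(1/2) powr q0 <= (measure lbg (?B-?b) / measure lbg ?B) powr q0"
  using q0_ge_1 by (intro powr_mono2) auto
 hence "en ((1/2) powr q0) * Phi_int ?B t <= en L * Phi_int (?B-?b) t"
  using assms by (intro order_trans[OF mult_right_mono[OF ennreal_leI] Phi_int_Muckenhoupt]) auto
 hence "en (1/L) * (en ((1/2) powr q0) * Phi_int ?B t) <= en (1/L) * (en L * Phi_int (?B-?b) t)"
  by (intro mult_left_mono) auto
 moreover have "en (1/L) * (en L * y) = y" "en (1/L) * (en ((1/2) powr q0) * y) = en ?th * y" for y
  using L_ge_1 by (simp_all add: mult.assoc[symmetric] ennreal_mult[symmetric] powr_divide)
 ultimately have "en ?th * Phi_int ?b t <= Phi_int (?B-?b) t"
  using mult_left_mono[OF Phi_int_mono[OF sub], of "en ?th"] order_trans by fastforce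
 hence "Phi_int ?b t + en ?th * Phi_int ?b t <= Phi_int ?b t + Phi_int (?B-?b) t" by (rule add_left_mono)
 also have "... = Phi_int (?b Un (?B-?b)) t"
  unfolding Phi_int_def by (rule nn_integral_disjoint_pair[symmetric]) auto
 also have "?b Un (?B-?b) = ?B" using sub by blast
 also have "Phi_int ?b t + en ?th * Phi_int ?b t = en (1+?th) * Phi_int ?b t"
  using L_ge_1 by (simp add: distrib_right)
 finally show ?thesis .
qed

lemma Phi_int_UNIV: assumes "t > 0" shows "Phi_int UNIV t = \<infinity>"
proof (rule ccontr)
 assume "Phi_int UNIV t ~= \<infinity>"
 then obtain b where b: "Phi_int UNIV t = en b" "b >= 0" by (cases "Phi_int UNIV t") auto
 let ?th = "1/(L*2 powr q0)" and ?I = "%j. Phi_int (ball (0::real^'n) (2^j)) t"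
 have ratio_pos: "?th > 0" using L_ge_1 by simp
 have grow: "en ((1+?th)^j) * ?I 0 <= ?I j" for j
 proof (induction j)
  case (Suc j)
  have "en ((1+?th)^Suc j) * ?I 0 = en (1+?th) * (en ((1+?th)^j) * ?I 0)"
   using ratio_pos by (simp add: ennreal_mult mult.assoc)
  also have "... <= en (1+?th) * ?I j" by (intro mult_left_mono Suc) auto
  also have "... <= ?I (Suc j)" using Phi_int_growth[of "2^j" t 0] assms by simp
  finally show ?case .
 qed simp
 obtain i0 where i0: "?I 0 = en i0" "i0 > 0"
  using Phi_int_pos[of 1 t 0] Phi_int_finite[of 1 t 0] assms by (cases "?I 0") auto
 obtain j where j: "b/i0 < (1+?th)^j" using real_arch_pow[of "1+?th" "b/i0"] ratio_pos by auto
 have "en ((1+?th)^j * i0) <= ?I j" using grow[of j] i0 ratio_pos by (simp add: ennreal_mult)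
 also have "?I j <= Phi_int UNIV t" by (rule Phi_int_mono) simp
 finally have "(1+?th)^j * i0 <= b" using b by (simp add: ennreal_le_iff)
 thus False using j i0 by (simp add: field_simps)
qed

definition decay :: "real => real^'n => real^'n => real" where
 "decay r c x = (r/(r + dist x c))^(CARD('n) + m_phi phi + 1)"

lemma decay_bounds: assumes "r > 0" shows "0 < decay r c x" "decay r c x <= 1"
proof -
 have "0 < r + dist x c" using assms by (simp add: add_pos_nonneg)
 hence ratio: "0 < r/(r + dist x c)" "r/(r + dist x c) <= 1" using assms by (auto simp: divide_le_eq_1)
 show "0 < decay r c x" unfolding decay_def by (rule zero_less_power[OF ratio(1)])
 show "decay r c x <= 1" unfolding decay_def by (rule power_le_one[OF less_imp_le[OF ratio(1)] ratio(2)])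
qed

lemma measurable_decay_powr [measurable]: "(%x. (r/(r + dist x (c::real^'n))) powr b):bml"
proof -
 have "(%x. (r/(r + dist x c)) powr b):borel_measurable borel" by measurable
 thus ?thesis by (intro measurable_completion) simp
qed

lemma Phi_decay_integral:
 "EX C>0. ALL c r t. r > 0 --> t > 0 --> modular (%x. en (t * decay r c x)) <= en C * Phi_int (ball c r) t"
proof -
 let ?N = "CARD('n) + m_phi phi + 1" and ?d = "real CARD('n) * q0"
 let ?b = "real ?N * p"
 define C where "C = 2 powr ?b/(1-2 powr (?d-?b))"
 have C: "C > 0" unfolding C_def using gap by (simp add: powr_less_one)
 have "modular (%x. en (t * decay r c x)) <= en (L*(C*L)) * Phi_int (ball c r) t"
  if r: "r > 0" and t: "t > 0" for c r t
 proof -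
  have "Phi x (en (t * decay r c x)) <= en L * (Phi x (en t) * en ((r/(r + dist x c)) powr ?b))" for x
  proof -
   have "Phi x (en (decay r c x) * en t) <= en (L * decay r c x powr p) * Phi x (en t)"
    using decay_bounds[OF r] by (intro Phi_scale_down) auto
   also have "decay r c x powr p = (r/(r + dist x c)) powr ?b"
    unfolding decay_def using r by (subst powr_realpow[symmetric]) (auto simp: powr_powr add_pos_nonneg)
   finally show ?thesis using L_ge_1 t decay_bounds[OF r, of c x] by (simp add: ennreal_mult mult_ac)
  qed
  hence "modular (%x. en (t * decay r c x)) <= (NN x. en L * (Phi x (en t) * en ((r/(r + dist x c)) powr ?b)))"
   by (intro nn_integral_mono)
  also have "... = en L * (NN x. Phi x (en t) * en ((r/(r + dist x c)) powr ?b))"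
   by (rule nn_integral_cmult) measurable
  also have "... <= en L * (en (C*L) * Phi_int (ball c r) t)"
   unfolding C_def using gap q0_ge_1 r L_ge_1 Phi_int_doubling[OF r t, unfolded Phi_int_def]
   by (intro mult_left_mono nn_integral_decay_le) (auto simp: Phi_int_def)
  also have "... = en (L*(C*L)) * Phi_int (ball c r) t" using L_ge_1 C by (simp add: ennreal_mult mult_ac)
  finally show ?thesis .
 qed
 moreover have "L*(C*L) > 0" using L_ge_1 C by simp
 ultimately show ?thesis by blast
qed

lemma Phi_dyadic_level_le:
 assumes t: "t > 0" and k0: "2 powi k0 <= t" and lam: "lam > 0" and k: "k <= k0"
 shows "Phi x (en (2 powi k/lam)) <= en L * en ((2 powr (- p))^nat (k0-k)) * Phi x (en t / en lam)"
proof -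
 let ?j = "real (nat (k0-k))"
 have powi: "(2::real) powi j = 2 powr of_int j" for j :: int by (simp add: powr_real_of_int')
 have "- ?j + of_int k0 = of_int k" using k by simp
 hence level: "2 powi k = 2 powr (- ?j)*2 powi k0" unfolding powi by (simp only: powr_add[symmetric])
 have "Phi x (en (2 powi k/lam)) = Phi x (en (2 powr (- ?j)) * en (2 powi k0/lam))"
  using lam by (simp add: level ennreal_mult[symmetric])
 also have "... <= en (L*(2 powr (- ?j)) powr p) * Phi x (en (2 powi k0/lam))"
  by (rule Phi_scale_down) (auto simp: powr_minus_divide intro!: ge_one_powr_ge_zero)
 also have "(2 powr (- ?j)) powr p = (2 powr (- p))^nat (k0-k)"
  by (simp add: powr_powr powr_realpow[symmetric] mult.commute)
 also have "Phi x (en (2 powi k0/lam)) <= Phi x (en t / en lam)"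
  using t k0 lam by (intro Phi_mono) (simp add: divide_ennreal ennreal_leI divide_right_mono)
 finally show ?thesis using L_ge_1 by (simp add: mult_left_mono ennreal_mult)
qed

lemma Phi_dyadic_sum:
 "EX C>0. ALL x v lam. lam > 0 --> dyadic_sum (%k. Phi x (en (2 powi k/lam))) v <= en C * Phi x (v / en lam)"
proof -
 let ?z = "2 powr (- p)"
 have z: "0 < ?z" "?z < 1" using p_pos by (auto simp: powr_less_one)
 define C where "C = L*(1/(1-?z))"
 have C: "C > 0" using z L_ge_1 by (simp add: C_def)
 have "dyadic_sum (%k. Phi x (en (2 powi k/lam))) v <= en C * Phi x (v / en lam)"
  if lam: "lam > 0" for x v and lam :: real
 proof -
  consider "v = 0" | "v = \<infinity>" | t where "v = en t" "t > 0" by (cases v) (auto simp: less_le)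
  thus ?thesis
  proof cases
   assume "v = \<infinity>"
   hence "v / en lam = \<infinity>" using lam by (simp add: ennreal_top_divide)
   thus ?thesis using C by (simp add: Phi_top ennreal_mult_top)
  next
   fix t assume t: "v = en t" "t > 0"
   obtain k0 :: int where k0: "2 powi k0 <= t" "t < 2*2 powi k0" using dyadic_level_exists[OF t(2)] by blast
   have "k <= k0" if "2 powi k < t" for k :: int
   proof (rule ccontr)
    assume "~k <= k0"
    hence "(2::real) powi (k0+1) <= 2 powi k" by (intro power_int_increasing) auto
    thus False using that k0 by (simp add: power_int_add_1')
   qed
   hence "dyadic_sum (%k. Phi x (en (2 powi k/lam))) v <= (\<integral>\<^sup>+k. en L * Phi x (v / en lam) * (en (?z^nat (k0-k)) * idr {..k0} k) \<partial>count_space UNIV)"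
    using Phi_dyadic_level_le[OF t(2) k0(1) lam] t
    by (intro nn_integral_mono) (auto simp: ennreal_less_iff mult_ac split: split_indicator)
   also have "... = en L * Phi x (v / en lam) * en (1/(1-?z))"
    by (subst nn_integral_cmult) (auto simp: nn_integral_geometric_int[OF z])
   also have "... = en L * en (1/(1-?z)) * Phi x (v / en lam)" by (simp add: mult_ac)
   also have "en L * en (1/(1-?z)) = en C" using ennreal_mult[of L "1/(1-?z)"] L_ge_1 z by (simp add: C_def)
   finally show ?thesis .
  qed simp
 qed
 thus ?thesis using C by blast
qed

end

subsection \<open>Density of test functions and representation of bounded functionals\<close>

lemma continuous_lebesgue_measurable:
 fixes f :: "real^'n::finite => 'b::topological_space"
 shows "continuous_on UNIV f ==> f:bml"
 by (intro measurable_completion) (simp add: borel_measurable_continuous_onI)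

lemma test_fn_measurable: "test_fn f ==> f:bml"
 by (intro continuous_lebesgue_measurable smooth_continuous test_fn_smooth)

lemma integrable_indicator_cball: "integrable lbg (idr (cball (c::real^'n::finite) r)::_ => real)"
 using emeasure_lborel_cball_finite[of c r] by (auto simp: integrable_indicator_iff)

lemma integrable_bounded_support:
 fixes f :: "real^'n::finite => 'b::{banach, second_countable_topology}"
 assumes "f:bml" "!!x. norm (f x) <= A" "!!x. x~:cball c r ==> f x = 0"
 shows "integrable lbg f"
proof (rule Bochner_Integration.integrable_bound)
 show "integrable lbg (%x. A * idr (cball c r) x)"
  by (intro integrable_mult_right integrable_indicator_cball)
 have "norm (f x) <= norm (A * idr (cball c r) x)" for x
  using order_trans[OF norm_ge_zero assms(2)[of x]] assms(2,3)[of x] by (auto split: split_indicator)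
 thus "AL x. norm (f x) <= norm (A * idr (cball c r) x)" by simp
qed (rule assms)

definition bsupp :: "'n::finite fn => bool" where
 "bsupp f \<longleftrightarrow> f:bml & (EX A R. ALL x. cmod (f x) <= A & (x~:cball 0 R --> f x = 0))"

lemma bsuppE:
 assumes "bsupp f" obtains A R where "A >= 0" "f:bml" "!!x. cmod (f x) <= A" "!!x. x~:cball 0 R ==> f x = 0"
 using assms unfolding bsupp_def by (metis norm_ge_zero order_trans)

lemma bsupp_lincomb:
 assumes "bsupp f" "bsupp g" shows "bsupp (%x. a * f x + b * g x)"
proof -
 obtain A R where f: "A >= 0" "f:bml" "!!x. cmod (f x) <= A" "!!x. x~:cball 0 R ==> f x = 0" using bsuppE[OF assms(1)] by metis
 obtain B S where g: "B >= 0" "g:bml" "!!x. cmod (g x) <= B" "!!x. x~:cball 0 S ==> g x = 0" using bsuppE[OF assms(2)] by metis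
 have "cmod (a * f x + b * g x) <= cmod a * A + cmod b * B" for x
  by (rule order_trans[OF norm_triangle_ineq]) (unfold norm_mult, intro add_mono mult_left_mono f g norm_ge_zero)
 moreover have "a * f x + b * g x = 0" if "x~:cball 0 (max R S)" for x using that f(4)[of x] g(4)[of x] by simp
 moreover have "(%x. a * f x + b * g x):bml" using f(2) g(2) by measurable
 ultimately show ?thesis unfolding bsupp_def by blast
qed

lemma bsupp_diff: "bsupp f ==> bsupp g ==> bsupp (%x. f x - g x)"
 using bsupp_lincomb[of f g 1 "-1"] by simp

lemma bsupp_L2: assumes "bsupp f" shows "L2 f"
proof -
 obtain A R where f: "f:bml" "!!x. cmod (f x) <= A" "!!x. x~:cball 0 R ==> f x = 0" using bsuppE[OF assms] by metis
 have "integrable lbg (%x. (cmod (f x))^2)"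
  by (rule integrable_bounded_support[where A = "A^2" and c = 0 and r = R]) (use f in "auto intro: power_mono")
 thus ?thesis using f(1) by (simp add: L2_def)
qed

lemma bsupp_mult_integrable:
 assumes "bsupp f" "continuous_on UNIV psi" shows "integrable lbg (%x. f x * psi x)"
proof -
 obtain A R where f: "A >= 0" "f:bml" "!!x. cmod (f x) <= A" "!!x. x~:cball 0 R ==> f x = 0" using bsuppE[OF assms(1)] by metis
 have "compact (psi ` cball 0 R)" by (intro compact_continuous_image continuous_on_subset[OF assms(2)]) auto
 then obtain B where B: "B > 0" "!!z. z:cball 0 R ==> cmod (psi z) <= B" using compact_imp_bounded bounded_pos by (metis imageI)
 show ?thesis
 proof (rule integrable_bounded_support[where A = "A*B" and c = 0 and r = R])
  show "norm (f x * psi x) <= A*B" for x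
   using f B by (cases "x:cball 0 R") (auto simp: norm_mult intro!: mult_mono)
  show "(%x. f x * psi x):bml" using f(2) continuous_lebesgue_measurable[OF assms(2)] by measurable
 qed (use f in auto)
qed

lemma bsupp_integrable: "bsupp f ==> integrable lbg f"
 using bsupp_mult_integrable[of f "%x. 1"] by simp

lemma bsupp_indicator: "E:sets lbg ==> E <= cball 0 R ==> bsupp (%x. idr E x)"
 unfolding bsupp_def by (intro conjI, simp, rule exI[of _ 1], rule exI[of _ R]) (auto split: split_indicator)

lemma test_fn_bsupp: "test_fn f ==> bsupp f"
 unfolding bsupp_def using test_fn_support[of f] test_fn_bounded[of f] test_fn_measurable by metis

lemma test_fn_integrable: "test_fn f ==> integrable lbg f"
 by (intro bsupp_integrable test_fn_bsupp)

definition dilated_cutoff :: "real => 'n::finite fn" where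
 "dilated_cutoff R x = cutoff (0 + (1/R) *! x)"

lemma dilated_cutoff_smooth: "smooth (dilated_cutoff R)"
 unfolding dilated_cutoff_def[abs_def] by (intro smooth_affine cutoff_smooth)

lemma dilated_cutoff_eq_1: "R > 0 ==> x:cball 0 R ==> dilated_cutoff R x = 1"
 unfolding dilated_cutoff_def by (intro cutoff_eq_1_unit_ball) simp

lemma dilated_cutoff_eq_0:
 fixes x :: "real^'n::finite"
 shows "R > 0 ==> x~:cball 0 (2 * real CARD('n) * R) ==> dilated_cutoff R x = 0"
 unfolding dilated_cutoff_def by (intro cutoff_eq_0) (simp add: field_simps)

lemma dilated_cutoff_test_fn: "R > 0 ==> test_fn (dilated_cutoff R)"
 by (rule test_fnI[OF dilated_cutoff_smooth dilated_cutoff_eq_0])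

lemma smooth_real_polynomial_function:
 fixes p :: "real^'n::finite => real"
 assumes "real_polynomial_function p" shows "smooth (%x. cr (p x))"
 using assms
proof (induction rule: real_polynomial_function.induct)
 case (linear f)
 note lin = bounded_linear.linear[OF linear]
 have "f (SUM i:UNIV. x $ i *! axis i 1) = (SUM i:UNIV. x $ i * f (axis i 1))" for x
  by (simp add: linear_sum[OF lin] linear_cmul[OF lin])
 hence expansion: "f x = (SUM i:UNIV. x $ i * f (axis i 1))" for x
  unfolding scalar_mult_eq_scaleR[symmetric] basis_expansion .
 have "(%x. cr (f x)) = (%x. SUM i:UNIV. cr (f (axis i 1)) * cr (x $ i))"
  by (rule ext, subst expansion) (simp add: mult.commute)
 thus ?case by (simp only: smooth_sum smooth_cmult smooth_coordinate)
qed (auto intro: smooth_const smooth_add smooth_mult)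

lemma test_fn_uniform_approx:
 fixes g :: "'n::finite fn"
 assumes g: "continuous_on UNIV g" "!!x. x~:cball 0 R ==> g x = 0" and R: "R > 0" and e: "e > 0"
 shows "EX psi. test_fn psi & (ALL x. cmod (psi x - g x) <= e) & (ALL x. x~:cball 0 (2 * real CARD('n) * R) --> psi x = 0)"
proof -
 let ?S = "cball (0::real^'n) (2 * real CARD('n) * R)" and ?kappa = "dilated_cutoff R"
 obtain D where D: "D >= 0" "!!x::real^'n. cmod (?kappa x) <= D" using test_fn_bounded[OF dilated_cutoff_test_fn[OF R]] by blast
 define d where "d = e/(D+1)/2"
 have "D+1 > 0" using D(1) by simp
 moreover have "d+d = e/(D+1)" unfolding d_def by (rule field_sum_of_halves)
 ultimately have d: "d > 0" "(D+1)*(d+d) = e" using e by (simp add: d_def, simp only:, simp)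
 obtain p where p: "real_polynomial_function p" "!!x. x:?S ==> \<bar>Re (g x) - p x\<bar> < d"
  by (rule Stone_Weierstrass_real_polynomial_function[of ?S "%x. Re (g x)", OF _ _ d(1)])
  (auto intro!: continuous_intros continuous_on_subset[OF g(1)])
 obtain q where q: "real_polynomial_function q" "!!x. x:?S ==> \<bar>Im (g x) - q x\<bar> < d"
  by (rule Stone_Weierstrass_real_polynomial_function[of ?S "%x. Im (g x)", OF _ _ d(1)])
  (auto intro!: continuous_intros continuous_on_subset[OF g(1)])
 let ?P = "%x. cr (p x) + \<i> * cr (q x)"
 have "cmod (?kappa x * ?P x - g x) <= e" for x
 proof (cases "x:?S")
  case True
  have "g x = ?kappa x * g x" using g(2)[of x] dilated_cutoff_eq_1[OF R, of x] by (cases "x:cball 0 R") auto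
  hence "cmod (?kappa x * ?P x - g x) = cmod (?kappa x) * cmod (?P x - g x)"
   by (metis norm_mult right_diff_distrib)
  also have "... <= (D+1)*(d+d)"
  proof (rule mult_mono)
   have "cmod (?P x - g x) <= \<bar>Re (?P x - g x)\<bar> + \<bar>Im (?P x - g x)\<bar>" by (rule cmod_le)
   also have "... <= d+d" using p(2)[OF True] q(2)[OF True] by (intro add_mono) (auto simp: abs_minus_commute less_imp_le)
   finally show "cmod (?P x - g x) <= d+d" .
  qed (use D(1) D(2)[of x] in auto)
  finally show ?thesis using d(2) by simp
 next
  case False
  moreover have "R <= 2 * real CARD('n) * R" using R mult_right_mono[OF CARD_ge_1[where 'n = 'n], of R] by linarith
  ultimately show ?thesis using dilated_cutoff_eq_0[OF R False] g(2)[of x] e by auto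
 qed
 moreover have "test_fn (%x. ?kappa x * ?P x)"
  by (intro test_fn_mult_right dilated_cutoff_test_fn R smooth_add smooth_cmult smooth_real_polynomial_function p q)
 moreover have "?kappa x * ?P x = 0" if "x~:?S" for x using dilated_cutoff_eq_0[OF R that] by simp
 ultimately show ?thesis by blast
qed

lemma continuous_bounded_approx:
 fixes g :: "'n::finite fn"
 assumes g: "g:bml" "!!x. cmod (g x) <= 1" "!!x. x~:cball 0 R ==> g x = 0" and R: "R > 0"
 shows "EX H D. (ALL k::nat. continuous_on UNIV (H k) & (ALL x. cmod (H k x) <= D & (x~:cball 0 (2 * real CARD('n) * R) --> H k x = 0))) & (AL x. (%k. H k x) ~~> g x)"
proof -
 let ?kappa = "dilated_cutoff R"
 have "g measurable_on UNIV"
  using g(1) by (simp add: measurable_on_iff_borel_measurable)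
 then obtain N G where N: "negligible N" and G: "!!k::nat. continuous_on UNIV (G k)" "!!x. x~:N ==> (%k. G k x) ~~> g x"
  unfolding measurable_on_def by auto
 obtain D where D: "D >= 0" "!!x::real^'n. cmod (?kappa x) <= D" using test_fn_bounded[OF dilated_cutoff_test_fn[OF R]] by blast
 define H where "H k x = (G k x / of_real (max 1 (cmod (G k x)))) * ?kappa x" for k x
 have H_cont: "continuous_on UNIV (H k)" for k
  unfolding H_def using G(1) smooth_continuous[OF dilated_cutoff_smooth] by (intro continuous_intros) auto
 have H_support: "H k x = 0" if "x~:cball 0 (2 * real CARD('n) * R)" for k x by (simp add: H_def dilated_cutoff_eq_0[OF R that])
 have H_bound: "cmod (H k x) <= D" for k x
 proof -
  have "cmod (G k x / of_real (max 1 (cmod (G k x)))) <= 1" by (simp add: norm_divide max_def divide_le_eq)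
  from mult_mono[OF this D(2)[of x]] show ?thesis unfolding H_def norm_mult by simp
 qed
 have H_lim: "(%k. H k x) ~~> g x" if "x~:N" for x
 proof -
  have "(%k. H k x) ~~> (g x / of_real (max 1 (cmod (g x)))) * ?kappa x"
   unfolding H_def by (intro tendsto_intros G(2) that tendsto_max) auto
  moreover have "(g x / of_real (max 1 (cmod (g x)))) * ?kappa x = g x"
   using g(2)[of x] g(3)[of x] dilated_cutoff_eq_1[OF R, of x] by (cases "x:cball 0 R") (auto simp: max_def)
  ultimately show ?thesis by simp
 qed
 hence "AL x. (%k. H k x) ~~> g x" using N by (intro AE_I'[where N = N]) (auto simp: negligible_iff_null_sets)
 thus ?thesis using H_cont H_bound H_support by (intro exI[of _ H] exI[of _ D]) blast
qed

lemma test_fn_dense: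
 fixes g :: "'n::finite fn"
 assumes g: "g:bml" "!!x. cmod (g x) <= 1" "!!x. x~:cball 0 R ==> g x = 0" and R: "R > 0"
 obtains psi C S where "!!k::nat. test_fn (psi k)" "!!k x. cmod (psi k x) <= C" "!!k x. x~:cball 0 S ==> psi k x = 0"
 "AL x. (%k. psi k x) ~~> g x"
proof -
 let ?R = "2 * real CARD('n) * R"
 obtain H D where H: "!!k::nat. continuous_on UNIV (H k)" "!!k x. cmod (H k x) <= D" "!!k x. x~:cball 0 ?R ==> H k x = 0" "AL x. (%k. H k x) ~~> g x"
  using continuous_bounded_approx[OF g R] by blast
 have "?R > 0" using R by simp
 hence "ALL k. EX psi. test_fn psi & (ALL x. cmod (psi x - H k x) <= inverse (real (Suc k))) & (ALL x. x~:cball 0 (2 * real CARD('n) * ?R) --> psi x = 0)"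
  by (intro allI test_fn_uniform_approx[OF H(1,3)]) auto
 then obtain psi where psi: "!!k. test_fn (psi k)" "!!k x. cmod (psi k x - H k x) <= inverse (real (Suc k))"
  "!!k x. x~:cball 0 (2 * real CARD('n) * ?R) ==> psi k x = 0" by metis
 have "cmod (psi k x) <= D+1" for k x
 proof -
  have "inverse (real (Suc k)) <= 1" by (simp add: field_simps)
  thus ?thesis using psi(2)[of k x] H(2)[of k x] norm_triangle_sub[of "psi k x" "H k x"] by linarith
 qed
 moreover have "AL x. (%k. psi k x) ~~> g x" using H(4)
 proof eventually_elim
  case (elim x)
  have "(%k. psi k x - H k x) ~~> 0"
   by (rule Lim_null_comparison[OF _ LIMSEQ_inverse_real_of_nat]) (rule always_eventually, use psi(2) in blast)
  from tendsto_add[OF this elim] show ?case by simp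
 qed
 ultimately show ?thesis using that psi(1,3) by blast
qed

lemma test_fn_L1_dense:
 fixes g :: "'n::finite fn"
 assumes "bsupp g" "e > 0"
 shows "EX psi. test_fn psi & (LI x. cmod (g x - psi x)) < e"
proof -
 obtain A R where A: "A >= 0" "g:bml" "!!x. cmod (g x) <= A" "!!x. x~:cball 0 R ==> g x = 0" using bsuppE[OF assms(1)] by metis
 let ?g = "%x. g x / of_real (A+1)"
 have "cmod (g x) <= A+1" for x using A(3)[of x] by simp
 hence g: "?g:bml" "!!x. cmod (?g x) <= 1" "!!x. x~:cball 0 (max R 1) ==> ?g x = 0" "max R 1 > 0"
  using A by (auto simp: norm_divide divide_le_eq)
 obtain psi C S where psi: "!!k::nat. test_fn (psi k)" "!!k x. cmod (psi k x) <= C" "!!k x. x~:cball 0 S ==> psi k x = 0"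
  "AL x. (%k. psi k x) ~~> ?g x" using test_fn_dense[OF g] by blast
 let ?ps = "%k x. of_real (A+1) * psi k x"
 have [measurable]: "g:bml" "psi k:bml" for k using A psi(1) by (auto intro: test_fn_measurable)
 have "(%k. (LI x. cmod (g x - ?ps k x))) ~~> (LI x::real^'n. 0)"
 proof (rule integral_dominated_convergence[where w = "%x. cmod (g x) + (A+1)*C * idr (cball 0 S) x"])
  show "AL x. (%k. cmod (g x - ?ps k x)) ~~> 0"
   using psi(4)
  proof eventually_elim
   case (elim x)
   have "(%k. cmod (g x - ?ps k x)) ~~> cmod (g x - of_real (A+1) * ?g x)" by (intro tendsto_intros elim)
   thus ?case using A(1) by (simp add: add_nonneg_eq_0_iff flip: of_real_add)
  qed
  show "integrable lbg (%x. cmod (g x) + (A+1)*C * idr (cball 0 S) x)"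
   by (intro Bochner_Integration.integrable_add integrable_mult_right integrable_indicator_cball integrable_norm bsupp_integrable assms)
  have "cmod (g x - ?ps k x) <= cmod (g x) + (A+1)*C * idr (cball 0 S) x" for k x
  proof -
   have "cmod (?ps k x) <= (A+1)*C * idr (cball 0 S) x"
    using A(1) psi(2)[of k x] psi(3)[of x k] by (auto simp: norm_mult simp flip: of_real_add intro: mult_left_mono split: split_indicator)
   thus ?thesis using norm_triangle_ineq4[of "g x" "?ps k x"] by linarith
  qed
  thus "AL x. norm (cmod (g x - ?ps k x)) <= cmod (g x) + (A+1)*C * idr (cball 0 S) x" for k by simp
 qed measurable
 from order_tendstoD(2)[OF this[simplified] assms(2)]
 obtain k where "(LI x. cmod (g x - ?ps k x)) < e" by (auto simp: eventually_sequentially)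
 thus ?thesis using test_fn_cmult[OF psi(1)] by blast
qed

lemma test_fn_separating:
 fixes h :: "'n::finite fn"
 assumes h: "h:bml" "!!R. integrable lbg (%x. idr (cball 0 R) x *! h x)"
 and zero: "!!psi. test_fn psi ==> (LI x. h x * psi x) = 0"
 shows "AL x. h x = 0"
proof -
 note [measurable] = h(1)
 have [measurable]: "(%x. cnj (h x)):bml"
  by (rule measurable_compose[OF h(1) borel_measurable_continuous_onI]) (intro continuous_intros)
 have local: "AL x. x:cball 0 (real (Suc R)) --> h x = 0" for R
 proof -
  let ?B = "cball (0::real^'n) (real (Suc R))"
  define g where "g x = idr ?B x *! (cnj (h x) / of_real (cmod (h x)))" for x
  have [measurable]: "g:bml" unfolding g_def by measurable
  obtain psi C S where psi: "!!k::nat. test_fn (psi k)" "!!k x. cmod (psi k x) <= C" "!!k x. x~:cball 0 S ==> psi k x = 0"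
   "AL x. (%k. psi k x) ~~> g x"
   by (rule test_fn_dense[of g "real (Suc R)"]) (auto simp: g_def norm_divide split: split_indicator)
  note [measurable] = test_fn_measurable[OF psi(1)]
  have "C >= 0" using psi(2)[of 0 0] norm_ge_zero order_trans by blast
  have "(%k. (LI x. h x * psi k x)) ~~> (LI x. h x * g x)"
  proof (rule integral_dominated_convergence[where w = "%x. norm (idr (cball 0 S) x *! h x) * C"])
   show "integrable lbg (%x. norm (idr (cball 0 S) x *! h x) * C)"
    by (intro integrable_mult_left integrable_norm h(2))
   show "AL x. (%k. h x * psi k x) ~~> h x * g x" using psi(4) by eventually_elim (intro tendsto_intros)
   show "AL x. norm (h x * psi k x) <= norm (idr (cball 0 S) x *! h x) * C" for k
    using psi(2,3) \<open>C >= 0\<close> by (intro AE_I2) (auto simp: norm_mult mult_left_mono split: split_indicator)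
  qed auto
  hence "(LI x. h x * g x) = 0" using zero[OF psi(1)] by (simp add: LIMSEQ_const_iff)
  moreover have "h x * g x = cr (idr ?B x * cmod (h x))" for x
   by (auto simp: g_def complex_norm_square[symmetric] power2_eq_square mult.commute split: split_indicator)
  ultimately have "(LI x. idr ?B x * cmod (h x)) = 0" by (simp only: integral_complex_of_real of_real_eq_0_iff)
  moreover have "integrable lbg (%x. idr ?B x * cmod (h x))" using integrable_norm[OF h(2)[of "real (Suc R)"]] by simp
  ultimately have "AL x. idr ?B x * cmod (h x) = 0" by (subst (asm) integral_nonneg_eq_0_iff_AE) auto
  thus ?thesis by eventually_elim (auto split: split_indicator_asm)
 qed
 hence "AL x. ALL R. x:cball 0 (real (Suc R)) --> h x = 0" by (simp only: AE_all_countable) blast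
 thus ?thesis
 proof eventually_elim
  case (elim x)
  obtain R where "norm x <= real R" using real_arch_simple by blast
  thus ?case using elim[rule_format, of R] by simp
 qed
qed

context sigma_finite_measure begin

context
 fixes nu :: "'a set => real" and C :: real and B :: "'a set"
 assumes nonneg: "!!E. E:sets M ==> nu E >= 0"
 and add: "!!E F. E:sets M ==> F:sets M ==> E Int F = {} ==> nu (E Un F) = nu E + nu F"
 and bound: "!!E. E:sets M ==> nu E <= C * measure M (E Int B)" and B: "B:fmeasurable M"
begin

lemma set_function_empty: "nu {} = 0"
 using add[of "{}" "{}"] by simp

lemma set_function_countably_additive: "countably_additive (sets M) (%E. en (nu E))"
proof (rule sets.empty_continuous_imp_countably_additive)
 show "positive (sets M) (%E. en (nu E))" using set_function_empty by (simp add: positive_def)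
 show "additive (sets M) (%E. en (nu E))" using add nonneg by (auto simp: additive_def simp flip: ennreal_plus)
 fix E :: "nat => 'a set" assume E: "range E <= sets M" "decseq E" "\<Inter>(range E)={}"
 have E_sets: "E i:sets M" for i using E(1) by blast
 have meas: "E i Int B:fmeasurable M" for i using B E_sets[of i] by (metis Int_commute fmeasurable_Int_fmeasurable)
 have "(%i. measure M (E i Int B)) ~~> measure M (\<Inter>i. E i Int B)"
  using E(2) fmeasurableD[OF meas] fmeasurableD2[OF meas] by (intro Lim_measure_decseq) (auto simp: decseq_def)
 hence limit: "(%i. C * measure M (E i Int B)) ~~> C*0"
  using E(3) by (intro tendsto_intros) (simp flip: INF_inf_const2)
 have "(%i. nu (E i)) ~~> 0"
  by (rule tendsto_sandwich[OF _ _ tendsto_const limit[simplified]]) (auto intro!: always_eventually nonneg bound E_sets)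
 thus "(%i. en (nu (E i))) ~~> 0" using tendsto_ennrealI by fastforce
qed simp

lemma nonneg_set_function_density:
 "EX f. f:borel_measurable M & (ALL E:sets M. (\<integral>\<^sup>+x. f x * idr E x \<partial>M) = en (nu E))"
proof -
 define N where "N = measure_of (space M) (sets M) (%E. en (nu E))"
 have sets_N: "sets N = sets M" by (simp add: N_def)
 have emeasure_N: "emeasure N E = en (nu E)" if "E:sets M" for E
  unfolding N_def using that set_function_empty set_function_countably_additive sets.sigma_algebra_axioms
  by (intro emeasure_measure_of_sigma) (auto simp: positive_def)
 have "absolutely_continuous M N"
  unfolding absolutely_continuous_def
 proof
  fix Z assume Z: "Z:null_sets M"
  hence "measure M (Z Int B) = 0" using B by (intro measure_eq_0_null_sets null_set_Int2) (auto simp: fmeasurable_def)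
  hence "nu Z = 0" using bound[of Z] nonneg[of Z] Z by (auto simp: null_sets_def)
  thus "Z:null_sets N" using Z emeasure_N[of Z] by (auto simp: null_sets_def sets_N)
 qed
 then obtain f where "f:borel_measurable M" "density M f = N" using Radon_Nikodym[OF _ sets_N] by blast
 thus ?thesis using emeasure_density[of f M] emeasure_N by (intro exI[of _ f]) auto
qed

lemma nonneg_set_function_integral:
 "EX f. ALL E:sets M. integrable M (%x. idr E x * f x) & (\<integral>x. idr E x * f x \<partial>M) = nu E"
proof -
 obtain f where f [measurable]: "f:borel_measurable M" and f_int: "!!E. E:sets M ==> (\<integral>\<^sup>+x. f x * idr E x \<partial>M) = en (nu E)"
  using nonneg_set_function_density by blast
 have "(\<integral>\<^sup>+x. f x \<partial>M) = (\<integral>\<^sup>+x. f x * idr (space M) x \<partial>M)" by (rule nn_integral_cong) simp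
 hence finite: "AE x in M. f x ~= top" using f_int[of "space M"] nn_integral_PInf_AE[OF f] by simp
 have "integrable M (%x. idr E x * enn2real (f x)) & (\<integral>x. idr E x * enn2real (f x) \<partial>M) = nu E" if [measurable]: "E:sets M" for E
 proof -
  have "(\<integral>\<^sup>+x. en (idr E x * enn2real (f x)) \<partial>M) = (\<integral>\<^sup>+x. f x * idr E x \<partial>M)"
   using finite by (intro nn_integral_cong_AE, eventually_elim) (auto simp: less_top[symmetric] split: split_indicator)
  hence "(\<integral>\<^sup>+x. en (idr E x * enn2real (f x)) \<partial>M) = en (nu E)" by (simp add: f_int)
  thus ?thesis using nonneg[OF that] by (auto intro!: integrableI_nn_integral_finite[where x = "nu E"] simp: integral_eq_nn_integral)
 qed
 thus ?thesis by (intro exI[of _ "%x. enn2real (f x)"]) blast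
qed

end

lemma set_function_density:
 assumes add: "!!E F. E:sets M ==> F:sets M ==> E Int F = {} ==> w (E Un F) = w E + (w F::real)"
 and bound: "!!E. E:sets M ==> \<bar>w E\<bar> <= A * measure M (E Int B)" and B: "B:fmeasurable M"
 shows "EX h. integrable M h & (ALL E:sets M. (\<integral>x. idr E x * h x \<partial>M) = w E)"
proof -
 have meas: "E Int B:fmeasurable M" if "E:sets M" for E
  using B that by (metis Int_commute fmeasurable_Int_fmeasurable)
 define nu where "nu E = A * measure M (E Int B) + w E" for E
 have "EX f. ALL E:sets M. integrable M (%x. idr E x * f x) & (\<integral>x. idr E x * f x \<partial>M) = nu E"
 proof (rule nonneg_set_function_integral[OF _ _ _ B])
  show "nu (E Un F) = nu E + nu F" if "E:sets M" "F:sets M" "E Int F = {}" for E F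
  proof -
   have "(E Un F) Int B = (E Int B) Un (F Int B)" "(E Int B) Int (F Int B) = {}" using that(3) by blast+
   thus ?thesis
    using measure_Un3[OF meas[OF that(1)] meas[OF that(2)]] by (simp add: nu_def add[OF that] algebra_simps)
  qed
  show "nu E >= 0" "nu E <= 2*A * measure M (E Int B)" if "E:sets M" for E using bound[OF that] by (auto simp: nu_def abs_le_iff)
 qed
 then obtain f where f: "!!E. E:sets M ==> integrable M (%x. idr E x * f x)" "!!E. E:sets M ==> (\<integral>x. idr E x * f x \<partial>M) = nu E" by blast
 have indicator: "integrable M (%x. idr E x * (A * idr B x))" "(\<integral>x. idr E x * (A * idr B x) \<partial>M) = A * measure M (E Int B)"
  if "E:sets M" for E
  using fmeasurableD[OF meas[OF that]] fmeasurableD2[OF meas[OF that]]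
  by (simp_all add: mult.left_commute[of _ A] less_top flip: indicator_inter_arith)
 define h where "h x = f x - A * idr B x" for x
 have "integrable M (%x. idr (space M) x * h x)"
  using Bochner_Integration.integrable_diff[OF f(1) indicator(1), of "space M" "space M"] by (simp add: h_def right_diff_distrib)
 hence "integrable M h" by (rule Bochner_Integration.integrable_cong[THEN iffD1, rotated 2]) auto
 moreover have "(\<integral>x. idr E x * h x \<partial>M) = w E" if "E:sets M" for E
  unfolding h_def right_diff_distrib using f[OF that] indicator[OF that] by (simp add: nu_def)
 ultimately show ?thesis by blast
qed

end

definition linear_on_tests :: "('n::finite fn => complex) => bool" where
 "linear_on_tests u \<longleftrightarrow> (ALL f g. test_fn f --> test_fn g --> u (%x. f x + g x) = u f + u g) & (ALL c f. test_fn f --> u (%x. c * f x) = c * u f)"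

lemma linear_on_tests_add: "linear_on_tests u ==> test_fn f ==> test_fn g ==> u (%x. f x + g x) = u f + u g"
 and linear_on_tests_cmult: "linear_on_tests u ==> test_fn f ==> u (%x. c * f x) = c * u f"
 by (auto simp: linear_on_tests_def)

lemma linear_on_tests_zero: "linear_on_tests u ==> u (%x. 0) = 0"
 using linear_on_tests_cmult[of u "%x. 0" 0] test_fn_zero by simp

lemma linear_on_tests_diff: "linear_on_tests u ==> test_fn f ==> test_fn g ==> u (%x. f x - g x) = u f - u g"
 using linear_on_tests_add[of u f "%x. (-1) * g x"] linear_on_tests_cmult[of u g "-1"] test_fn_cmult[of g "-1"] by simp

lemma linear_on_tests_sum:
 "linear_on_tests u ==> (!!a. a:S ==> test_fn (f a)) ==> u (%x. SUM a:S. f a x) = (SUM a:S. u (f a))"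
proof (induction S rule: infinite_finite_induct)
 case (insert a S)
 thus ?case using linear_on_tests_add[of u "f a" "%x. SUM a:S. f a x"] test_fn_sum[of S f] by simp
qed (auto simp: linear_on_tests_zero)

locale bounded_test_functional =
 fixes v :: "'n::finite fn => complex" and A R :: real and c :: "real^'n"
 assumes linear: "linear_on_tests v" and A_nonneg: "A >= 0"
 and bound: "!!psi. test_fn psi ==> cmod (v psi) <= A*(LI x. idr (cball c R) x * cmod (psi x))"
begin

definition N :: "'n fn => real" where
 "N f = (LI x. idr (cball c R) x * cmod (f x))"

lemma N_integrable: "bsupp f ==> integrable lbg (%x. idr (cball c R) x * cmod (f x))"
 using integrable_mult_indicator[of "cball c R" lebesgue "%x. cmod (f x)"] bsupp_integrable[of f] by simp

lemma N_lincomb: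
 assumes "bsupp f" "bsupp g" shows "N (%x. a * f x + b * g x) <= cmod a * N f + cmod b * N g"
proof -
 have "N (%x. a * f x + b * g x) <= (LI x. cmod a * (idr (cball c R) x * cmod (f x)) + cmod b * (idr (cball c R) x * cmod (g x)))"
  unfolding N_def using assms N_integrable bsupp_lincomb[OF assms]
  by (intro integral_mono) (auto simp: norm_mult split: split_indicator intro!: norm_triangle_le)
 thus ?thesis using N_integrable assms by (simp add: N_def)
qed

lemma N_le: "bsupp f ==> N f <= (LI x. cmod (f x))"
 unfolding N_def by (intro integral_mono N_integrable integrable_norm bsupp_integrable) (auto split: split_indicator)

lemma N_approx:
 assumes "bsupp g" obtains psi where "!!k. test_fn (psi k)" "!!k. N (%x. g x - psi k x) <= inverse (real (Suc k))"
proof -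
 have "EX psi. test_fn psi & N (%x. g x - psi x) <= inverse (real (Suc k))" for k
 proof -
  obtain psi where psi: "test_fn psi" "(LI x. cmod (g x - psi x)) < inverse (real (Suc k))"
   using test_fn_L1_dense[OF assms, of "inverse (real (Suc k))"] by auto
  thus ?thesis using N_le[OF bsupp_diff[OF assms test_fn_bsupp[OF psi(1)]]] by (intro exI[of _ psi]) simp
 qed
 thus ?thesis using that by metis
qed

lemma v_diff_le:
 assumes "test_fn f" "test_fn g" shows "cmod (v f - v g) <= A * N (%x. f x - g x)"
 using bound[OF test_fn_diff[OF assms]] by (simp add: N_def linear_on_tests_diff[OF linear assms])

lemma extension_exists: "EX V. ALL g. bsupp g --> (ALL psi. test_fn psi --> cmod (V g - v psi) <= A * N (%x. g x - psi x))"
proof -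
 have "EX y. ALL psi. test_fn psi --> cmod (y - v psi) <= A * N (%x. g x - psi x)" if g: "bsupp g" for g
 proof -
  obtain chi where chi: "!!k. test_fn (chi k)" "!!k. N (%x. g x - chi k x) <= inverse (real (Suc k))" using N_approx[OF g] by metis
  have dist: "cmod (v (chi k) - v psi) <= A*(inverse (real (Suc k)) + N (%x. g x - psi x))" if "test_fn psi" for k psi
  proof -
   have "N (%x. 1*(g x - psi x) + (- 1)*(g x - chi k x)) <= cmod 1 * N (%x. g x - psi x) + cmod (- 1) * N (%x. g x - chi k x)"
    by (intro N_lincomb bsupp_diff g test_fn_bsupp that chi)
   hence "A * N (%x. chi k x - psi x) <= A*(inverse (real (Suc k)) + N (%x. g x - psi x))"
    using chi(2)[of k] A_nonneg by (intro mult_left_mono) (auto simp: algebra_simps)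
   thus ?thesis using v_diff_le[OF chi(1) that, of k] by linarith
  qed
  have "Cauchy (%k. v (chi k))"
  proof (rule metric_CauchyI)
   fix e :: real assume "e > 0"
   hence "e/(2*(A+1)) > 0" using A_nonneg by simp
   then obtain M where M: "inverse (real (Suc M)) < e/(2*(A+1))" using reals_Archimedean by blast
   have "dist (v (chi k)) (v (chi l)) < e" if "k >= M" "l >= M" for k l
   proof -
    have "inverse (real (Suc k)) <= inverse (real (Suc M))" "inverse (real (Suc l)) <= inverse (real (Suc M))"
     using that by (auto intro!: le_imp_inverse_le)
    hence "inverse (real (Suc k)) + N (%x. g x - chi l x) <= 2 * inverse (real (Suc M))" using chi(2)[of l] by linarith
    hence "A*(inverse (real (Suc k)) + N (%x. g x - chi l x)) <= A*(2 * inverse (real (Suc M)))"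
     by (rule mult_left_mono[OF _ A_nonneg])
    also have "... <= (A+1)*(2 * inverse (real (Suc M)))" by (intro mult_right_mono) auto
    also have "... < e" using M A_nonneg by (simp add: pos_less_divide_eq algebra_simps)
    finally show ?thesis using dist[OF chi(1), of k l] by (simp add: dist_norm)
   qed
   thus "EX M. ALL k>=M. ALL l>=M. dist (v (chi k)) (v (chi l)) < e" by blast
  qed
  then obtain y where y: "(%k. v (chi k)) ~~> y" by (meson Cauchy_convergent_iff convergentD)
  have "cmod (y - v psi) <= A * N (%x. g x - psi x)" if "test_fn psi" for psi
  proof (rule LIMSEQ_le)
   show "(%k. cmod (v (chi k) - v psi)) ~~> cmod (y - v psi)" by (intro tendsto_intros y)
   have "(%k. A*(inverse (real (Suc k)) + N (%x. g x - psi x))) ~~> A*(0 + N (%x. g x - psi x))"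
    by (intro tendsto_intros LIMSEQ_inverse_real_of_nat)
   thus "(%k. A*(inverse (real (Suc k)) + N (%x. g x - psi x))) ~~> A * N (%x. g x - psi x)" by simp
  qed (use dist[OF that] in blast)
  thus ?thesis by blast
 qed
 thus ?thesis by metis
qed

definition V :: "'n fn => complex" where
 "V = (SOME V. ALL g. bsupp g --> (ALL psi. test_fn psi --> cmod (V g - v psi) <= A * N (%x. g x - psi x)))"

lemma V_approx: "bsupp g ==> test_fn psi ==> cmod (V g - v psi) <= A * N (%x. g x - psi x)"
 using someI_ex[OF extension_exists, folded V_def] by blast

lemma V_bound: "bsupp g ==> cmod (V g) <= A * N g"
 using V_approx[OF _ test_fn_zero] linear_on_tests_zero[OF linear] by simp

lemma V_lincomb:
 assumes f: "bsupp f" and g: "bsupp g" shows "V (%x. a * f x + b * g x) = a * V f + b * V g"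
proof -
 obtain ph chi where ph: "!!k. test_fn (ph k)" "!!k. N (%x. f x - ph k x) <= inverse (real (Suc k))"
  and chi: "!!k. test_fn (chi k)" "!!k. N (%x. g x - chi k x) <= inverse (real (Suc k))"
  using N_approx[OF f] N_approx[OF g] by metis
 let ?s = "%k x. a * ph k x + b * chi k x"
 have v_lincomb: "v (?s k) = a * v (ph k) + b * v (chi k)" for k
  using ph(1) chi(1) by (simp add: linear_on_tests_add[OF linear] linear_on_tests_cmult[OF linear] test_fn_cmult)
 have lim: "(%k. v (t k)) ~~> V h"
  if "bsupp h" "!!k. test_fn (t k)" "!!k. N (%x. h x - t k x) <= B * inverse (real (Suc k))" for h t B
 proof (rule Lim_transform[of "%_. V h"])
  have "cmod (v (t k) - V h) <= A*B * inverse (real (Suc k))" for k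
   using V_approx[OF that(1,2), of k] mult_left_mono[OF that(3) A_nonneg, of k] by (simp add: norm_minus_commute)
  thus "(%k. v (t k) - V h) ~~> 0"
   by (intro Lim_null_comparison[OF always_eventually tendsto_mult_right_zero[OF LIMSEQ_inverse_real_of_nat]] allI)
 qed simp
 have "N (%x. (a * f x + b * g x) - ?s k x) <= (cmod a + cmod b) * inverse (real (Suc k))" for k
 proof -
  have "N (%x. a*(f x - ph k x) + b*(g x - chi k x)) <= cmod a * N (%x. f x - ph k x) + cmod b * N (%x. g x - chi k x)"
   by (intro N_lincomb bsupp_diff f g test_fn_bsupp ph chi)
  also have "... <= cmod a * inverse (real (Suc k)) + cmod b * inverse (real (Suc k))"
   by (intro add_mono mult_left_mono ph chi norm_ge_zero)
  finally show ?thesis by (simp add: algebra_simps)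
 qed
 hence "(%k. v (?s k)) ~~> V (%x. a * f x + b * g x)"
  by (intro lim[where B = "cmod a + cmod b"] bsupp_lincomb f g test_fn_add test_fn_cmult ph chi)
 moreover have "(%k. v (?s k)) ~~> a * V f + b * V g"
  unfolding v_lincomb using lim[OF f ph(1), where B = 1] lim[OF g chi(1), where B = 1] ph(2) chi(2) by (intro tendsto_intros) auto
 ultimately show ?thesis by (rule LIMSEQ_unique)
qed

definition restr :: "'n fn => 'n fn" where
 "restr g x = idr (cball c R) x * g x"

lemma bsupp_restr:
 assumes "g:bml" "!!x. cmod (g x) <= C" shows "bsupp (restr g)"
proof -
 have "norm x <= norm c + R" if "x:cball c R" for x using that norm_triangle_sub[of x c] by (simp add: dist_norm norm_minus_commute)
 moreover have "cmod (restr g x) <= C" for x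
  using assms(2)[of x] order_trans[OF norm_ge_zero] by (auto simp: restr_def split: split_indicator)
 ultimately show ?thesis unfolding bsupp_def using assms(1)
  by (intro conjI exI[of _ C] exI[of _ "norm c + R"]) (auto simp: restr_def[abs_def] split: split_indicator)
qed

lemma bsupp_restr_indicator: "E:sets borel ==> bsupp (restr (idr E))"
 by (intro bsupp_restr[where C = 1]) (auto intro!: borel_measurable_indicator split: split_indicator)

lemma V_indicator_le:
 assumes E: "E:sets borel" shows "cmod (V (restr (idr E))) <= A * measure lborel (E Int cball c R)"
proof -
 have "N (restr (idr E)) = (LI x. idr (E Int cball c R) x)"
  unfolding N_def by (rule Bochner_Integration.integral_cong) (auto simp: restr_def split: split_indicator)
 also have "... = measure lborel (E Int cball c R)" using E by simp
 finally show ?thesis using V_bound[OF bsupp_restr_indicator[OF E]] by simp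
qed

lemma density_exists:
 "EX h. integrable lborel h & (ALL E:sets borel. (\<integral>x. idr E x * h x \<partial>lborel) = V (restr (idr E)))"
proof -
 have V_add: "V (restr (idr (E Un F))) = V (restr (idr E)) + V (restr (idr F))"
  if "E:sets borel" "F:sets borel" "E Int F = {}" for E F
 proof -
  have "restr (idr (E Un F)) = (%x. 1 * restr (idr E) x + 1 * restr (idr F) x)"
   using that(3) by (auto simp: restr_def fun_eq_iff split: split_indicator)
  thus ?thesis using V_lincomb[OF bsupp_restr_indicator bsupp_restr_indicator, OF that(1,2), where a = 1 and b = 1] by simp
 qed
 have part: "EX h. integrable lborel h & (ALL E:sets borel. (\<integral>x. idr E x * h x \<partial>lborel) = r (V (restr (idr E))))"
  if "!!y z. r (y+z) = r y + r z" "!!z. \<bar>r z\<bar> <= cmod z" for r :: "complex => real"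
  using lborel.set_function_density[of "%E. r (V (restr (idr E)))" A "cball c R"] emeasure_lborel_cball_finite[of c R]
  by (auto simp: fmeasurable_def V_add that(1) order_trans[OF that(2) V_indicator_le])
 obtain h1 h2 where h: "integrable lborel h1" "!!E. E:sets borel ==> (\<integral>x. idr E x * h1 x \<partial>lborel) = Re (V (restr (idr E)))"
  "integrable lborel h2" "!!E. E:sets borel ==> (\<integral>x. idr E x * h2 x \<partial>lborel) = Im (V (restr (idr E)))"
  using part[of Re] part[of Im] abs_Re_le_cmod abs_Im_le_cmod by auto
 let ?h = "%x. cr (h1 x) + \<i> * cr (h2 x)"
 have "(\<integral>x. idr E x * ?h x \<partial>lborel) = V (restr (idr E))" if E: "E:sets borel" for E
 proof -
  have "integrable lborel (%x. idr E x * h1 x)" "integrable lborel (%x. idr E x * h2 x)"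
   using integrable_mult_indicator[OF _ h(1), of E] integrable_mult_indicator[OF _ h(3), of E] E by simp_all
  moreover have "(\<integral>x. idr E x * ?h x \<partial>lborel) = (\<integral>x. cr (idr E x * h1 x) + \<i> * cr (idr E x * h2 x) \<partial>lborel)"
   by (rule Bochner_Integration.integral_cong) (auto split: split_indicator)
  ultimately show ?thesis by (simp add: h E complex_eq_iff del: of_real_mult)
 qed
 moreover have "integrable lborel ?h" using h by simp
 ultimately show ?thesis by blast
qed

lemma V_sum:
 "finite Y ==> (!!y. y:Y ==> bsupp (f y)) ==> V (%x. SUM y:Y. a y * f y x) = (SUM y:Y. a y * V (f y)) & bsupp (%x. SUM y:Y. a y * f y x)"
proof (induction Y rule: finite_induct)
 case empty
 have "bsupp (%x::real^'n. 0)" by (intro test_fn_bsupp test_fn_zero)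
 thus ?case using V_bound[of "%x. 0"] N_def[of "%x. 0"] by simp
next
 case (insert y Y)
 thus ?case using V_lincomb[of "f y" "%x. SUM y:Y. a y * f y x" "a y" 1] bsupp_lincomb[of "f y" "%x. SUM y:Y. a y * f y x" "a y" 1]
  by simp
qed

context
 fixes h :: "'n fn"
 assumes h: "integrable lborel h" "!!E. E:sets borel ==> (\<integral>x. idr E x * h x \<partial>lborel) = V (restr (idr E))"
begin

lemma density_represents_simple:
 assumes s: "simple_function lborel s" shows "(\<integral>x. h x * s x \<partial>lborel) = V (restr s)"
proof -
 let ?E = "%y. s -` {y}"
 have "s:borel_measurable borel" using borel_measurable_simple_function[OF s] by simp
 hence finite: "finite (range s)" and E: "?E y:sets borel" for y
  using s measurable_sets_borel[of s borel "{y}"] by (simp_all add: simple_function_def)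
 have bsupp: "bsupp (restr (idr (?E y)))" for y by (rule bsupp_restr_indicator[OF E])
 have repr: "s x = (SUM y:range s. y * idr (?E y) x)" for x
  by (rule trans[OF simple_function_indicator_representation_banach[OF s]]) (auto intro!: sum.cong split: split_indicator)
 have integrable: "integrable lborel (%x. idr (?E y) x * h x)" for y
  using integrable_mult_indicator[of "?E y" lborel h] E h(1) by (simp add: scaleR_conv_of_real of_real_indicator)
 have "(\<integral>x. h x * s x \<partial>lborel) = (\<integral>x. (SUM y:range s. y*(idr (?E y) x * h x)) \<partial>lborel)"
  by (rule Bochner_Integration.integral_cong[OF refl], subst repr) (simp add: sum_distrib_left mult_ac)
 also have "... = (SUM y:range s. y * V (restr (idr (?E y))))"
  by (subst Bochner_Integration.integral_sum) (use integrable E in "auto simp: h(2)")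
 also have "... = V (%x. SUM y:range s. y * restr (idr (?E y)) x)" using V_sum[OF finite bsupp] by simp
 also have "(%x. SUM y:range s. y * restr (idr (?E y)) x) = restr s"
  by (rule ext, unfold restr_def, subst repr) (simp add: sum_distrib_left mult_ac)
 finally show ?thesis .
qed

lemma V_restr_tendsto:
 assumes t: "test_fn psi" and s: "!!i::nat. s i:borel_measurable borel" "!!x. (%i. s i x) ~~> psi x" "!!i x. cmod (s i x) <= C" "!!x. cmod (psi x) <= C"
 shows "(%i. V (restr (s i))) ~~> v psi"
proof (rule Lim_transform[of "%_. v psi"])
 let ?B = "cball c R"
 have [measurable]: "psi:borel_measurable borel" using t by (auto intro: borel_measurable_continuous_onI smooth_continuous test_fn_smooth)
 note [measurable] = s(1)
 have "(%i. A*(LI x. idr ?B x * cmod (s i x - psi x))) ~~> A*(LI x::real^'n. 0)"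
 proof (intro tendsto_mult_left integral_dominated_convergence[where w = "%x. 2*C * idr ?B x"])
  show "AL x. (%i. idr ?B x * cmod (s i x - psi x)) ~~> 0"
   using s(2) by (intro AE_I2 tendsto_mult_right_zero tendsto_norm_zero) (simp add: LIM_zero)
  have "cmod (s i x - psi x) <= 2*C" for i x
   using s(3)[of i x] s(4)[of x] norm_triangle_ineq4[of "s i x" "psi x"] by linarith
  thus "AL x. norm (idr ?B x * cmod (s i x - psi x)) <= 2*C * idr ?B x" for i
   by (intro AE_I2) (auto split: split_indicator)
  show "(%x. idr ?B x * cmod (s i x - psi x)):bml" for i
   by (intro measurable_completion borel_measurable_times borel_measurable_indicator borel_measurable_norm borel_measurable_diff) (simp_all add: s(1))
 qed (use integrable_indicator_cball in auto)
 hence lim: "(%i. A*(LI x. idr ?B x * cmod (s i x - psi x))) ~~> 0" by simp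
 have "cmod (V (restr (s i)) - v psi) <= A*(LI x. idr ?B x * cmod (s i x - psi x))" for i
 proof -
  have "bsupp (restr (s i))" by (rule bsupp_restr[OF measurable_completion s(3)]) (simp add: s(1))
  moreover have "N (%x. restr (s i) x - psi x) = (LI x. idr ?B x * cmod (s i x - psi x))"
   unfolding N_def by (rule Bochner_Integration.integral_cong) (auto simp: restr_def split: split_indicator)
  ultimately show ?thesis using V_approx[OF _ t, of "restr (s i)"] by simp
 qed
 thus "(%i. V (restr (s i)) - v psi) ~~> 0" by (intro Lim_null_comparison[OF always_eventually lim]) auto
qed simp

lemma density_represents:
 assumes t: "test_fn psi" shows "(\<integral>x. h x * psi x \<partial>lborel) = v psi"
proof -
 have [measurable]: "h:borel_measurable borel" "psi:borel_measurable borel"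
  using h(1) t by (auto intro: borel_measurable_continuous_onI smooth_continuous test_fn_smooth)
 obtain C where C: "!!x. cmod (psi x) <= C" using test_fn_bounded[OF t] by blast
 have "C >= 0" using C[of 0] norm_ge_zero order_trans by blast
 obtain s where s: "!!i::nat. simple_function lborel (s i)" "!!x. (%i. s i x) ~~> psi x" "!!i x. cmod (s i x) <= 2 * cmod (psi x)"
  using borel_measurable_implies_sequence_metric[of psi lborel 0] by auto
 have [measurable]: "s i:borel_measurable borel" for i using borel_measurable_simple_function[OF s(1)] by simp
 have s_le: "cmod (s i x) <= 2*C" "cmod (psi x) <= 2*C" for i x using s(3)[of i x] C[of x] \<open>C >= 0\<close> by linarith+
 have "(%i. \<integral>x. h x * s i x \<partial>lborel) ~~> v psi"
  unfolding density_represents_simple[OF s(1)] by (rule V_restr_tendsto[OF t _ s(2) s_le]) simp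
 moreover have "(%i. \<integral>x. h x * s i x \<partial>lborel) ~~> (\<integral>x. h x * psi x \<partial>lborel)"
 proof (rule integral_dominated_convergence[where w = "%x. 2*C * cmod (h x)"])
  have "cmod (h x) * cmod (s i x) <= cmod (h x) * (2*C)" for i x by (intro mult_left_mono s_le norm_ge_zero)
  thus "AE x in lborel. norm (h x * s i x) <= 2*C * cmod (h x)" for i by (simp add: norm_mult mult_ac)
 qed (use s(2) h(1) in "auto intro!: tendsto_intros")
 ultimately show ?thesis using LIMSEQ_unique by auto
qed

lemma density_bound:
 "AE x in lborel. cmod (h x) <= A & (x~:cball c R --> h x = 0)"
proof -
 let ?B = "cball c R"
 have "AE x in lborel. h x:cball 0 A"
 proof (rule sigma_finite_measure.averaging_theorem[OF sigma_finite_lborel h(1)])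
  fix E :: "(real^'n) set" assume E: "E:sets lborel" "measure lborel E > 0"
  have "measure lborel (E Int ?B) <= measure lborel E"
   using E by (intro measure_mono_fmeasurable) (auto simp: fmeasurable_def less_top[symmetric] dest!: measure_eq_emeasure_eq_ennreal simp: measure_def)
  hence "cmod (V (restr (idr E))) <= A * measure lborel E"
   using E(1) by (intro order_trans[OF V_indicator_le mult_left_mono] A_nonneg) auto
  moreover have "(LINT x:E|lborel. h x) = V (restr (idr E))"
   using h(2)[of E] E(1) by (simp add: set_lebesgue_integral_def scaleR_conv_of_real of_real_indicator)
  ultimately show "(1 / measure lborel E) *! (LINT x:E|lborel. h x):cball 0 A"
   using E(2) by (simp add: norm_divide divide_le_eq)
 qed simp
 moreover have "AE x in lborel. idr (- ?B) x *! h x:{0}"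
 proof (rule sigma_finite_measure.averaging_theorem[OF sigma_finite_lborel integrable_mult_indicator[OF _ h(1)]])
  fix E :: "(real^'n) set" assume E: "E:sets lborel"
  have "(LINT x:E|lborel. idr (- ?B) x *! h x) = (\<integral>x. idr (E-?B) x * h x \<partial>lborel)"
   unfolding set_lebesgue_integral_def by (rule Bochner_Integration.integral_cong) (auto split: split_indicator)
  also have "... = V (restr (idr (E-?B)))" using E by (intro h(2)) auto
  also have "... = 0" using V_indicator_le[of "E-?B"] E by (simp add: Int_commute)
  finally show "(1 / measure lborel E) *! (LINT x:E|lborel. idr (- ?B) x *! h x):{0}" by simp
 qed auto
 ultimately show ?thesis by eventually_elim auto
qed

end

theorem representation:
 "EX h. h:bml & (ALL x. cmod (h x) <= A) & (ALL x. x~:cball c R --> h x = 0) & (ALL psi. test_fn psi --> (LI x. h x * psi x) = v psi)"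
proof -
 obtain h where h: "integrable lborel h" "!!E. E:sets borel ==> (\<integral>x. idr E x * h x \<partial>lborel) = V (restr (idr E))"
  using density_exists by blast
 have [measurable]: "h:borel_measurable borel" using h(1) by auto
 define h' where "h' x = (if x:cball c R & cmod (h x) <= A then h x else 0)" for x
 have h'[measurable]: "h':borel_measurable borel" unfolding h'_def by (intro measurable_If) (simp_all add: pred_def)
 have "(LI x. h' x * psi x) = v psi" if t: "test_fn psi" for psi
 proof -
  have [measurable]: "psi:borel_measurable borel" using t by (auto intro: borel_measurable_continuous_onI smooth_continuous test_fn_smooth)
  have "AE x in lborel. h' x * psi x = h x * psi x" using density_bound[OF h(1) h(2)] by (rule eventually_mono) (auto simp: h'_def)
  hence "(\<integral>x. h' x * psi x \<partial>lborel) = (\<integral>x. h x * psi x \<partial>lborel)" by (intro integral_cong_AE) auto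
  thus ?thesis using density_represents[OF h t] by (simp add: integral_completion)
 qed
 moreover have "h':bml" by (intro measurable_completion) simp
 ultimately show ?thesis using A_nonneg by (intro exI[of _ h']) (auto simp: h'_def)
qed

end

subsection \<open>Functionals controlled by their grand maximal function\<close>

lemma tempered_linear_on_tests: "tempered u ==> linear_on_tests u"
 unfolding tempered_def linear_on_tests_def using test_fn_schwartz by blast

text \<open>The function \<open>z \<mapsto> psi\<^sub>t (y - z)\<close> against which \<open>u * psi\<^sub>t\<close> is evaluated at \<open>y\<close>.\<close>

definition dilate :: "'n::finite fn => real => real^'n => 'n fn" where
 "dilate psi t y = (%z. psi ((1/t) *! (y-z)) / cr (t^CARD('n)))"

lemma dilate_alt:
 fixes psi :: "'n::finite fn"
 shows "dilate psi t y = (%z. of_real (1/t^CARD('n)) * psi ((1/t) *! y + (- (1/t)) *! z))"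
 unfolding dilate_def by (simp add: algebra_simps)

lemma grand_max_upper: "psi:S_m (m_phi phi) ==> t > 0 ==> dist y x < t ==> en (cmod (u (dilate psi t y))) <= grand_max phi u x"
 unfolding grand_max_def dilate_def by (rule Sup_upper) blast

lemma abs_summable_bounded:
 fixes f :: "'a => 'b::banach"
 assumes "!!F. finite F ==> F <= A ==> (SUM a:F. norm (f a)) <= b"
 shows "(%a. norm (f a)) summable_on A" "norm (infsum f A) <= b"
proof -
 show summable: "(%a. norm (f a)) summable_on A"
  using assms by (intro nonneg_bdd_above_summable_on bdd_aboveI2[where M = b]) auto
 show "norm (infsum f A) <= b"
  by (rule order_trans[OF norm_infsum_bound[OF summable] infsum_le_finite_sums[OF summable]]) (use assms in auto)
qed

lemma filterlim_finite_subsets_at_top: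
 assumes "!!k. finite (F k)" "!!k. F k <= A" "!!a. a:A ==> \<forall>\<^sub>F k in G. a:F k"
 shows "filterlim F (finite_subsets_at_top A) G"
 unfolding filterlim_finite_subsets_at_top
proof (intro allI impI)
 fix X assume X: "finite X & X <= A"
 hence "\<forall>\<^sub>F k in G. ALL a:X. a:F k" using assms(3) by (intro eventually_ball_finite) auto
 thus "\<forall>\<^sub>F k in G. finite (F k) & X <= F k & F k <= A" by eventually_elim (use assms in auto)
qed

lemma wball_subset_cball_ctr: "k >= 2 ==> wball a <= cball (ctr a) (k * rad a)"
 unfolding wball_def by (intro subset_cball mult_right_mono) auto

lemma wball_subset_cball:
 assumes "wball a Int cball 0 R ~= {}" "rad a <= E" shows "wball a <= cball 0 (R + 4*E)"
proof
 fix x assume "x:wball a"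
 moreover obtain y where "y:wball a" "norm y <= R" using assms(1) by auto
 ultimately show "x:cball 0 (R + 4*E)"
  using assms(2) norm_triangle_sub[of x y] dist_triangle3[of x y "ctr a"] by (simp add: wball_def dist_norm)
qed

lemma whitney_rad_le:
 assumes "lip1 d" "a:whitney d" "wball a Int cball 0 R ~= {}" shows "rad a <= max 1 (d 0 + R)"
proof -
 obtain x where x: "x:wball a" "norm x <= R" using assms(3) by auto
 have "98 * rad a <= d x" using whitney_bounds(1)[OF assms(1,2), of x 2] x by (simp add: wball_def dist_commute)
 moreover have "d x <= d 0 + R" using lip1D[OF assms(1), of x 0] x by simp
 ultimately show ?thesis using rad_pos[of a] by linarith
qed

lemma finite_whitney_meeting:
 fixes d :: "real^'n::finite => real"
 assumes "lip1 d" "e > 0"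
 shows "finite {a:whitney d. e <= rad a & wball a Int cball 0 R ~= {}}" (is "finite ?S")
proof -
 let ?X = "cball (0::real^'n) (R + 4 * max 1 (d 0 + R))" and ?e = "(e / real CARD('n))^CARD('n)"
 let ?C = "real (overlap TYPE('n)) / unit_ball_vol (real CARD('n)) * measure lbg ?X"
 show ?thesis
 proof (rule finite_if_finite_subsets_card_bdd[where C = "nat \<lceil>?C / ?e\<rceil>", THEN conjunct1])
  fix G assume G: "G <= ?S" "finite G"
  have "real (card G) * ?e = (SUM a:G. ?e)" by simp
  also have "... <= (SUM a:G. scl a^CARD('n))"
   using G assms(2) by (intro sum_mono power_mono) (auto simp: rad_def pos_divide_le_eq mult.commute)
  also have "... <= ?C"
  proof (rule sum_scl_power_le[OF assms(1) G(2)])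
   show "wball a <= ?X" if "a:G" for a
    using G(1) that by (intro wball_subset_cball whitney_rad_le[OF assms(1)]) auto
  qed (use G(1) in auto)
  finally have "real (card G) <= ?C/?e" using assms(2) by (subst pos_le_divide_eq) auto
  thus "card G <= nat \<lceil>?C / ?e\<rceil>" by linarith
 qed
qed

lemma whitney_series_abs_summable:
 fixes d :: "real^'n::finite => real" and f :: "'n dyadic => 'b::banach"
 assumes lip: "lip1 d" and C: "C >= 0"
 and f: "!!a. a:whitney d ==> (wball a <= cball 0 R & norm (f a) <= C * scl a^CARD('n)) | f a = 0"
 shows "(%a. norm (f a)) summable_on whitney d"
proof (rule abs_summable_bounded(1))
 let ?M = "real (overlap TYPE('n)) / unit_ball_vol (real CARD('n)) * measure lbg (cball (0::real^'n) R)"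
 fix F assume F: "finite F" "F <= whitney d"
 let ?G = "{a:F. wball a <= cball 0 R}"
 have "(SUM a:F. norm (f a)) = (SUM a:?G. norm (f a))"
  by (rule sum.mono_neutral_right) (use F f in auto)
 also have "... <= (SUM a:?G. C * scl a^CARD('n))" using f F C by (intro sum_mono) fastforce
 also have "... <= C*?M"
  unfolding sum_distrib_left[symmetric] using F C by (intro mult_left_mono sum_scl_power_le[OF lip]) auto
 finally show "(SUM a:F. norm (f a)) <= C*?M" .
qed

lemma test_fn_pd_bound_whitney:
 assumes lip: "lip1 d" and t: "test_fn psi"
 obtains D R where "D >= 0" "ALL a:whitney d. wball a <= cball 0 R & pd_bound K D (scl a) (wball a) psi | (ALL x:wball a. psi x = 0)"
proof -
 obtain R where R: "R > 0" "!!x. x~:cball 0 R ==> psi x = 0" using test_fn_support[OF t] by blast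
 obtain D where D: "D > 0" "pd_bound K D 1 UNIV psi" using test_fn_pd_bound[OF t] by blast
 define E where "E = max 1 (d 0 + R)"
 have "wball a <= cball 0 (R + 4*E) & pd_bound K (E^K*D) (scl a) (wball a) psi"
  if a: "a:whitney d" and meets: "wball a Int cball 0 R ~= {}" for a
 proof
  have rad: "rad a <= E" unfolding E_def by (rule whitney_rad_le[OF lip a meets])
  thus "wball a <= cball 0 (R + 4*E)" by (rule wball_subset_cball[OF meets])
  have "pd_bound K (E^K*D) (scl a) UNIV psi"
   using rad scl_le_rad[of a] D by (intro pd_bound_rescale[OF D(2)]) (auto simp: E_def)
  thus "pd_bound K (E^K*D) (scl a) (wball a) psi" by (auto simp: pd_bound_def)
 qed
 hence "ALL a:whitney d. wball a <= cball 0 (R + 4*E) & pd_bound K (E^K*D) (scl a) (wball a) psi | (ALL x:wball a. psi x = 0)"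
  using R(2) by blast
 moreover have "E^K*D >= 0" using D(1) by (simp add: E_def)
 ultimately show ?thesis using that by blast
qed

lemma le_wball_average:
 fixes a :: "'n::finite dyadic"
 assumes integrable: "integrable lbg (%x. idr (wball a) x * g x)" and bound: "!!x. x:wball a ==> y <= g x"
 shows "y <= (LI x. idr (wball a) x * g x) / measure lbg (wball a)"
proof -
 have "y * measure lbg (wball a) = (LI x. idr (wball a) x * y)" by (simp add: wball_def)
 also have "... <= (LI x. idr (wball a) x * g x)"
  using bound integrable integrable_indicator_cball[of "ctr a" "2 * rad a"]
  by (intro integral_mono) (auto simp: wball_def split: split_indicator)
 finally show ?thesis by (simp add: pos_le_divide_eq wball_def content_cball_pos)
qed

lemma test_fn_pd_bound_small_ball:
 fixes a :: "'n::finite dyadic" and D e :: real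
 assumes t: "test_fn psi" and D: "D >= 0" "pd_bound (Suc K) D 1 UNIV psi" and e: "rad a <= e" "e <= 1"
 shows "pd_bound (Suc K) ((LI x. idr (wball a) x * (cmod (psi x) + (4 * real CARD('n) + 1)*D*e)) / measure lbg (wball a)) (scl a) (wball a) psi"
 (is "pd_bound _ (?I/?m) _ _ _")
proof -
 let ?n = "real CARD('n)"
 have e_nonneg: "e >= 0" using e(1) rad_pos[of a] by linarith
 have integrable: "integrable lbg (%x. idr (wball a) x * (cmod (psi x) + (4*?n + 1)*D*e))"
  using integrable_mult_indicator[OF _ integrable_norm[OF test_fn_integrable[OF t]], of "wball a"] integrable_indicator_cball[of "ctr a" "2 * rad a"]
  by (simp add: wball_def distrib_left)
 have near_centre: "cmod (psi z - psi (ctr a)) <= 2*?n*D*e" if "z:wball a" for z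
 proof -
  have "cmod (psi z - psi (ctr a)) <= ?n*D * norm (z - ctr a)"
   by (rule smooth_diff_bound_cball[OF test_fn_smooth[OF t] _ that[unfolded wball_def] D(1)]) (use pd_boundD[OF D(2), of "[_]"] in auto)
  also have "... <= ?n*D*(2*e)"
   using that e(1) D(1) by (intro mult_left_mono) (auto simp: wball_def dist_norm norm_minus_commute)
  finally show ?thesis by (simp add: mult_ac)
 qed
 show ?thesis
  unfolding pd_bound_def
 proof (intro allI impI ballI)
  fix ds :: "'n list" and z assume ds: "length ds <= Suc K" and z: "z:wball a"
  have "cmod (pdl ds psi z) * scl a^length ds <= ?I/?m"
  proof (rule le_wball_average[OF integrable])
   fix w assume w: "w:wball a"
   show "cmod (pdl ds psi z) * scl a^length ds <= cmod (psi w) + (4*?n + 1)*D*e"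
   proof (cases ds)
    case Nil
    have "cmod (psi z) <= cmod (psi w) + cmod (psi z - psi (ctr a)) + cmod (psi w - psi (ctr a))"
     using norm_triangle_ineq4[of "psi z - psi (ctr a)" "psi w - psi (ctr a)"] norm_triangle_sub[of "psi z" "psi w"] by simp
    moreover have "D*e >= 0" using D(1) e_nonneg by simp
    ultimately show ?thesis using near_centre[OF z] near_centre[OF w] Nil by (simp add: algebra_simps)
   next
    case (Cons i js)
    have "scl a <= e" using scl_le_rad[of a] e(1) by linarith
    moreover from this have "scl a^length ds <= scl a" using Cons e(2) by (simp add: mult_left_le power_le_one)
    ultimately have "cmod (pdl ds psi z) * scl a^length ds <= D*e"
     using pd_boundD[OF D(2) ds, of z] D(1) by (intro mult_mono) auto
    moreover have "0 <= 4*?n*D*e" using D(1) e_nonneg by simp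
    ultimately show ?thesis using norm_ge_zero[of "psi w"] unfolding distrib_right by linarith
   qed
  qed
  thus "cmod (pdl ds psi z) <= ?I/?m / scl a^length ds" by (subst pos_le_divide_eq) auto
 qed
qed

context growth begin

abbreviation "mm == m_phi phi"
abbreviation "gmax == grand_max phi"

lemma bump_eq_dilate:
 fixes xi :: "'n fn" and x :: "real^'n"
 assumes xi: "test_fn xi" "!!z. z~:cball c (k1*e) ==> xi z = 0" "pd_bound (Suc mm) A e UNIV xi"
 and e: "e > 0" and A: "A > 0" and k: "k1 >= 0" "k2 >= 0" and x: "dist x c <= k2*e"
 obtains psi where "psi:S_m mm"
 "xi = (%z. of_real ((1+k1+k2)^((mm+2)*(CARD('n) + 1))*A*e^CARD('n)) * dilate psi e x z)"
proof -
 define k where "k = 1+k1+k2"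
 let ?N = "(mm+2)*(CARD('n) + 1)"
 define M where "M = k^?N*A*e^CARD('n)"
 have k_pos: "k > 0" using k by (simp add: k_def)
 have M: "M > 0" using A e k_pos by (simp add: M_def)
 define psi where "psi w = of_real (e^CARD('n) / M) * xi (x + (- e) *! w)" for w
 note smooth = test_fn_smooth[OF xi(1)]
 note smooth_xi = smooth_affine[OF smooth, of x "- e"]
 have zero: "psi w = 0" if "w~:cball 0 (k1+k2)" for w
 proof -
  have "e * norm w <= norm (x-c) + norm (c-(x + (- e) *! w))"
   using norm_triangle_ineq[of "x-c" "c-(x + (- e) *! w)"] e by simp
  moreover have "e * norm w > e*(k1+k2)" using that e by simp
  ultimately have "x + (- e) *! w~:cball c (k1*e)" using x by (simp add: dist_norm algebra_simps)
  thus ?thesis by (simp add: psi_def xi(2))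
 qed
 have test: "test_fn psi"
  by (rule test_fnI[OF _ zero]) (unfold psi_def, rule smooth_cmult[OF smooth_xi])
 have "(1 + norm w)^?N * cmod (pdl ds psi w) <= 1" if ds: "length ds <= mm+1" for ds w
 proof (cases "w:cball 0 (k1+k2)")
  case False
  hence "pdl ds psi w = 0" by (rule pdl_zero_outside_cball[rotated]) (rule zero)
  thus ?thesis by simp
 next
  case True
  have "cmod (pdl ds psi w) = e^CARD('n) / M*(e^length ds * cmod (pdl ds xi (x + (- e) *! w)))"
   unfolding psi_def pdl_cmult[OF smooth_xi] pdl_affine[OF smooth] using e M by (simp add: norm_mult norm_power norm_divide)
  also have "... <= e^CARD('n) / M*(e^length ds * (A/e^length ds))"
   using pd_boundD[OF xi(3) _ UNIV_I, of ds] ds e M by (intro mult_left_mono) auto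
  also have "... = 1/k^?N" using e A M k_pos by (simp add: M_def)
  finally have "(1 + norm w)^?N * cmod (pdl ds psi w) <= k^?N*(1/k^?N)"
   using True k_pos by (intro mult_mono power_mono) (auto simp: k_def)
  thus ?thesis using k_pos by simp
 qed
 hence "psi:S_m mm" unfolding S_m_def using test_fn_schwartz[OF test] by auto
 moreover have "xi = (%z. of_real M * dilate psi e x z)" using e M by (auto simp: psi_def dilate_def)
 ultimately show ?thesis using that unfolding M_def k_def by blast
qed

lemma functional_bound_by_grand_max:
 fixes u :: "'n fn => complex"
 assumes u: "linear_on_tests u" and xi: "test_fn xi" "!!z. z~:cball c (k1*e) ==> xi z = 0" "pd_bound (Suc mm) A e UNIV xi"
 and e: "e > 0" and k: "k1 >= 0" "k2 >= 0" and x: "dist x c <= k2*e" and V: "gmax u x <= en V" "V >= 0"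
 shows "cmod (u xi) <= (1+k1+k2)^((mm+2)*(CARD('n) + 1))*A*e^CARD('n) * V"
proof (cases "A = 0")
 case True
 have "xi z = 0" for z using pd_boundD[OF xi(3), of "[]" z] True by simp
 hence "xi = (%x. 0)" by auto
 thus ?thesis using linear_on_tests_zero[OF u] True by simp
next
 case False
 define M where "M = (1+k1+k2)^((mm+2)*(CARD('n) + 1))*A*e^CARD('n)"
 have "A >= 0" using order_trans[OF norm_ge_zero pd_boundD[OF xi(3), of "[]" x]] by simp
 hence A: "A > 0" using False by simp
 hence M: "M > 0" using e k by (simp add: M_def add_pos_nonneg)
 obtain psi where psi: "psi:S_m mm" and eq: "xi = (%z. of_real M * dilate psi e x z)"
  using bump_eq_dilate[OF xi e A k x] unfolding M_def by blast
 have "dilate psi e x = (%z. of_real (1/M) * xi z)" using M by (auto simp: eq)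
 hence "u (dilate psi e x) = of_real (1/M) * u xi" by (simp only: linear_on_tests_cmult[OF u xi(1)])
 hence "cmod (u xi) / M = cmod (u (dilate psi e x))" using M by (simp add: norm_mult norm_divide)
 moreover have "en (cmod (u (dilate psi e x))) <= en V"
  using grand_max_upper[OF psi e, of x x u] e V(1) by simp
 ultimately have "cmod (u xi) / M <= V" using V(2) by (simp add: ennreal_le_iff)
 thus ?thesis using M unfolding M_def[symmetric] by (simp add: pos_divide_le_eq mult.commute)
qed

definition controlled :: "('n fn => complex) => real => (real^'n => real) => bool" where
 "controlled u V d \<longleftrightarrow> linear_on_tests u & V >= 0 & lip1 d & (ALL x. d x >= 0) & (ALL x. EX y. dist x y <= d x & gmax u y <= en V)"

lemma controlledD:
 assumes "controlled u V d" shows "linear_on_tests u" "V >= 0" "lip1 d" "d x >= 0"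
 using assms by (auto simp: controlled_def)

definition adapted :: "real => 'n dyadic => 'n fn => bool" where
 "adapted B a xi \<longleftrightarrow> smooth xi & (ALL z. z~:wball a --> xi z = 0) & pd_bound (Suc mm) B (scl a) UNIV xi"

lemma adaptedD:
 assumes "adapted B a xi"
 shows "smooth xi" "z~:wball a ==> xi z = 0" "pd_bound (Suc mm) B (scl a) UNIV xi" "B >= 0" "test_fn xi"
proof -
 show "smooth xi" "z~:wball a ==> xi z = 0" and bound: "pd_bound (Suc mm) B (scl a) UNIV xi"
  using assms by (auto simp: adapted_def)
 show "B >= 0" using order_trans[OF norm_ge_zero pd_boundD[OF bound, of "[]" 0]] by simp
 show "test_fn xi" by (rule test_fnI[of _ "ctr a" "2 * rad a"]) (use assms in "auto simp: adapted_def wball_def")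
qed

lemma adapted_mult:
 assumes xi: "adapted B a xi" and f: "smooth f" "pd_bound (Suc mm) D (scl a) (wball a) f" and D: "D >= 0"
 shows "adapted (2^Suc mm * B*D) a (%x. xi x * f x)"
proof -
 have "pd_bound (Suc mm) (2^Suc mm * B*D) (scl a) (wball a) (%x. xi x * f x)"
  using adaptedD(4)[OF xi] D
  by (intro pd_bound_mult[OF adaptedD(1)[OF xi] f(1) pd_bound_mono[OF adaptedD(3)[OF xi]] f(2)]) auto
 hence "pd_bound (Suc mm) (2^Suc mm * B*D) (scl a) UNIV (%x. xi x * f x)"
  unfolding wball_def by (rule pd_bound_extend) (use adaptedD(2,4)[OF xi] D in "auto simp: wball_def")
 thus ?thesis using adaptedD(1,2)[OF xi] f(1) by (simp add: adapted_def smooth_mult)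
qed

definition bump_const :: real where
 "bump_const = (1 + 2 * real CARD('n) + 500 * real CARD('n))^((mm+2)*(CARD('n) + 1))"

lemma bump_const_pos: "bump_const > 0"
 by (simp add: bump_const_def add_pos_nonneg)

lemma controlled_adapted_bound:
 assumes u: "controlled u V d" and a: "a:whitney d" and xi: "adapted B a xi"
 shows "cmod (u xi) <= bump_const*B * scl a^CARD('n) * V"
proof -
 obtain y where y: "dist (ctr a) y <= d (ctr a)" "gmax u y <= en V" using u by (auto simp: controlled_def)
 have "d (ctr a) <= 500 * rad a" using a by (simp add: whitney_def)
 hence dy: "dist y (ctr a) <= 500 * real CARD('n) * scl a" using y(1) by (simp add: dist_commute rad_def)
 show ?thesis
  unfolding bump_const_def
  by (rule functional_bound_by_grand_max[OF controlledD(1)[OF u] adaptedD(5)[OF xi] _ adaptedD(3)[OF xi] scl_pos _ _ dy y(2) controlledD(2)[OF u]])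
  (auto intro!: adaptedD(2)[OF xi] simp: wball_def rad_def)
qed

definition zeta_const :: real where
 "zeta_const = (SOME C. C > 0 & (ALL rho (a::'n dyadic). lip1 rho --> pd_bound (Suc mm) C (scl a) UNIV (zeta rho a)))"

lemma zeta_const_pos: "zeta_const > 0"
 and adapted_zeta: "lip1 rho ==> adapted zeta_const a (zeta rho a)"
 using someI_ex[OF zeta_pd_bound[of "Suc mm", where 'n = 'n], folded zeta_const_def]
 by (blast, unfold adapted_def, blast intro: zeta_smooth zeta_eq_0)

text \<open>The terms of the series paired with a test function are of the size of the volumes of the balls.\<close>

lemma adapted_family_bound:
 assumes u: "controlled u V d" and t: "test_fn psi"
 shows "EX C>=0. EX R. ALL a xi B. a:whitney d --> adapted B a xi --> (wball a <= cball 0 R & cmod (u (%x. xi x * psi x)) <= C*B * scl a^CARD('n)) | u (%x. xi x * psi x) = 0"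
proof -
 note V = controlledD(2)[OF u]
 obtain D R where D: "D >= 0" and cases: "ALL a:whitney d. wball a <= cball 0 R & pd_bound (Suc mm) D (scl a) (wball a) psi | (ALL x:wball a. psi x = 0)"
  using test_fn_pd_bound_whitney[OF controlledD(3)[OF u] t] by metis
 have "(wball a <= cball 0 R & cmod (u (%x. xi x * psi x)) <= bump_const*(2^Suc mm * D)*V*B * scl a^CARD('n)) | u (%x. xi x * psi x) = 0"
  if a: "a:whitney d" and xi: "adapted B a xi" for a xi B
  using cases[rule_format, OF a]
 proof
  assume "ALL x:wball a. psi x = 0"
  hence "(%x. xi x * psi x) = (%x. 0)" using adaptedD(2)[OF xi] by (metis mult_zero_left mult_zero_right)
  thus ?thesis using linear_on_tests_zero[OF controlledD(1)[OF u]] by simp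
 next
  assume bound: "wball a <= cball 0 R & pd_bound (Suc mm) D (scl a) (wball a) psi"
  show ?thesis
   using controlled_adapted_bound[OF u a adapted_mult[OF xi test_fn_smooth[OF t] conjunct2[OF bound] D]] bound by (simp add: mult_ac)
 qed
 moreover have "bump_const*(2^Suc mm * D)*V >= 0" using D V bump_const_pos by simp
 ultimately show ?thesis by blast
qed

lemma adapted_family_abs_summable:
 assumes u: "controlled u V d" and t: "test_fn psi" and xi: "!!a. a:whitney d ==> adapted B a (xi a)" and B: "B >= 0"
 shows "(%a. norm (u (%x. xi a x * psi x))) summable_on whitney d"
proof -
 obtain C R where C: "C >= 0" and bound: "ALL a xi B. a:whitney d --> adapted B a xi --> (wball a <= cball 0 R & cmod (u (%x. xi x * psi x)) <= C*B * scl a^CARD('n)) | u (%x. xi x * psi x) = 0"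
  using adapted_family_bound[OF u t] by blast
 show ?thesis
 proof (rule whitney_series_abs_summable[OF controlledD(3)[OF u], where C = "C*B" and R = R])
  fix a assume a: "a:whitney d"
  show "(wball a <= cball 0 R & norm (u (%x. xi a x * psi x)) <= C*B * scl a^CARD('n)) | u (%x. xi a x * psi x) = 0"
   using bound[rule_format, OF a xi[OF a]] by auto
 qed (use B C in simp)
qed

lemma zeta_series_abs_summable:
 assumes "controlled u V d" "test_fn psi"
 shows "(%a. norm (u (%x. zeta d a x * psi x))) summable_on whitney d"
 using zeta_const_pos by (intro adapted_family_abs_summable[OF assms, where B = zeta_const] adapted_zeta controlledD(3)[OF assms(1)]) auto

definition remainder_const :: real where
 "remainder_const = bump_const*(2^Suc mm * zeta_const) / unit_ball_vol (real CARD('n)) * real (overlap TYPE('n))"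

lemma remainder_const_nonneg: "remainder_const >= 0"
 using bump_const_pos zeta_const_pos by (simp add: remainder_const_def)

lemma small_ball_zeta_bound:
 assumes u: "controlled u V d" and a: "a:whitney d" and t: "test_fn psi" and D: "D >= 0" "pd_bound (Suc mm) D 1 UNIV psi" and e: "rad a <= e" "e <= 1"
 shows "cmod (u (%x. zeta d a x * psi x)) <= bump_const*(2^Suc mm * zeta_const) / unit_ball_vol (real CARD('n)) * V*(LI x. idr (wball a) x * (cmod (psi x) + (4 * real CARD('n) + 1)*D*e))"
 (is "_ <= ?C/?v*V*?I")
proof -
 let ?m = "measure lbg (wball a)"
 have "2 * real CARD('n) >= 1" using CARD_ge_1[where 'n = 'n] by linarith
 hence volume: "?v * scl a^CARD('n) <= ?m"
  using measure_cball_ge[of "scl a" "2 * real CARD('n)" "ctr a"] by (simp add: wball_def rad_def mult.assoc)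
 moreover have "?v * scl a^CARD('n) > 0" by simp
 ultimately have m: "?m > 0" by linarith
 have "e >= 0" using e(1) rad_pos[of a] by linarith
 hence I: "?I >= 0" using D(1) by (intro Bochner_Integration.integral_nonneg) simp
 have C: "?C >= 0" using bump_const_pos zeta_const_pos by simp
 have "pd_bound (Suc mm) (?I/?m) (scl a) (wball a) psi"
  by (rule test_fn_pd_bound_small_ball[OF t D e])
 from controlled_adapted_bound[OF u a adapted_mult[OF adapted_zeta[OF controlledD(3)[OF u]] test_fn_smooth[OF t] this]]
 have "cmod (u (%x. zeta d a x * psi x)) <= ?C*V*?I*(scl a^CARD('n) / ?m)" using I m by (simp add: mult_ac)
 also have "... <= ?C*V*?I*(1/?v)"
  using volume m C I controlledD(2)[OF u] by (intro mult_left_mono) (auto simp: divide_simps mult.commute)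
 finally show ?thesis by (simp add: mult_ac)
qed

text \<open>Raising \<open>d\<close> to \<open>max d e\<close> turns the decomposition of \<open>{d > 0}\<close> into a locally finite one of the
whole space, without changing its balls of radius larger than \<open>e\<close>.\<close>

lemma lip1_max: "lip1 d ==> lip1 (%x. max (d x) e)"
 unfolding lipschitz_on_def dist_real_def by (auto simp: max_def abs_le_iff) (smt (verit, best))+

lemma controlled_max: "controlled u V d ==> e >= 0 ==> controlled u V (%x. max (d x) e)"
 unfolding controlled_def by (auto intro!: lip1_max simp: le_max_iff_disj)

lemma zeta_max:
 assumes "lip1 d" "e > 0" "rad a > e"
 shows "a:whitney (%x. max (d x) e) \<longleftrightarrow> a:whitney d" "zeta (%x. max (d x) e) a = zeta d a"
proof -
 let ?d = "%x. max (d x) e"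
 have mem_iff: "b:whitney ?d \<longleftrightarrow> b:whitney d" if "100 * rad b > e" for b
  using that by (auto simp: whitney_def)
 show "a:whitney ?d \<longleftrightarrow> a:whitney d" by (rule mem_iff) (use assms rad_pos[of a] in linarith)
 have "b:whitney ?d \<longleftrightarrow> b:whitney d" if "a:whitney d" "wball b Int wball a ~= {}" for b
 proof -
  have lip: "lip1 ?d" by (rule lip1_max[OF assms(1)])
  have "100 * rad b > e" if b: "b:whitney ?d | b:whitney d"
  proof -
   have "scl a <= 6 * scl b"
    using b \<open>a : whitney d\<close> that touching_wballs(1)[OF lip assms(1), of b a] touching_wballs(1)[OF assms(1) assms(1), of b a] \<open>wball b \<inter> wball a ~= {}\<close> by auto
   hence "rad a <= 6 * rad b" by (rule rad_mono)
   thus ?thesis using assms(3) rad_pos[of b] by linarith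
  qed
  thus ?thesis using mem_iff by blast
 qed
 hence "earlier ?d a = earlier d a" if "a:whitney d" using that by (auto simp: earlier_def)
 thus "zeta ?d a = zeta d a" using \<open>a : whitney ?d \<longleftrightarrow> a : whitney d\<close> by (auto simp: zeta_def fun_eq_iff)
qed

lemma zeta_partial_sum_bound:
 assumes u: "controlled u V d" and t: "test_fn psi" and R: "!!x. x~:cball 0 R ==> psi x = 0"
 and D: "D >= 0" "pd_bound (Suc mm) D 1 UNIV psi" and e: "0 < e" "e <= 1"
 shows "cmod (u psi - (SUM a:{a:whitney d. e < rad a & wball a Int cball 0 R ~= {}}. u (%x. zeta d a x * psi x))) <= remainder_const*V*((LI x. cmod (psi x)) + (4 * real CARD('n) + 1)*D * measure lbg (cball (0::real^'n) (R+4)) * e)"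
 (is "cmod (u psi - ?sum) <= _*V*(_ + ?k*D*?m*e)")
proof -
 define d' where "d' x = max (d x) e" for x
 have u': "controlled u V d'" unfolding d'_def using e by (intro controlled_max[OF u]) simp
 define c where "c = remainder_const / real (overlap TYPE('n)) * V"
 define w where "w x = cmod (psi x) + ?k*D*e * idr (cball 0 (R+4)) x" for x
 note lip' = controlledD(3)[OF u'] and linear = controlledD(1)[OF u]
 let ?f = "%a. u (%x. zeta d' a x * psi x)"
 define S where "S = {a:whitney d'. wball a Int cball 0 R ~= {}}"
 have "S = {a:whitney d'. e/500 <= rad a & wball a Int cball 0 R ~= {}}"
  unfolding S_def whitney_def d'_def by auto
 hence S: "finite S" using finite_whitney_meeting[OF lip', of "e/500" R] e by simp
 let ?large = "{a:S. e < rad a}" and ?small = "{a:S. rad a <= e}"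
 have "psi x = (SUM a:S. zeta d' a x * psi x)" for x
 proof (cases "x:cball 0 R")
  case True
  have "(SUM a:S. zeta d' a x) = 1"
   by (rule sum_zeta[OF lip' _ S]) (use True e in "auto simp: S_def d'_def")
  thus ?thesis by (simp add: sum_distrib_right[symmetric])
 qed (simp add: R)
 hence "u psi = u (%x. SUM a:S. zeta d' a x * psi x)" by simp
 also have "... = (SUM a:S. ?f a)"
  by (intro linear_on_tests_sum[OF linear] test_fn_mult_left zeta_smooth t)
 also have "... = (SUM a:?large. ?f a)+(SUM a:?small. ?f a)"
  using S by (subst sum.union_disjoint[symmetric]) (auto intro!: sum.cong)
 also have "(SUM a:?large. ?f a) = ?sum"
  using zeta_max[OF controlledD(3)[OF u] e(1)] by (intro sum.cong) (auto simp: S_def d'_def[abs_def])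
 finally have "u psi - ?sum = (SUM a:?small. ?f a)" by simp
 also have "cmod ... <= (SUM a:?small. c*(LI x. idr (wball a) x * w x))"
 proof (rule sum_norm_le)
  fix a assume a: "a:?small"
  hence "wball a <= cball 0 (R + 4*1)" using e(2) by (intro wball_subset_cball) (auto simp: S_def)
  hence localize: "(LI x. idr (wball a) x * (cmod (psi x) + ?k*D*e)) = (LI x. idr (wball a) x * w x)"
   unfolding w_def by (intro Bochner_Integration.integral_cong) (auto split: split_indicator)
  show "cmod (?f a) <= c*(LI x. idr (wball a) x * w x)"
   using small_ball_zeta_bound[OF u' _ t D _ e(2), of a, unfolded localize] a by (simp add: S_def c_def remainder_const_def overlap_def mult_ac)
 qed
 also have "... <= c*(real (overlap TYPE('n)) * (LI x. w x))"
  unfolding sum_distrib_left[symmetric]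
 proof (intro mult_left_mono sum_integral_whitney_le[OF lip'])
  show "integrable lbg w"
   using test_fn_integrable[OF t] integrable_indicator_cball unfolding w_def by (intro Bochner_Integration.integrable_add integrable_mult_right) auto
  show "finite ?small" by (rule finite_subset[OF _ S]) auto
 qed (use D e remainder_const_nonneg controlledD(2)[OF u] in "auto simp: S_def wball_def c_def w_def")
 also have "(LI x. w x) = (LI x. cmod (psi x)) + ?k*D*?m*e"
  using test_fn_integrable[OF t] integrable_indicator_cball[of 0 "R+4"] unfolding w_def by (subst Bochner_Integration.integral_add) (auto simp: mult_ac)
 finally show ?thesis by (simp add: overlap_def c_def)
qed

lemma zeta_series_remainder:
 assumes u: "controlled u V d" and t: "test_fn psi"
 shows "cmod (u psi - (\<Sum>\<^sub>\<infinity>a\<in>whitney d. u (%x. zeta d a x * psi x))) <= remainder_const*V*(LI x. cmod (psi x))"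
proof -
 obtain R where R: "R > 0" "!!x. x~:cball 0 R ==> psi x = 0" using test_fn_support[OF t] by blast
 obtain D where D: "D > 0" "pd_bound (Suc mm) D 1 UNIV psi" using test_fn_pd_bound[OF t] by blast
 let ?f = "%a. u (%x. zeta d a x * psi x)"
 define A where "A = {a:whitney d. wball a Int cball 0 R ~= {}}"
 define e where "e k = inverse (real (Suc k))" for k
 define F where "F k = {a. a:whitney d & e k < rad a & wball a Int cball 0 R ~= {}}" for k
 have "e k > 0" "e k <= 1" for k by (auto simp: e_def field_simps)
 note e = this
 have "?f a = 0" if "a:whitney d - A" for a
 proof -
  have "zeta d a x * psi x = 0" for x
   using that R(2)[of x] zeta_eq_0[of x a d] by (cases "x:wball a") (auto simp: A_def disjoint_iff)
  hence "(%x. zeta d a x * psi x) = (%x. 0)" by blast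
  thus ?thesis using linear_on_tests_zero[OF controlledD(1)[OF u]] by simp
 qed
 moreover have "(?f has_sum (\<Sum>\<^sub>\<infinity>a\<in>whitney d. ?f a)) (whitney d)"
  using abs_summable_summable[OF zeta_series_abs_summable[OF u t]] by simp
 ultimately have "(?f has_sum (\<Sum>\<^sub>\<infinity>a\<in>whitney d. ?f a)) A"
  by (subst has_sum_cong_neutral[where T = "whitney d" and g = ?f]) (auto simp: A_def)
 moreover have "filterlim F (finite_subsets_at_top A) sequentially"
 proof (rule filterlim_finite_subsets_at_top)
  show "finite (F k)" for k
   by (rule finite_subset[OF _ finite_whitney_meeting[OF controlledD(3)[OF u] e(1)[of k], of R]]) (auto simp: F_def)
  show "\<forall>\<^sub>F k in sequentially. a:F k" if "a:A" for a
   using order_tendstoD(2)[OF LIMSEQ_inverse_real_of_nat rad_pos[of a]] by eventually_elim (use that in "auto simp: F_def A_def e_def")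
 qed (auto simp: F_def A_def)
 ultimately have lim: "(%k. SUM a:F k. ?f a) ~~> (\<Sum>\<^sub>\<infinity>a\<in>whitney d. ?f a)"
  unfolding has_sum_def by (rule filterlim_compose)
 show ?thesis
 proof (rule LIMSEQ_le)
  show "(%k. cmod (u psi - (SUM a:F k. ?f a))) ~~> cmod (u psi - (\<Sum>\<^sub>\<infinity>a\<in>whitney d. ?f a))"
   by (intro tendsto_intros lim)
  let ?k = "(4 * real CARD('n) + 1)*D * measure lbg (cball (0::real^'n) (R+4))"
  have "(%k. remainder_const*V*((LI x. cmod (psi x)) + ?k * e k)) ~~> remainder_const*V*((LI x. cmod (psi x)) + ?k*0)"
   unfolding e_def by (intro tendsto_intros LIMSEQ_inverse_real_of_nat)
  thus "(%k. remainder_const*V*((LI x. cmod (psi x)) + ?k * e k)) ~~> remainder_const*V*(LI x. cmod (psi x))" by simp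
  show "EX N. ALL k>=N. cmod (u psi - (SUM a:F k. ?f a)) <= remainder_const*V*((LI x. cmod (psi x)) + ?k * e k)"
   using zeta_partial_sum_bound[OF u t R(2) less_imp_le[OF D(1)] D(2) e] unfolding F_def by blast
 qed
qed

end

subsection \<open>Subtracting moments\<close>

lemma lebesgue_integral_affine:
 fixes f :: "real^'n::finite => complex"
 assumes f: "f:borel_measurable borel" and c: "c ~= 0"
 shows "(LI x. f x) = abs c^CARD('n) *! (LI x. f (t + c *! x))"
proof -
 have measurable: "(%x. f (t + c *! x)):borel_measurable borel" using f by measurable
 have "(\<integral>x. f x \<partial>lborel) = (\<integral>x. f x \<partial>density (distr lborel borel (%x. t + c *! x)) (%_. abs c^CARD('n)))"
  using lborel_affine[OF c, of t] by simp
 also have "... = (\<integral>x. abs c^CARD('n) *! f x \<partial>distr lborel borel (%x. t + c *! x))"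
  using f by (intro integral_density) auto
 also have "... = (\<integral>x. abs c^CARD('n) *! f (t + c *! x) \<partial>lborel)" using f by (intro integral_distr) auto
 finally show ?thesis using f measurable by (simp add: integral_completion)
qed

locale growth_moments = growth phi K p q0 for phi :: "real^'n::finite => real => real" and K p q0 +
 fixes s :: nat and theta :: "('n => nat) => 'n fn" and dual_bound :: real
 assumes s_ge: "m_phi phi <= s" and dual_bound_pos: "dual_bound > 0"
 and dual_measurable: "!!mu. sum mu UNIV <= s ==> theta mu:borel_measurable borel"
 and dual_le: "!!mu x. sum mu UNIV <= s ==> cmod (theta mu x) <= dual_bound"
 and dual_support: "!!mu x. sum mu UNIV <= s ==> x~:ball 0 1 ==> theta mu x = 0"
 and dual_moments: "!!mu nu. sum mu UNIV <= s ==> sum nu UNIV <= s ==> (LI x. theta mu x * monom_fn nu x) = (if mu = nu then 1 else 0)"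
begin

definition unscale :: "'n dyadic => real^'n => real^'n" where
 "unscale a x = (- (1 / scl a) *! ctr a) + (1 / scl a) *! x"

definition indices :: "('n => nat) set" where
 "indices = {mu. sum mu UNIV <= s}"

text \<open>The unique combination of the rescaled dual functions with the moments \<open>l\<close>,
as a functional; subtracting it from \<open>xi u\<close> gives the bad part at a Whitney ball.\<close>

definition moment_part :: "'n dyadic => ('n fn => complex) => 'n fn => complex" where
 "moment_part a l psi = (SUM mu:indices. l (%x. monom_fn mu (unscale a x)) * ((LI x. theta mu (unscale a x) * psi x) / of_real (scl a^CARD('n))))"

definition bad_part :: "('n fn => complex) => 'n dyadic => 'n fn => 'n fn => complex" where
 "bad_part u a xi psi = u (%x. xi x * psi x) - moment_part a (%f. u (%x. xi x * f x)) psi"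

lemma finite_indices: "finite indices"
 unfolding indices_def by (rule finite_multi_index)

lemma unscale_alt: "unscale a x = (1 / scl a) *! (x - ctr a)"
 by (simp add: unscale_def algebra_simps)

lemma norm_unscale: "norm (unscale a x) = dist (ctr a) x / scl a"
 by (simp add: unscale_alt dist_norm norm_minus_commute)

lemma smooth_monom_unscale: "smooth (%x. monom_fn mu (unscale a x))"
 unfolding unscale_def by (intro smooth_affine smooth_monom)

lemma dual_unscale_eq_0:
 assumes "mu:indices" "x~:wball a" shows "theta mu (unscale a x) = 0"
proof (rule dual_support)
 have "scl a <= dist (ctr a) x" using assms(2) scl_le_rad[of a] rad_pos[of a] unfolding wball_def mem_cball by linarith
 thus "unscale a x~:ball 0 1" by (simp add: norm_unscale le_divide_eq)
qed (use assms in "simp add: indices_def")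

lemma integrable_wball_continuous:
 assumes "continuous_on UNIV psi" shows "integrable lbg (%x. idr (wball (a::'n dyadic)) x * cmod (psi x))"
proof -
 have "x:cball 0 (norm (ctr a) + 2 * rad a)" if "x:wball a" for x
  using that norm_triangle_sub[of x "ctr a"] by (simp add: wball_def dist_norm norm_minus_commute)
 hence "bsupp (%x::real^'n. idr (wball a) x)"
  by (intro bsupp_indicator[where R = "norm (ctr a) + 2 * rad a"]) (auto simp: wball_def)
 from integrable_norm[OF bsupp_mult_integrable[OF this assms]] show ?thesis
  by (rule Bochner_Integration.integrable_cong[THEN iffD1, rotated 2]) (auto simp: norm_mult split: split_indicator)
qed

lemma dual_unscale_integral:
 assumes mu: "mu:indices" and psi: "continuous_on UNIV psi"
 shows "integrable lbg (%x. theta mu (unscale a x) * psi x)"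
 "cmod (LI x. theta mu (unscale a x) * psi x) <= dual_bound*(LI x. idr (wball a) x * cmod (psi x))"
proof -
 have [measurable]: "theta mu:borel_measurable borel" using dual_measurable mu by (simp add: indices_def)
 have "(%x. theta mu (unscale a x)):borel_measurable borel" unfolding unscale_def by measurable
 hence [measurable]: "(%x. theta mu (unscale a x)):bml" by (intro measurable_completion) simp
 have [measurable]: "psi:bml" by (rule continuous_lebesgue_measurable[OF psi])
 note int = integrable_wball_continuous[OF psi, of a]
 have bound: "cmod (theta mu (unscale a x) * psi x) <= dual_bound*(idr (wball a) x * cmod (psi x))" for x
  using dual_unscale_eq_0[OF mu, of x a] dual_le[of mu "unscale a x"] mu
  by (cases "x:wball a") (auto simp: norm_mult indices_def intro: mult_right_mono)
 show int': "integrable lbg (%x. theta mu (unscale a x) * psi x)"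
  by (rule Bochner_Integration.integrable_bound[OF integrable_mult_right[OF int, of dual_bound]])
  (use bound dual_bound_pos in "auto simp: abs_mult")
 have "cmod (LI x. theta mu (unscale a x) * psi x) <= (LI x. cmod (theta mu (unscale a x) * psi x))" by (rule integral_norm_bound)
 also have "... <= (LI x. dual_bound*(idr (wball a) x * cmod (psi x)))"
  by (rule integral_mono) (use int int' bound in auto)
 finally show "cmod (LI x. theta mu (unscale a x) * psi x) <= dual_bound*(LI x. idr (wball a) x * cmod (psi x))" by simp
qed

lemma moment_part_add:
 assumes "continuous_on UNIV f" "continuous_on UNIV g"
 shows "moment_part a l (%x. f x + g x) = moment_part a l f + moment_part a l g"
proof -
 have "(LI x. theta mu (unscale a x) * (f x + g x)) = (LI x. theta mu (unscale a x) * f x)+(LI x. theta mu (unscale a x) * g x)" if "mu:indices" for mu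
  using dual_unscale_integral(1)[OF that assms(1), of a] dual_unscale_integral(1)[OF that assms(2), of a] by (simp add: distrib_left)
 thus ?thesis unfolding moment_part_def sum.distrib[symmetric] by (intro sum.cong refl) (simp add: add_divide_distrib distrib_left)
qed

lemma moment_part_cmult: "moment_part a l (%x. c * f x) = c * moment_part a l f"
proof -
 have "(LI x. theta mu (unscale a x) * (c * f x)) = c*(LI x. theta mu (unscale a x) * f x)" for mu
  by (subst integral_mult_right_zero[symmetric]) (simp add: mult.left_commute)
 thus ?thesis unfolding moment_part_def sum_distrib_left by (intro sum.cong refl) (simp add: mult_ac)
qed

lemma moment_part_sum: "moment_part a (%f. SUM i:S. l i f) psi = (SUM i:S. moment_part a (l i) psi)"
 unfolding moment_part_def sum_distrib_right by (rule sum.swap)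

lemma dual_unscale_moments:
 assumes mu: "mu:indices" and nu: "nu:indices"
 shows "(LI x. theta mu (unscale a x) * monom_fn nu (unscale a x)) / of_real (scl a^CARD('n)) = (if mu = nu then 1 else 0)"
proof -
 have [measurable]: "theta mu:borel_measurable borel" using dual_measurable mu by (simp add: indices_def)
 have [measurable]: "monom_fn nu:borel_measurable borel"
  by (intro borel_measurable_continuous_onI smooth_continuous smooth_monom)
 have "(LI x. theta mu x * monom_fn nu x) = \<bar>1 / scl a\<bar>^CARD('n) *! (LI x. theta mu (unscale a x) * monom_fn nu (unscale a x))"
  unfolding unscale_def by (rule lebesgue_integral_affine[where f = "%x. theta mu x * monom_fn nu x"]) auto
 hence "(LI x. theta mu (unscale a x) * monom_fn nu (unscale a x)) / of_real (scl a^CARD('n)) = (LI x. theta mu x * monom_fn nu x)"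
  by (simp add: scaleR_conv_of_real power_divide)
 also have "... = (if mu = nu then 1 else 0)" using mu nu by (intro dual_moments) (auto simp: indices_def)
 finally show ?thesis .
qed

lemma moment_part_poly:
 assumes "poly_fn s P"
 and add: "!!f g. smooth f ==> smooth g ==> l (%x. f x + g x) = l f + l g" and cmult: "!!c f. smooth f ==> l (%x. c * f x) = c * l f"
 shows "moment_part a l P = l P"
proof -
 have sm: "smooth (%x. Q (unscale a x))" if "poly_fn s Q" for Q
  unfolding unscale_def by (intro smooth_affine smooth_poly_fn[OF that])
 have unscaled: "moment_part a l (%x. Q (unscale a x)) = l (%x. Q (unscale a x))" if "poly_fn s Q" for Q
  using that
 proof (induction rule: poly_fn.induct)
  case (monomial nu)
  have nu: "nu:indices" using monomial by (simp add: indices_def)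
  hence "moment_part a l (%x. monom_fn nu (unscale a x)) = (SUM mu:indices. l (%x. monom_fn mu (unscale a x)) * (if mu = nu then 1 else 0))"
   unfolding moment_part_def by (intro sum.cong refl arg_cong2[where f = "(*)"] dual_unscale_moments)
  also have "... = l (%x. monom_fn nu (unscale a x))" using nu finite_indices by (simp add: sum.delta if_distrib cong: if_cong)
  finally show ?case .
 next
  case (add f g)
  thus ?case
   using moment_part_add[OF smooth_continuous[OF sm[OF add.hyps(1)]] smooth_continuous[OF sm[OF add.hyps(2)]], of a l] assms(2)[OF sm[OF add.hyps(1)] sm[OF add.hyps(2)]]
   by simp
 next
  case (cmult f c)
  thus ?case using moment_part_cmult[of a l c "%x. f (unscale a x)"] assms(3)[OF sm[OF cmult.hyps(1)]] by simp
 qed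
 define Q where "Q w = P (ctr a + scl a *! w)" for w
 have "poly_fn s Q" unfolding Q_def by (rule poly_fn_affine[OF assms(1)])
 moreover have "(%x. Q (unscale a x)) = P" unfolding Q_def unscale_alt by auto
 ultimately show ?thesis using unscaled by metis
qed

lemma bad_part_zero:
 assumes "linear_on_tests u" shows "bad_part u a (%x. 0) psi = 0"
 using linear_on_tests_zero[OF assms] by (simp add: bad_part_def moment_part_def)

lemma bad_part_poly:
 assumes u: "linear_on_tests u" and xi: "test_fn xi" and P: "poly_fn s P"
 shows "bad_part u a xi P = 0"
proof -
 have "moment_part a (%f. u (%x. xi x * f x)) P = u (%x. xi x * P x)"
 proof (rule moment_part_poly[OF P])
  show "u (%x. xi x * (f x + g x)) = u (%x. xi x * f x) + u (%x. xi x * g x)" if "smooth f" "smooth g" for f g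
   using linear_on_tests_add[OF u test_fn_mult_right[OF xi that(1)] test_fn_mult_right[OF xi that(2)]] by (simp add: distrib_left)
  show "u (%x. xi x * (c * f x)) = c * u (%x. xi x * f x)" if "smooth f" for f c
   using linear_on_tests_cmult[OF u test_fn_mult_right[OF xi that(1)], of c] by (simp add: mult.left_commute)
 qed
 thus ?thesis by (simp add: bad_part_def)
qed

lemma bad_part_add:
 assumes u: "linear_on_tests u" and xi: "test_fn xi" and "smooth f" "smooth g"
 shows "bad_part u a xi (%x. f x + g x) = bad_part u a xi f + bad_part u a xi g"
 using linear_on_tests_add[OF u test_fn_mult_right[OF xi assms(3)] test_fn_mult_right[OF xi assms(4)]]
 moment_part_add[OF smooth_continuous[OF assms(3)] smooth_continuous[OF assms(4)]]
 by (simp add: bad_part_def distrib_left)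

lemma bad_part_cmult:
 assumes u: "linear_on_tests u" and xi: "test_fn xi" and "smooth f"
 shows "bad_part u a xi (%x. c * f x) = c * bad_part u a xi f"
 using linear_on_tests_cmult[OF u test_fn_mult_right[OF xi assms(3)], of c]
 by (simp add: bad_part_def moment_part_cmult mult.left_commute right_diff_distrib)

lemma bad_part_sum:
 assumes u: "linear_on_tests u" and xi: "!!i. i:S ==> test_fn (xi i)" and "smooth f"
 shows "bad_part u a (%x. SUM i:S. xi i x) f = (SUM i:S. bad_part u a (xi i) f)"
proof -
 have split: "u (%x. (SUM i:S. xi i x) * g x) = (SUM i:S. u (%x. xi i x * g x))" if "smooth g" for g
  unfolding sum_distrib_right by (rule linear_on_tests_sum[OF u]) (intro test_fn_mult_right xi that)
 have "moment_part a (%g. u (%x. (SUM i:S. xi i x) * g x)) f = moment_part a (%g. SUM i:S. u (%x. xi i x * g x)) f"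
  unfolding moment_part_def by (intro sum.cong refl arg_cong2[where f = "(*)"] split smooth_monom_unscale)
 thus ?thesis unfolding bad_part_def by (simp add: split[OF assms(3)] moment_part_sum sum_subtractf)
qed

lemma bad_part_cong:
 assumes "!!x. x:wball a ==> f x = g x" "!!x. x~:wball a ==> xi x = 0"
 shows "bad_part u a xi f = bad_part u a xi g"
proof -
 have "(%x. xi x * f x) = (%x. xi x * g x)" using assms by (metis mult_zero_left)
 moreover have "(%x. theta mu (unscale a x) * f x) = (%x. theta mu (unscale a x) * g x)" if "mu:indices" for mu
  using assms(1) dual_unscale_eq_0[OF that] by (metis mult_zero_left)
 ultimately show ?thesis by (simp add: bad_part_def moment_part_def)
qed

definition monom_const :: real where
 "monom_const = (SOME C. C > 0 & (ALL mu:indices. ALL a. pd_bound (Suc mm) C (scl a) (wball a) (%x. monom_fn mu (unscale a x))))"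

lemma monom_const_exists:
 "EX C>0. ALL mu:indices. ALL a. pd_bound (Suc mm) C (scl a) (wball a) (%x. monom_fn mu (unscale a x))"
proof -
 let ?B = "cball (0::real^'n) (2 * real CARD('n))" and ?D = "{ds::'n list. length ds <= Suc mm}"
 have "EX C>=0. ALL w:?B. cmod (pdl ds (monom_fn mu) w) <= C" for ds and mu :: "'n => nat"
 proof -
  have "compact (pdl ds (monom_fn mu) ` ?B)"
   by (intro compact_continuous_image continuous_on_subset[OF smooth_continuous[OF smooth_pdl[OF smooth_monom]]]) auto
  thus ?thesis using compact_imp_bounded bounded_pos by (metis imageI less_imp_le)
 qed
 then obtain C where C: "!!ds mu. C ds mu >= 0" "!!ds (mu::'n => nat) w. w:?B ==> cmod (pdl ds (monom_fn mu) w) <= C ds mu" by metis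
 define M where "M = 1+(\<Sum>(ds, mu)\<in>?D \<times> indices. C ds mu)"
 have finite: "finite (?D \<times> indices)" using finite_lists_length_le[of "UNIV::'n set"] finite_indices by simp
 have "pd_bound (Suc mm) M (scl a) (wball a) (%x. monom_fn mu (unscale a x))" if mu: "mu:indices" for mu a
  unfolding pd_bound_def
 proof (intro allI impI ballI)
  fix ds :: "'n list" and x assume ds: "length ds <= Suc mm" and x: "x:wball a"
  have "unscale a x:?B" using x by (simp add: norm_unscale wball_def rad_def pos_divide_le_eq)
  hence "cmod (pdl ds (monom_fn mu) (unscale a x)) <= C ds mu" by (rule C(2))
  also have "... <= M"
   unfolding M_def using member_le_sum[OF _ _ finite, of "(ds, mu)" "case_prod C"] ds mu C(1) by auto
  finally have "(1 / scl a)^length ds * cmod (pdl ds (monom_fn mu) (unscale a x)) <= (1 / scl a)^length ds * M" by (intro mult_left_mono) auto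
  thus "cmod (pdl ds (%x. monom_fn mu (unscale a x)) x) <= M / scl a^length ds"
   unfolding unscale_def pdl_affine[OF smooth_monom] by (simp add: norm_mult norm_power norm_divide power_divide)
 qed
 moreover have "M > 0" unfolding M_def using C(1) by (intro add_pos_nonneg sum_nonneg) auto
 ultimately show ?thesis by blast
qed

lemma monom_const_pos: "monom_const > 0"
 and monom_pd_bound: "mu:indices ==> pd_bound (Suc mm) monom_const (scl a) (wball a) (%x. monom_fn mu (unscale a x))"
 using someI_ex[OF monom_const_exists, folded monom_const_def] by blast+

definition moment_const :: real where
 "moment_const = real (card indices) * (bump_const*(2^Suc mm * monom_const)*dual_bound)"

lemma moment_const_nonneg: "moment_const >= 0"
 using bump_const_pos monom_const_pos dual_bound_pos by (simp add: moment_const_def)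

lemma moment_part_bound:
 assumes u: "controlled u V d" and a: "a:whitney d" and xi: "adapted B a xi" and psi: "continuous_on UNIV psi"
 shows "cmod (moment_part a (%f. u (%x. xi x * f x)) psi) <= moment_const*B*V*(LI x. idr (wball a) x * cmod (psi x))"
proof -
 let ?I = "(LI x. idr (wball a) x * cmod (psi x))" and ?C = "bump_const*(2^Suc mm * monom_const)*dual_bound"
 have "cmod (u (%x. xi x * monom_fn mu (unscale a x)) * ((LI x. theta mu (unscale a x) * psi x) / of_real (scl a^CARD('n)))) <= ?C*B*V*?I"
  if mu: "mu:indices" for mu
 proof -
  have "cmod (u (%x. xi x * monom_fn mu (unscale a x))) <= bump_const*(2^Suc mm * B*monom_const) * scl a^CARD('n) * V"
   using monom_const_pos by (intro controlled_adapted_bound[OF u a] adapted_mult[OF xi] smooth_monom_unscale monom_pd_bound mu) simp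
  moreover have "cmod ((LI x. theta mu (unscale a x) * psi x) / of_real (scl a^CARD('n))) <= dual_bound*?I / scl a^CARD('n)"
   using dual_unscale_integral(2)[OF mu psi, of a] by (simp add: norm_divide norm_power divide_right_mono)
  ultimately have "cmod (u (%x. xi x * monom_fn mu (unscale a x))) * cmod ((LI x. theta mu (unscale a x) * psi x) / of_real (scl a^CARD('n))) <= (bump_const*(2^Suc mm * B*monom_const) * scl a^CARD('n) * V)*(dual_bound*?I / scl a^CARD('n))"
   using bump_const_pos monom_const_pos adaptedD(4)[OF xi] controlledD(2)[OF u] by (intro mult_mono) auto
  also have "... = ?C*B*V*?I" by simp
  finally show ?thesis by (simp only: norm_mult)
 qed
 hence "cmod (moment_part a (%f. u (%x. xi x * f x)) psi) <= (SUM mu:indices. ?C*B*V*?I)"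
  unfolding moment_part_def by (rule sum_norm_le)
 thus ?thesis by (simp add: moment_const_def mult_ac)
qed

definition bad_const :: real where
 "bad_const = bump_const*2^Suc mm + moment_const*(unit_ball_vol (real CARD('n)) * (2 * real CARD('n))^CARD('n))"

lemma bad_const_nonneg: "bad_const >= 0"
 using bump_const_pos moment_const_nonneg by (simp add: bad_const_def)

lemma bad_part_bound:
 assumes u: "controlled u V d" and a: "a:whitney d" and xi: "adapted B a xi"
 and Q: "smooth Q" "pd_bound (Suc mm) E (scl a) (wball a) Q" and E: "E >= 0"
 shows "cmod (bad_part u a xi Q) <= bad_const*B*V*E * scl a^CARD('n)"
proof -
 let ?n = "real CARD('n)"
 have "(LI x. idr (wball a) x * cmod (Q x)) <= (LI x. E * idr (wball a) x)"
 proof (rule integral_mono)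
  show "integrable lbg (%x. E * idr (wball a) x)"
   unfolding wball_def by (intro integrable_mult_right integrable_indicator_cball)
  show "idr (wball a) x * cmod (Q x) <= E * idr (wball a) x" for x
   using pd_boundD[OF Q(2), of "[]" x] by (auto split: split_indicator)
 qed (intro integrable_wball_continuous smooth_continuous Q)
 also have "... = E*(unit_ball_vol ?n * (2*?n)^CARD('n) * scl a^CARD('n))"
  using content_cball[of "2 * rad a" "ctr a"] by (simp add: wball_def rad_def power_mult_distrib)
 finally have "moment_const*B*V*(LI x. idr (wball a) x * cmod (Q x)) <= moment_const*B*V*(E*(unit_ball_vol ?n * (2*?n)^CARD('n) * scl a^CARD('n)))"
  using moment_const_nonneg adaptedD(4)[OF xi] controlledD(2)[OF u] by (intro mult_left_mono) auto
 with moment_part_bound[OF u a xi smooth_continuous[OF Q(1)]] controlled_adapted_bound[OF u a adapted_mult[OF xi Q E]]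
 have "cmod (bad_part u a xi Q) <= bump_const*(2^Suc mm * B*E) * scl a^CARD('n) * V + moment_const*B*V*(E*(unit_ball_vol ?n * (2*?n)^CARD('n) * scl a^CARD('n)))"
  unfolding bad_part_def by (intro order_trans[OF norm_triangle_ineq4]) linarith
 thus ?thesis by (simp add: bad_const_def algebra_simps)
qed

definition far_const :: real where
 "far_const = bad_const*(2 * real CARD('n) * real CARD('n))^Suc mm"

lemma far_const_nonneg: "far_const >= 0"
 using bad_const_nonneg by (simp add: far_const_def)

lemma bad_part_taylor_bound:
 assumes u: "controlled u V d" and a: "a:whitney d" and xi: "adapted B a xi" and psi: "smooth psi"
 and D: "D >= 0" "!!ds z. length ds = Suc mm ==> z:wball a ==> cmod (pdl ds psi z) <= D"
 shows "cmod (bad_part u a xi psi) <= far_const*B*V*D * scl a^(CARD('n) + mm+1)"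
proof -
 define r where "r = real CARD('n) * (2 * rad a)"
 note linear = controlledD(1)[OF u] and test = adaptedD(5)[OF xi]
 obtain P where P: "poly_fn mm P" "pd_bound (Suc mm) (D*r^Suc mm) r (wball a) (%x. psi x - P x)"
  using taylor_remainder_bound[OF psi _ D(1), of "2 * rad a" mm "ctr a"] D(2) unfolding wball_def r_def by auto
 have P_poly: "poly_fn s P" by (rule poly_fn_mono[OF P(1) s_ge])
 have smooth: "smooth (%x. psi x - P x)" by (rule smooth_diff[OF psi smooth_poly_fn[OF P(1)]])
 have r: "r > 0" by (simp add: r_def)
 have "scl a <= 1*r"
  using scl_le_rad[of a] rad_pos[of a] mult_right_mono[OF CARD_ge_1[where 'n = 'n], of "2 * rad a"] unfolding r_def by linarith
 hence "pd_bound (Suc mm) (1^Suc mm * (D*r^Suc mm)) (scl a) (wball a) (%x. psi x - P x)"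
  using r D(1) by (intro pd_bound_rescale[OF P(2)]) auto
 hence "cmod (bad_part u a xi (%x. psi x - P x)) <= bad_const*B*V*(D*r^Suc mm) * scl a^CARD('n)"
  using r D(1) by (intro bad_part_bound[OF u a xi smooth]) auto
 moreover have "bad_part u a xi psi = bad_part u a xi (%x. psi x - P x)"
  using bad_part_add[OF linear test smooth smooth_poly_fn[OF P(1)], of a] bad_part_poly[OF linear test P_poly, of a] by simp
 ultimately show ?thesis by (simp add: far_const_def r_def rad_def power_mult_distrib power_add mult_ac)
qed

lemma bad_family_bound:
 assumes u: "controlled u V d" and t: "test_fn psi"
 shows "EX C>=0. EX R. ALL a xi B. a:whitney d --> adapted B a xi --> (wball a <= cball 0 R & cmod (bad_part u a xi psi) <= C*B * scl a^CARD('n)) | bad_part u a xi psi = 0"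
proof -
 obtain D R where D: "D >= 0" and cases: "ALL a:whitney d. wball a <= cball 0 R & pd_bound (Suc mm) D (scl a) (wball a) psi | (ALL x:wball a. psi x = 0)"
  using test_fn_pd_bound_whitney[OF controlledD(3)[OF u] t] by metis
 have "(wball a <= cball 0 R & cmod (bad_part u a xi psi) <= bad_const*V*D*B * scl a^CARD('n)) | bad_part u a xi psi = 0"
  if a: "a:whitney d" and xi: "adapted B a xi" for a xi B
  using cases[rule_format, OF a]
 proof
  assume "ALL x:wball a. psi x = 0"
  hence "bad_part u a xi psi = bad_part u a xi (%x. 0 * psi x)" using adaptedD(2)[OF xi] by (intro bad_part_cong) auto
  thus ?thesis using bad_part_cmult[OF controlledD(1)[OF u] adaptedD(5)[OF xi] test_fn_smooth[OF t], of a 0] by simp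
 next
  assume "wball a <= cball 0 R & pd_bound (Suc mm) D (scl a) (wball a) psi"
  thus ?thesis using bad_part_bound[OF u a xi test_fn_smooth[OF t] _ D] by (simp add: mult_ac)
 qed
 moreover have "bad_const*V*D >= 0" using bad_const_nonneg controlledD(2)[OF u] D by simp
 ultimately show ?thesis by blast
qed

lemma bad_series_summable:
 assumes u: "controlled u V d" and t: "test_fn psi" and xi: "!!a. a:whitney d ==> adapted B a (xi a)" and B: "B >= 0"
 shows "(%a. bad_part u a (xi a) psi) summable_on whitney d"
proof -
 obtain C R where C: "C >= 0" and bound: "ALL a xi B. a:whitney d --> adapted B a xi --> (wball a <= cball 0 R & cmod (bad_part u a xi psi) <= C*B * scl a^CARD('n)) | bad_part u a xi psi = 0"
  using bad_family_bound[OF u t] by blast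
 show ?thesis
  by (rule abs_summable_summable[OF whitney_series_abs_summable[OF controlledD(3)[OF u], where C = "C*B" and R = R]])
  (use bound[rule_format, OF _ xi] B C in auto)
qed

lemma bad_series_close:
 assumes u: "controlled u V d" and t: "test_fn psi" and xi: "!!a. a:whitney d ==> adapted B a (xi a)" and B: "B >= 0"
 and X: "X:sets lbg" "!!a. a:whitney d ==> xi a ~= (%x. 0) ==> wball a <= X"
 shows "cmod ((\<Sum>\<^sub>\<infinity>a\<in>whitney d. u (%x. xi a x * psi x))-(\<Sum>\<^sub>\<infinity>a\<in>whitney d. bad_part u a (xi a) psi)) <= moment_const*B * real (overlap TYPE('n)) * V*(LI x. idr X x * cmod (psi x))"
proof -
 let ?m = "%a. moment_part a (%f. u (%x. xi a x * f x)) psi" and ?g = "%x. idr X x * cmod (psi x)"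
 define c where "c = moment_const*B*V"
 have c: "c >= 0" using moment_const_nonneg B controlledD(2)[OF u] by (simp add: c_def)
 have integrable: "integrable lbg ?g"
  using integrable_mult_indicator[OF X(1) integrable_norm[OF test_fn_integrable[OF t]]] by simp
 have "(SUM a:F. norm (?m a)) <= c*(real (overlap TYPE('n)) * (LI x. ?g x))" if F: "finite F" "F <= whitney d" for F
 proof -
  let ?G = "{a:F. xi a ~= (%x. 0)}"
  have "(SUM a:F. norm (?m a)) = (SUM a:?G. norm (?m a))"
   by (rule sum.mono_neutral_right) (use F linear_on_tests_zero[OF controlledD(1)[OF u]] in "auto simp: moment_part_def")
  also have "... <= (SUM a:?G. c*(LI x. idr (wball a) x * ?g x))"
  proof (rule sum_mono)
   fix a assume a: "a:?G"
   hence a_whitney: "a:whitney d" using F by blast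
   have "(%x. idr (wball a) x * ?g x) = (%x. idr (wball a) x * cmod (psi x))"
    using X(2)[OF a_whitney] a by (auto simp: fun_eq_iff split: split_indicator)
   thus "norm (?m a) <= c*(LI x. idr (wball a) x * ?g x)"
    using moment_part_bound[OF u a_whitney xi[OF a_whitney] smooth_continuous[OF test_fn_smooth[OF t]]] by (simp add: c_def)
  qed
  also have "... <= c*(real (overlap TYPE('n)) * (LI x. ?g x))"
   unfolding sum_distrib_left[symmetric] using F
   by (intro mult_left_mono c sum_integral_whitney_le[OF controlledD(3)[OF u]] integrable wball_subset_cball_ctr) (auto simp: wball_def)
  finally show ?thesis .
 qed
 from abs_summable_bounded[of "whitney d" ?m, OF this]
 have m: "(%a. norm (?m a)) summable_on whitney d" "norm (infsum ?m (whitney d)) <= c*(real (overlap TYPE('n)) * (LI x. ?g x))" by blast+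
 have "(%a. u (%x. xi a x * psi x)) = (%a. bad_part u a (xi a) psi + ?m a)" by (simp add: bad_part_def)
 hence "(\<Sum>\<^sub>\<infinity>a\<in>whitney d. u (%x. xi a x * psi x)) = (\<Sum>\<^sub>\<infinity>a\<in>whitney d. bad_part u a (xi a) psi) + infsum ?m (whitney d)"
  using infsum_add[OF bad_series_summable[OF u t xi B] abs_summable_summable[OF m(1)]] by simp
 thus ?thesis using m(2) by (simp add: c_def mult_ac)
qed

definition good_const :: real where
 "good_const = remainder_const + moment_const*zeta_const * real (overlap TYPE('n))"

lemma good_part_bound:
 assumes u: "controlled u V d" and t: "test_fn psi"
 shows "cmod (u psi - (\<Sum>\<^sub>\<infinity>a\<in>whitney d. bad_part u a (zeta d a) psi)) <= good_const*V*(LI x. cmod (psi x))"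
proof -
 have "cmod ((\<Sum>\<^sub>\<infinity>a\<in>whitney d. u (%x. zeta d a x * psi x))-(\<Sum>\<^sub>\<infinity>a\<in>whitney d. bad_part u a (zeta d a) psi)) <= moment_const*zeta_const * real (overlap TYPE('n)) * V*(LI x. idr UNIV x * cmod (psi x))"
  by (rule bad_series_close[OF u t adapted_zeta[OF controlledD(3)[OF u]] less_imp_le[OF zeta_const_pos]]) auto
 with zeta_series_remainder[OF u t]
 have "cmod (u psi - (\<Sum>\<^sub>\<infinity>a\<in>whitney d. bad_part u a (zeta d a) psi)) <= remainder_const*V*(LI x. cmod (psi x)) + moment_const*zeta_const * real (overlap TYPE('n)) * V*(LI x. cmod (psi x))"
  using norm_triangle_le[OF add_mono] by fastforce
 thus ?thesis by (simp add: good_const_def algebra_simps)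
qed

text \<open>Passing from the level \<open>d\<close> to a higher one \<open>d'\<close>, the difference of the bad parts is a sum over the
balls of \<open>d\<close>, in which every term has vanishing moments.\<close>

definition product_const :: real where
 "product_const = 2^Suc mm * zeta_const*(6^Suc mm * zeta_const)"

definition level_const :: real where
 "level_const = remainder_const*zeta_const + moment_const*zeta_const + moment_const*product_const * real (overlap TYPE('n))"

lemma product_const_nonneg: "product_const >= 0"
 using zeta_const_pos by (simp add: product_const_def)

lemma level_const_nonneg: "level_const >= 0"
 using zeta_const_pos product_const_nonneg moment_const_nonneg remainder_const_nonneg by (simp add: level_const_def)

context
 fixes u :: "'n fn => complex" and V V' :: real and d d' :: "real^'n => real"
 assumes u: "controlled u V d" and u': "controlled u V' d'" and d'_le: "!!x. d' x <= d x" and V_le: "V <= V'"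
begin

lemmas lip = controlledD(3)[OF u] and lip' = controlledD(3)[OF u'] and linear = controlledD(1)[OF u]
 and V'_nonneg = controlledD(2)[OF u']

definition zeta_prod :: "'n dyadic => 'n dyadic => 'n fn" where
 "zeta_prod b a x = zeta d' b x * zeta d a x"

definition transition :: "'n dyadic => 'n fn => complex" where
 "transition a psi = bad_part u a (zeta d a) psi - (\<Sum>\<^sub>\<infinity>b\<in>whitney d'. bad_part u b (zeta_prod b a) psi)"

lemma zeta_prod_eq_0: "x~:wball b ==> zeta_prod b a x = 0"
 by (simp add: zeta_prod_def zeta_eq_0)

lemma zeta_prod_disjoint: "wball a Int wball b = {} ==> zeta_prod b a = (%x. 0)"
 using zeta_eq_0[of _ a d] zeta_eq_0[of _ b d'] by (auto simp: zeta_prod_def fun_eq_iff disjoint_iff)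

lemma zeta_prod_test_fn: "test_fn (zeta_prod b a)"
 unfolding zeta_prod_def[abs_def] by (intro test_fn_mult_right zeta_test_fn zeta_smooth)

lemma zeta_prod_adapted:
 assumes "a:whitney d" "b:whitney d'" shows "adapted product_const b (zeta_prod b a)"
proof (cases "wball a Int wball b = {}")
 case True
 thus ?thesis
  using product_const_nonneg by (simp add: adapted_def zeta_prod_disjoint smooth_const pd_bound_def pdl_const)
next
 case False
 have "scl b <= 6 * scl a" by (rule touching_wballs(1)[OF lip lip' d'_le assms False])
 hence "pd_bound (Suc mm) (6^Suc mm * zeta_const) (scl b) UNIV (zeta d a)"
  using zeta_const_pos by (intro pd_bound_rescale[OF adaptedD(3)[OF adapted_zeta[OF lip]]]) auto
 hence "pd_bound (Suc mm) (6^Suc mm * zeta_const) (scl b) (wball b) (zeta d a)" by (auto simp: pd_bound_def)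
 thus ?thesis
  unfolding product_const_def zeta_prod_def[abs_def] using zeta_const_pos by (intro adapted_mult adapted_zeta lip' zeta_smooth) auto
qed

lemma zeta_prod_ball:
 assumes "a:whitney d" "b:whitney d'" "zeta_prod b a ~= (%x. 0)" shows "wball b <= cball (ctr a) (26 * rad a)"
 using touching_wballs(3)[OF lip lip' d'_le assms(1,2)] zeta_prod_disjoint[of a b] assms(3) by blast

lemma transition_summable:
 "a:whitney d ==> test_fn psi ==> (%b. bad_part u b (zeta_prod b a) psi) summable_on whitney d'"
 by (rule bad_series_summable[OF u' _ zeta_prod_adapted product_const_nonneg])

lemma transition_bound:
 assumes a: "a:whitney d" and t: "test_fn psi"
 shows "cmod (transition a psi) <= level_const*V'*(LI x. idr (cball (ctr a) (26 * rad a)) x * cmod (psi x))"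
proof -
 let ?X = "cball (ctr a) (26 * rad a)"
 let ?I = "(LI x. idr ?X x * cmod (psi x))" and ?ps = "%x. zeta d a x * psi x"
 let ?S = "\<Sum>\<^sub>\<infinity>b\<in>whitney d'. u (%x. zeta_prod b a x * psi x)" and ?T = "\<Sum>\<^sub>\<infinity>b\<in>whitney d'. bad_part u b (zeta_prod b a) psi"
 have test: "test_fn ?ps" by (rule test_fn_mult_right[OF zeta_test_fn test_fn_smooth[OF t]])
 have integrable: "integrable lbg (%x. idr X x * cmod (psi x))" if "X:sets lbg" for X
  using integrable_mult_indicator[OF that integrable_norm[OF test_fn_integrable[OF t]]] by simp
 have sub: "wball a <= ?X" by (rule wball_subset_cball_ctr) simp
 have "idr (wball a) x * cmod (psi x) <= idr ?X x * cmod (psi x)" for x using sub by (auto split: split_indicator)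
 hence wball_le: "(LI x. idr (wball a) x * cmod (psi x)) <= ?I"
  by (intro integral_mono[OF integrable integrable]) (auto simp: wball_def)
 have "(LI x. cmod (?ps x)) <= (LI x. zeta_const*(idr ?X x * cmod (psi x)))"
 proof (rule integral_mono)
  show "cmod (?ps x) <= zeta_const*(idr ?X x * cmod (psi x))" for x
   using pd_boundD[OF adaptedD(3)[OF adapted_zeta[OF lip, of a]], of "[]" x] zeta_eq_0[of x a d] sub
   by (cases "x:wball a") (auto simp: norm_mult intro: mult_right_mono split: split_indicator)
 qed (auto intro!: integrable_norm test_fn_integrable test integrable)
 hence "remainder_const*V'*(LI x. cmod (?ps x)) <= remainder_const*V'*(zeta_const*?I)"
  using remainder_const_nonneg V'_nonneg by (intro mult_left_mono) auto
 with zeta_series_remainder[OF u' test]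
 have remainder: "cmod (u ?ps - ?S) <= remainder_const*zeta_const*V'*?I" by (simp add: zeta_prod_def mult_ac)
 have "moment_const*zeta_const*V*(LI x. idr (wball a) x * cmod (psi x)) <= moment_const*zeta_const*V'*?I"
  using moment_const_nonneg zeta_const_pos V_le V'_nonneg wball_le by (intro mult_mono wball_le mult_left_mono) auto
 with moment_part_bound[OF u a adapted_zeta[OF lip] smooth_continuous[OF test_fn_smooth[OF t]]]
 have moments: "cmod (moment_part a (%f. u (%x. zeta d a x * f x)) psi) <= moment_const*zeta_const*V'*?I" by (rule order_trans)
 have products: "cmod (?S-?T) <= moment_const*product_const * real (overlap TYPE('n)) * V'*?I"
  by (rule bad_series_close[OF u' t zeta_prod_adapted[OF a] product_const_nonneg _ zeta_prod_ball[OF a]]) auto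
 have "transition a psi = (u ?ps - ?S) - moment_part a (%f. u (%x. zeta d a x * f x)) psi + (?S-?T)"
  by (simp add: transition_def bad_part_def)
 hence "cmod (transition a psi) <= remainder_const*zeta_const*V'*?I + moment_const*zeta_const*V'*?I + moment_const*product_const * real (overlap TYPE('n)) * V'*?I"
  using remainder moments products by (metis (no_types, lifting) add_mono norm_triangle_le norm_triangle_le_diff)
 thus ?thesis by (simp add: level_const_def algebra_simps)
qed

lemma transition_poly:
 assumes a: "a:whitney d" and P: "poly_fn s P" and eq: "!!x. x:cball (ctr a) (26 * rad a) ==> psi x = P x"
 shows "transition a psi = 0"
proof -
 have "wball a <= cball (ctr a) (26 * rad a)" by (rule wball_subset_cball_ctr) simp
 hence "bad_part u a (zeta d a) psi = bad_part u a (zeta d a) P" by (intro bad_part_cong eq zeta_eq_0) blast+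
 moreover have "bad_part u b (zeta_prod b a) psi = 0" if b: "b:whitney d'" for b
 proof (cases "zeta_prod b a = (%x. 0)")
  case True
  thus ?thesis using bad_part_zero[OF linear] by simp
 next
  case False
  hence "bad_part u b (zeta_prod b a) psi = bad_part u b (zeta_prod b a) P"
   using zeta_prod_ball[OF a b] by (intro bad_part_cong eq zeta_prod_eq_0) auto
  thus ?thesis using bad_part_poly[OF linear zeta_prod_test_fn P] by simp
 qed
 ultimately show ?thesis using bad_part_poly[OF linear zeta_test_fn P] by (simp add: transition_def cong: infsum_cong)
qed

lemma transition_represented:
 assumes a: "a:whitney d"
 shows "EX h. h:bml & (ALL x. cmod (h x) <= level_const*V') & (ALL x. x~:cball (ctr a) (26 * rad a) --> h x = 0) & (ALL psi. test_fn psi --> (LI x. h x * psi x) = transition a psi) & (ALL P. poly_fn s P --> (LI x. h x * P x) = 0)"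
proof -
 let ?X = "cball (ctr a) (26 * rad a)"
 interpret bounded_test_functional "transition a" "level_const*V'" "26 * rad a" "ctr a"
 proof
  show "linear_on_tests (transition a)"
   unfolding linear_on_tests_def
  proof (intro conjI allI impI)
   fix f g :: "'n fn" assume t: "test_fn f" "test_fn g"
   show "transition a (%x. f x + g x) = transition a f + transition a g"
    using infsum_add[OF transition_summable[OF a t(1)] transition_summable[OF a t(2)]] t
    by (simp add: transition_def bad_part_add[OF linear zeta_test_fn] bad_part_add[OF linear zeta_prod_test_fn] test_fn_smooth)
  next
   fix c and f :: "'n fn" assume "test_fn f"
   thus "transition a (%x. c * f x) = c * transition a f"
    by (simp add: transition_def bad_part_cmult[OF linear zeta_test_fn] bad_part_cmult[OF linear zeta_prod_test_fn] test_fn_smooth infsum_cmult_right' right_diff_distrib)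
  qed
 qed (use transition_bound[OF a] level_const_nonneg V'_nonneg in auto)
 obtain h where h: "h:bml" "!!x. cmod (h x) <= level_const*V'" "!!x. x~:?X ==> h x = 0"
  "!!psi. test_fn psi ==> (LI x. h x * psi x) = transition a psi"
  using representation by auto
 have "(LI x. h x * P x) = 0" if P: "poly_fn s P" for P
 proof -
  define R where "R = norm (ctr a) + 26 * rad a"
  have R: "R > 0" by (simp add: R_def add_nonneg_pos)
  have eq_1: "dilated_cutoff R x = 1" if "x:?X" for x
   using that norm_triangle_sub[of x "ctr a"] by (intro dilated_cutoff_eq_1[OF R]) (simp add: R_def dist_norm norm_minus_commute)
  have t: "test_fn (%x. P x * dilated_cutoff R x)" by (rule test_fn_mult_left[OF smooth_poly_fn[OF P] dilated_cutoff_test_fn[OF R]])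
  have "(LI x. h x * P x) = (LI x. h x * (P x * dilated_cutoff R x))"
   by (rule Bochner_Integration.integral_cong) (use h(3) eq_1 in "metis mult_zero_left mult.right_neutral")+
  also have "... = 0" using transition_poly[OF a P] eq_1 h(4)[OF t] by simp
  finally show ?thesis .
 qed
 thus ?thesis using h by blast
qed

definition meeting :: "'n dyadic => 'n dyadic set" where
 "meeting b = {a:whitney d. wball a Int wball b ~= {}}"

lemma
 assumes b: "b:whitney d'"
 shows finite_meeting: "finite (meeting b)" and card_meeting: "card (meeting b) <= overlap TYPE('n)"
proof -
 have sub: "meeting b <= near d (ctr b)"
  using touching_wballs(2)[OF lip lip' d'_le _ b] by (auto simp: meeting_def intro!: nearI)
 show "finite (meeting b)" by (rule finite_subset[OF sub finite_near[OF lip]])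
 show "card (meeting b) <= overlap TYPE('n)" by (rule order_trans[OF card_mono[OF finite_near[OF lip] sub] card_near[OF lip]])
qed

lemma sum_zeta_prod:
 assumes b: "b:whitney d'" shows "(%x. SUM a:meeting b. zeta_prod b a x) = zeta d' b"
proof
 fix x
 show "(SUM a:meeting b. zeta_prod b a x) = zeta d' b x"
 proof (cases "x:wball b")
  case True
  hence "dist x (ctr b) <= 50 * rad b" using wball_subset_cball_ctr[of 50 b] by (auto simp: dist_commute)
  hence "d x > 0" using whitney_pos[OF lip' b] d'_le[of x] by fastforce
  hence "(SUM a:meeting b. zeta d a x) = 1"
   using True by (intro sum_zeta[OF lip _ finite_meeting[OF b]]) (auto simp: meeting_def)
  thus ?thesis by (simp add: zeta_prod_def sum_distrib_left[symmetric])
 qed (simp add: zeta_prod_def zeta_eq_0)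
qed

lemma bad_part_zeta_prod_eq_0: "a:whitney d ==> a~:meeting b ==> bad_part u b (zeta_prod b a) psi = 0"
 using zeta_prod_disjoint[of a b] bad_part_zero[OF linear] by (auto simp: meeting_def)

lemma infsum_bad_part_zeta_prod:
 assumes t: "test_fn psi" and b: "b:whitney d'"
 shows "(\<Sum>\<^sub>\<infinity>a\<in>whitney d. bad_part u b (zeta_prod b a) psi) = bad_part u b (zeta d' b) psi"
proof -
 have "(\<Sum>\<^sub>\<infinity>a\<in>whitney d. bad_part u b (zeta_prod b a) psi) = (\<Sum>\<^sub>\<infinity>a\<in>meeting b. bad_part u b (zeta_prod b a) psi)"
  by (rule infsum_cong_neutral) (use bad_part_zeta_prod_eq_0 in "auto simp: meeting_def")
 also have "... = bad_part u b (%x. SUM a:meeting b. zeta_prod b a x) psi"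
  unfolding infsum_finite[OF finite_meeting[OF b]] by (rule bad_part_sum[symmetric, OF linear zeta_prod_test_fn test_fn_smooth[OF t]])
 finally show ?thesis by (simp add: sum_zeta_prod[OF b])
qed

lemma zeta_prod_series_summable:
 assumes t: "test_fn psi"
 shows "(%(a, b). bad_part u b (zeta_prod b a) psi) summable_on (whitney d \<times> whitney d')"
proof -
 let ?X = "%b a. bad_part u b (zeta_prod b a) psi"
 obtain C R where C: "C >= 0" and bound: "ALL b xi B. b:whitney d' --> adapted B b xi --> (wball b <= cball 0 R & cmod (bad_part u b xi psi) <= C*B * scl b^CARD('n)) | bad_part u b xi psi = 0"
  using bad_family_bound[OF u' t] by blast
 define f where "f b = (SUM a:meeting b. norm (?X b a))" for b
 have "(wball b <= cball 0 R & norm (f b) <= real (overlap TYPE('n)) * (C*product_const) * scl b^CARD('n)) | f b = 0" if b: "b:whitney d'" for b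
 proof (cases "wball b <= cball 0 R")
  case True
  have "cmod (?X b a) <= C*product_const * scl b^CARD('n)" if "a:meeting b" for a
   using bound[rule_format, OF b zeta_prod_adapted[OF _ b], of a] that C product_const_nonneg by (auto simp: meeting_def)
  hence "f b <= real (card (meeting b)) * (C*product_const * scl b^CARD('n))"
   unfolding f_def using sum_bounded_above by metis
  also have "... <= real (overlap TYPE('n)) * (C*product_const * scl b^CARD('n))"
   using card_meeting[OF b] C product_const_nonneg by (intro mult_right_mono) auto
  finally show ?thesis using True by (simp add: f_def mult.assoc sum_nonneg)
 next
  case False
  thus ?thesis using bound[rule_format, OF b zeta_prod_adapted[OF _ b]] by (auto simp: f_def meeting_def)
 qed
 hence outer: "(%b. norm (f b)) summable_on whitney d'"
  using C product_const_nonneg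
  by (intro whitney_series_abs_summable[OF lip', where C = "real (overlap TYPE('n)) * (C*product_const)"]) auto
 have inner: "((%a. norm (?X b a)) has_sum f b) (whitney d)" if "b:whitney d'" for b
  unfolding f_def
  by (rule has_sum_cong_neutral[THEN iffD1, OF _ _ _ has_sum_finite[OF finite_meeting[OF that]]])
  (use bad_part_zeta_prod_eq_0 in "auto simp: meeting_def")
 have "(%b. norm (infsum (%a. norm (?X b a)) (whitney d))) summable_on whitney d'"
  by (rule summable_on_cong[THEN iffD2, OF _ outer]) (simp add: infsumI[OF inner])
 hence "(%p. norm (case p of (b, a) => ?X b a)) summable_on (whitney d' \<times> whitney d)"
  unfolding Infinite_Sum.abs_summable_on_Sigma_iff using has_sum_imp_summable[OF inner] by auto
 thus ?thesis using summable_on_swap[of "%(a, b). ?X b a"] abs_summable_summable by simp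
qed

lemma infsum_transition:
 assumes t: "test_fn psi"
 shows "(\<Sum>\<^sub>\<infinity>a\<in>whitney d. transition a psi) = (\<Sum>\<^sub>\<infinity>a\<in>whitney d. bad_part u a (zeta d a) psi)-(\<Sum>\<^sub>\<infinity>b\<in>whitney d'. bad_part u b (zeta d' b) psi)"
proof -
 let ?X = "%b a. bad_part u b (zeta_prod b a) psi"
 note summable = zeta_prod_series_summable[OF t]
 have "(%a. - (\<Sum>\<^sub>\<infinity>b\<in>whitney d'. ?X b a)) summable_on whitney d"
  unfolding summable_on_uminus using summable_on_Sigma_banach[OF summable] by simp
 from infsum_add[OF bad_series_summable[OF u t adapted_zeta[OF lip] less_imp_le[OF zeta_const_pos]] this]
 have "(\<Sum>\<^sub>\<infinity>a\<in>whitney d. transition a psi) = (\<Sum>\<^sub>\<infinity>a\<in>whitney d. bad_part u a (zeta d a) psi)-(\<Sum>\<^sub>\<infinity>a\<in>whitney d. \<Sum>\<^sub>\<infinity>b\<in>whitney d'. ?X b a)"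
  by (simp add: transition_def infsum_uminus)
 also have "(\<Sum>\<^sub>\<infinity>a\<in>whitney d. \<Sum>\<^sub>\<infinity>b\<in>whitney d'. ?X b a) = (\<Sum>\<^sub>\<infinity>b\<in>whitney d'. bad_part u b (zeta d' b) psi)"
  using infsum_swap_banach[OF summable] infsum_bad_part_zeta_prod[OF t] by (simp cong: infsum_cong)
 finally show ?thesis .
qed

end

end

subsection \<open>The grand maximal function\<close>

lemma schwartz_seminorm_upper:
 fixes psi :: "'n::finite fn"
 assumes s: "schwartz psi" and ds: "length ds <= N"
 shows "(1 + norm x)^N * cmod (pdl ds psi x) <= schwartz_seminorm N psi"
proof -
 have "ALL ds. EX C. ALL x. (1 + norm x)^N * cmod (pdl ds psi x) <= C" using s unfolding schwartz_def by blast
 from choice[OF this] obtain C where C: "!!ds x. (1 + norm x)^N * cmod (pdl ds psi x) <= C ds" by blast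
 have nonneg: "C ds >= 0" for ds by (rule order_trans[OF _ C[of 0 ds]]) simp
 have "(1 + norm y)^N * cmod (pdl es psi y) <= (SUM ds:{ds. length ds <= N}. C ds)" if "length es <= N" for y es
  using that nonneg finite_lists_length_le[of "UNIV::'n set" N]
  by (intro order_trans[OF C[of y es] member_le_sum[of es "{ds. length ds <= N}" C]]) auto
 hence "bdd_above {(1 + norm x)^N * cmod (pdl ds psi x) | x ds. length ds <= N}" by (intro bdd_aboveI) auto
 thus ?thesis unfolding schwartz_seminorm_def by (intro cSup_upper) (use ds in auto)
qed

lemma schwartz_seminorm_le:
 fixes psi :: "'n::finite fn"
 assumes "!!ds x. length ds <= N ==> (1 + norm x)^N * cmod (pdl ds psi x) <= B"
 shows "schwartz_seminorm N psi <= B"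
 unfolding schwartz_seminorm_def by (rule cSup_least) (use assms in \<open>auto intro: exI[of _ "[]"]\<close>)

lemma schwartz_seminorm_nonneg: "schwartz psi ==> schwartz_seminorm N psi >= 0"
 by (rule order_trans[OF _ schwartz_seminorm_upper[of psi "[]" N 0]]) auto

lemma schwartz_seminorm_mono:
 fixes psi :: "'n::finite fn"
 assumes "schwartz psi" "N <= M" shows "schwartz_seminorm N psi <= schwartz_seminorm M psi"
proof (rule schwartz_seminorm_le)
 fix ds :: "'n list" and x assume "length ds <= N"
 hence "(1 + norm x)^M * cmod (pdl ds psi x) <= schwartz_seminorm M psi" using assms by (intro schwartz_seminorm_upper) auto
 moreover have "(1 + norm x)^N * cmod (pdl ds psi x) <= (1 + norm x)^M * cmod (pdl ds psi x)"
  using assms(2) by (intro mult_right_mono power_increasing) auto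
 ultimately show "(1 + norm x)^N * cmod (pdl ds psi x) <= schwartz_seminorm M psi" by linarith
qed

lemma schwartz_lincomb:
 assumes "schwartz f" "schwartz g" shows "schwartz (%x. a * f x + b * g x)"
 unfolding schwartz_iff
proof (intro conjI allI)
 have smooth: "smooth f" "smooth g" using assms by (auto simp: schwartz_iff)
 thus "smooth (%x. a * f x + b * g x)" by (intro smooth_add smooth_cmult)
 fix ds N
 obtain A B where A: "!!x. (1 + norm x)^N * cmod (pdl ds f x) <= A" and B: "!!x. (1 + norm x)^N * cmod (pdl ds g x) <= B"
  using assms unfolding schwartz_iff by metis
 have "(1 + norm x)^N * cmod (pdl ds (%x. a * f x + b * g x) x) <= cmod a * A + cmod b * B" for x
 proof -
  have "cmod (pdl ds (%x. a * f x + b * g x) x) <= cmod a * cmod (pdl ds f x) + cmod b * cmod (pdl ds g x)"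
   unfolding pdl_add[OF smooth(1)[THEN smooth_cmult] smooth(2)[THEN smooth_cmult]] pdl_cmult[OF smooth(1)] pdl_cmult[OF smooth(2)] norm_mult[symmetric] by (rule norm_triangle_ineq)
  from mult_left_mono[OF this, of "(1 + norm x)^N"] show ?thesis
   using mult_left_mono[OF A[of x], of "cmod a"] mult_left_mono[OF B[of x], of "cmod b"] by (simp add: algebra_simps)
 qed
 thus "EX C. ALL x. (1 + norm x)^N * cmod (pdl ds (%x. a * f x + b * g x) x) <= C" by blast
qed

lemma tempered_lincomb:
 assumes "tempered u" "tempered v" shows "tempered (%psi. a * u psi + b * v psi)"
proof -
 obtain C N where C: "!!psi. schwartz psi ==> cmod (u psi) <= C * schwartz_seminorm N psi" using assms(1) unfolding tempered_def by blast
 obtain D M where D: "!!psi. schwartz psi ==> cmod (v psi) <= D * schwartz_seminorm M psi" using assms(2) unfolding tempered_def by blast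
 have "cmod (a * u psi + b * v psi) <= (cmod a * abs C + cmod b * abs D) * schwartz_seminorm (max N M) psi" if s: "schwartz psi" for psi
 proof -
  let ?q = "schwartz_seminorm (max N M) psi"
  have "cmod (u psi) <= abs C * ?q" "cmod (v psi) <= abs D * ?q"
   using C[OF s] D[OF s] schwartz_seminorm_mono[OF s, of N "max N M"] schwartz_seminorm_mono[OF s, of M "max N M"]
   schwartz_seminorm_nonneg[OF s, of N] schwartz_seminorm_nonneg[OF s, of M]
   by (meson abs_ge_self abs_ge_zero max.cobounded1 max.cobounded2 mult_mono order_trans)+
  hence "cmod a * cmod (u psi) + cmod b * cmod (v psi) <= cmod a * (abs C * ?q) + cmod b * (abs D * ?q)"
   by (intro add_mono mult_left_mono) auto
  thus ?thesis by (intro norm_triangle_le) (simp add: norm_mult algebra_simps)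
 qed
 hence "EX C N. ALL psi. schwartz psi --> cmod (a * u psi + b * v psi) <= C * schwartz_seminorm N psi" by blast
 thus ?thesis using assms unfolding tempered_def by (simp add: algebra_simps)
qed

lemma grand_max_leI:
 assumes "!!psi t y. psi:S_m (m_phi phi) ==> t > 0 ==> dist y x < t ==> en (cmod (u (dilate psi t y))) <= M"
 shows "grand_max phi u x <= M"
 unfolding grand_max_def by (rule Sup_least) (use assms in "auto simp: dilate_def")

lemma grand_max_open: "open {x. a < grand_max phi (u::'n::finite fn => complex) x}"
proof (subst open_subopen, intro ballI)
 have mem_iff: "a < grand_max phi u x \<longleftrightarrow> (EX psi t y. psi:S_m (m_phi phi) & t > 0 & dist y x < t & a < en (cmod (u (dilate psi t y))))" for x
  unfolding grand_max_def less_Sup_iff dilate_def by blast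
 fix x assume "x:{x. a < grand_max phi u x}"
 then obtain psi t y where "psi:S_m (m_phi phi)" "t > 0" "x:ball y t" "a < en (cmod (u (dilate psi t y)))" using mem_iff by auto
 moreover from this have "ball y t <= {x. a < grand_max phi u x}" using mem_iff by fastforce
 ultimately show "EX T. open T & x:T & T <= {x. a < grand_max phi u x}" by blast
qed

lemma grand_max_measurable [measurable]: "grand_max phi (u::'n::finite fn => complex):bml"
proof (rule borel_measurableI_greater)
 fix a :: ennreal
 have "{x. a < grand_max phi u x}:sets lbg" using grand_max_open[of a phi u] by simp
 thus "{x:space lbg. a < grand_max phi u x}:sets lbg" by simp
qed

lemma grand_max_lincomb:
 fixes u v :: "'n::finite fn => complex"
 shows "grand_max phi (%psi. a * u psi + b * v psi) x <= en (cmod a) * grand_max phi u x + en (cmod b) * grand_max phi v x"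
proof (rule grand_max_leI)
 fix psi :: "'n fn" and t y assume "psi:S_m (m_phi phi)" "t > 0" "dist y x < t"
 note upper = grand_max_upper[OF this]
 let ?ps = "dilate psi t y"
 have "en (cmod (a * u ?ps + b * v ?ps)) <= en (cmod a * cmod (u ?ps) + cmod b * cmod (v ?ps))"
  by (intro ennreal_leI norm_triangle_le) (simp add: norm_mult)
 also have "... = en (cmod a) * en (cmod (u ?ps)) + en (cmod b) * en (cmod (v ?ps))" by (simp add: ennreal_mult)
 also have "... <= en (cmod a) * grand_max phi u x + en (cmod b) * grand_max phi v x"
  by (intro add_mono mult_left_mono upper) auto
 finally show "en (cmod (a * u ?ps + b * v ?ps)) <= en (cmod a) * grand_max phi u x + en (cmod b) * grand_max phi v x" .
qed

subsection \<open>Modulars\<close>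

lemma divide_ennreal_eq_mult: "lam > 0 ==> v / en lam = en (1/lam) * v"
 by (simp add: divide_ennreal_def inverse_ennreal divide_inverse mult.commute)

lemma divide_ennreal_1 [simp]: "v / en 1 = v"
 using divide_ennreal_eq_mult[of 1 v] by simp

lemma dyadic_sum_le: "dyadic_sum (%k. en (2 powi k)) v <= 2 * v"
proof (cases "v = 0 | v = top")
 case True
 thus ?thesis by (auto simp: ennreal_mult_top)
next
 case False
 then obtain w where w: "v = en w" "w > 0" by (cases v) (auto simp: ennreal_eq_0_iff not_le)
 obtain M :: int where M: "2 powi M <= w" "w < 2*2 powi M" using dyadic_level_exists[OF w(2)] by blast
 have "en (2 powi k) = en (2 powi M) * en ((1/2)^nat (M-k))" "k <= M" if "(2::real) powi k < w" for k
 proof -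
  show k: "k <= M"
  proof (rule ccontr)
   assume "~k <= M"
   hence "(2::real) powi (M+1) <= 2 powi k" by (intro power_int_increasing) auto
   thus False using that M(2) by (simp add: power_int_add)
  qed
  hence "(2::real) powi M = 2 powi k*2^nat (M-k)" by (simp add: power_int_add[symmetric] power_int_of_nat[symmetric] del: power_int_of_nat)
  thus "en (2 powi k) = en (2 powi M) * en ((1/2)^nat (M-k))" by (simp add: ennreal_mult[symmetric] power_divide)
 qed
 hence "dyadic_sum (%k. en (2 powi k)) v <= (\<integral>\<^sup>+k. en (2 powi M) * (en ((1/2)^nat (M-k)) * idr {..M} k) \<partial>count_space UNIV)"
  using w by (intro nn_integral_mono) (auto simp: ennreal_less_iff split: split_indicator)
 also have "... = en (2 powi M) * en 2"
  using nn_integral_geometric_int[of "1/2" M] by (simp add: nn_integral_cmult)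
 also have "... = en (2 powi M*2)" by (rule ennreal_mult[symmetric]) auto
 also have "... <= en (2*w)" using M(1) by (intro ennreal_leI) simp
 finally show ?thesis using w by (simp add: ennreal_mult)
qed

definition bounded_atom :: "nat => 'n::finite fn => real^'n => real => real => bool" where
 "bounded_atom k h c r A \<longleftrightarrow> h:bml & (ALL x. cmod (h x) <= A) & (ALL x. x~:ball c r --> h x = 0) & (ALL P. poly_fn k P --> (LI x. h x * P x) = 0)"

lemma bounded_atomD:
 assumes "bounded_atom k h c r A"
 shows "h:bml" "cmod (h x) <= A" "x~:ball c r ==> h x = 0" "poly_fn k P ==> (LI x. h x * P x) = 0" "A >= 0"
 using assms order_trans[OF norm_ge_zero] by (auto simp: bounded_atom_def)

lemma bounded_atom_mono: "bounded_atom k h c r A ==> l <= k ==> bounded_atom l h c r A"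
 unfolding bounded_atom_def using poly_fn_mono by blast

lemma bounded_atom_bsupp: assumes "bounded_atom k h c r A" shows "bsupp h"
proof -
 have "norm x <= norm c + r" if "x:ball c r" for x using that norm_triangle_sub[of x c] by (simp add: dist_norm norm_minus_commute)
 thus ?thesis using bounded_atomD(1-3)[OF assms] unfolding bsupp_def by (intro conjI exI[of _ A] exI[of _ "norm c + r"]) auto
qed

context growth begin

lemma Phi_scale: assumes "c >= 0" shows "Phi x (en c * v) <= en (L * max 1 c) * Phi x v"
proof -
 have "Phi x (en c * v) <= Phi x (en (max 1 c) * v)" by (intro Phi_mono mult_right_mono ennreal_leI) auto
 also have "... <= en (L * max 1 c) * Phi x v" by (rule Phi_scale_up) simp
 finally show ?thesis .
qed

lemma Phi_modular_scale:
 assumes [measurable]: "g:bml" and "c >= 0"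
 shows "modular (%x. en c * g x) <= en (L * max 1 c) * modular g"
 by (subst nn_integral_cmult[symmetric]) (auto intro!: nn_integral_mono Phi_scale assms)

lemma modular_E_le_1:
 assumes "B >= 0"
 shows "EX M>=1. ALL g lam. g:bml --> lam > 0 --> modular (%x. g x / en lam) <= en B --> modular_E phi g (M*lam) <= 1"
proof -
 define b where "b = 2*K*L*B"
 define M where "M = (1+b) powr (1/p)"
 have b: "b >= 0" using K_ge_1 L_ge_1 assms by (simp add: b_def)
 have M: "M >= 1" "M powr p = 1+b" unfolding M_def using p_pos b by (auto intro: ge_one_powr_ge_zero simp: powr_powr)
 have "modular_E phi g (M*lam) <= 1"
  if g [measurable]: "g:bml" and lam: "lam > 0" and bound: "modular (%x. g x / en lam) <= en B" for g lam
 proof -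
  have "phi_ext phi x (g x / en (M*lam)) <= en (2*K) * (en (L*(1/M) powr p) * Phi x (g x / en lam))" for x
  proof -
   have "g x / en (M*lam) = en (1/M) * (g x / en lam)"
    using M lam by (simp add: divide_ennreal_eq_mult ennreal_mult[symmetric] mult.assoc[symmetric])
   thus ?thesis
    using phi_ext_le_Phi[of x "g x / en (M*lam)"] M
    by (auto intro!: order_trans[OF phi_ext_le_Phi] mult_left_mono Phi_scale_down)
  qed
  hence "modular_E phi g (M*lam) <= (NN x. en (2*K) * (en (L*(1/M) powr p) * Phi x (g x / en lam)))"
   unfolding modular_E_def by (rule nn_integral_mono)
  also have "... <= en (2*K) * (en (L*(1/M) powr p) * en B)"
   by (simp add: nn_integral_cmult) (intro mult_left_mono bound, auto)
  also have "... = en (b/(1+b))"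
   using K_ge_1 L_ge_1 assms M by (simp add: ennreal_mult[symmetric] powr_divide b_def mult_ac)
  also have "... <= 1" using b by (simp add: divide_le_eq)
  finally show ?thesis .
 qed
 thus ?thesis using M(1) by blast
qed

lemma Lphi_E_iff: "Lphi_E phi g \<longleftrightarrow> g:bml & modular g < \<infinity>"
proof
 assume "Lphi_E phi g"
 then obtain lam where lam: "lam > 0" "modular_E phi g lam <= 1" and g [measurable]: "g:bml"
  unfolding Lphi_E_def by blast
 have "modular (%x. g x / en lam) <= modular_E phi g lam"
  unfolding modular_E_def by (intro nn_integral_mono Phi_le_phi_ext)
 hence finite: "modular (%x. g x / en lam) < \<infinity>" using lam(2) by (metis ennreal_one_less_top infinity_ennreal_def le_less_trans)
 have "g x = en lam * (g x / en lam)" for x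
  using lam(1) by (simp add: divide_ennreal_eq_mult mult.assoc[symmetric] ennreal_mult[symmetric])
 hence "modular g = modular (%x. en lam * (g x / en lam))" by simp
 also have "... <= en (L * max 1 lam) * modular (%x. g x / en lam)" using lam by (intro Phi_modular_scale) auto
 also have "... < \<infinity>" using finite by (simp add: ennreal_mult_less_top)
 finally show "g:bml & modular g < \<infinity>" using g by blast
next
 assume g: "g:bml & modular g < \<infinity>"
 define B where "B = enn2real (modular g)"
 have "modular (%x. g x / en 1) <= en B" "B >= 0" using g by (simp_all add: B_def del: ennreal_1)
 then obtain M where "M >= 1" "modular_E phi g (M*1) <= 1" using modular_E_le_1[of B] g by (metis zero_less_one)
 thus "Lphi_E phi g" unfolding Lphi_E_def using g by (intro conjI exI[of _ M]) auto
qed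

lemma Hphi_iff: "u:Hphi phi \<longleftrightarrow> tempered u & modular (gmax u) < \<infinity>"
 by (simp add: Hphi_def Lphi_E_iff)

lemma Hphi_lincomb:
 assumes "u:Hphi phi" "v:Hphi phi" shows "(%psi. a * u psi + b * v psi):Hphi phi"
proof -
 let ?w = "%psi. a * u psi + b * v psi"
 have finite: "modular (%x. en (cmod c) * gmax w x) < \<infinity>" if "w:Hphi phi" for c w
  using Phi_modular_scale[of "gmax w" "cmod c"] that by (auto simp: Hphi_iff ennreal_mult_less_top elim!: le_less_trans)
 have "modular (gmax ?w) <= (NN x. en (2*L) * (Phi x (en (cmod a) * gmax u x) + Phi x (en (cmod b) * gmax v x)))"
  by (intro nn_integral_mono order_trans[OF Phi_mono[OF grand_max_lincomb] Phi_add])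
 also have "... = en (2*L) * (modular (%x. en (cmod a) * gmax u x) + modular (%x. en (cmod b) * gmax v x))"
  by (simp add: nn_integral_cmult nn_integral_add)
 also have "... < \<infinity>" using finite assms by (simp add: ennreal_mult_less_top)
 finally show ?thesis using assms tempered_lincomb unfolding Hphi_iff by blast
qed

subsection \<open>Kernels and atoms\<close>

lemma dilate_smooth: "psi:S_m k ==> smooth (dilate psi t y)"
 unfolding dilate_alt by (intro smooth_cmult smooth_affine) (simp add: S_m_def schwartz_iff)

lemma dilate_measurable: "psi:S_m k ==> dilate psi t y:bml"
 by (intro continuous_lebesgue_measurable smooth_continuous dilate_smooth)

lemma dilate_decay:
 fixes psi :: "'n fn"
 assumes psi: "psi:S_m mm" and t: "t > 0" and ds: "length ds <= mm+1"
 shows "cmod (pdl ds (dilate psi t y) z) <= (1/t)^(CARD('n) + length ds) * decay t y z"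
proof -
 let ?M = "CARD('n) + mm+1" and ?w = "(1/t) *! (y-z)"
 have sm: "smooth psi" using psi by (simp add: S_m_def schwartz_iff)
 have "(1 + norm ?w)^?M * cmod (pdl ds psi ?w) <= (1 + norm ?w)^((mm+2)*(CARD('n) + 1)) * cmod (pdl ds psi ?w)"
  by (intro mult_right_mono power_increasing) auto
 also have "... <= 1" using psi ds unfolding S_m_def mem_Collect_eq by blast
 finally have "cmod (pdl ds psi ?w) <= (1/(1 + norm ?w))^?M"
  by (simp add: power_divide pos_le_divide_eq mult.commute add_pos_nonneg)
 also have "1/(1 + norm ?w) = t/(t + dist z y)"
  using t add_pos_nonneg[OF t, of "dist z y"] by (simp add: dist_norm norm_minus_commute divide_simps)
 finally have bound: "cmod (pdl ds psi ?w) <= decay t y z" by (simp add: decay_def)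
 have "(1/t) *! y + - (1/t) *! z = ?w" by (simp add: algebra_simps)
 hence "cmod (pdl ds (dilate psi t y) z) = (1/t)^(CARD('n) + length ds) * cmod (pdl ds psi ?w)"
  unfolding dilate_alt pdl_cmult[OF smooth_affine[OF sm]] pdl_affine[OF sm]
  using t by (simp add: norm_mult norm_power norm_divide power_add power_divide)
 also have "... <= (1/t)^(CARD('n) + length ds) * decay t y z" using t by (intro mult_left_mono bound) auto
 finally show ?thesis .
qed

definition kernel_const :: real where
 "kernel_const = 2 powr real (CARD('n) + mm+1) / (1-2 powr (real CARD('n) - real (CARD('n) + mm+1)))"

lemma kernel_const_pos: "kernel_const > 0"
proof -
 have "2 powr (real CARD('n) - real (CARD('n) + mm+1)) < (2::real) powr 0" by (intro powr_less_mono) auto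
 thus ?thesis unfolding kernel_const_def by (intro divide_pos_pos) auto
qed

lemma kernel_bound:
 fixes g :: "real^'n => ennreal"
 assumes [measurable]: "g:bml" and psi: "psi:S_m mm" and t: "t > 0"
 and growth: "!!rho. rho >= t ==> (NN x. g x * idr (ball y rho) x) <= en (rho^CARD('n)) * G"
 shows "(NN z. g z * en (cmod (dilate psi t y z))) <= en kernel_const * G"
proof -
 let ?n = "CARD('n)"
 let ?M = "real (?n+mm+1)"
 have "g z * en (cmod (dilate psi t y z)) <= en ((1/t)^?n) * (g z * en ((t/(t + dist z y)) powr ?M))" for z
 proof -
  have "t/(t + dist z y) > 0" using t by (simp add: add_pos_nonneg)
  hence "decay t y z = (t/(t + dist z y)) powr ?M" using powr_realpow[of "t/(t + dist z y)" "?n+mm+1"] by (simp add: decay_def)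
  hence "cmod (dilate psi t y z) <= (1/t)^?n * (t/(t + dist z y)) powr ?M"
   using dilate_decay[OF psi t, of "[]" y z] by simp
  hence "g z * en (cmod (dilate psi t y z)) <= g z * en ((1/t)^?n * (t/(t + dist z y)) powr ?M)"
   by (intro mult_left_mono ennreal_leI) auto
  thus ?thesis using t by (simp add: ennreal_mult mult_ac)
 qed
 hence "(NN z. g z * en (cmod (dilate psi t y z))) <= (NN z. en ((1/t)^?n) * (g z * en ((t/(t + dist z y)) powr ?M)))"
  by (rule nn_integral_mono)
 also have "... = en ((1/t)^?n) * (NN z. g z * en ((t/(t + dist z y)) powr ?M))"
  by (intro nn_integral_cmult) measurable
 also have "... <= en ((1/t)^?n) * (en (kernel_const*1) * (en (t^?n) * G))"
  unfolding kernel_const_def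
 proof (intro mult_left_mono nn_integral_decay_le[where d = "real ?n"])
  fix j
  have "(1::real) <= 2^j" by simp
  hence "t <= 2^j*t" using t by (simp add: mult_le_cancel_right1)
  moreover have "(2^j*t)^?n = 2 powr (real ?n * real j)*t^?n"
   using powr_realpow[of 2 "?n*j"] by (simp add: power_mult_distrib power_mult[symmetric] mult.commute)
  ultimately show "(NN x. g x * idr (ball y (2^j*t)) x) <= en (1*2 powr (real ?n * real j)) * (en (t^?n) * G)"
   using growth[of "2^j*t"] t by (simp add: ennreal_mult mult.assoc)
 qed (use t in auto)
 also have "... = en kernel_const * G"
  using t kernel_const_pos by (simp add: ennreal_mult[symmetric] mult.assoc[symmetric] power_divide)
 finally show ?thesis .
qed

lemma dilate_integral_le:
 fixes psi :: "'n fn"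
 assumes "psi:S_m mm" "t > 0"
 shows "(NN z. en (cmod (dilate psi t y z))) <= en (kernel_const * unit_ball_vol (real CARD('n)))"
proof -
 have "(NN z. 1 * en (cmod (dilate psi t y z))) <= en kernel_const * en (unit_ball_vol (real CARD('n)))"
 proof (rule kernel_bound[OF _ assms])
  fix rho assume "rho >= t"
  hence "rho >= 0" using assms(2) by simp
  thus "(NN x. 1 * idr (ball y rho) x) <= en (rho^CARD('n)) * en (unit_ball_vol (real CARD('n)))"
   using content_ball[of rho y] by (simp add: emeasure_eq_measure2 mult.commute ennreal_mult[symmetric])
 qed simp
 thus ?thesis using kernel_const_pos by (simp add: ennreal_mult)
qed

text \<open>Far from its ball an atom is tested against the Taylor remainder of the kernel, which gives the
decay of order n + m + 1; near the ball only the size of the atom matters.\<close>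

lemma bounded_atom_pairing_near:
 fixes h :: "'n fn"
 assumes h: "bounded_atom mm h c r A" and psi: "psi:S_m mm" and t: "t > 0"
 shows "cmod (LI z. h z * dilate psi t y z) <= A*(kernel_const * unit_ball_vol (real CARD('n)))"
proof -
 note [measurable] = dilate_measurable[OF psi]
 note A = bounded_atomD(5)[OF h]
 have "en (cmod (LI z. h z * dilate psi t y z)) <= (NN z. en (cmod (h z * dilate psi t y z)))"
  using bsupp_mult_integrable[OF bounded_atom_bsupp[OF h] smooth_continuous[OF dilate_smooth[OF psi]]] by (rule integral_norm_bound_ennreal)
 also have "... <= (NN z. en A * en (cmod (dilate psi t y z)))"
  using bounded_atomD(2)[OF h] A by (intro nn_integral_mono) (simp add: norm_mult ennreal_mult[symmetric] ennreal_leI mult_right_mono)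
 also have "... = en A * (NN z. en (cmod (dilate psi t y z)))" by (intro nn_integral_cmult) measurable
 also have "... <= en A * en (kernel_const * unit_ball_vol (real CARD('n)))" by (intro mult_left_mono dilate_integral_le psi t) auto
 finally show ?thesis using A kernel_const_pos by (simp add: ennreal_mult[symmetric] ennreal_le_iff)
qed

lemma bounded_atom_smooth_pairing:
 fixes h :: "'n fn"
 assumes h: "bounded_atom mm h c r A" and r: "r > 0" and f: "smooth f"
 and D: "D >= 0" "!!ds z. length ds = Suc mm ==> z:cball c r ==> cmod (pdl ds f z) <= D"
 shows "cmod (LI z. h z * f z) <= A*(D*(real CARD('n) * r)^Suc mm)*(unit_ball_vol (real CARD('n)) * r^CARD('n))"
proof -
 let ?E = "D*(real CARD('n) * r)^Suc mm"
 obtain P where P: "poly_fn mm P" "pd_bound (Suc mm) ?E (real CARD('n) * r) (cball c r) (%x. f x - P x)"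
  by (rule taylor_remainder_bound[OF f r D])
 note sP = smooth_poly_fn[OF P(1)] and A = bounded_atomD(5)[OF h]
 have integrable: "integrable lbg (%z. h z * g z)" if "smooth g" for g
  by (rule bsupp_mult_integrable[OF bounded_atom_bsupp[OF h] smooth_continuous[OF that]])
 have "(LI z. h z * f z) = (LI z. h z * (f z - P z))"
  using integrable[OF f] integrable[OF sP] bounded_atomD(4)[OF h P(1)] by (simp add: right_diff_distrib)
 also have "cmod ... <= (LI z. A*?E * idr (cball c r) z)"
 proof (rule order_trans[OF integral_norm_bound integral_mono])
  show "norm (h z * (f z - P z)) <= A*?E * idr (cball c r) z" for z
   using bounded_atomD(2,3)[OF h, of z] pd_boundD[OF P(2), of "[]" z] A
   by (auto simp: norm_mult intro: mult_mono split: split_indicator)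
 qed (intro integrable_norm integrable smooth_diff f sP integrable_mult_right integrable_indicator_cball)+
 also have "... = A*?E*(unit_ball_vol (real CARD('n)) * r^CARD('n))" using content_cball[of r c] r by simp
 finally show ?thesis by simp
qed

definition atom_const :: real where
 "atom_const = 3^(CARD('n) + mm+1)*(kernel_const * unit_ball_vol (real CARD('n))) + unit_ball_vol (real CARD('n)) * real CARD('n)^Suc mm * 4^(CARD('n) + mm+1)"

lemma atom_const_pos: "atom_const > 0"
 unfolding atom_const_def using kernel_const_pos by (intro add_pos_nonneg mult_pos_pos) auto

lemma bounded_atom_pairing:
 fixes h :: "'n fn"
 assumes h: "bounded_atom mm h c r A" and r: "r > 0" and psi: "psi:S_m mm" and t: "t > 0" and xy: "dist y x < t"
 shows "cmod (LI z. h z * dilate psi t y z) <= atom_const*A * decay r c x"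
proof -
 let ?n = "CARD('n)" and ?v = "unit_ball_vol (real CARD('n))"
 let ?M = "?n+mm+1"
 let ?near = "3^?M*(kernel_const*?v)" and ?far = "?v * real ?n^Suc mm * 4^?M"
 note A = bounded_atomD(5)[OF h]
 have decay: "decay r c x > 0" using decay_bounds[OF r] by blast
 have near_far: "?near >= 0" "?far >= 0" using kernel_const_pos by auto
 show ?thesis
 proof (cases "dist x c < 2*r")
  case True
  have "1/3 <= r/(r + dist x c)" using True r add_pos_nonneg[OF r, of "dist x c"] by (simp add: divide_simps)
  hence "(1/3)^?M <= decay r c x" unfolding decay_def by (intro power_mono) auto
  hence "A*(kernel_const*?v)*1 <= A*(kernel_const*?v)*(3^?M * decay r c x)"
   using A kernel_const_pos by (intro mult_left_mono) (auto simp: power_divide divide_le_eq mult.commute)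
  also have "... = ?near*A * decay r c x" by simp
  also have "... <= atom_const*A * decay r c x"
   using decay A near_far unfolding atom_const_def by (intro mult_right_mono) auto
  finally show ?thesis using bounded_atom_pairing_near[OF h psi t, of y] by simp
 next
  case False
  define s where "s = dist x c"
  have s: "s >= 2*r" "s > 0" using False r by (auto simp: s_def)
  have "cmod (pdl ds (dilate psi t y) z) <= (2 / s)^?M" if ds: "length ds = Suc mm" and z: "z:cball c r" for ds z
  proof -
   have "s <= dist x y + dist y z + dist z c" unfolding s_def by metric
   moreover have "dist z c <= r" using z by (simp add: dist_commute)
   ultimately have far: "s/2 <= t + dist z y" using xy s by (simp add: dist_commute)
   have "cmod (pdl ds (dilate psi t y) z) <= (1/t)^?M * decay t y z" using dilate_decay[OF psi t, of ds y z] ds by simp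
   also have "... = (1/(t + dist z y))^?M" using t by (simp add: decay_def power_mult_distrib[symmetric])
   also have "... <= (2 / s)^?M" using far s t by (intro power_mono) (auto simp: field_simps)
   finally show ?thesis .
  qed
  hence "cmod (LI z. h z * dilate psi t y z) <= A*((2 / s)^?M * (real ?n * r)^Suc mm)*(?v*r^?n)"
   using s by (intro bounded_atom_smooth_pairing[OF h r dilate_smooth[OF psi]]) auto
  also have "... = ?v * real ?n^Suc mm * A*(2*r / s)^?M" by (simp add: power_mult_distrib power_divide power_add mult_ac)
  also have "... <= ?v * real ?n^Suc mm * A*(4*(r/(r + dist x c)))^?M"
   using r s A unfolding s_def[symmetric] by (intro mult_left_mono power_mono) (simp_all add: field_simps)
  also have "... = ?far*A * decay r c x" by (simp only: decay_def power_mult_distrib mult_ac)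
  also have "... <= atom_const*A * decay r c x" using decay A near_far unfolding atom_const_def by (intro mult_right_mono) auto
  finally show ?thesis .
 qed
qed

lemma decay_measurable [measurable]: "(%x. decay r c x):bml"
proof -
 have "(%x. decay r c x):borel_measurable borel" unfolding decay_def by measurable
 thus ?thesis by (intro measurable_completion) simp
qed

lemma Phi_decay_series:
 "EX C>0. ALL c r A lam. (ALL j::nat. r j > 0 & A j >= 0) --> lam > 0 --> modular (%x. (\<Sum>j. en (A j * decay (r j) (c j) x)) / en lam) <= en C * (\<Sum>j. Phi_int (ball (c j) (r j)) (A j / lam))"
proof -
 obtain C where C: "C > 0" "!!c r t. r > 0 ==> t > 0 ==> modular (%x. en (t * decay r c x)) <= en C * Phi_int (ball c r) t"
  using Phi_decay_integral by blast
 have "modular (%x. (\<Sum>j. en (A j * decay (r j) (c j) x)) / en lam) <= en (L*C) * (\<Sum>j. Phi_int (ball (c j) (r j)) (A j / lam))"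
  if sizes: "!!j::nat. r j > 0 & A j >= 0" and lam: "lam > 0" for c r A lam
 proof -
  have "en (1/lam) * en (A j * decay (r j) (c j) x) = en (A j / lam * decay (r j) (c j) x)" for j x
   using sizes[of j] lam decay_bounds[of "r j" "c j" x] by (simp add: ennreal_mult[symmetric])
  hence "(\<Sum>j. en (A j * decay (r j) (c j) x)) / en lam = (\<Sum>j. en (A j / lam * decay (r j) (c j) x))" for x
   using lam by (simp add: divide_ennreal_eq_mult ennreal_suminf_cmult[symmetric])
  hence "modular (%x. (\<Sum>j. en (A j * decay (r j) (c j) x)) / en lam) <= (NN x. en L * (\<Sum>j. Phi x (en (A j / lam * decay (r j) (c j) x))))"
   by (auto intro!: nn_integral_mono Phi_suminf)
  also have "... = en L * (\<Sum>j. modular (%x. en (A j / lam * decay (r j) (c j) x)))"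
   by (subst nn_integral_cmult, measurable, subst nn_integral_suminf, measurable)
  also have "... <= en L * (\<Sum>j. en C * Phi_int (ball (c j) (r j)) (A j / lam))"
  proof (intro mult_left_mono suminf_le)
   show "modular (%x. en (A j / lam * decay (r j) (c j) x)) <= en C * Phi_int (ball (c j) (r j)) (A j / lam)" for j
    using C(2)[of "r j" "A j / lam" "c j"] sizes[of j] lam by (cases "A j = 0") auto
  qed auto
  also have "... = en (L*C) * (\<Sum>j. Phi_int (ball (c j) (r j)) (A j / lam))"
   using C(1) L_ge_1 by (simp add: ennreal_suminf_cmult ennreal_mult mult.assoc)
  finally show ?thesis .
 qed
 moreover have "L*C > 0" using C(1) L_ge_1 by simp
 ultimately show ?thesis by blast
qed

end

subsection \<open>Testing the grand maximal function on test functions\<close>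

lemma pd_bound_affine:
 assumes "smooth f" "pd_bound K A 1 UNIV f" "abs c <= 1"
 shows "pd_bound K A 1 UNIV (%x. f (y + c *! x))"
 unfolding pd_bound_def
proof (intro allI impI ballI)
 fix ds :: "'a list" and x assume "length ds <= K"
 hence "cmod (pdl ds f (y + c *! x)) <= A" using pd_boundD[OF assms(2)] by fastforce
 hence "abs c^length ds * cmod (pdl ds f (y + c *! x)) <= 1*A"
  using assms(3) by (intro mult_mono power_le_one) auto
 thus "cmod (pdl ds (%x. f (y + c *! x)) x) <= A/1^length ds"
  by (simp add: pdl_affine[OF assms(1)] norm_mult norm_power)
qed

lemma test_fn_affine:
 assumes "test_fn f" "c ~= 0" shows "test_fn (%x. f (y + c *! x))"
proof -
 obtain R where R: "R > 0" "!!x. x~:cball 0 R ==> f x = 0" using test_fn_support[OF assms(1)] by blast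
 have "f (y + c *! x) = 0" if "x~:cball 0 ((R + norm y) / abs c)" for x
 proof (rule R(2))
  have "R + norm y < norm (c *! x)" using that assms(2) by (simp add: not_le pos_divide_less_eq mult.commute)
  thus "y + c *! x~:cball 0 R" using norm_triangle_ineq4[of "y + c *! x" y] by simp
 qed
 thus ?thesis by (rule test_fnI[OF smooth_affine[OF test_fn_smooth[OF assms(1)]]])
qed

lemma test_fn_dilate: "test_fn psi ==> t > 0 ==> test_fn (dilate psi t y)"
 unfolding dilate_alt by (intro test_fn_cmult test_fn_affine) auto

lemma dilated_cutoff_pd_bound:
 assumes "pd_bound K D 1 UNIV (cutoff::'n::finite fn)" "R >= 1"
 shows "pd_bound K D 1 UNIV (dilated_cutoff R::'n fn)"
 unfolding dilated_cutoff_def[abs_def] using assms(2) by (intro pd_bound_affine[OF cutoff_smooth assms(1)]) auto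

lemma schwartz_cutoff_seminorm:
 fixes f :: "'n::finite fn"
 assumes f: "schwartz f"
 shows "EX B. ALL R>=1. schwartz_seminorm N (%z. f z - f z * dilated_cutoff R z) <= B/R"
proof -
 obtain D where D: "D > 0" "pd_bound N D 1 UNIV (cutoff::'n fn)" using test_fn_pd_bound[OF cutoff_test_fn] by blast
 define Q where "Q = schwartz_seminorm (Suc N) f"
 have Q: "Q >= 0" unfolding Q_def by (rule schwartz_seminorm_nonneg[OF f])
 have sm: "smooth f" using f by (simp add: schwartz_iff)
 have "schwartz_seminorm N (%z. f z - f z * dilated_cutoff R z) <= 2^N*Q*(1+D)/R" if R: "R >= 1" for R
 proof (rule schwartz_seminorm_le)
  fix ds :: "'n list" and z assume ds: "length ds <= N"
  let ?g = "%z. f z * (1 - dilated_cutoff R z)"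
  have g: "(%z. f z - f z * dilated_cutoff R z) = ?g" by (auto simp: algebra_simps)
  show "(1 + norm z)^N * cmod (pdl ds (%z. f z - f z * dilated_cutoff R z) z) <= 2^N*Q*(1+D)/R"
  proof (cases "norm z < R")
   case True
   have "pdl ds ?g z = pdl ds (%w. 0) z"
    using R True by (intro pdl_cong_open[of "ball 0 R"]) (auto simp: dilated_cutoff_eq_1)
   thus ?thesis using Q D R unfolding g by (simp add: pdl_const)
  next
   case False
   let ?w = "1 + norm z"
   have w: "?w > 0" by (simp add: add_pos_nonneg)
   have "pd_bound N (Q/?w^Suc N) 1 {z} f"
    unfolding pd_bound_def using schwartz_seminorm_upper[OF f, of _ "Suc N" z] w
    by (auto simp: pos_le_divide_eq Q_def mult.commute simp del: power_Suc)
   moreover have "pd_bound N (cmod 1 + D) 1 UNIV (%z::real^'n. 1 - dilated_cutoff R z)"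
    using R D by (intro pd_bound_diff smooth_const dilated_cutoff_smooth pd_bound_const dilated_cutoff_pd_bound) auto
   hence "pd_bound N (1+D) 1 {z} (%z. 1 - dilated_cutoff R z)" by (auto simp: pd_bound_def)
   ultimately have "pd_bound N (2^N*(Q/?w^Suc N)*(1+D)) 1 {z} ?g"
    using Q D(1) by (intro pd_bound_mult sm smooth_diff smooth_const dilated_cutoff_smooth) auto
   from pd_boundD[OF this ds] have "?w^N * cmod (pdl ds ?g z) <= ?w^N*(2^N*(Q/?w^Suc N)*(1+D))" by (intro mult_left_mono) auto
   also have "... = 2^N*Q*(1+D)*(1/?w)"
   proof -
    have "w^N*(a*(Q/w^Suc N)*b) = a*Q*b*(1/w)" if "w > 0" for a b w :: real using that by (simp add: field_simps)
    from this[OF w] show ?thesis .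
   qed
   also have "... <= 2^N*Q*(1+D)*(1/R)" using Q D R False by (intro mult_left_mono divide_left_mono) auto
   finally show ?thesis unfolding g by simp
  qed
 qed
 thus ?thesis by blast
qed

lemma tempered_cutoff_tendsto:
 fixes f :: "'n::finite fn"
 assumes u: "tempered u" and f: "schwartz f"
 shows "(%k. u (%z. f z * dilated_cutoff (real (Suc k)) z)) ~~> u f"
proof -
 obtain C N where C: "!!psi. schwartz psi ==> cmod (u psi) <= C * schwartz_seminorm N psi"
  and add: "!!psi chi. schwartz psi ==> schwartz chi ==> u (%x. psi x + chi x) = u psi + u chi" using u unfolding tempered_def by blast
 obtain B where B: "!!R. R >= 1 ==> schwartz_seminorm N (%z. f z - f z * dilated_cutoff R z) <= B/R"
  using schwartz_cutoff_seminorm[OF f] by metis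
 have "cmod (u (%z. f z * dilated_cutoff (real (Suc k)) z) - u f) <= abs C * B * inverse (real (Suc k))" for k
 proof -
  let ?fk = "%z. f z * dilated_cutoff (real (Suc k)) z" and ?g = "%z. f z - f z * dilated_cutoff (real (Suc k)) z"
  have cut_schwartz: "schwartz ?fk" using f by (intro test_fn_schwartz test_fn_mult_left dilated_cutoff_test_fn) (auto simp: schwartz_iff)
  have g: "schwartz ?g" using schwartz_lincomb[OF f cut_schwartz, of 1 "-1"] by simp
  have "u f = u ?fk + u ?g" using add[OF cut_schwartz g] by simp
  hence "cmod (u ?fk - u f) = cmod (u ?g)" by (simp add: norm_minus_commute)
  also have "... <= abs C * schwartz_seminorm N ?g"
   using C[OF g] schwartz_seminorm_nonneg[OF g, of N] by (meson abs_ge_self mult_right_mono order_trans)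
  also have "... <= abs C * (B / real (Suc k))" by (intro mult_left_mono B) auto
  finally show ?thesis by (simp add: divide_inverse)
 qed
 hence "(%k. u (%z. f z * dilated_cutoff (real (Suc k)) z) - u f) ~~> 0"
  by (intro Lim_null_comparison[OF always_eventually tendsto_mult_right_zero[OF LIMSEQ_inverse_real_of_nat]] allI)
 thus ?thesis by (rule LIM_zero_cancel)
qed

context growth begin

definition cutoff_const :: real where
 "cutoff_const = (SOME D. D > 0 & pd_bound (Suc mm) D 1 UNIV (cutoff::'n fn))"

lemma cutoff_const: "cutoff_const > 0" "pd_bound (Suc mm) cutoff_const 1 UNIV (cutoff::'n fn)"
proof -
 have "EX D. D > 0 & pd_bound (Suc mm) D 1 UNIV (cutoff::'n fn)" using test_fn_pd_bound[OF cutoff_test_fn] by blast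
 from someI_ex[OF this] show "cutoff_const > 0" "pd_bound (Suc mm) cutoff_const 1 UNIV (cutoff::'n fn)"
  by (auto simp: cutoff_const_def)
qed

definition test_const :: real where
 "test_const = 2^Suc mm * cutoff_const"

lemma test_const_pos: "test_const > 0"
 using cutoff_const(1) by (simp add: test_const_def)

lemma S_m_truncate:
 fixes psi :: "'n fn" and y :: "real^'n"
 assumes psi: "psi:S_m mm" and R: "R >= 1" and t: "t > 0" "t <= R"
 defines "chi == %v. of_real (1/test_const) * (psi v * dilated_cutoff R (y + (- t) *! v))"
 shows "chi:S_m mm" "test_fn chi" "(%z. dilate psi t y z * dilated_cutoff R z) = (%z. of_real test_const * dilate chi t y z)"
proof -
 let ?kappa = "%v. dilated_cutoff R (y + (- t) *! v)" and ?N = "(mm+2)*(CARD('n) + 1)"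
 have sm: "smooth psi" using psi by (simp add: S_m_def schwartz_iff)
 have kappa: "test_fn ?kappa" using R t by (intro test_fn_affine dilated_cutoff_test_fn) auto
 note product = test_fn_mult_left[OF sm kappa]
 show test: "test_fn chi" unfolding chi_def by (rule test_fn_cmult[OF product])
 have "pd_bound (Suc mm) cutoff_const 1 UNIV (%v::real^'n. cutoff ((1/R) *! y + (- t/R) *! v))"
  using R t by (intro pd_bound_affine[OF cutoff_smooth cutoff_const(2)]) auto
 also have "(%v::real^'n. cutoff ((1/R) *! y + (- t/R) *! v)) = ?kappa" by (simp add: dilated_cutoff_def algebra_simps)
 finally have kap_bound: "pd_bound (Suc mm) cutoff_const 1 UNIV ?kappa" .
 have "(1 + norm v)^?N * cmod (pdl ds chi v) <= 1" if ds: "length ds <= mm+1" for ds v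
 proof -
  define W where "W = (1 + norm v)^?N"
  have W: "W > 0" unfolding W_def by (simp add: add_pos_nonneg)
  have "W * cmod (pdl ds psi v) <= 1" if "length ds <= mm+1" for ds
   using psi that unfolding S_m_def mem_Collect_eq W_def by blast
  hence "pd_bound (Suc mm) (1/W) 1 {v} psi" unfolding pd_bound_def using W by (auto simp: pos_le_divide_eq mult.commute)
  moreover have "pd_bound (Suc mm) cutoff_const 1 {v} ?kappa" using kap_bound by (auto simp: pd_bound_def)
  ultimately have "pd_bound (Suc mm) (2^Suc mm * (1/W)*cutoff_const) 1 {v} (%v. psi v * ?kappa v)"
   using W cutoff_const(1) by (intro pd_bound_mult sm test_fn_smooth[OF kappa]) auto
  from pd_boundD[OF this, of ds v] ds have "cmod (pdl ds (%v. psi v * ?kappa v) v) <= test_const/W" by (simp add: test_const_def)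
  thus ?thesis
   unfolding chi_def pdl_cmult[OF test_fn_smooth[OF product]] W_def[symmetric]
   using test_const_pos W by (simp add: norm_mult norm_divide field_simps)
 qed
 thus "chi:S_m mm" unfolding S_m_def using test_fn_schwartz[OF test] by blast
 show "(%z. dilate psi t y z * dilated_cutoff R z) = (%z. of_real test_const * dilate chi t y z)"
  using t test_const_pos unfolding dilate_def chi_def by (auto simp: algebra_simps)
qed

lemma grand_max_le_of_test_fn:
 assumes w: "tempered w" and M: "M >= 0"
 and bound: "!!psi t y. psi:S_m mm ==> test_fn psi ==> t > 0 ==> dist y x < t ==> cmod (w (dilate psi t y)) <= M"
 shows "gmax w x <= en (test_const*M)"
proof (rule grand_max_leI, rule ennreal_leI)
 fix psi :: "'n fn" and t y assume psi: "psi:S_m mm" and t: "t > 0" and xy: "dist y x < t"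
 show "cmod (w (dilate psi t y)) <= test_const*M"
 proof (cases "schwartz (dilate psi t y)")
  case False
  hence "w (dilate psi t y) = 0" using w unfolding tempered_def by blast
  thus ?thesis using test_const_pos M by simp
 next
  case True
  obtain k0 where k0: "t < real k0" using reals_Archimedean2 by blast
  show ?thesis
  proof (rule LIMSEQ_le_const2[OF tendsto_norm[OF tempered_cutoff_tendsto[OF w True]]], intro exI[of _ k0] allI impI)
   fix k assume "k >= k0"
   hence k: "real (Suc k) >= 1" "t <= real (Suc k)" using k0 by auto
   note chi = S_m_truncate[OF psi k(1) t k(2), of y]
   show "cmod (w (%z. dilate psi t y z * dilated_cutoff (real (Suc k)) z)) <= test_const*M"
    unfolding chi(3) linear_on_tests_cmult[OF tempered_linear_on_tests[OF w] test_fn_dilate[OF chi(2) t]]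
    using bound[OF chi(1,2) t xy] test_const_pos by (simp add: norm_mult mult_left_mono)
  qed
 qed
qed

end

subsection \<open>Atomic decomposition\<close>

lemma infsum_telescope_int:
 fixes S :: "int => 'a::banach"
 assumes "(%k. S k - S (k+1)) summable_on UNIV" "(%n. S (- int n)) ~~> a" "(%n. S (int n)) ~~> b"
 shows "(\<Sum>\<^sub>\<infinity>k. S k - S (k+1)) = a-b"
proof -
 let ?T = "%k. S k - S (k+1)"
 have "filterlim (%n. {- int n..<int n}) (finite_subsets_at_top UNIV) sequentially"
 proof (rule filterlim_finite_subsets_at_top)
  show "\<forall>\<^sub>F n in sequentially. k:{- int n..<int n}" for k
   by (rule eventually_sequentiallyI[of "nat \<bar>k\<bar> + 1"]) auto
 qed auto
 moreover have "(sum ?T \<longlongrightarrow> (\<Sum>\<^sub>\<infinity>k. ?T k)) (finite_subsets_at_top UNIV)"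
  using assms(1) has_sum_infsum unfolding has_sum_def by blast
 ultimately have "(%n. sum ?T {- int n..<int n}) ~~> (\<Sum>\<^sub>\<infinity>k. ?T k)" by (rule filterlim_compose[rotated])
 moreover have "sum ?T {- int n..<int n} = S (- int n) - S (int n)" for n
 proof (induction n)
  case (Suc n)
  have "{- int (Suc n)..<int (Suc n)} = insert (- int (Suc n)) (insert (int n) {- int n..<int n})" by auto
  thus ?case using Suc by (simp add: algebra_simps)
 qed simp
 ultimately show ?thesis using tendsto_diff[OF assms(2,3)] LIMSEQ_unique by fastforce
qed

lemma nn_integral_finite_point:
 fixes f :: "real^'n::finite => ennreal"
 assumes "f:bml" "(NN x. f x) < \<infinity>" "r > 0" shows "EX x:ball c r. f x ~= \<infinity>"
proof (rule ccontr)
 assume "~?thesis"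
 moreover have "AL x. f x ~= \<infinity>" by (rule nn_integral_PInf_AE) (use assms in auto)
 ultimately have "AL x. x~:ball c r" by (auto elim: eventually_mono)
 hence "ball c r:null_sets lbg" by (subst AE_iff_null_sets) auto
 hence "measure lbg (ball c r) = 0" by (rule measure_eq_0_null_sets)
 thus False using measure_ball_pos[OF assms(3), of c] by simp
qed

context growth begin

definition dyadic_const :: real where
 "dyadic_const = (SOME C. C > 0 & (ALL x v lam. lam > 0 --> dyadic_sum (%k. Phi x (en (2 powi k/lam))) v <= en C * Phi x (v / en lam)))"

lemma dyadic_const_pos: "dyadic_const > 0"
 and dyadic_const: "lam > 0 ==> dyadic_sum (%k. Phi x (en (2 powi k/lam))) v <= en dyadic_const * Phi x (v / en lam)"
 using someI_ex[OF Phi_dyadic_sum, folded dyadic_const_def] by blast+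

end

context growth_moments begin

definition atom_modular_const :: real where
 "atom_modular_const = real (overlap TYPE('n)) * (L * max 1 (2*level_const) * dyadic_const)"

lemma atom_modular_const_nonneg: "atom_modular_const >= 0"
 using L_ge_1 dyadic_const_pos by (simp add: atom_modular_const_def)

context
 fixes u :: "'n fn => complex"
 assumes u: "u:Hphi phi"
begin

definition level_set :: "int => (real^'n) set" where
 "level_set k = {x. en (2 powi k) < gmax u x}"

definition level_dist :: "int => real^'n => real" where
 "level_dist k = (%x. infdist x (- level_set k))"

lemma tempered_u: "tempered u" and linear_u: "linear_on_tests u" and modular_u: "modular (gmax u) < \<infinity>"
 using u tempered_linear_on_tests by (auto simp: Hphi_iff)

lemma open_level_set: "open (level_set k)"
 unfolding level_set_def by (rule grand_max_open)

lemma level_set_sets [measurable]: "level_set k:sets lbg"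
 using open_level_set[of k] by simp

lemma level_set_compl_nonempty: "- level_set k ~= {}"
proof
 assume "- level_set k = {}"
 hence "en (2 powi k) <= gmax u x" for x unfolding level_set_def by (auto intro: less_imp_le)
 hence "Phi_int UNIV (2 powi k) <= modular (gmax u)"
  unfolding Phi_int_def by (auto intro!: nn_integral_mono Phi_mono)
 thus False using modular_u Phi_int_UNIV[of "2 powi k"] by (simp add: top_unique)
qed

lemma lip_level_dist: "lip1 (level_dist k)"
 unfolding level_dist_def by (rule lip1_infdist)

lemma controlled_level_dist: "controlled u (2 powi k) (level_dist k)"
 unfolding controlled_def
proof (intro conjI allI)
 show "EX y. dist x y <= level_dist k x & gmax u y <= en (2 powi k)" for x
 proof -
  have "closed (- level_set k)" using open_level_set by (simp add: closed_Compl)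
  then obtain y where "y:- level_set k" "infdist x (- level_set k) = dist x y"
   using infdist_attains_inf level_set_compl_nonempty by metis
  thus ?thesis by (intro exI[of _ y]) (auto simp: level_dist_def level_set_def not_less)
 qed
qed (auto simp: level_dist_def infdist_nonneg linear_u lip1_infdist)

lemma two_powi_mono: "k <= l ==> (2::real) powi k <= 2 powi l"
 by (intro power_int_increasing) auto

lemma level_dist_antimono: assumes "k <= l" shows "level_dist l x <= level_dist k x"
proof -
 have "level_set l <= level_set k"
  unfolding level_set_def using two_powi_mono[OF assms] ennreal_leI le_less_trans by blast
 thus ?thesis unfolding level_dist_def using level_set_compl_nonempty by (intro infdist_mono) auto
qed

lemma near_level_set: "a:near (level_dist k) x ==> x:level_set k"
 using whitney_pos[OF lip_level_dist, of a k x] by (auto simp: near_def level_dist_def intro: ccontr)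

lemma sum_indicator_level_le:
 assumes "finite F" "F <= whitney (level_dist k)" "!!a. a:F ==> B a <= cball (ctr a) (50 * rad a)"
 shows "(SUM a:F. idr (B a) x) <= real (overlap TYPE('n)) * idr (level_set k) x"
proof (cases "x:level_set k")
 case True
 thus ?thesis using sum_indicator_whitney_le[OF lip_level_dist assms] by simp
next
 case False
 have "x~:B a" if "a:F" for a
 proof
  assume "x:B a"
  hence "x:cball (ctr a) (50 * rad a)" using assms(3)[OF that] by blast
  thus False using False near_level_set[of a k x] that assms(2) by (auto simp: near_def dist_commute)
 qed
 thus ?thesis by simp
qed

definition level_atom :: "int => 'n dyadic => 'n fn" where
 "level_atom k a = (SOME h. h:bml & (ALL x. cmod (h x) <= level_const*2 powi (k+1)) & (ALL x. x~:cball (ctr a) (26 * rad a) --> h x = 0) & (ALL psi. test_fn psi --> (LI x. h x * psi x) = transition u (level_dist k) (level_dist (k+1)) a psi) & (ALL P. poly_fn s P --> (LI x. h x * P x) = 0))"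

lemma level_atom:
 assumes a: "a:whitney (level_dist k)"
 shows "bounded_atom s (level_atom k a) (ctr a) (27 * rad a) (2*level_const*2 powi k)"
 "test_fn psi ==> (LI x. level_atom k a x * psi x) = transition u (level_dist k) (level_dist (k+1)) a psi"
proof -
 have "level_dist (k+1) x <= level_dist k x" for x by (rule level_dist_antimono) simp
 moreover have "(2::real) powi k <= 2 powi (k+1)" by (rule two_powi_mono) simp
 ultimately have spec: "level_atom k a:bml & (ALL x. cmod (level_atom k a x) <= level_const*2 powi (k+1)) & (ALL x. x~:cball (ctr a) (26 * rad a) --> level_atom k a x = 0) & (ALL psi. test_fn psi --> (LI x. level_atom k a x * psi x) = transition u (level_dist k) (level_dist (k+1)) a psi) & (ALL P. poly_fn s P --> (LI x. level_atom k a x * P x) = 0)"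
  unfolding level_atom_def by (rule someI_ex[OF transition_represented[OF controlled_level_dist controlled_level_dist _ _ a]])
 have "cball (ctr a) (26 * rad a) <= ball (ctr a) (27 * rad a)" by (rule cball_subset_ball_iff[THEN iffD2]) simp
 hence "ALL x. x~:ball (ctr a) (27 * rad a) --> level_atom k a x = 0" using spec by blast
 thus "bounded_atom s (level_atom k a) (ctr a) (27 * rad a) (2*level_const*2 powi k)"
  using spec unfolding bounded_atom_def by (auto simp: power_int_add mult_ac)
 show "test_fn psi ==> (LI x. level_atom k a x * psi x) = transition u (level_dist k) (level_dist (k+1)) a psi" using spec by blast
qed

text \<open>The atoms of all levels, enumerated along \<open>to_nat\<close>; unused indices carry the zero atom.\<close>

definition used :: "(int \<times> 'n dyadic) set" where
 "used = Sigma UNIV (%k. whitney (level_dist k))"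

definition atom_fn :: "nat => 'n fn" where
 "atom_fn j = (if j:to_nat ` used then case from_nat j of (k, a) => level_atom k a else (%x. 0))"

definition atom_ctr :: "nat => real^'n" where
 "atom_ctr j = ctr (snd (from_nat j::int \<times> 'n dyadic))"

definition atom_rad :: "nat => real" where
 "atom_rad j = 27 * rad (snd (from_nat j::int \<times> 'n dyadic))"

definition atom_size :: "nat => real" where
 "atom_size j = (if j:to_nat ` used then 2*level_const*2 powi (fst (from_nat j::int \<times> 'n dyadic)) else 0)"

lemma atom_rad_pos: "atom_rad j > 0"
 by (simp add: atom_rad_def)

lemma atom_size_nonneg: "atom_size j >= 0"
 using level_const_nonneg by (simp add: atom_size_def)

lemma bounded_atom_atom_fn: "bounded_atom s (atom_fn j) (atom_ctr j) (atom_rad j) (atom_size j)"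
proof (cases "j:to_nat ` used")
 case True
 then obtain k a where "j = to_nat (k, a)" "a:whitney (level_dist k)" by (auto simp: used_def)
 thus ?thesis using True level_atom(1) by (simp add: atom_fn_def atom_ctr_def atom_rad_def atom_size_def)
qed (simp add: atom_fn_def atom_size_def bounded_atom_def)

lemma atom_series_le:
 fixes G :: "real => ennreal"
 assumes "G 0 = 0"
 shows "(\<Sum>j. idr (ball (atom_ctr j) (atom_rad j)) x * G (atom_size j)) <= en (real (overlap TYPE('n))) * dyadic_sum (%k. G (2*level_const*2 powi k)) (gmax u x)"
proof (rule suminf_le_const[OF summableI])
 fix N
 let ?B = "%a::'n dyadic. ball (ctr a) (27 * rad a)" and ?g = "%k. G (2*level_const*2 powi k)"
 define S where "S = used Int to_nat -` {..<N}"
 define A where "A k = {a. (k, a):S}" for k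
 have finite: "finite S" "finite (A k)" for k
 proof -
  show finite: "finite S" unfolding S_def by (intro finite_Int disjI2 finite_vimageI) auto
  show "finite (A k)" by (rule finite_subset[OF _ finite_imageI[OF finite, of snd]]) (force simp: A_def)
 qed
 have A: "A k <= whitney (level_dist k)" for k by (auto simp: A_def S_def used_def)
 have "(\<Sum>j<N. idr (ball (atom_ctr j) (atom_rad j)) x * G (atom_size j)) = (SUM j:to_nat ` S. idr (ball (atom_ctr j) (atom_rad j)) x * G (atom_size j))"
  by (rule sum.mono_neutral_right) (auto simp: S_def atom_size_def assms)
 also have "... = (SUM p:S. idr (?B (snd p)) x * ?g (fst p))"
  by (subst sum.reindex) (auto simp: atom_ctr_def atom_rad_def atom_size_def S_def intro!: sum.cong)
 also have "... = (SUM k:fst ` S. SUM a:A k. idr (?B a) x * ?g k)"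
  by (subst sum.Sigma) (use finite in "force simp: case_prod_unfold A_def intro!: sum.cong")+
 also have "... <= (SUM k:fst ` S. en (real (overlap TYPE('n))) * (if en (2 powi k) < gmax u x then ?g k else 0))"
 proof (rule sum_mono)
  fix k
  have "(SUM a:A k. idr (?B a) x * ?g k) = en (SUM a:A k. idr (?B a) x) * ?g k"
   by (simp add: sum_distrib_right[symmetric] sum_ennreal[symmetric] ennreal_indicator)
  also have "... <= en (real (overlap TYPE('n)) * idr (level_set k) x) * ?g k"
   by (intro mult_right_mono ennreal_leI sum_indicator_level_le finite A ball_subset_cball_iff[THEN iffD2]) auto
  finally show "(SUM a:A k. idr (?B a) x * ?g k) <= en (real (overlap TYPE('n))) * (if en (2 powi k) < gmax u x then ?g k else 0)"
   by (auto simp: level_set_def split: split_indicator_asm)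
 qed
 also have "... = en (real (overlap TYPE('n))) * (\<integral>\<^sup>+k. (if en (2 powi k) < gmax u x then ?g k else 0) * idr (fst ` S) k \<partial>count_space UNIV)"
  using finite by (subst nn_integral_count_space_indicator[symmetric]) (auto simp: sum_distrib_left nn_integral_count_space_finite)
 also have "... <= en (real (overlap TYPE('n))) * (\<integral>\<^sup>+k. (if en (2 powi k) < gmax u x then ?g k else 0) \<partial>count_space UNIV)"
  by (intro mult_left_mono nn_integral_mono) (auto split: split_indicator)
 finally show "(\<Sum>j<N. idr (ball (atom_ctr j) (atom_rad j)) x * G (atom_size j)) <= en (real (overlap TYPE('n))) * (\<integral>\<^sup>+k. (if en (2 powi k) < gmax u x then ?g k else 0) \<partial>count_space UNIV)" .
qed

lemma atom_size_series_le:
 "(\<Sum>j. idr (ball (atom_ctr j) (atom_rad j)) x * en (atom_size j)) <= en (4 * real (overlap TYPE('n)) * level_const) * gmax u x"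
proof -
 have "dyadic_sum (%k. en (2*level_const*2 powi k)) (gmax u x) = (\<integral>\<^sup>+k. en (2*level_const) * (if en (2 powi k) < gmax u x then en (2 powi k) else 0) \<partial>count_space UNIV)"
  using level_const_nonneg by (intro nn_integral_cong) (simp add: ennreal_mult)
 also have "... = en (2*level_const) * (\<integral>\<^sup>+k. (if en (2 powi k) < gmax u x then en (2 powi k) else 0) \<partial>count_space UNIV)"
  by (rule nn_integral_cmult) simp
 also have "... <= en (2*level_const) * (2 * gmax u x)" by (intro mult_left_mono dyadic_sum_le) auto
 finally have "(\<Sum>j. idr (ball (atom_ctr j) (atom_rad j)) x * en (atom_size j)) <= en (real (overlap TYPE('n))) * (en (2*level_const) * (en 2 * gmax u x))"
  by (intro order_trans[OF atom_series_le[of ennreal] mult_left_mono]) auto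
 also have "... = en (4 * real (overlap TYPE('n)) * level_const) * gmax u x"
  using level_const_nonneg by (simp only: mult.assoc[symmetric] ennreal_mult[symmetric] of_nat_0_le_iff mult_nonneg_nonneg zero_le_numeral) (simp add: mult_ac)
 finally show ?thesis .
qed

lemma atom_Phi_series_le:
 assumes lam: "lam > 0"
 shows "(\<Sum>j. idr (ball (atom_ctr j) (atom_rad j)) x * Phi x (en (atom_size j / lam))) <= en atom_modular_const * Phi x (gmax u x / en lam)"
proof -
 let ?c = "L * max 1 (2*level_const)"
 have c: "?c >= 0" using L_ge_1 by simp
 have "Phi x (en (2*level_const*2 powi k/lam)) <= en ?c * Phi x (en (2 powi k/lam))" for k :: int
  using Phi_scale[of "2*level_const" x "en (2 powi k/lam)"] level_const_nonneg lam by (simp add: ennreal_mult[symmetric])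
 hence "dyadic_sum (%k. Phi x (en (2*level_const*2 powi k/lam))) (gmax u x) <= (\<integral>\<^sup>+k. en ?c * (if en (2 powi k) < gmax u x then Phi x (en (2 powi k/lam)) else 0) \<partial>count_space UNIV)"
  by (intro nn_integral_mono) auto
 also have "... = en ?c * (\<integral>\<^sup>+k. (if en (2 powi k) < gmax u x then Phi x (en (2 powi k/lam)) else 0) \<partial>count_space UNIV)"
  by (rule nn_integral_cmult) simp
 also have "... <= en ?c * (en dyadic_const * Phi x (gmax u x / en lam))" by (intro mult_left_mono dyadic_const lam) auto
 finally have "(\<Sum>j. idr (ball (atom_ctr j) (atom_rad j)) x * Phi x (en (atom_size j / lam))) <= en (real (overlap TYPE('n))) * (en ?c * (en dyadic_const * Phi x (gmax u x / en lam)))"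
  by (intro order_trans[OF atom_series_le[of "%t. Phi x (en (t/lam))"] mult_left_mono]) auto
 also have "... = en atom_modular_const * Phi x (gmax u x / en lam)"
 proof -
  have "en atom_modular_const = en (real (overlap TYPE('n))) * (en ?c * en dyadic_const)"
   unfolding atom_modular_const_def using c dyadic_const_pos by (subst ennreal_mult, simp, simp, subst ennreal_mult) auto
  thus ?thesis by (simp only: mult.assoc)
 qed
 finally show ?thesis .
qed

lemma sum_Phi_int_atoms_le:
 assumes "lam > 0"
 shows "(\<Sum>j. Phi_int (ball (atom_ctr j) (atom_rad j)) (atom_size j / lam)) <= en atom_modular_const * modular (%x. gmax u x / en lam)"
proof -
 have "(\<Sum>j. Phi_int (ball (atom_ctr j) (atom_rad j)) (atom_size j / lam)) = (NN x. (\<Sum>j. Phi x (en (atom_size j / lam)) * idr (ball (atom_ctr j) (atom_rad j)) x))"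
  unfolding Phi_int_def by (rule nn_integral_suminf[symmetric]) measurable
 also have "... <= (NN x. en atom_modular_const * Phi x (gmax u x / en lam))"
  using atom_Phi_series_le[OF assms] by (intro nn_integral_mono) (simp add: mult.commute)
 also have "... = en atom_modular_const * modular (%x. gmax u x / en lam)" by (rule nn_integral_cmult) measurable
 finally show ?thesis .
qed

definition bad_sum :: "int => 'n fn => complex" where
 "bad_sum k psi = (\<Sum>\<^sub>\<infinity>a\<in>whitney (level_dist k). bad_part u a (zeta (level_dist k) a) psi)"

lemma bad_sum_at_bottom:
 assumes "test_fn psi" shows "(%n. bad_sum (- int n) psi) ~~> u psi"
proof -
 have "(2::real) powi (- int n) = (1/2)^n" for n by (simp add: power_int_minus power_one_over inverse_eq_divide)
 hence "norm (u psi - bad_sum (- int n) psi) <= good_const*(LI x. cmod (psi x))*(1/2)^n" for n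
  using good_part_bound[OF controlled_level_dist assms, of "- int n"] by (simp add: bad_sum_def mult_ac)
 moreover have "(%n. good_const*(LI x. cmod (psi x))*(1/2)^n) ~~> 0"
  by (intro tendsto_mult_right_zero LIMSEQ_power_zero) simp
 ultimately have "(%n. u psi - bad_sum (- int n) psi) ~~> 0"
  by (rule Lim_null_comparison[OF always_eventually[OF allI]])
 from tendsto_diff[OF tendsto_const[of "u psi"] this] show ?thesis by simp
qed

abbreviation upper_modular :: "int => ennreal" where
 "upper_modular k == (NN x. Phi x (gmax u x) * idr (level_set k) x)"

lemma modular_level_set_tendsto_0: "(%n. upper_modular (int n)) ~~> 0"
proof -
 have "(%n. upper_modular (int n)) ~~> (NN x::real^'n. 0)"
 proof (rule nn_integral_dominated_convergence[where u = "%n x. Phi x (gmax u x) * idr (level_set (int n)) x" and u' = "%x. 0" and w = "%x. Phi x (gmax u x)"])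
  have "AL x. Phi x (gmax u x) ~= \<infinity>" by (rule nn_integral_PInf_AE) (use modular_u in auto)
  thus "AL x. (%n. Phi x (gmax u x) * idr (level_set (int n)) x) ~~> 0"
  proof eventually_elim
   case (elim x)
   then obtain g where g: "gmax u x = en g" "g >= 0" using Phi_top[of x] by (cases "gmax u x") auto
   obtain m where m: "g < 2^m" using real_arch_pow[of 2 g] by auto
   have "x~:level_set (int n)" if "n >= m" for n
   proof -
    have "(2::real)^m <= 2^n" using that by (intro power_increasing) auto
    hence "g <= 2^n" using m by linarith
    thus ?thesis using g by (simp add: level_set_def not_less ennreal_leI)
   qed
   thus ?case by (intro tendsto_eventually eventually_sequentiallyI[of m]) auto
  qed
 qed (use modular_u in "auto split: split_indicator")
 thus ?thesis by simp
qed

lemma bad_part_level_bound: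
 assumes t: "test_fn psi"
 shows "EX C>=0. ALL k a x. k >= 0 --> a:whitney (level_dist k) --> x:ball 0 1 --> cmod (bad_part u a (zeta (level_dist k) a) psi) <= C*(2 powi k * decay (rad a) (ctr a) x)"
proof -
 let ?M = "CARD('n) + mm+1"
 obtain R where R: "R > 0" "!!x. x~:cball 0 R ==> psi x = 0" using test_fn_support[OF t] by blast
 obtain D where D: "D > 0" "pd_bound (Suc mm) D 1 UNIV psi" using test_fn_pd_bound[OF t] by blast
 define E where "E = max 1 (level_dist 0 0 + R)"
 define E' where "E' = E+(1+R + 2*E)"
 define C where "C = far_const*zeta_const*D*E'^?M"
 have C: "C >= 0" using far_const_nonneg zeta_const_pos D R by (simp add: C_def E'_def E_def)
 have "cmod (bad_part u a (zeta (level_dist k) a) psi) <= C*(2 powi k * decay (rad a) (ctr a) x)"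
  if k: "k >= 0" and a: "a:whitney (level_dist k)" and x: "x:ball 0 1" for k a x
 proof (cases "wball a Int cball 0 R = {}")
  case True
  hence "bad_part u a (zeta (level_dist k) a) psi = bad_part u a (zeta (level_dist k) a) (%x. 0 * psi x)"
   using R(2) True by (intro bad_part_cong zeta_eq_0) (auto simp: disjoint_iff)
  also have "... = 0" using bad_part_cmult[OF linear_u zeta_test_fn[of "level_dist k" a] test_fn_smooth[OF t], of a 0] by simp
  finally show ?thesis using C decay_bounds[of "rad a" "ctr a" x] by simp
 next
  case False
  have rad: "rad a <= E"
   using whitney_rad_le[OF lip_level_dist a False] level_dist_antimono[OF k, of 0] unfolding E_def by linarith
  obtain z where z: "z:wball a" "norm z <= R" using False by auto
  have "dist x (ctr a) <= norm x + norm z + dist z (ctr a)"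
   using dist_triangle[of x "ctr a" z] norm_triangle_ineq4[of x z] by (simp add: dist_norm)
  hence "rad a + dist x (ctr a) <= E'" using z rad x by (simp add: E'_def wball_def dist_commute)
  hence "rad a * (rad a + dist x (ctr a)) <= rad a * E'" by (intro mult_left_mono) auto
  hence "rad a <= E'*(rad a / (rad a + dist x (ctr a)))" by (simp add: pos_le_divide_eq add_pos_nonneg mult.commute)
  hence "scl a <= E'*(rad a / (rad a + dist x (ctr a)))" using scl_le_rad[of a] by linarith
  hence "scl a^?M <= (E'*(rad a / (rad a + dist x (ctr a))))^?M" by (intro power_mono) auto
  hence "far_const*zeta_const*2 powi k*D * scl a^?M <= far_const*zeta_const*2 powi k*D*(E'^?M * decay (rad a) (ctr a) x)"
   unfolding decay_def power_mult_distrib using far_const_nonneg zeta_const_pos D by (intro mult_left_mono) auto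
  moreover have "cmod (bad_part u a (zeta (level_dist k) a) psi) <= far_const*zeta_const*2 powi k*D * scl a^?M"
   using pd_boundD[OF D(2)] D(1)
   by (intro bad_part_taylor_bound[OF controlled_level_dist a adapted_zeta[OF lip_level_dist] test_fn_smooth[OF t]]) auto
  ultimately show ?thesis by (simp add: C_def mult_ac)
 qed
 thus ?thesis using C by blast
qed

lemma sum_Phi_ball_level_le:
 assumes F: "finite F" "F <= whitney (level_dist k)"
 shows "(SUM a:F. Phi_int (ball (ctr a) (rad a)) (2 powi k)) <= en (real (overlap TYPE('n))) * upper_modular k"
proof -
 let ?o = "real (overlap TYPE('n))"
 have "(SUM a:F. Phi_int (ball (ctr a) (rad a)) (2 powi k)) = (NN x. (SUM a:F. Phi x (en (2 powi k)) * idr (ball (ctr a) (rad a)) x))"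
  unfolding Phi_int_def by (rule nn_integral_sum[symmetric]) measurable
 also have "... <= (NN x. en ?o * (Phi x (gmax u x) * idr (level_set k) x))"
 proof (rule nn_integral_mono)
  fix x
  have "(SUM a:F. Phi x (en (2 powi k)) * idr (ball (ctr a) (rad a)) x) = Phi x (en (2 powi k)) * en (SUM a:F. idr (ball (ctr a) (rad a)) x)"
   by (simp add: sum_distrib_left[symmetric] sum_ennreal[symmetric] ennreal_indicator)
  also have "... <= Phi x (en (2 powi k)) * en (?o * idr (level_set k) x)"
   by (intro mult_left_mono ennreal_leI sum_indicator_level_le F ball_subset_cball_iff[THEN iffD2]) auto
  also have "... <= en ?o * (Phi x (gmax u x) * idr (level_set k) x)"
   by (auto simp: level_set_def mult.commute intro!: mult_left_mono Phi_mono split: split_indicator)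
  finally show "(SUM a:F. Phi x (en (2 powi k)) * idr (ball (ctr a) (rad a)) x) <= en ?o * (Phi x (gmax u x) * idr (level_set k) x)" .
 qed
 also have "... = en ?o * upper_modular k" by (rule nn_integral_cmult) measurable
 finally show ?thesis .
qed

lemma bad_sum_modular_bound:
 assumes t: "test_fn psi"
 shows "EX C. ALL n F. finite F --> F <= whitney (level_dist (int n)) --> Phi_int (ball 0 1) (SUM a:F. cmod (bad_part u a (zeta (level_dist (int n)) a) psi)) <= en C * upper_modular (int n)"
proof -
 obtain C1 where C1: "C1 >= 0" and bound: "!!k a x. k >= 0 ==> a:whitney (level_dist k) ==> x:ball 0 1 ==> cmod (bad_part u a (zeta (level_dist k) a) psi) <= C1*(2 powi k * decay (rad a) (ctr a) x)"
  using bad_part_level_bound[OF t] by metis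
 obtain C2 where C2: "C2 > 0" "!!c r t. r > 0 ==> t > 0 ==> modular (%x. en (t * decay r c x)) <= en C2 * Phi_int (ball c r) t"
  using Phi_decay_integral by blast
 let ?c = "L * max 1 C1" and ?o = "real (overlap TYPE('n))"
 have "Phi_int (ball 0 1) (SUM a:F. cmod (bad_part u a (zeta (level_dist (int n)) a) psi)) <= en (?c*(L*(C2*?o))) * upper_modular (int n)"
  if F: "finite F" "F <= whitney (level_dist (int n))" for n F
 proof -
  let ?b = "%a. cmod (bad_part u a (zeta (level_dist (int n)) a) psi)" and ?d = "%a x. 2 powi int n * decay (rad a) (ctr a) x"
  have d: "?d a x >= 0" for a :: "'n dyadic" and x using decay_bounds[of "rad a" "ctr a" x] by simp
  have "Phi x (en (sum ?b F)) * idr (ball 0 1) x <= Phi x (en C1 * (SUM a:F. en (?d a x)))" for x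
  proof (cases "x:ball 0 1")
   case True
   have "sum ?b F <= C1*(SUM a:F. ?d a x)" unfolding sum_distrib_left using bound[OF of_nat_0_le_iff _ True] F by (intro sum_mono) auto
   thus ?thesis using True C1 d by (auto simp: ennreal_mult[symmetric] sum_nonneg intro!: Phi_mono ennreal_leI)
  qed simp
  hence "Phi_int (ball 0 1) (sum ?b F) <= modular (%x. en C1 * (SUM a:F. en (?d a x)))"
   unfolding Phi_int_def by (rule nn_integral_mono)
  also have "... <= en ?c * modular (%x. SUM a:F. en (?d a x))" by (rule Phi_modular_scale[OF _ C1]) measurable
  also have "modular (%x. SUM a:F. en (?d a x)) <= (NN x. en L * (SUM a:F. Phi x (en (?d a x))))"
   by (intro nn_integral_mono Phi_sum F)
  also have "... = en L * (SUM a:F. modular (%x. en (?d a x)))"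
   by (subst nn_integral_cmult, measurable, subst nn_integral_sum, measurable)
  also have "(SUM a:F. modular (%x. en (?d a x))) <= (SUM a:F. en C2 * Phi_int (ball (ctr a) (rad a)) (2 powi int n))"
   by (intro sum_mono C2(2)) auto
  also have "... <= en C2 * (en ?o * upper_modular (int n))"
   unfolding sum_distrib_left[symmetric] by (intro mult_left_mono sum_Phi_ball_level_le F) simp
  finally show ?thesis using L_ge_1 C2(1) by (simp add: ennreal_mult mult.assoc mult_left_mono)
 qed
 thus ?thesis by blast
qed

lemma bad_sum_at_top:
 assumes t: "test_fn psi" shows "(%n. bad_sum (int n) psi) ~~> 0"
proof (rule tendstoI)
 fix e :: real assume e: "e > 0"
 define ep where "ep n = upper_modular (int n)" for n
 obtain C where bound: "ALL n F. finite F --> F <= whitney (level_dist (int n)) --> Phi_int (ball 0 1) (SUM a:F. cmod (bad_part u a (zeta (level_dist (int n)) a) psi)) <= en C * ep n"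
  using bad_sum_modular_bound[OF t] unfolding ep_def by blast
 have "(%n. en C * ep n) ~~> 0"
  using ennreal_tendsto_cmult[OF _ modular_level_set_tendsto_0, of "en C"] by (simp add: ep_def)
 moreover have "0 < Phi_int (ball 0 1) (e/2)" using e by (intro Phi_int_pos) auto
 ultimately have "\<forall>\<^sub>F n in sequentially. en C * ep n < Phi_int (ball 0 1) (e/2)" by (rule order_tendstoD)
 thus "\<forall>\<^sub>F n in sequentially. dist (bad_sum (int n) psi) 0 < e"
 proof eventually_elim
  case (elim n)
  have "norm (bad_sum (int n) psi) <= e/2"
   unfolding bad_sum_def
  proof (rule abs_summable_bounded(2), rule ccontr)
   fix F assume F: "finite F" "F <= whitney (level_dist (int n))"
    and large: "~(SUM a:F. cmod (bad_part u a (zeta (level_dist (int n)) a) psi)) <= e/2"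
   have "Phi_int (ball 0 1) (e/2) <= Phi_int (ball 0 1) (SUM a:F. cmod (bad_part u a (zeta (level_dist (int n)) a) psi))"
    unfolding Phi_int_def using large by (intro nn_integral_mono mult_right_mono Phi_mono ennreal_leI) auto
   thus False using bound[rule_format, OF F] elim by simp
  qed
  thus ?case using e by simp
 qed
qed

lemma atoms_abs_summable:
 assumes t: "test_fn psi" shows "summable (%j. norm (LI x. atom_fn j x * psi x))"
proof -
 obtain R where R: "R > 0" "!!x. x~:cball 0 R ==> psi x = 0" using test_fn_support[OF t] by blast
 obtain D where D: "D > 0" "pd_bound (Suc mm) D 1 UNIV psi" using test_fn_pd_bound[OF t] by blast
 define B where "B = (1+R+0)^((mm+2)*(CARD('n) + 1))*D*1^CARD('n)"
 have "psi z = 0" if "z~:cball 0 (R*1)" for z using R(2) that by simp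
 then obtain chi where chi: "chi:S_m mm" "psi = (%z. of_real B * dilate chi 1 0 z)"
  unfolding B_def using R(1) D by (auto intro: bump_eq_dilate[of psi 0 R 1 D 0 0, OF t])
 obtain C where C: "C > 0" "!!c r A lam. (ALL j::nat. r j > 0 & A j >= 0) ==> lam > 0 ==> modular (%x. (\<Sum>j. en (A j * decay (r j) (c j) x)) / en lam) <= en C * (\<Sum>j. Phi_int (ball (c j) (r j)) (A j / lam))"
  using Phi_decay_series by blast
 let ?d = "%j x. atom_size j * decay (atom_rad j) (atom_ctr j) x"
 have d: "?d j x >= 0" for j x using atom_size_nonneg[of j] decay_bounds[OF atom_rad_pos[of j], of "atom_ctr j" x] by simp
 have "modular (%x. (\<Sum>j. en (?d j x)) / en 1) <= en C * (\<Sum>j. Phi_int (ball (atom_ctr j) (atom_rad j)) (atom_size j / 1))"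
  by (rule C(2)) (use atom_rad_pos atom_size_nonneg in auto)
 also have "... <= en C * (en atom_modular_const * modular (%x. gmax u x / en 1))" by (intro mult_left_mono sum_Phi_int_atoms_le) auto
 also have "... < \<infinity>" using modular_u by (simp add: ennreal_mult_less_top del: ennreal_1)
 finally have "modular (%x. \<Sum>j. en (?d j x)) < \<infinity>" by (simp del: ennreal_1)
 then obtain x where x: "x:ball 0 1" "Phi x (\<Sum>j. en (?d j x)) ~= \<infinity>"
  using nn_integral_finite_point[of "%x. Phi x (\<Sum>j. en (?d j x))" 1 0] by auto
 hence "(\<Sum>j. en (?d j x)) ~= top" using Phi_top[of x] by auto
 hence summable: "summable (%j. ?d j x)" using d by (intro summable_suminf_not_top)
 have "norm (LI z. atom_fn j z * psi z) <= abs B * atom_const * ?d j x" for j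
 proof -
  have "(LI z. atom_fn j z * psi z) = of_real B * (LI z. atom_fn j z * dilate chi 1 0 z)"
   unfolding chi(2) by (subst integral_mult_right_zero[symmetric]) (simp add: mult.left_commute)
  moreover have "cmod (LI z. atom_fn j z * dilate chi 1 0 z) <= atom_const * atom_size j * decay (atom_rad j) (atom_ctr j) x"
   by (rule bounded_atom_pairing[OF bounded_atom_mono[OF bounded_atom_atom_fn s_ge] atom_rad_pos chi(1)]) (use x(1) in auto)
  ultimately show ?thesis by (simp add: norm_mult mult.assoc mult_left_mono)
 qed
 thus ?thesis by (intro summable_comparison_test'[OF summable_mult[OF summable, of "abs B * atom_const"], of 0]) simp
qed

lemma infsum_level_atoms:
 assumes t: "test_fn psi"
 shows "(\<Sum>\<^sub>\<infinity>a\<in>whitney (level_dist k). (LI x. level_atom k a x * psi x)) = bad_sum k psi - bad_sum (k+1) psi"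
proof -
 have "(\<Sum>\<^sub>\<infinity>a\<in>whitney (level_dist k). (LI x. level_atom k a x * psi x)) = (\<Sum>\<^sub>\<infinity>a\<in>whitney (level_dist k). transition u (level_dist k) (level_dist (k+1)) a psi)"
  by (intro infsum_cong level_atom(2) t)
 also have "... = bad_sum k psi - bad_sum (k+1) psi"
  unfolding bad_sum_def
  by (rule infsum_transition[OF controlled_level_dist controlled_level_dist level_dist_antimono two_powi_mono t]) auto
 finally show ?thesis .
qed

lemma atoms_sums:
 assumes t: "test_fn psi" shows "(%j. (LI x. atom_fn j x * psi x)) sums u psi"
proof -
 let ?I = "%j. (LI x. atom_fn j x * psi x)" and ?J = "%(k, a). (LI x. level_atom k a x * psi x)"
 have sums: "?I sums suminf ?I" using summable_norm_cancel[OF atoms_abs_summable[OF t]] by (rule summable_sums)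
 hence "(?I has_sum suminf ?I) UNIV" by (rule norm_summable_imp_has_sum[OF atoms_abs_summable[OF t]])
 hence "(?I has_sum suminf ?I) (to_nat ` used)" by (rule has_sum_cong_neutral[THEN iffD1, rotated -1]) (auto simp: atom_fn_def)
 hence "((?I \<circ> to_nat) has_sum suminf ?I) used" by (subst has_sum_reindex[symmetric]) (auto intro: inj_on_subset[OF inj_to_nat])
 hence J: "(?J has_sum suminf ?I) used" by (rule has_sum_cong[THEN iffD1, rotated]) (auto simp: atom_fn_def)
 hence summable: "?J summable_on used" by (rule has_sum_imp_summable)
 have "suminf ?I = (\<Sum>\<^sub>\<infinity>k. bad_sum k psi - bad_sum (k+1) psi)"
  using infsumI[OF J] infsum_Sigma'_banach[OF summable[unfolded used_def]] by (simp add: used_def infsum_level_atoms[OF t])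
 also have "... = u psi - 0"
  using summable_on_Sigma_banach[OF summable[unfolded used_def]]
  by (intro infsum_telescope_int bad_sum_at_bottom bad_sum_at_top t) (simp add: infsum_level_atoms[OF t])
 finally show ?thesis using sums by simp
qed

end

end

subsection \<open>The Hardy-Littlewood maximal function\<close>

definition HL :: "(real^'n::finite => ennreal) => real^'n => ennreal" where
 "HL g x = Sup {en (1/rho^CARD('n)) * (NN z. g z * idr (ball y rho) z) | y rho. dist y x < rho}"

lemma pos_of_dist_less: "dist y x < rho ==> rho > (0::real)"
 by (meson le_less_trans zero_le_dist)

lemma ennreal_power_inverse_cancel: "rho > 0 ==> en (rho^n) * (en (1/rho^n) * v) = v"
 by (simp add: mult.assoc[symmetric] ennreal_mult[symmetric])

lemma HL_upper:
 fixes y :: "real^'n::finite"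
 assumes "dist y x < rho" shows "(NN z. g z * idr (ball y rho) z) <= en (rho^CARD('n)) * HL g x"
proof -
 have "en (1/rho^CARD('n)) * (NN z. g z * idr (ball y rho) z) <= HL g x"
  unfolding HL_def by (rule Sup_upper) (use assms in blast)
 hence "en (rho^CARD('n)) * (en (1/rho^CARD('n)) * (NN z. g z * idr (ball y rho) z)) <= en (rho^CARD('n)) * HL g x"
  by (rule mult_left_mono) simp
 thus ?thesis unfolding ennreal_power_inverse_cancel[OF pos_of_dist_less[OF assms]] .
qed

lemma less_HL:
 fixes x :: "real^'n::finite"
 assumes "a < HL g x"
 obtains y rho where "x:ball y rho" "rho > 0" "a * en (rho^CARD('n)) <= (NN z. g z * idr (ball y rho) z)" "ball y rho <= {x. a < HL g x}"
proof -
 obtain y rho where y: "dist y x < rho" "a < en (1/rho^CARD('n)) * (NN z. g z * idr (ball y rho) z)"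
  using assms unfolding HL_def less_Sup_iff by blast
 note rho = pos_of_dist_less[OF y(1)]
 have "en (rho^CARD('n)) * a <= en (rho^CARD('n)) * (en (1/rho^CARD('n)) * (NN z. g z * idr (ball y rho) z))"
  using y(2) by (intro mult_left_mono) auto
 hence "a * en (rho^CARD('n)) <= (NN z. g z * idr (ball y rho) z)"
  unfolding ennreal_power_inverse_cancel[OF rho] by (simp add: mult.commute)
 moreover have "a < HL g x'" if "x':ball y rho" for x'
  using y(2) that unfolding HL_def less_Sup_iff by auto
 ultimately show ?thesis by (intro that[of y rho]) (use y(1) rho in auto)
qed

lemma HL_measurable [measurable]: "HL (g::real^'n::finite => ennreal):bml"
proof (rule borel_measurableI_greater)
 fix a :: ennreal
 have "open {x. a < HL g x}"
 proof (subst open_subopen, intro ballI)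
  fix x assume "x:{x. a < HL g x}"
  then obtain y rho where "x:ball y rho" "ball y rho <= {x. a < HL g x}" using less_HL[of a g x] by (metis mem_Collect_eq)
  thus "EX T. open T & x:T & T <= {x. a < HL g x}" by (intro exI[of _ "ball y rho"]) auto
 qed
 thus "{x:space lbg. a < HL g x}:sets lbg" by simp
qed

lemma HL_superlevel_sets [measurable, simp]: "{x. a < HL (g::real^'n::finite => ennreal) x}:sets lbg"
proof -
 have "{x:space lbg. a < HL g x}:sets lbg" by measurable
 thus ?thesis by simp
qed

lemma emeasure_UN_le_countable:
 assumes I: "countable I" and X [measurable]: "!!i. i:I ==> X i:sets M"
 shows "emeasure M (UN i:I. X i) <= (\<integral>\<^sup>+i. emeasure M (X i) \<partial>count_space I)"
proof -
 have "idr (UN i:I. X i) x <= (\<integral>\<^sup>+i. idr (X i) x \<partial>count_space I)" for x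
 proof (cases "x:(UN i:I. X i)")
  case True
  then obtain i where i: "i:I" "x:X i" by blast
  hence "1 = (\<integral>\<^sup>+j. idr {i} j \<partial>count_space I)" by simp
  also have "... <= (\<integral>\<^sup>+j. idr (X j) x \<partial>count_space I)" using i by (intro nn_integral_mono) (auto split: split_indicator)
  finally show ?thesis using True by simp
 qed simp
 hence "(\<integral>\<^sup>+x. idr (UN i:I. X i) x \<partial>M) <= (\<integral>\<^sup>+x. \<integral>\<^sup>+i. idr (X i) x \<partial>count_space I \<partial>M)"
  by (rule nn_integral_mono)
 also have "... = (\<integral>\<^sup>+i. \<integral>\<^sup>+x. idr (X i) x \<partial>M \<partial>count_space I)" by (rule nn_integral_count_space_nn_integral[OF I]) measurable
 also have "... = (\<integral>\<^sup>+i. emeasure M (X i) \<partial>count_space I)" by (intro nn_integral_cong) simp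
 finally show ?thesis using sets.countable_UN'[OF I, of X M] X by (simp add: image_subset_iff)
qed

lemma HL_weak_type:
 fixes g :: "real^'n::finite => ennreal"
 assumes g [measurable]: "g:bml" and finite: "(NN x. g x) < \<infinity>" and lam: "lam > 0"
 shows "en lam * emeasure lbg {x. en lam < HL g x} <= en (unit_ball_vol (real CARD('n)) * 5^CARD('n)) * (NN x. g x)"
proof -
 let ?n = "CARD('n)" and ?E = "{x. en lam < HL g x}"
 let ?A = "unit_ball_vol (real ?n) * 5^?n"
 define K where "K = {(y, rho). rho > 0 & en lam * en (rho^?n) <= (NN z. g z * idr (ball y rho) z)}"
 define Q where "Q = enn2real (NN x. g x) / lam"
 have cover: "?E <= (UN i:K. ball (fst i) (snd i))"
 proof
  fix x assume "x:?E"
  then obtain y rho where "x:ball y rho" "rho > 0" "en lam * en (rho^?n) <= (NN z. g z * idr (ball y rho) z)"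
   using less_HL[of "en lam" g x] by (metis mem_Collect_eq)
  thus "x:(UN i:K. ball (fst i) (snd i))" by (intro UN_I[of "(y, rho)"]) (auto simp: K_def)
 qed
 have radius: "0 < snd i & snd i <= max 1 Q" if "i:K" for i
 proof -
  obtain y rho where i: "i = (y, rho)" "rho > 0" "en lam * en (rho^?n) <= (NN z. g z * idr (ball y rho) z)" using \<open>i \<in> K\<close> by (auto simp: K_def)
  have "en (lam*rho^?n) <= (NN z. g z * idr (ball y rho) z)" using i lam by (simp add: ennreal_mult)
  also have "... <= (NN x. g x)" by (intro nn_integral_mono) (auto split: split_indicator)
  also have "... = en (enn2real (NN x. g x))" using finite by simp
  finally have "rho^?n <= Q" using lam by (simp add: ennreal_le_iff Q_def pos_le_divide_eq mult.commute)
  moreover have "rho <= rho^?n" if "rho >= 1" using that by (intro self_le_power) auto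
  ultimately show ?thesis using i by fastforce
 qed
 obtain C where C: "countable C" "C <= K" "pairwise (%i j. disjnt (ball (fst i) (snd i)) (ball (fst j) (snd j))) C"
  "?E <= (UN i:C. ball (fst i) (5 * snd i))"
  by (rule Vitali_covering_lemma_balls[OF cover]) (erule radius, rule that)
 have single: "en lam * emeasure lbg (ball (fst i) (5 * snd i)) <= en ?A * (NN z. g z * idr (ball (fst i) (snd i)) z)" if "i:C" for i
 proof -
  have i: "snd i > 0" "en lam * en (snd i^?n) <= (NN z. g z * idr (ball (fst i) (snd i)) z)" using that C(2) by (auto simp: K_def)
  have "en lam * emeasure lbg (ball (fst i) (5 * snd i)) = en ?A * (en lam * en (snd i^?n))"
   using content_ball[of "5 * snd i" "fst i"] i(1) lam by (simp add: emeasure_eq_measure2 power_mult_distrib ennreal_mult[symmetric] mult_ac)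
  thus ?thesis using mult_left_mono[OF i(2), of "en ?A"] by simp
 qed
 have "emeasure lbg ?E <= emeasure lbg (UN i:C. ball (fst i) (5 * snd i))" by (rule emeasure_mono[OF C(4)]) (auto intro: sets.countable_UN' C(1))
 also have "... <= (\<integral>\<^sup>+i. emeasure lbg (ball (fst i) (5 * snd i)) \<partial>count_space C)" by (rule emeasure_UN_le_countable[OF C(1)]) auto
 finally have "en lam * emeasure lbg ?E <= (\<integral>\<^sup>+i. en lam * emeasure lbg (ball (fst i) (5 * snd i)) \<partial>count_space C)"
  by (simp add: nn_integral_cmult mult_left_mono)
 also have "... <= (\<integral>\<^sup>+i. en ?A * emeasure (density lbg g) (ball (fst i) (snd i)) \<partial>count_space C)"
  using single by (intro nn_integral_mono) (simp add: emeasure_density)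
 also have "... = en ?A * emeasure (density lbg g) (UN i:C. ball (fst i) (snd i))"
  using C(3) by (subst emeasure_UN_countable[OF _ C(1)]) (auto simp: nn_integral_cmult disjoint_family_on_def pairwise_def disjnt_def)
 also have "... <= en ?A * (NN x. g x)"
  using emeasure_space[of "density lbg g" "UN i:C. ball (fst i) (snd i)"] by (intro mult_left_mono) (auto simp: emeasure_density)
 finally show ?thesis .
qed

lemma HL_le_add_const:
 fixes g h :: "real^'n::finite => ennreal"
 assumes [measurable]: "h:bml" and bound: "!!x. g x <= h x + en s" and s: "s >= 0"
 shows "HL g x <= HL h x + en (unit_ball_vol (real CARD('n)) * s)"
 unfolding HL_def[of g]
proof (rule Sup_least, safe)
 fix y rho assume y: "dist y x < rho"
 let ?n = "CARD('n)" and ?v = "unit_ball_vol (real CARD('n))"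
 note rho = pos_of_dist_less[OF y]
 have "(NN z. g z * idr (ball y rho) z) <= (NN z. h z * idr (ball y rho) z + en s * idr (ball y rho) z)"
  using bound by (intro nn_integral_mono) (auto split: split_indicator)
 also have "... = (NN z. h z * idr (ball y rho) z) + en s * emeasure lbg (ball y rho)"
  by (subst nn_integral_add) (auto simp: nn_integral_cmult)
 also have "en s * emeasure lbg (ball y rho) = en (rho^?n) * en (?v * s)"
  using content_ball[of rho y] rho s by (simp add: emeasure_eq_measure2 ennreal_mult[symmetric] mult_ac)
 also have "(NN z. h z * idr (ball y rho) z) + en (rho^?n) * en (?v * s) <= en (rho^?n) * (HL h x + en (?v * s))"
  unfolding distrib_left by (intro add_right_mono HL_upper[OF y])
 finally have "en (1/rho^?n) * (NN z. g z * idr (ball y rho) z) <= en (1/rho^?n) * (en (rho^?n) * (HL h x + en (?v * s)))"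
  by (intro mult_left_mono) auto
 also have "... = HL h x + en (?v * s)" using ennreal_power_inverse_cancel[OF rho, of ?n] by (simp add: mult.left_commute)
 finally show "en (1/rho^?n) * (NN z. g z * idr (ball y rho) z) <= HL h x + en (?v * s)" .
qed

lemma HL_weak_type_truncated:
 fixes g :: "real^'n::finite => real"
 assumes g [measurable]: "g:bml" and nonneg: "!!x. g x >= 0" and square: "(NN x. en ((g x)^2)) < \<infinity>" and lam: "lam > 0"
 shows "en lam * emeasure lbg {x. en lam < HL (%x. en (g x)) x} <= en (2*(unit_ball_vol (real CARD('n)) * 5^CARD('n))) * (NN x. (if en lam < en (2 * unit_ball_vol (real CARD('n)) * g x) then en (g x) else 0))"
 (is "_ <= en (2*?A) * (NN x. ?h x)")
proof -
 let ?v = "unit_ball_vol (real CARD('n))"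
 define t where "t = lam/(2*?v)"
 have "?v > 0" by simp
 hence t: "t > 0" "?v*t = lam/2" using lam less_imp_neq[OF \<open>?v > 0\<close>, symmetric] by (simp_all add: t_def)
 have less_iff: "en lam < en (2*?v * g x) \<longleftrightarrow> t < g x" for x
  using lam nonneg[of x] \<open>?v > 0\<close> by (simp add: ennreal_less_iff t_def pos_divide_less_eq mult_ac)
 have "?h x <= en (1/t) * en ((g x)^2)" for x
 proof (cases "t < g x")
  case True
  hence "g x <= 1/t*(g x)^2" using t(1) by (simp add: pos_le_divide_eq power2_eq_square mult_left_mono)
  thus ?thesis unfolding less_iff using True t(1) by (simp add: ennreal_mult[symmetric] ennreal_leI less_imp_le)
 qed (simp add: less_iff)
 hence "(NN x. ?h x) <= en (1/t) * (NN x. en ((g x)^2))" by (subst nn_integral_cmult[symmetric]) (auto intro: nn_integral_mono)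
 also have "... < \<infinity>" using square by (simp add: ennreal_mult_less_top)
 finally have finite: "(NN x. ?h x) < \<infinity>" .
 have half: "en lam = en (lam/2) + en (lam/2)" using lam by (simp add: ennreal_plus[symmetric] del: ennreal_plus)
 have "en (lam/2) < HL ?h x" if "en lam < HL (%x. en (g x)) x" for x
 proof (rule ccontr)
  assume "~en (lam/2) < HL ?h x"
  moreover have "HL (%x. en (g x)) x <= HL ?h x + en (?v*t)"
   using t(1) nonneg unfolding less_iff by (intro HL_le_add_const) (auto intro!: ennreal_leI)
  ultimately have "HL (%x. en (g x)) x <= en lam" unfolding half t(2) by (meson add_right_mono not_less order_trans)
  thus False using that by simp
 qed
 hence "emeasure lbg {x. en lam < HL (%x. en (g x)) x} <= emeasure lbg {x. en (lam/2) < HL ?h x}" by (intro emeasure_mono) auto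
 hence "en lam * emeasure lbg {x. en lam < HL (%x. en (g x)) x} <= en 2 * (en (lam/2) * emeasure lbg {x. en (lam/2) < HL ?h x})"
  using lam by (subst mult.assoc[symmetric], subst ennreal_mult[symmetric]) (auto intro: mult_left_mono)
 also have "... <= en 2 * (en ?A * (NN x. ?h x))" using lam by (intro mult_left_mono HL_weak_type finite) auto
 also have "... = en (2*?A) * (NN x. ?h x)" by (simp add: ennreal_mult mult.assoc)
 finally show ?thesis .
qed

lemma square_le_dyadic_sum:
 "(v::ennreal)^2 <= 4 * dyadic_sum (%k. (en (2 powi k))^2) v" (is "_ <= 4*(\<integral>\<^sup>+k. ?f k \<partial>_)")
proof (cases v)
 case (real w)
 show ?thesis
 proof (cases "w > 0")
  case True
  obtain M :: int where M: "2 powi M <= w" "w < 2*2 powi M" using dyadic_level_exists[OF True] by blast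
  have pred: "(2::real) powi M = 2*2 powi (M-1)" by (simp add: power_int_diff)
  define k where "k = (if 2 powi M < w then M else M-1)"
  have k: "2 powi k < w" "w <= 2*2 powi k" using M pred by (auto simp: k_def)
  have "w^2 <= (2*2 powi k)^2" using k True by (intro power_mono) auto
  hence "en (w^2) <= en (4*(2 powi k)^2)" by (intro ennreal_leI) (simp add: power_mult_distrib)
  hence "v^2 <= 4*(en (2 powi k))^2" using real by (simp add: ennreal_power ennreal_mult)
  also have "(en (2 powi k))^2 = (\<integral>\<^sup>+i. ?f k * idr {k} i \<partial>count_space UNIV)"
   using k real by (simp add: nn_integral_cmult ennreal_lessI)
  also have "... <= (\<integral>\<^sup>+i. ?f i \<partial>count_space UNIV)" by (intro nn_integral_mono) (auto split: split_indicator)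
  finally show ?thesis by (simp add: mult_left_mono)
 qed (use real in simp)
next
 case top
 have "\<infinity> = emeasure (count_space UNIV) {0::int..}" by (subst emeasure_count_space_infinite) (auto simp: infinite_Ici)
 also have "... = (\<integral>\<^sup>+k. idr {0..} k \<partial>count_space (UNIV::int set))" by simp
 also have "... <= (\<integral>\<^sup>+k. ?f k \<partial>count_space UNIV)"
 proof (rule nn_integral_mono)
  fix k :: int
  have "1 <= en ((2 powi k)^2)" if "k >= 0" using that by (simp add: one_le_power)
  thus "idr {0..} k <= ?f k" using top by (auto simp: ennreal_power split: split_indicator)
 qed
 finally show ?thesis by (simp add: ennreal_mult_top top_unique)
qed

lemma HL_strong_type:
 fixes g :: "real^'n::finite => real"
 assumes g [measurable]: "g:bml" and nonneg: "!!x. g x >= 0" and square: "(NN x. en ((g x)^2)) < \<infinity>"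
 shows "(NN x. (HL (%x. en (g x)) x)^2) < \<infinity>"
proof -
 let ?v = "unit_ball_vol (real CARD('n))" and ?G = "%x. en (g x)"
 let ?A = "2*(?v*5^CARD('n))" and ?Z = "count_space (UNIV::int set)"
 let ?h = "%k x. if en (2 powi k) < en (2*?v * g x) then ?G x else 0"
 have "(HL ?G x)^2 <= (\<integral>\<^sup>+k. 4*((en (2 powi k))^2*idr {x. en (2 powi k) < HL ?G x} x) \<partial>?Z)" for x
  by (subst nn_integral_cmult, simp)
  (auto intro!: order_trans[OF square_le_dyadic_sum] mult_left_mono nn_integral_mono split: split_indicator)
 hence "(NN x. (HL ?G x)^2) <= (NN x. (\<integral>\<^sup>+k. 4*((en (2 powi k))^2*idr {x. en (2 powi k) < HL ?G x} x) \<partial>?Z))"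
  by (rule nn_integral_mono)
 also have "... = (\<integral>\<^sup>+k. 4*((en (2 powi k))^2 * emeasure lbg {x. en (2 powi k) < HL ?G x}) \<partial>?Z)"
  by (subst nn_integral_count_space_nn_integral) (auto simp: nn_integral_cmult nn_integral_cmult_indicator)
 also have "... <= (\<integral>\<^sup>+k. 4*(en (2 powi k) * (en ?A * (NN x. ?h k x))) \<partial>?Z)"
  unfolding power2_eq_square mult.assoc by (intro nn_integral_mono mult_left_mono HL_weak_type_truncated[OF g nonneg square, unfolded mult.assoc]) simp_all
 also have "... = (\<integral>\<^sup>+k. (NN x. 4 * en ?A * (en (2 powi k) * ?h k x)) \<partial>?Z)"
  by (subst nn_integral_cmult) (auto simp: nn_integral_cmult mult_ac)
 also have "... = (NN x. (\<integral>\<^sup>+k. 4 * en ?A * (en (2 powi k) * ?h k x) \<partial>?Z))"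
  by (rule nn_integral_count_space_nn_integral[symmetric]) auto
 also have "... = (NN x. 4 * en ?A * (\<integral>\<^sup>+k. en (2 powi k) * ?h k x \<partial>?Z))"
  by (simp add: nn_integral_cmult)
 also have "... <= (NN x. 4 * en ?A * (en (4*?v) * en ((g x)^2)))"
 proof (intro nn_integral_mono mult_left_mono)
  fix x
  have "(\<integral>\<^sup>+k. en (2 powi k) * ?h k x \<partial>?Z) = (\<integral>\<^sup>+k. ?G x * (if en (2 powi k) < en (2*?v * g x) then en (2 powi k) else 0) \<partial>?Z)"
   by (intro nn_integral_cong) (simp add: mult.commute)
  also have "... = ?G x * (\<integral>\<^sup>+k. (if en (2 powi k) < en (2*?v * g x) then en (2 powi k) else 0) \<partial>?Z)"
   by (rule nn_integral_cmult) simp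
  also have "... <= ?G x * (en 2 * en (2*?v * g x))" using dyadic_sum_le by (intro mult_left_mono) auto
  also have "... = en (g x * (2*(2*?v * g x)))" using nonneg[of x] by (simp only: ennreal_mult[symmetric] mult_nonneg_nonneg zero_le_numeral unit_ball_vol_nonneg of_nat_0_le_iff)
  also have "g x * (2*(2*?v * g x)) = 4*?v*(g x)^2" by (simp add: power2_eq_square)
  finally show "(\<integral>\<^sup>+k. en (2 powi k) * ?h k x \<partial>?Z) <= en (4*?v) * en ((g x)^2)" by (simp add: ennreal_mult)
 qed auto
 also have "... < \<infinity>" using square by (simp add: nn_integral_cmult ennreal_mult_less_top)
 finally show ?thesis .
qed

lemma (in growth) grand_max_square_integrable:
 assumes f: "L2 f" shows "(NN x. (grand_max phi (dist_of f) x)^2) < \<infinity>"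
proof -
 have [measurable]: "f:bml" using f by (simp add: L2_def)
 let ?g = "%x. en (cmod (f x))"
 have "grand_max phi (dist_of f) x <= en kernel_const * HL ?g x" for x
 proof (rule grand_max_leI)
  fix psi :: "'n fn" and t y assume psi: "psi:S_m mm" and t: "t > 0" and xy: "dist y x < t"
  have "en (cmod (dist_of f (dilate psi t y))) <= en (cmod (LI z. f z * dilate psi t y z))" by (simp add: dist_of_def)
  also have "... <= (NN z. en (cmod (f z * dilate psi t y z)))"
   by (cases "integrable lbg (%z. f z * dilate psi t y z)") (auto intro: integral_norm_bound_ennreal simp: not_integrable_integral_eq)
  also have "... = (NN z. ?g z * en (cmod (dilate psi t y z)))" by (simp only: norm_mult ennreal_mult norm_ge_zero)
  also have "... <= en kernel_const * HL ?g x" by (rule kernel_bound[OF _ psi t]) (use xy in "auto intro!: HL_upper")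
  finally show "en (cmod (dist_of f (dilate psi t y))) <= en kernel_const * HL ?g x" .
 qed
 hence "(NN x. (grand_max phi (dist_of f) x)^2) <= (NN x. (en kernel_const)^2*(HL ?g x)^2)"
  by (intro nn_integral_mono) (simp add: power_mult_distrib[symmetric] power_mono)
 also have "... = (en kernel_const)^2*(NN x. (HL ?g x)^2)" by (rule nn_integral_cmult) measurable
 also have "... < \<infinity>"
  using HL_strong_type[of "%x. cmod (f x)"] f by (simp add: ennreal_mult_less_top power2_eq_square L2_def integrable_iff_bounded)
 finally show ?thesis .
qed

subsection \<open>Square-integrable functions and distributions\<close>

lemma L2_measurable: "L2 f ==> f:bml"
 by (simp add: L2_def)

lemma L2_lincomb:
 assumes "L2 f" "L2 g" shows "L2 (%x. a * f x + b * g x)"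
proof -
 have [measurable]: "f:bml" "g:bml" using assms by (auto simp: L2_def)
 let ?B = "%x. 2*(cmod a)^2*(cmod (f x))^2 + 2*(cmod b)^2*(cmod (g x))^2"
 have "integrable lbg ?B" using assms by (simp add: L2_def)
 hence "integrable lbg (%x. (cmod (a * f x + b * g x))^2)"
 proof (rule Bochner_Integration.integrable_bound)
  have "(cmod (a * f x + b * g x))^2 <= ?B x" for x
  proof -
   have "(cmod (a * f x + b * g x))^2 <= (cmod (a * f x) + cmod (b * g x))^2" by (intro power_mono norm_triangle_ineq) auto
   also have "... <= 2*(cmod (a * f x))^2 + 2*(cmod (b * g x))^2"
    using sum_squares_bound[of "cmod (a * f x)" "cmod (b * g x)"] by (simp add: power2_sum)
   finally show ?thesis by (simp add: norm_mult power_mult_distrib)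
  qed
  thus "AL x. norm ((cmod (a * f x + b * g x))^2) <= norm (?B x)" by (auto intro: order_trans[OF _ abs_ge_self])
 qed measurable
 thus ?thesis by (simp add: L2_def)
qed

lemma L2_cmult: "L2 f ==> L2 (%x. a * f x)"
 using L2_lincomb[of f f a 0] by simp

lemma L2_diff: "L2 f ==> L2 g ==> L2 (%x. f x - g x)"
 using L2_lincomb[of f g 1 "-1"] by simp

lemma L2_dominated:
 assumes "L2 D" "g:bml" "AL x. cmod (g x) <= cmod (D x)" shows "L2 g"
proof -
 have [measurable]: "g:bml" by fact
 have "integrable lbg (%x. (cmod (g x))^2)"
  by (rule Bochner_Integration.integrable_bound[of _ "%x. (cmod (D x))^2"])
  (use assms in "auto simp: L2_def elim!: eventually_mono intro: power_mono")
 thus ?thesis by (simp add: L2_def)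
qed

lemma L2_mult_integrable:
 assumes "L2 f" "L2 g" shows "integrable lbg (%x. f x * g x)"
proof (rule Bochner_Integration.integrable_bound)
 have [measurable]: "f:bml" "g:bml" using assms by (auto simp: L2_def)
 show "(%x. f x * g x):bml" by measurable
 show "integrable lbg (%x. (cmod (f x))^2+(cmod (g x))^2)" using assms by (simp add: L2_def)
 have "cmod (f x) * cmod (g x) <= (cmod (f x))^2+(cmod (g x))^2" for x
  using sum_squares_bound[of "cmod (f x)" "cmod (g x)"] mult_nonneg_nonneg[OF norm_ge_zero norm_ge_zero, of "f x" "g x"] by linarith
 thus "AL x. norm (f x * g x) <= norm ((cmod (f x))^2+(cmod (g x))^2)" by (simp add: norm_mult)
qed

lemma L2_nn_integral: "L2 f ==> (NN x. en ((cmod (f x))^2)) = en ((L2_norm f)^2)"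
 by (subst nn_integral_eq_integral) (auto simp: L2_def L2_norm_def)

context
 fixes F :: "nat => 'n::finite fn" and G D :: "'n fn"
 assumes F: "!!N. F N:bml" and G: "G:bml" and D: "L2 D"
 and F_le: "!!N. AL x. cmod (F N x) <= cmod (D x)" and F_tendsto: "AL x. (%N. F N x) ~~> G x"
begin

lemma L2_limit_le: "AL x. cmod (G x) <= cmod (D x)"
proof -
 have "AL x. ALL N. cmod (F N x) <= cmod (D x)" using F_le by (simp add: AE_all_countable)
 with F_tendsto show ?thesis
 proof eventually_elim
  case (elim x)
  show ?case by (rule LIMSEQ_le_const2[OF tendsto_norm[OF elim(1)]]) (use elim(2) in blast)
 qed
qed

lemma L2_limit: "L2 G"
 by (rule L2_dominated[OF D G L2_limit_le])

lemma L2_pairing_tendsto: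
 assumes psi: "L2 psi" shows "(%N. (LI x. F N x * psi x)) ~~> (LI x. G x * psi x)"
proof (rule integral_dominated_convergence)
 note [measurable] = F G L2_measurable[OF psi]
 show "(%x. G x * psi x):bml" "(%x. F N x * psi x):bml" for N by measurable
 show "integrable lbg (%x. cmod (D x * psi x))" using L2_mult_integrable[OF D psi] by simp
 show "AL x. (%N. F N x * psi x) ~~> G x * psi x" using F_tendsto by eventually_elim (intro tendsto_intros)
 show "AL x. norm (F N x * psi x) <= cmod (D x * psi x)" for N
  using F_le[of N] by eventually_elim (simp add: norm_mult mult_right_mono)
qed

lemma L2_dominated_convergence: "(%N. (L2_norm (%x. G x - F N x))^2) ~~> 0"
proof -
 note [measurable] = F G
 have "(%N. (LI x. (cmod (G x - F N x))^2)) ~~> (LI x::real^'n. 0)"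
 proof (rule integral_dominated_convergence)
  show "integrable lbg (%x. 4*(cmod (D x))^2)" using D by (simp add: L2_def)
  show "AL x. (%N. (cmod (G x - F N x))^2) ~~> 0" using F_tendsto
  proof eventually_elim
   case (elim x)
   have "(%N. (cmod (G x - F N x))^2) ~~> (cmod (G x - G x))^2" by (intro tendsto_intros elim)
   thus ?case by simp
  qed
  show "AL x. norm ((cmod (G x - F N x))^2) <= 4*(cmod (D x))^2" for N
   using F_le[of N] L2_limit_le
  proof eventually_elim
   case (elim x)
   have "cmod (G x - F N x) <= 2 * cmod (D x)" using norm_triangle_ineq4[of "G x" "F N x"] elim by linarith
   hence "(cmod (G x - F N x))^2 <= (2 * cmod (D x))^2" by (intro power_mono) auto
   thus ?case by (simp add: power_mult_distrib)
  qed
 qed measurable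
 thus ?thesis by (simp add: L2_norm_def)
qed

end

lemma schwartz_continuous: "schwartz psi ==> continuous_on UNIV psi"
 by (intro smooth_continuous) (simp add: schwartz_iff)

lemma dist_of_lincomb:
 assumes f: "bsupp f" and g: "bsupp g"
 shows "dist_of (%x. a * f x + b * g x) = (%psi. a * dist_of f psi + b * dist_of g psi)"
proof
 fix psi
 show "dist_of (%x. a * f x + b * g x) psi = a * dist_of f psi + b * dist_of g psi"
 proof (cases "schwartz psi")
  case True
  note integrable = bsupp_mult_integrable[OF f schwartz_continuous[OF True]] bsupp_mult_integrable[OF g schwartz_continuous[OF True]]
  have "(LI x. (a * f x + b * g x) * psi x) = (LI x. a*(f x * psi x) + b*(g x * psi x))"
   by (rule Bochner_Integration.integral_cong) (auto simp: algebra_simps)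
  thus ?thesis using True integrable by (simp add: dist_of_def)
 qed (simp add: dist_of_def)
qed

lemma dist_of_sum:
 assumes "!!j. bsupp (h j)" "test_fn psi"
 shows "dist_of (%x. \<Sum>j<N. h j x) psi = (\<Sum>j<N. (LI x. h (j::nat) x * psi x))"
proof -
 have cont: "continuous_on UNIV psi" using assms(2) by (intro smooth_continuous test_fn_smooth)
 have "dist_of (%x. \<Sum>j<N. h j x) psi = (LI x. \<Sum>j<N. h j x * psi x)"
  using test_fn_schwartz[OF assms(2)] by (simp add: dist_of_def sum_distrib_right)
 also have "... = (\<Sum>j<N. (LI x. h j x * psi x))" by (intro Bochner_Integration.integral_sum bsupp_mult_integrable assms(1) cont)
 finally show ?thesis .
qed

lemma tempered_dist_of:
 fixes f :: "'n::finite fn"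
 assumes f: "bsupp f" shows "tempered (dist_of f)"
 unfolding tempered_def
proof (intro conjI allI impI)
 note integrable = bsupp_mult_integrable[OF f schwartz_continuous]
 have scale: "schwartz psi ==> schwartz (%x. c * psi x)" for psi :: "'n fn" and c using schwartz_lincomb[of psi psi c 0] by simp
 show "dist_of f psi = 0" if "~schwartz psi" for psi using that by (simp add: dist_of_def)
 show "dist_of f (%x. psi x + chi x) = dist_of f psi + dist_of f chi" if "schwartz psi" "schwartz chi" for psi chi
  using that integrable schwartz_lincomb[OF that, of 1 1] by (simp add: dist_of_def distrib_left)
 show "dist_of f (%x. c * psi x) = c * dist_of f psi" if "schwartz psi" for c psi
  using that scale[OF that, of c] by (simp add: dist_of_def mult.left_commute)
 have "cmod (dist_of f psi) <= (LI x. cmod (f x)) * schwartz_seminorm 0 psi" if s: "schwartz psi" for psi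
 proof -
  have "cmod (LI x. f x * psi x) <= (LI x. cmod (f x) * schwartz_seminorm 0 psi)"
  proof (rule order_trans[OF integral_norm_bound integral_mono])
   show "norm (f x * psi x) <= cmod (f x) * schwartz_seminorm 0 psi" for x
    unfolding norm_mult using schwartz_seminorm_upper[OF s, of "[]" 0 x] by (intro mult_left_mono) auto
  qed (use bsupp_integrable[OF f] integrable[OF s] in auto)
  thus ?thesis using s by (simp add: dist_of_def)
 qed
 thus "EX C N. ALL psi. schwartz psi --> cmod (dist_of f psi) <= C * schwartz_seminorm N psi" by blast
qed

lemma ennreal_tendsto_0_le:
 fixes f g :: "'a => ennreal"
 assumes "(g \<longlongrightarrow> 0) F" "!!x. f x <= g x" shows "(f \<longlongrightarrow> 0) F"
 by (rule tendsto_sandwich[OF _ _ tendsto_const assms(1)]) (simp_all add: assms(2))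

lemma suminf_ennreal_tail_tendsto_0:
 fixes f :: "nat => ennreal"
 assumes "(\<Sum>j. f j) ~= top" shows "(%N. \<Sum>j. f (j+N)) ~~> 0"
proof -
 have "f j < top" for j
  using sum_le_suminf[of f "{j}"] assms by (simp add: less_top le_less_trans)
 hence f: "f j = en (enn2real (f j))" for j by simp
 have summable: "summable (%j. enn2real (f j))" using assms by (intro summable_suminf_not_top) (auto simp flip: f)
 have "(\<Sum>j. f (j+N)) = en (\<Sum>j. enn2real (f (j+N)))" for N
  using summable by (subst f, intro suminf_ennreal2) (auto intro: summable_ignore_initial_segment)
 thus ?thesis using tendsto_ennrealI[OF suminf_exist_split2[OF summable]] by simp
qed

lemma AE_zero_of_liminf:
 fixes g :: "nat => 'a => ennreal"
 assumes [measurable]: "!!N. g N:borel_measurable M" "g':borel_measurable M"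
 and bound: "AE x in M. g' x <= liminf (%N. g N x)" and null: "(%N. (\<integral>\<^sup>+x. g N x \<partial>M)) ~~> 0"
 shows "AE x in M. g' x = 0"
proof -
 have "(\<integral>\<^sup>+x. g' x \<partial>M) <= (\<integral>\<^sup>+x. liminf (%N. g N x) \<partial>M)" by (rule nn_integral_mono_AE[OF bound])
 also have "... <= liminf (%N. \<integral>\<^sup>+x. g N x \<partial>M)" by (rule nn_integral_liminf) measurable
 also have "... = 0" by (rule lim_imp_Liminf[OF _ null]) simp
 finally show ?thesis by (simp add: nn_integral_0_iff_AE)
qed

subsection \<open>Norm and modular\<close>

lemma Lnorm_E_le: "lam > 0 ==> modular_E phi g lam <= 1 ==> Lnorm_E phi g <= lam"
 unfolding Lnorm_E_def by (rule cInf_lower) (auto intro: bdd_belowI[of _ 0])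

lemma Lnorm_E_nonneg: "Lphi_E phi g ==> Lnorm_E phi g >= 0"
 unfolding Lnorm_E_def Lphi_E_def by (intro cInf_greatest) auto

context growth begin

lemma Phi_modular_le: "modular (%x. g x / en lam) <= modular_E phi g lam"
 unfolding modular_E_def by (intro nn_integral_mono Phi_le_phi_ext)

lemma Lnorm_E_comparison:
 assumes C: "C >= 0"
 shows "EX M. ALL f g. f:bml --> Lphi_E phi g --> (ALL lam>0. modular (%x. f x / en lam) <= en C * modular (%x. g x / en lam)) --> Lnorm_E phi f <= M * Lnorm_E phi g"
proof -
 obtain M where M: "M >= 1" "!!g lam. g:bml ==> lam > 0 ==> modular (%x. g x / en lam) <= en C ==> modular_E phi g (M*lam) <= 1"
  using modular_E_le_1[OF C] by blast
 have "Lnorm_E phi f <= M * Lnorm_E phi g"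
  if f: "f:bml" and g: "Lphi_E phi g" and bound: "ALL lam>0. modular (%x. f x / en lam) <= en C * modular (%x. g x / en lam)" for f g
 proof -
  have "Lnorm_E phi f / M <= lam" if lam: "lam > 0" "modular_E phi g lam <= 1" for lam
  proof -
   have "modular (%x. f x / en lam) <= en C * 1"
    using bound[rule_format, OF lam(1)] order_trans[OF Phi_modular_le lam(2)] by (meson mult_left_mono order_trans zero_le)
   hence "Lnorm_E phi f <= M*lam" using M(1) lam(1) by (intro Lnorm_E_le M(2) f) auto
   thus ?thesis using M(1) by (simp add: pos_divide_le_eq mult.commute)
  qed
  hence "Lnorm_E phi f / M <= Lnorm_E phi g" unfolding Lnorm_E_def[of _ g] using g by (intro cInf_greatest) (auto simp: Lphi_E_def)
  thus ?thesis using M(1) by (simp add: pos_divide_le_eq mult.commute)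
 qed
 thus ?thesis by blast
qed

lemma Lnorm_E_tendsto_0:
 assumes g: "!!N. Lphi_E phi (g N)" and null: "!!lam. lam > 0 ==> (%N. modular (%x. g N x / en lam)) ~~> 0"
 shows "(%N. Lnorm_E phi (g N)) ~~> 0"
proof (rule order_tendstoI)
 fix e :: real assume "0 < e"
 hence "\<forall>\<^sub>F N in sequentially. modular (%x. g N x / en (e/2)) < en (1/(2*K))"
  using null[of "e/2"] K_ge_1 by (intro order_tendstoD(2)) auto
 thus "\<forall>\<^sub>F N in sequentially. Lnorm_E phi (g N) < e"
 proof eventually_elim
  case (elim N)
  have [measurable]: "g N:bml" using g unfolding Lphi_E_def by blast
  have "modular_E phi (g N) (e/2) <= (NN x. en (2*K) * Phi x (g N x / en (e/2)))"
   unfolding modular_E_def by (intro nn_integral_mono phi_ext_le_Phi)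
  also have "... = en (2*K) * modular (%x. g N x / en (e/2))" by (rule nn_integral_cmult) measurable
  also have "... <= en (2*K) * en (1/(2*K))" using elim by (intro mult_left_mono) auto
  also have "... = 1" using K_ge_1 by (simp add: ennreal_mult[symmetric])
  finally have "Lnorm_E phi (g N) <= e/2" using \<open>0 < e\<close> by (intro Lnorm_E_le) auto
  thus ?case using \<open>0 < e\<close> by linarith
 qed
next
 fix e :: real assume "e < 0"
 thus "\<forall>\<^sub>F N in sequentially. e < Lnorm_E phi (g N)" using less_le_trans[OF \<open>e < 0\<close> Lnorm_E_nonneg[OF g]] by simp
qed

lemma Phi_modular_le_of_norm_less:
 assumes g: "Lphi_E phi g" and less: "Lnorm_E phi g < rho" and rho: "rho <= 1"
 shows "modular g <= en (L*rho powr p)"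
proof -
 obtain lam where lam: "lam > 0" "modular_E phi g lam <= 1" "lam < rho"
  using cInf_lessD[OF _ less[unfolded Lnorm_E_def]] g unfolding Lphi_E_def by blast
 have [measurable]: "g:bml" using g unfolding Lphi_E_def by blast
 have "g x = en lam * (g x / en lam)" for x using lam(1) by (simp add: divide_ennreal_eq_mult mult.assoc[symmetric] ennreal_mult[symmetric])
 hence "Phi x (g x) <= en (L*lam powr p) * Phi x (g x / en lam)" for x
  using Phi_scale_down[of lam x "g x / en lam"] lam rho by simp
 hence "modular g <= (NN x. en (L*lam powr p) * Phi x (g x / en lam))" by (rule nn_integral_mono)
 also have "... = en (L*lam powr p) * modular (%x. g x / en lam)" by (rule nn_integral_cmult) measurable
 also have "... <= en (L*rho powr p) * 1"
  using lam L_ge_1 p_pos order_trans[OF Phi_modular_le lam(2)] by (intro mult_mono ennreal_leI mult_left_mono powr_mono2) auto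
 finally show ?thesis by simp
qed

lemma Phi_modular_tendsto_0:
 assumes g: "!!N. Lphi_E phi (g N)" and null: "(%N. Lnorm_E phi (g N)) ~~> 0"
 shows "(%N. modular (g N)) ~~> 0"
proof -
 define rho where "rho N = Lnorm_E phi (g N) + inverse (real (Suc N))" for N
 have rho: "rho ~~> 0" unfolding rho_def using tendsto_add[OF null LIMSEQ_inverse_real_of_nat] by simp
 have less: "0 <= Lnorm_E phi (g N)" "Lnorm_E phi (g N) < rho N" for N using Lnorm_E_nonneg[OF g] by (simp_all add: rho_def)
 have "(%N. rho N powr p) ~~> 0"
  using rho less p_pos by (intro tendsto_zero_powrI[where b = p] tendsto_const) (use order_trans[OF less(1) less_imp_le[OF less(2)]] in auto)
 from tendsto_ennrealI[OF tendsto_mult_right_zero[OF this, of L]]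
 have lim: "(%N. en (L * rho N powr p)) ~~> 0" by simp
 have "\<forall>\<^sub>F N in sequentially. rho N <= 1" using order_tendstoD(2)[OF rho zero_less_one] by eventually_elim simp
 hence "\<forall>\<^sub>F N in sequentially. modular (g N) <= en (L * rho N powr p)"
  by eventually_elim (rule Phi_modular_le_of_norm_less[OF g less(2)])
 thus ?thesis by (rule tendsto_sandwich[OF _ _ tendsto_const lim, rotated]) simp
qed

lemma AE_nonpos_of_modular_null:
 fixes D :: "nat => real^'n => real"
 assumes [measurable]: "!!N. D N:bml" "D':bml"
 and lim: "AL x. (%N. D N x) ~~> D' x" and bound: "!!N. AL x. D N x <= E N x"
 and null: "(%N. modular (%x. en (E N x))) ~~> 0"
 shows "AL x. D' x <= 0"
proof -
 have bound: "modular (%x. en (D N x)) <= modular (%x. en (E N x))" for N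
  using bound[of N] by (intro nn_integral_mono_AE) (auto elim!: eventually_mono intro: Phi_mono ennreal_leI)
 have "AL x. Phi x (en (D' x / 2)) = 0"
 proof (rule AE_zero_of_liminf[where g = "%N x. Phi x (en (D N x))"])
  show "(%N. modular (%x. en (D N x))) ~~> 0" by (rule ennreal_tendsto_0_le[OF null bound])
  show "AL x. Phi x (en (D' x / 2)) <= liminf (%N. Phi x (en (D N x)))" using lim
  proof eventually_elim
   case (elim x)
   show ?case
   proof (cases "D' x > 0")
    case True
    hence "\<forall>\<^sub>F N in sequentially. D' x / 2 < D N x" by (intro order_tendstoD(1)[OF elim]) simp
    hence "\<forall>\<^sub>F N in sequentially. Phi x (en (D' x / 2)) <= Phi x (en (D N x))"
     by eventually_elim (intro Phi_mono ennreal_leI, simp)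
    thus ?thesis by (rule Liminf_bounded)
   qed (simp add: ennreal_neg)
  qed
 qed measurable
 thus ?thesis
 proof eventually_elim
  case (elim x)
  from Phi_eq_0[OF this] show ?case by (simp add: ennreal_eq_0_iff)
 qed
qed

subsection \<open>Bounded atoms as atoms\<close>

lemma phi_set_ball:
 assumes "r > 0" "t > 0" shows "en (phi_set phi (ball c r) t) = (NN x. en (phi x t) * idr (ball c r) x)"
 unfolding phi_set_def using ball_finite[OF assms] by simp

lemma phi_set_ball_mono:
 assumes "r > 0" "0 <= t" "t <= t'" shows "phi_set phi (ball c r) t <= phi_set phi (ball c r) t'"
proof (cases "t = 0")
 case False
 have "en (phi_set phi (ball c r) t) <= en (phi_set phi (ball c r) t')"
  using assms False by (simp add: phi_set_ball) (auto intro!: nn_integral_mono ennreal_leI phi_mono split: split_indicator)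
 thus ?thesis by (simp add: ennreal_le_iff phi_set_def)
qed (simp add: phi_set_def phi_0)

lemma phi_set_ball_le:
 assumes "r > 0" "t >= 0" shows "en (phi_set phi (ball c r) t) <= en (2*K) * Phi_int (ball c r) t"
proof (cases "t = 0")
 case False
 thus ?thesis using assms le_Phi_int[of t "ball c r"] by (simp add: phi_set_ball)
qed (simp add: phi_set_def phi_0)

lemma weighted_power_integral_le:
 assumes r: "r > 0" and t: "t > 0" and q': "q' > 0" and bound: "!!x. cmod (h x) <= A"
 shows "(NN x. en (cmod (h x) powr q' * phi x t) * idr (ball c r) x) <= en (A powr q' * phi_set phi (ball c r) t)"
proof -
 have [measurable]: "(%x. phi x t):bml" using phi_measurable t by simp
 have "(NN x. en (cmod (h x) powr q' * phi x t) * idr (ball c r) x) <= (NN x. en (A powr q') * (en (phi x t) * idr (ball c r) x))"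
  using bound q' t phi_nonneg[of t]
  by (intro nn_integral_mono) (auto simp: ennreal_mult[symmetric] intro!: ennreal_leI mult_right_mono powr_mono2 split: split_indicator)
 also have "... = en (A powr q') * en (phi_set phi (ball c r) t)" unfolding phi_set_ball[OF r t] by (rule nn_integral_cmult) measurable
 finally show ?thesis by (simp add: ennreal_mult phi_set_def)
qed

lemma Lq_phi_norm_bounds:
 assumes r: "r > 0" and A: "A >= 0" and bound: "!!x. cmod (h x) <= A" and q: "q = \<infinity> | (EX q'>0. q = ereal q')"
 shows "Lq_phi_norm phi q (ball c r) h:{0..A}"
 using q
proof (elim disjE exE conjE)
 assume q: "q = \<infinity>"
 let ?S = "{M. M >= 0 & (AL x. x:ball c r --> cmod (h x) <= M)}"
 have A_mem: "A:?S" using A bound by simp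
 have "Inf ?S <= A" by (rule cInf_lower[OF A_mem]) (auto intro: bdd_belowI[of _ 0])
 moreover have "0 <= Inf ?S" by (rule cInf_greatest) (use A_mem in auto)
 ultimately show ?thesis using q by (simp add: Lq_phi_norm_def)
next
 fix q' :: real assume q': "q' > 0" "q = ereal q'"
 let ?f = "%t. (enn2real (NN x. en (cmod (h x) powr q' * phi x t) * idr (ball c r) x) / phi_set phi (ball c r) t) powr (1/q')"
 have f_le: "?f t <= A" if t: "t > 0" for t
 proof -
  have pos: "phi_set phi (ball c r) t >= 0" by (simp add: phi_set_def)
  have "enn2real (NN x. en (cmod (h x) powr q' * phi x t) * idr (ball c r) x) <= A powr q' * phi_set phi (ball c r) t"
   using pos by (intro enn2real_leI weighted_power_integral_le r t q'(1) bound) simp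
  hence "enn2real (NN x. en (cmod (h x) powr q' * phi x t) * idr (ball c r) x) / phi_set phi (ball c r) t <= A powr q'"
   using pos by (cases "phi_set phi (ball c r) t = 0") (auto simp: pos_divide_le_eq)
  hence "?f t <= (A powr q') powr (1/q')" using q'(1) pos by (intro powr_mono2) auto
  also have "... = A" using q'(1) A by (simp add: powr_powr)
  finally show ?thesis .
 qed
 have "Sup {?f t | t. t > 0} <= A" by (rule cSup_least) (use f_le in "auto intro: exI[of _ 1]")
 moreover have "?f 1 <= Sup {?f t | t. t > 0}" by (rule cSup_upper) (use f_le in "auto intro!: bdd_aboveI[of _ A] exI[of _ 1]")
 hence "0 <= Sup {?f t | t. t > 0}" by (rule order_trans[rotated]) simp
 ultimately show ?thesis using q' by (simp add: Lq_phi_norm_def)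
qed

lemma Lphi_norm_indicator_ball_pos:
 assumes r: "r > 0" shows "Lphi_norm phi (idr (ball c r)) > 0"
proof -
 let ?g = "%x. en (cmod (idr (ball c r) x::complex))"
 have g: "?g x = idr (ball c r) x" for x by (auto split: split_indicator)
 have modular: "modular ?g = Phi_int (ball c r) 1"
  unfolding Phi_int_def g by (intro nn_integral_cong) (auto split: split_indicator)
 have E: "Lphi_E phi ?g" unfolding Lphi_E_iff modular using Phi_int_finite[OF r, of 1 c] by (simp add: g)
 have "Lnorm_E phi ?g ~= 0"
 proof
  assume "Lnorm_E phi ?g = 0"
  hence "(%N::nat. modular ?g) ~~> 0" by (intro Phi_modular_tendsto_0 E) simp
  hence "Phi_int (ball c r) 1 = 0" unfolding modular by (simp add: LIMSEQ_const_iff)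
  thus False using Phi_int_pos[OF r, of 1 c] by simp
 qed
 thus ?thesis using Lnorm_E_nonneg[OF E] by (simp add: Lphi_norm_def)
qed

lemma bounded_atom_imp_atom:
 assumes a: "bounded_atom s a c r (inverse (Lphi_norm phi (idr (ball c r))))" and r: "r > 0" and q: "q = \<infinity> | (EX q'>0. q = ereal q')"
 shows "atom phi q s a (ball c r)"
 unfolding atom_def Let_def
proof (intro conjI allI impI)
 let ?N = "inverse (Lphi_norm phi (idr (ball c r)))"
 show "is_ball (ball c r)" using r by (auto simp: is_ball_def)
 show "a:bml" by (rule bounded_atomD(1)[OF a])
 show "a x = 0" if "x~:ball c r" for x by (rule bounded_atomD(3)[OF a that])
 show "if q = \<infinity> then AL x. x:ball c r --> cmod (a x) <= ?N else ALL t>0. (NN x. en (cmod (a x) powr real_of_ereal q * phi x t) * idr (ball c r) x) <= en (?N powr real_of_ereal q * phi_set phi (ball c r) t)"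
  using q bounded_atomD(2)[OF a] weighted_power_integral_le[OF r] by auto
 fix mu :: "'n => nat" assume mu: "sum mu UNIV <= s"
 have eq: "(%x. a x * cr (PROD i:UNIV. (x $ i)^mu i)) = (%x. a x * monom_fn mu x)" by (simp add: monom_fn_def)
 show "integrable lbg (%x. a x * cr (PROD i:UNIV. (x $ i)^mu i))"
  unfolding eq by (intro bsupp_mult_integrable bounded_atom_bsupp[OF a] smooth_continuous smooth_monom)
 show "(LI x. a x * cr (PROD i:UNIV. (x $ i)^mu i)) = 0"
  unfolding eq by (intro bounded_atomD(4)[OF a] poly_fn.monomial mu)
qed

lemma bounded_atom_multiple_of_atom:
 assumes h: "bounded_atom s h c r A" and r: "r > 0" and q: "q = \<infinity> | (EX q'>0. q = ereal q')"
 shows "EX a k. atom phi q s a (ball c r) & h = (%x. k * a x)"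
proof -
 define N where "N = Lphi_norm phi (idr (ball c r))"
 have N: "N > 0" unfolding N_def by (rule Lphi_norm_indicator_ball_pos[OF r])
 note A = bounded_atomD(5)[OF h]
 define k :: complex where "k = of_real (A*N)"
 have "bounded_atom s (%x. inverse k * h x) c r (inverse N)"
  unfolding bounded_atom_def
 proof (intro conjI allI impI)
  note [measurable] = bounded_atomD(1)[OF h]
  show "(%x. inverse k * h x):bml" by measurable
  show "cmod (inverse k * h x) <= inverse N" for x
  proof -
   have "cmod (inverse k * h x) = cmod (h x) / (A*N)" using A N by (simp add: k_def norm_mult norm_inverse divide_inverse)
   also have "... <= inverse N" using bounded_atomD(2)[OF h, of x] A N by (cases "A = 0") (simp_all add: field_simps)
   finally show ?thesis .
  qed
  show "inverse k * h x = 0" if "x~:ball c r" for x using bounded_atomD(3)[OF h that] by simp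
  show "(LI x. inverse k * h x * P x) = 0" if "poly_fn s P" for P using bounded_atomD(4)[OF h that] by (simp add: mult.assoc)
 qed
 hence "atom phi q s (%x. inverse k * h x) (ball c r)" unfolding N_def by (rule bounded_atom_imp_atom[OF _ r q])
 moreover have "h x = k*(inverse k * h x)" for x
 proof (cases "A = 0")
  case False
  hence "k ~= 0" using N by (simp add: k_def)
  thus ?thesis by simp
 qed (use bounded_atomD(2)[OF h, of x] in simp)
 ultimately show ?thesis by blast
qed

lemma bounded_atom_operator_bound:
 assumes T: "!!lam a B c. lam > 0 ==> atom phi q s a B ==> L2 (%x. c * a x) ==> (NN x. en (phi x (cmod (T (%y. c * a y) x) / lam))) <= en (C * phi_set phi B (Lq_phi_norm phi q B (%y. c * a y) / lam))"
 and q: "q = \<infinity> | (EX q'>0. q = ereal q')" and C: "C >= 0"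
 and h: "bounded_atom s h c r A" and r: "r > 0" and lam: "lam > 0"
 shows "modular (%x. en (cmod (T h x)) / en lam) <= en (C*(2*K)) * Phi_int (ball c r) (A/lam)"
proof -
 obtain a k where a: "atom phi q s a (ball c r)" and eq: "h = (%x. k * a x)" using bounded_atom_multiple_of_atom[OF h r q] by blast
 note A = bounded_atomD(5)[OF h]
 have norm: "Lq_phi_norm phi q (ball c r) h:{0..A}" by (rule Lq_phi_norm_bounds[OF r A bounded_atomD(2)[OF h] q])
 have "modular (%x. en (cmod (T h x)) / en lam) <= (NN x. en (phi x (cmod (T h x) / lam)))"
 proof (rule nn_integral_mono)
  fix x
  show "Phi x (en (cmod (T h x)) / en lam) <= en (phi x (cmod (T h x) / lam))"
   using Phi_le_phi_ext[of x "en (cmod (T h x) / lam)"] phi_ext_ennreal[of "cmod (T h x) / lam" x] lam by (simp add: divide_ennreal)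
 qed
 also have "... <= en (C * phi_set phi (ball c r) (Lq_phi_norm phi q (ball c r) h / lam))"
  using T[OF lam a, of k] bsupp_L2[OF bounded_atom_bsupp[OF h]] unfolding eq by blast
 also have "... <= en (C * phi_set phi (ball c r) (A/lam))"
  using norm lam C by (intro ennreal_leI mult_left_mono phi_set_ball_mono r divide_right_mono) auto
 also have "... = en C * en (phi_set phi (ball c r) (A/lam))" using C by (rule ennreal_mult')
 also have "... <= en C * (en (2*K) * Phi_int (ball c r) (A/lam))" using A lam by (intro mult_left_mono phi_set_ball_le r) auto
 also have "... = en (C*(2*K)) * Phi_int (ball c r) (A/lam)" using C K_ge_1 by (simp add: ennreal_mult mult.assoc)
 finally show ?thesis .
qed

end

subsection \<open>Partial sums of the atomic decomposition\<close>

context growth begin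

definition modular_null :: "(nat => 'n fn => complex) => bool" where
 "modular_null U \<longleftrightarrow> (ALL N. U N:Hphi phi) & (%N. modular (gmax (U N))) ~~> 0"

lemma modular_null_lincomb:
 assumes U: "modular_null U" and W: "modular_null W"
 shows "modular_null (%N psi. a * U N psi + b * W N psi)"
 unfolding modular_null_def
proof (intro conjI allI)
 show "(%psi. a * U N psi + b * W N psi):Hphi phi" for N using U W by (intro Hphi_lincomb) (auto simp: modular_null_def)
 let ?m = "%u. modular (gmax u)" and ?k = "%c. en (L * max 1 (cmod c))"
 have "(%N. en (2*L) * (?k a * ?m (U N) + ?k b * ?m (W N))) ~~> en (2*L) * (?k a * 0 + ?k b * 0)"
  using U W by (intro ennreal_tendsto_cmult tendsto_add) (auto simp: modular_null_def)
 hence lim: "(%N. en (2*L) * (?k a * ?m (U N) + ?k b * ?m (W N))) ~~> 0" by simp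
 show "(%N. ?m (%psi. a * U N psi + b * W N psi)) ~~> 0"
 proof (rule ennreal_tendsto_0_le[OF lim])
  fix N
  have "?m (%psi. a * U N psi + b * W N psi) <= (NN x. en (2*L) * (Phi x (en (cmod a) * gmax (U N) x) + Phi x (en (cmod b) * gmax (W N) x)))"
   by (intro nn_integral_mono order_trans[OF Phi_mono[OF grand_max_lincomb] Phi_add])
  also have "... <= en (2*L) * (?k a * ?m (U N) + ?k b * ?m (W N))"
   by (simp add: nn_integral_cmult nn_integral_add) (intro mult_left_mono add_mono Phi_modular_scale, auto)
  finally show "?m (%psi. a * U N psi + b * W N psi) <= en (2*L) * (?k a * ?m (U N) + ?k b * ?m (W N))" .
 qed
qed

end

context growth_moments begin

definition partial_sum :: "('n fn => complex) => nat => 'n fn" where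
 "partial_sum u N x = (\<Sum>j<N. atom_fn u j x)"

definition remainder :: "('n fn => complex) => nat => 'n fn => complex" where
 "remainder u N psi = u psi - dist_of (partial_sum u N) psi"

lemma remainder_lincomb: "remainder u N = (%psi. 1 * u psi + (- 1) * dist_of (partial_sum u N) psi)"
 by (simp add: remainder_def[abs_def])

context
 fixes u :: "'n fn => complex"
 assumes u: "u:Hphi phi"
begin

lemma bsupp_atom_fn: "bsupp (atom_fn u j)"
 by (rule bounded_atom_bsupp[OF bounded_atom_atom_fn[OF u]])

lemma bsupp_partial_sum: "bsupp (partial_sum u N)"
proof (induction N)
 case 0
 show ?case by (auto simp: partial_sum_def[abs_def] bsupp_def)
next
 case (Suc N)
 from bsupp_lincomb[OF this bsupp_atom_fn, of 1 1] show ?case by (simp add: partial_sum_def[abs_def])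
qed

lemma tempered_remainder: "tempered (remainder u N)"
 unfolding remainder_lincomb by (intro tempered_lincomb tempered_u[OF u] tempered_dist_of bsupp_partial_sum)

lemma remainder_sums:
 assumes t: "test_fn psi" shows "(%j. (LI x. atom_fn u (j+N) x * psi x)) sums remainder u N psi"
 using sums_split_initial_segment[OF atoms_sums[OF u t], of N] dist_of_sum[OF bsupp_atom_fn t, where N = N]
 by (simp add: remainder_def partial_sum_def[abs_def])

lemma grand_max_remainder_le:
 "gmax (remainder u N) x <= en (test_const*atom_const) * (\<Sum>j. en (atom_size u (j+N) * decay (atom_rad (j+N)) (atom_ctr (j+N)) x))"
 (is "_ <= _*(\<Sum>j. en (?d j))")
proof (cases "(\<Sum>j. en (?d j)) = top")
 case True
 thus ?thesis using test_const_pos atom_const_pos by (simp add: ennreal_mult_top)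
next
 case False
 have d: "?d j >= 0" for j using atom_size_nonneg[OF u] decay_bounds(1)[OF atom_rad_pos[OF u]] by (simp add: less_imp_le)
 have summable: "summable ?d" by (rule summable_suminf_not_top[OF d False])
 have "gmax (remainder u N) x <= en (test_const*(atom_const * suminf ?d))"
 proof (rule grand_max_le_of_test_fn[OF tempered_remainder])
  show "atom_const * suminf ?d >= 0" using atom_const_pos suminf_nonneg[OF summable d] by simp
  fix psi :: "'n fn" and t y assume psi: "psi:S_m mm" "test_fn psi" and t: "t > 0" and y: "dist y x < t"
  let ?I = "%j. (LI z. atom_fn u (j+N) z * dilate psi t y z)"
  have bound: "norm (?I j) <= atom_const * ?d j" for j
   using bounded_atom_pairing[OF bounded_atom_mono[OF bounded_atom_atom_fn[OF u] s_ge] atom_rad_pos[OF u] psi(1) t y] by (simp add: mult.assoc)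
  have norms: "summable (%j. norm (?I j))" by (rule summable_comparison_test'[OF summable_mult[OF summable, of atom_const], of 0]) (use bound in auto)
  have "cmod (remainder u N (dilate psi t y)) <= (\<Sum>j. norm (?I j))"
   unfolding sums_unique[OF remainder_sums[OF test_fn_dilate[OF psi(2) t]]] by (rule summable_norm[OF norms])
  also have "... <= (\<Sum>j. atom_const * ?d j)" by (intro suminf_le norms summable_mult summable bound)
  also have "... = atom_const * suminf ?d" by (rule suminf_mult[OF summable])
  finally show "cmod (remainder u N (dilate psi t y)) <= atom_const * suminf ?d" .
 qed
 also have "... = en (test_const*atom_const) * (\<Sum>j. en (?d j))"
  using suminf_ennreal[OF d False] test_const_pos atom_const_pos suminf_nonneg[OF summable d] by (simp add: ennreal_mult mult.assoc)
 finally show ?thesis .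
qed

lemma remainder_modular_bound:
 assumes lam: "lam > 0"
 shows "EX C. ALL N. modular (%x. gmax (remainder u N) x / en lam) <= en C * (\<Sum>j. Phi_int (ball (atom_ctr (j+N)) (atom_rad (j+N))) (atom_size u (j+N) / lam))"
proof -
 obtain C where C: "C > 0" "!!c r A lam. (ALL j::nat. r j > 0 & A j >= 0) ==> lam > 0 ==> modular (%x. (\<Sum>j. en (A j * decay (r j) (c j) x)) / en lam) <= en C * (\<Sum>j. Phi_int (ball (c j) (r j)) (A j / lam))"
  using Phi_decay_series by blast
 let ?D = "%N x. (\<Sum>j. en (atom_size u (j+N) * decay (atom_rad (j+N)) (atom_ctr (j+N)) x)) / en lam"
 let ?P = "%N. (\<Sum>j. Phi_int (ball (atom_ctr (j+N)) (atom_rad (j+N))) (atom_size u (j+N) / lam))"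
 let ?k = "test_const*atom_const"
 have "modular (%x. gmax (remainder u N) x / en lam) <= en (L * max 1 ?k * C) * ?P N" for N
 proof -
  have "modular (%x. gmax (remainder u N) x / en lam) <= modular (%x. en ?k * ?D N x)"
   unfolding divide_ennreal_eq_mult[OF lam] mult.left_commute[of "en ?k"] by (intro nn_integral_mono Phi_mono mult_left_mono grand_max_remainder_le) auto
  also have "... <= en (L * max 1 ?k) * modular (?D N)" using test_const_pos atom_const_pos by (intro Phi_modular_scale) auto
  also have "... <= en (L * max 1 ?k) * (en C * ?P N)"
   using atom_rad_pos[OF u] atom_size_nonneg[OF u] lam by (intro mult_left_mono C(2)) auto
  finally show ?thesis using C(1) L_ge_1 by (simp add: ennreal_mult mult.assoc)
 qed
 thus ?thesis by blast
qed

lemma remainder_modular: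
 assumes lam: "lam > 0"
 shows "(%N. modular (%x. gmax (remainder u N) x / en lam)) ~~> 0" (is "?m ~~> 0")
 and "modular (%x. gmax (remainder u N) x / en lam) < \<infinity>"
proof -
 let ?P = "%j. Phi_int (ball (atom_ctr j) (atom_rad j)) (atom_size u j / lam)"
 obtain C where C: "!!N. ?m N <= en C * (\<Sum>j. ?P (j+N))" using remainder_modular_bound[OF lam] by blast
 have "(\<Sum>j. ?P j) <= en atom_modular_const * modular (%x. gmax u x / en lam)" by (rule sum_Phi_int_atoms_le[OF u lam])
 also have "... <= en atom_modular_const * (en (L * max 1 (1/lam)) * modular (gmax u))"
  unfolding divide_ennreal_eq_mult[OF lam] using lam by (intro mult_left_mono Phi_modular_scale) auto
 also have "... < top" using u unfolding Hphi_iff by (simp add: ennreal_mult_less_top)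
 finally have finite: "(\<Sum>j. ?P j) < top" .
 have "(%N. \<Sum>j. ?P (j+N)) ~~> 0" using finite by (intro suminf_ennreal_tail_tendsto_0) auto
 hence "(%N. en C * (\<Sum>j. ?P (j+N))) ~~> en C * 0" by (rule ennreal_tendsto_cmult[rotated]) simp
 hence lim: "(%N. en C * (\<Sum>j. ?P (j+N))) ~~> 0" by simp
 show "?m ~~> 0" by (rule ennreal_tendsto_0_le[OF lim C])
 have "(\<Sum>j. ?P (j+N)) <= (\<Sum>j. ?P j)" by (subst (2) suminf_offset[of _ N]) auto
 hence "en C * (\<Sum>j. ?P (j+N)) < top" using finite by (simp add: ennreal_mult_less_top le_less_trans)
 with C show "?m N < \<infinity>" by (auto intro: le_less_trans)
qed

lemma modular_null_remainder: "modular_null (remainder u)"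
 using remainder_modular[of 1] by (simp add: modular_null_def Hphi_iff tempered_remainder del: ennreal_1)

lemma remainder_Hphi: "remainder u N:Hphi phi"
 using modular_null_remainder by (simp add: modular_null_def)

lemma partial_sum_Hphi: "dist_of (partial_sum u N):Hphi phi"
 using Hphi_lincomb[OF u remainder_Hphi, of 1 "-1" N] by (simp add: remainder_def)

end

context
 fixes f :: "'n fn"
 assumes f: "L2 f" and f_Hphi: "dist_of f:Hphi phi"
begin

definition dominating :: "'n fn" where
 "dominating x = cr (4 * real (overlap TYPE('n)) * level_const * enn2real (gmax (dist_of f) x))"

lemma dominating_L2: "L2 dominating"
proof -
 let ?c = "4 * real (overlap TYPE('n)) * level_const" and ?g = "gmax (dist_of f)"
 have [measurable]: "dominating:bml" unfolding dominating_def[abs_def] by measurable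
 have "en ((cmod (dominating x))^2) <= en (?c^2) * (?g x)^2" for x
  by (cases "?g x") (auto simp: dominating_def norm_mult power_mult_distrib ennreal_mult ennreal_power abs_mult)
 hence "(NN x. en ((cmod (dominating x))^2)) <= (NN x. en (?c^2) * (?g x)^2)" by (rule nn_integral_mono)
 also have "... = en (?c^2) * (NN x. (?g x)^2)" by (rule nn_integral_cmult) measurable
 also have "... < \<infinity>" using grand_max_square_integrable[OF f] by (simp add: ennreal_mult_less_top)
 finally show ?thesis by (simp add: L2_def integrable_iff_bounded)
qed

lemma atoms_le_dominating:
 assumes finite: "gmax (dist_of f) x < \<infinity>"
 shows "(\<Sum>j<N. cmod (atom_fn (dist_of f) j x)) <= cmod (dominating x)"
proof -
 let ?u = "dist_of f" and ?c = "4 * real (overlap TYPE('n)) * level_const"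
 have "en (\<Sum>j<N. cmod (atom_fn ?u j x)) = (\<Sum>j<N. en (cmod (atom_fn ?u j x)))" by (rule sum_ennreal[symmetric]) simp
 also have "... <= (\<Sum>j<N. idr (ball (atom_ctr j) (atom_rad j)) x * en (atom_size ?u j))"
  using bounded_atomD(2,3)[OF bounded_atom_atom_fn[OF f_Hphi]] by (intro sum_mono) (auto intro: ennreal_leI split: split_indicator)
 also have "... <= (\<Sum>j. idr (ball (atom_ctr j) (atom_rad j)) x * en (atom_size ?u j))" by (rule sum_le_suminf) auto
 also have "... <= en ?c * gmax ?u x" by (rule atom_size_series_le[OF f_Hphi])
 also have "... = en (cmod (dominating x))" using finite level_const_nonneg by (simp add: dominating_def norm_mult ennreal_mult)
 finally show ?thesis by (simp add: ennreal_le_iff)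
qed

lemma grand_max_finite_AE: "AL x. gmax (dist_of f) x < \<infinity>"
proof -
 have "AL x. (gmax (dist_of f) x)^2 ~= \<infinity>" using grand_max_square_integrable[OF f] by (intro nn_integral_PInf_AE) auto
 thus ?thesis by eventually_elim (auto simp: less_top[symmetric] power2_eq_square ennreal_mult_eq_top_iff)
qed

lemma partial_sum_le_dominating: "AL x. cmod (partial_sum (dist_of f) N x) <= cmod (dominating x)"
 using grand_max_finite_AE
proof eventually_elim
 case (elim x)
 show ?case unfolding partial_sum_def by (rule order_trans[OF norm_sum atoms_le_dominating[OF elim]])
qed

lemma partial_sum_measurable: "partial_sum (dist_of f) N:bml"
 by (intro L2_measurable bsupp_L2 bsupp_partial_sum f_Hphi)

lemma partial_sum_convergent: "AL x. convergent (%N. partial_sum (dist_of f) N x)"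
 using grand_max_finite_AE
proof eventually_elim
 case (elim x)
 have "(\<Sum>j\<le>N. norm (atom_fn (dist_of f) j x)) <= cmod (dominating x)" for N
  using atoms_le_dominating[OF elim, of "Suc N"] by (simp add: lessThan_Suc_atMost)
 hence "summable (%j. norm (atom_fn (dist_of f) j x))" by (rule bounded_imp_summable[rotated]) simp
 from summable_norm_cancel[OF this] show ?case by (simp add: partial_sum_def summable_iff_convergent)
qed

lemma partial_sum_tendsto: "AL x. (%N. partial_sum (dist_of f) N x) ~~> f x"
proof -
 define G where "G x = lim (%N. partial_sum (dist_of f) N x)" for x
 have lim: "AL x. (%N. partial_sum (dist_of f) N x) ~~> G x"
  using partial_sum_convergent unfolding G_def by (simp add: convergent_LIMSEQ_iff)
 have G: "G:bml" unfolding G_def[abs_def] by (rule borel_measurable_lim_metric[OF partial_sum_measurable])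
 note L2_G = L2_limit[OF partial_sum_measurable G dominating_L2 partial_sum_le_dominating lim]
 note diff = L2_diff[OF f L2_G]
 have "AL x. f x - G x = 0"
 proof (rule test_fn_separating)
  show "(%x. f x - G x):bml" by (rule L2_measurable[OF diff])
  show "integrable lbg (%x. idr (cball 0 R) x *! (f x - G x))" for R
  proof -
   have "(%x. idr (cball 0 R) x *! (f x - G x)) = (%x. idr (cball 0 R) x * (f x - G x))" by (auto simp: fun_eq_iff split: split_indicator)
   thus ?thesis using L2_mult_integrable[OF bsupp_L2[OF bsupp_indicator[of "cball 0 R" R]] diff] by simp
  qed
  fix psi :: "'n fn" assume t: "test_fn psi"
  note L2_ps0 = bsupp_L2[OF test_fn_bsupp[OF t]]
  have "(%N. (LI x. partial_sum (dist_of f) N x * psi x)) ~~> (LI x. G x * psi x)"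
   by (rule L2_pairing_tendsto[OF partial_sum_measurable G dominating_L2 partial_sum_le_dominating lim L2_ps0])
  moreover have "(%N. (LI x. partial_sum (dist_of f) N x * psi x)) ~~> dist_of f psi"
   using atoms_sums[OF f_Hphi t] dist_of_sum[OF bsupp_atom_fn[OF f_Hphi] t] test_fn_schwartz[OF t]
   by (simp add: sums_def partial_sum_def dist_of_def)
  ultimately have "(LI x. G x * psi x) = dist_of f psi" by (rule LIMSEQ_unique)
  thus "(LI x. (f x - G x) * psi x) = 0"
   using L2_mult_integrable[OF f L2_ps0] L2_mult_integrable[OF L2_G L2_ps0] test_fn_schwartz[OF t] by (simp add: dist_of_def left_diff_distrib)
 qed
 with lim show ?thesis by eventually_elim simp
qed

lemma partial_sum_L2_tendsto: "(%N. (L2_norm (%x. f x - partial_sum (dist_of f) N x))^2) ~~> 0"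
 by (rule L2_dominated_convergence[OF partial_sum_measurable L2_measurable[OF f] dominating_L2 partial_sum_le_dominating partial_sum_tendsto])

end

end

subsection \<open>Linear and positive sublinear operators\<close>

lemma linear_L2_lincomb:
 assumes T: "linear_L2 T" and f: "L2 f" and g: "L2 g"
 shows "AL x. T (%y. a * f y + b * g y) x = a * T f x + b * T g x"
proof -
 have "AL x. T (%y. a * f y + b * g y) x = T (%y. a * f y) x + T (%y. b * g y) x"
  "AL x. T (%y. a * f y) x = a * T f x" "AL x. T (%y. b * g y) x = b * T g x"
  using T f g L2_cmult[OF f, of a] L2_cmult[OF g, of b] unfolding linear_L2_def by blast+
 thus ?thesis by eventually_elim simp
qed

lemma pos_sublinear_L2D:
 assumes "pos_sublinear_L2 T" "L2 f"
 shows "Im (T f x) = 0" "Re (T f x) >= 0" "Re (T (%y. c * f y) x) <= cmod c * Re (T f x)"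
 "L2 g ==> Re (T (%y. f y + g y) x) <= Re (T f x) + Re (T g x)"
 using assms unfolding pos_sublinear_L2_def by simp_all

lemma pos_sublinear_L2_lincomb:
 assumes T: "pos_sublinear_L2 T" and f: "L2 f" and g: "L2 g"
 shows "Re (T (%y. a * f y + b * g y) x) <= cmod a * Re (T f x) + cmod b * Re (T g x)"
 using pos_sublinear_L2D(4)[OF T L2_cmult[OF f] L2_cmult[OF g], of a b x]
 pos_sublinear_L2D(3)[OF T f, of a x] pos_sublinear_L2D(3)[OF T g, of b x] by linarith

lemma cmod_diff_le_of_Re:
 assumes "Im a = 0" "Im b = 0" "Re a <= Re b + e" "Re b <= Re a + e"
 shows "cmod (a-b) <= e"
 using assms by (simp add: cmod_eq_Re)

lemma cmod_operator_diff_le: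
 assumes T: "linear_L2 T | pos_sublinear_L2 T" and f: "L2 f" and g: "L2 g"
 shows "AL x. cmod (T f x - T g x) <= cmod (T (%y. f y - g y) x)"
 using T
proof
 assume "linear_L2 T"
 from linear_L2_lincomb[OF this f g, of 1 "-1"] show ?thesis by eventually_elim simp
next
 assume T: "pos_sublinear_L2 T"
 let ?d = "%y. f y - g y"
 note d = L2_diff[OF f g]
 have "cmod (T f x - T g x) <= Re (T ?d x)" for x
  using pos_sublinear_L2_lincomb[OF T g d, of 1 1 x] pos_sublinear_L2_lincomb[OF T f d, of 1 "-1" x]
  by (intro cmod_diff_le_of_Re pos_sublinear_L2D(1)[OF T] f g) simp_all
 thus ?thesis using complex_Re_le_cmod by (intro AE_I2) (meson order_trans)
qed

lemma operator_zero:
 assumes T: "linear_L2 T | pos_sublinear_L2 T" shows "AL x. T (%x. 0) x = 0"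
 using T
proof
 have zero: "L2 (%x::real^'n::finite. 0)" by (simp add: L2_def)
 show ?thesis if "linear_L2 T" using linear_L2_lincomb[OF that zero zero, of 0 0] by simp
 show ?thesis if "pos_sublinear_L2 T"
  using pos_sublinear_L2D(1,2)[OF that zero] pos_sublinear_L2D(3)[OF that zero, of 0] by (simp add: complex_eq_iff order_antisym)
qed

lemma operator_L2_tendsto:
 assumes T: "linear_L2 T | pos_sublinear_L2 T" and bounded: "bounded_L2 T" and f: "L2 f" and g: "!!N::nat. L2 (g N)"
 and lim: "(%N. (L2_norm (%x. f x - g N x))^2) ~~> 0"
 shows "(%N. (NN x. en ((cmod (T f x - T (g N) x))^2))) ~~> 0"
proof -
 obtain C where C: "!!h. L2 h ==> L2 (T h) & L2_norm (T h) <= C * L2_norm h" using bounded unfolding bounded_L2_def by blast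
 have lim: "(%N. en (C^2*(L2_norm (%x. f x - g N x))^2)) ~~> 0"
  using tendsto_ennrealI[OF tendsto_mult_right_zero[OF lim, of "C^2"]] by simp
 show ?thesis
 proof (rule ennreal_tendsto_0_le[OF lim])
  fix N
  let ?d = "%x. f x - g N x"
  note d = L2_diff[OF f g[of N]]
  have "(NN x. en ((cmod (T f x - T (g N) x))^2)) <= (NN x. en ((cmod (T ?d x))^2))"
   using cmod_operator_diff_le[OF T f g[of N]] by (intro nn_integral_mono_AE) (auto elim!: eventually_mono intro!: ennreal_leI power_mono)
  also have "... = en ((L2_norm (T ?d))^2)" using C[OF d] by (intro L2_nn_integral) blast
  also have "... <= en ((C * L2_norm ?d)^2)" using C[OF d] by (intro ennreal_leI power_mono) (auto simp: L2_norm_def)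
  finally show "(NN x. en ((cmod (T f x - T (g N) x))^2)) <= en (C^2*(L2_norm (%x. f x - g N x))^2)" by (simp add: power_mult_distrib)
 qed
qed

lemma bounded_extensionD:
 assumes "bounded_extension phi T T'"
 shows "L2 f ==> dist_of f:Hphi phi ==> AL x. T' (dist_of f) x = T f x" "u:Hphi phi ==> Lphi phi (T' u)"
 "EX C. ALL u:Hphi phi. Lphi_norm phi (T' u) <= C * Hphi_norm phi u"
 "linear_L2 T ==> u:Hphi phi ==> v:Hphi phi ==> AL x. T' (dist_add u v) x = T' u x + T' v x"
 "pos_sublinear_L2 T ==> u:Hphi phi ==> AL x. Im (T' u x) = 0 & Re (T' u x) >= 0"
 "pos_sublinear_L2 T ==> u:Hphi phi ==> AL x. Re (T' (dist_scale k u) x) <= cmod k * Re (T' u x)"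
 "pos_sublinear_L2 T ==> u:Hphi phi ==> v:Hphi phi ==> AL x. Re (T' (dist_add u v) x) <= Re (T' u x) + Re (T' v x)"
 using assms unfolding bounded_extension_def by simp_all

lemma cmod_bounded_extension_diff_le:
 assumes T: "linear_L2 T | pos_sublinear_L2 T" and T': "bounded_extension phi T T'" and u: "u:Hphi phi" and v: "v:Hphi phi"
 and w: "dist_add w v = u" "dist_add u (dist_scale (- 1) w) = v" "w:Hphi phi" "dist_scale (- 1) w:Hphi phi"
 shows "AL x. cmod (T' u x - T' v x) <= cmod (T' w x)"
 using T
proof
 assume "linear_L2 T"
 from bounded_extensionD(4)[OF T' this w(3) v] show ?thesis unfolding w(1) by eventually_elim simp
next
 assume P: "pos_sublinear_L2 T"
 note sub = bounded_extensionD(5-7)[OF T' P]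
 show ?thesis
  using sub(1)[OF u] sub(1)[OF v] sub(2)[OF w(3), of "-1"] sub(3)[OF w(3) v] sub(3)[OF u w(4)] unfolding w(1,2)
 proof eventually_elim
  case (elim x)
  have "cmod (T' u x - T' v x) <= Re (T' w x)" using elim by (intro cmod_diff_le_of_Re) auto
  thus ?case using complex_Re_le_cmod[of "T' w x"] by linarith
 qed
qed

lemma abs_summable_telescope:
 fixes S :: "nat => 'a::banach"
 assumes step: "!!N. norm (S (Suc N) - S N) <= b N" and start: "S 0 = 0" and finite: "(\<Sum>j. en (b j)) ~= top"
 shows "S ~~> lim S" "en (norm (lim S)) <= (\<Sum>j. en (b j))"
proof -
 have b: "b j >= 0" for j by (rule order_trans[OF norm_ge_zero step])
 have summable: "summable b" by (rule summable_suminf_not_top[OF b finite])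
 have norms: "summable (%N. norm (S (Suc N) - S N))" by (rule summable_comparison_test'[OF summable, of 0]) (simp add: step)
 from summable_LIMSEQ[OF summable_norm_cancel[OF norms]]
 have lim: "S ~~> (\<Sum>N. S (Suc N) - S N)" unfolding sum_lessThan_telescope by (simp add: start)
 thus "S ~~> lim S" by (simp add: limI)
 have "norm (\<Sum>N. S (Suc N) - S N) <= (\<Sum>N. norm (S (Suc N) - S N))" by (rule summable_norm[OF norms])
 also have "... <= suminf b" by (intro suminf_le norms summable step)
 finally show "en (norm (lim S)) <= (\<Sum>j. en (b j))" using suminf_ennreal[OF b finite] by (simp add: limI[OF lim] ennreal_leI)
qed

subsection \<open>Extension of the operator\<close>

locale atom_bounded_operator = growth_moments phi K p q0 s theta dual_bound
 for phi :: "real^'n::finite => real => real" and K p q0 s theta dual_bound +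
 fixes T :: "'n fn => 'n fn" and T_const :: real
 assumes T: "linear_L2 T | pos_sublinear_L2 T" and T_bounded: "bounded_L2 T" and T_const_nonneg: "T_const >= 0"
 and T_atom: "!!h c r A lam. bounded_atom s h c r A ==> r > 0 ==> lam > 0 ==> (NN x. Phi x (en (cmod (T h x)) / en lam)) <= en T_const * Phi_int (ball c r) (A/lam)"
begin

lemma T_measurable: "L2 f ==> T f:bml"
 using T_bounded unfolding bounded_L2_def L2_def by blast

definition extension :: "('n fn => complex) => 'n fn" where
 "extension u x = lim (%N. T (partial_sum u N) x)"

definition extension_const :: real where
 "extension_const = L*T_const*atom_modular_const"

lemma extension_const_nonneg: "extension_const >= 0"
 using L_ge_1 T_const_nonneg atom_modular_const_nonneg by (simp add: extension_const_def)

lemma partial_sum_L2: "u:Hphi phi ==> L2 (partial_sum u N)"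
 by (intro bsupp_L2 bsupp_partial_sum)

lemma T_partial_sum_measurable: "u:Hphi phi ==> T (partial_sum u N):bml"
 by (intro T_measurable partial_sum_L2)

lemma extension_measurable: "u:Hphi phi ==> extension u:bml"
 unfolding extension_def[abs_def] by (intro borel_measurable_lim_metric T_partial_sum_measurable)

lemma T_atom_fn_measurable: "u:Hphi phi ==> T (atom_fn u j):bml"
 by (intro T_measurable bsupp_L2 bsupp_atom_fn)

lemma atom_images_modular_bound:
 assumes u: "u:Hphi phi" and lam: "lam > 0"
 shows "modular (%x. (\<Sum>j. en (cmod (T (atom_fn u j) x))) / en lam) <= en extension_const * modular (%x. gmax u x / en lam)"
proof -
 note [measurable] = T_atom_fn_measurable[OF u]
 have "modular (%x. (\<Sum>j. en (cmod (T (atom_fn u j) x))) / en lam) <= (NN x. en L * (\<Sum>j. Phi x (en (cmod (T (atom_fn u j) x)) / en lam)))"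
  unfolding divide_ennreal_eq_mult[OF lam] ennreal_suminf_cmult[of "en (1/lam)", symmetric] by (intro nn_integral_mono Phi_suminf)
 also have "... = en L * (\<Sum>j. modular (%x. en (cmod (T (atom_fn u j) x)) / en lam))"
  by (subst nn_integral_cmult, measurable, subst nn_integral_suminf, measurable)
 also have "... <= en L * (\<Sum>j. en T_const * Phi_int (ball (atom_ctr j) (atom_rad j)) (atom_size u j / lam))"
  by (intro mult_left_mono suminf_le T_atom bounded_atom_atom_fn[OF u] atom_rad_pos[OF u] lam) auto
 also have "... <= en L * (en T_const * (en atom_modular_const * modular (%x. gmax u x / en lam)))"
  unfolding ennreal_suminf_cmult by (intro mult_left_mono sum_Phi_int_atoms_le u lam) auto
 also have "... = en extension_const * modular (%x. gmax u x / en lam)"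
  using L_ge_1 T_const_nonneg atom_modular_const_nonneg by (simp add: extension_const_def ennreal_mult mult.assoc)
 finally show ?thesis .
qed

lemma extension_limit:
 assumes u: "u:Hphi phi"
 shows "AL x. (%N. T (partial_sum u N) x) ~~> extension u x & en (cmod (extension u x)) <= (\<Sum>j. en (cmod (T (atom_fn u j) x)))"
proof -
 note [measurable] = T_atom_fn_measurable[OF u]
 have "modular (%x. (\<Sum>j. en (cmod (T (atom_fn u j) x))) / en 1) <= en extension_const * modular (%x. gmax u x / en 1)"
  by (rule atom_images_modular_bound[OF u]) simp
 also have "... < \<infinity>" using u by (simp add: Hphi_iff ennreal_mult_less_top del: ennreal_1)
 finally have "AL x. Phi x (\<Sum>j. en (cmod (T (atom_fn u j) x))) ~= \<infinity>" by (intro nn_integral_PInf_AE) (auto simp del: ennreal_1)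
 moreover have "AL x. ALL N. cmod (T (partial_sum u (Suc N)) x - T (partial_sum u N) x) <= cmod (T (atom_fn u N) x)"
 proof (subst AE_all_countable, intro allI)
  fix N
  have "(%y. partial_sum u (Suc N) y - partial_sum u N y) = atom_fn u N" by (simp add: partial_sum_def)
  thus "AL x. cmod (T (partial_sum u (Suc N)) x - T (partial_sum u N) x) <= cmod (T (atom_fn u N) x)"
   using cmod_operator_diff_le[OF T partial_sum_L2[OF u] partial_sum_L2[OF u], of "Suc N" N] by simp
 qed
 moreover have "AL x. T (partial_sum u 0) x = 0" using operator_zero[OF T] by (simp add: partial_sum_def[abs_def])
 ultimately show ?thesis
 proof eventually_elim
  case (elim x)
  have "(\<Sum>j. en (cmod (T (atom_fn u j) x))) ~= top" using elim(1) Phi_top[of x] by auto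
  note telescope = abs_summable_telescope[of "%N. T (partial_sum u N) x", OF elim(2)[rule_format] elim(3) this]
  show ?case unfolding extension_def by (intro conjI telescope)
 qed
qed

lemma extension_tendsto: "u:Hphi phi ==> AL x. (%N. T (partial_sum u N) x) ~~> extension u x"
 by (drule extension_limit, erule eventually_mono) (erule conjunct1)

lemma extension_modular_bound:
 assumes u: "u:Hphi phi" and lam: "lam > 0"
 shows "modular (%x. en (cmod (extension u x)) / en lam) <= en extension_const * modular (%x. gmax u x / en lam)"
proof (rule order_trans[OF nn_integral_mono_AE atom_images_modular_bound[OF u lam]])
 show "AL x. Phi x (en (cmod (extension u x)) / en lam) <= Phi x ((\<Sum>j. en (cmod (T (atom_fn u j) x))) / en lam)"
  using extension_limit[OF u] unfolding divide_ennreal_eq_mult[OF lam] by eventually_elim (intro Phi_mono mult_left_mono, auto)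
qed

lemma extension_agrees:
 assumes f: "L2 f" and u: "dist_of f:Hphi phi"
 shows "AL x. extension (dist_of f) x = T f x"
proof -
 let ?S = "%N. partial_sum (dist_of f) N"
 note [measurable] = T_measurable[OF f] extension_measurable[OF u] T_partial_sum_measurable[OF u]
 have "AL x. en ((cmod (T f x - extension (dist_of f) x))^2) = 0"
 proof (rule AE_zero_of_liminf[where g = "%N x. en ((cmod (T f x - T (?S N) x))^2)"])
  show "(%N. (NN x. en ((cmod (T f x - T (?S N) x))^2))) ~~> 0"
   by (rule operator_L2_tendsto[OF T T_bounded f partial_sum_L2[OF u] partial_sum_L2_tendsto[OF f u]])
  show "AL x. en ((cmod (T f x - extension (dist_of f) x))^2) <= liminf (%N. en ((cmod (T f x - T (?S N) x))^2))"
   using extension_tendsto[OF u]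
  proof eventually_elim
   case (elim x)
   hence "(%N. en ((cmod (T f x - T (?S N) x))^2)) ~~> en ((cmod (T f x - extension (dist_of f) x))^2)" by (intro tendsto_intros) auto
   from lim_imp_Liminf[OF _ this] show ?case by simp
  qed
 qed measurable
 thus ?thesis by eventually_elim (simp add: ennreal_eq_0_iff)
qed

lemma operator_modular_null:
 assumes g: "!!N. L2 (g N)" and null: "modular_null (%N. dist_of (g N))"
 shows "(%N. modular (%x. en (cmod (T (g N) x)))) ~~> 0"
proof -
 let ?m = "%N. modular (gmax (dist_of (g N)))"
 have H: "dist_of (g N):Hphi phi" for N using null by (simp add: modular_null_def)
 have "modular (%x. en (cmod (T (g N) x))) = modular (%x. en (cmod (extension (dist_of (g N)) x)))" for N
  using extension_agrees[OF g H, of N] by (intro nn_integral_cong_AE) (auto elim!: eventually_mono)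
 hence bound: "modular (%x. en (cmod (T (g N) x))) <= en extension_const * ?m N" for N
  using extension_modular_bound[OF H, of 1 N] by (simp del: ennreal_1)
 have "?m ~~> 0" using null by (simp add: modular_null_def)
 hence "(%N. en extension_const * ?m N) ~~> en extension_const * 0" by (rule ennreal_tendsto_cmult[rotated]) simp
 hence lim: "(%N. en extension_const * ?m N) ~~> 0" by simp
 show ?thesis by (rule ennreal_tendsto_0_le[OF lim bound])
qed

lemma AE_nonpos_of_lincomb_limit:
 assumes u: "u:Hphi phi" and v: "v:Hphi phi" and w: "w:Hphi phi" "w = (%psi. a * u psi + b * v psi)"
 and measurable: "!!N. D N:bml" "D':bml" and lim: "AL x. (%N. D N x) ~~> D' x"
 and bound: "!!N. AL x. D N x <= cmod (T (%y. partial_sum w N y - (a * partial_sum u N y + b * partial_sum v N y)) x)"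
 shows "AL x. D' x <= 0"
proof (rule AE_nonpos_of_modular_null[OF measurable lim bound])
 let ?e = "%N y. partial_sum w N y - (a * partial_sum u N y + b * partial_sum v N y)"
 note bsupp = bsupp_partial_sum[OF u] bsupp_partial_sum[OF v] bsupp_partial_sum[OF w(1)]
 have e: "?e N = (%y. 1 * partial_sum w N y + (- 1)*(a * partial_sum u N y + b * partial_sum v N y))" for N by (simp add: fun_eq_iff)
 have dist: "dist_of (?e N) = (%psi. (- 1) * remainder w N psi + 1*(a * remainder u N psi + b * remainder v N psi))" for N
  unfolding e dist_of_lincomb[OF bsupp(3) bsupp_lincomb[OF bsupp(1,2)]] dist_of_lincomb[OF bsupp(1,2)]
  by (simp add: remainder_def w(2) algebra_simps)
 have null: "modular_null (%N. dist_of (?e N))"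
  unfolding dist by (intro modular_null_lincomb modular_null_remainder u v w(1))
 have "L2 (?e N)" for N by (intro bsupp_L2 bsupp_diff bsupp_lincomb bsupp)
 thus "(%N. modular (%x. en (cmod (T (?e N) x)))) ~~> 0" by (rule operator_modular_null[OF _ null])
qed

lemma extension_linear:
 assumes lin: "linear_L2 T" and u: "u:Hphi phi" and v: "v:Hphi phi"
 shows "AL x. extension (%psi. a * u psi + b * v psi) x = a * extension u x + b * extension v x"
proof -
 define w where "w = (%psi. a * u psi + b * v psi)"
 have w: "w:Hphi phi" unfolding w_def by (rule Hphi_lincomb[OF u v])
 let ?S = "%u N. partial_sum u N"
 note [measurable] = T_partial_sum_measurable[OF u] T_partial_sum_measurable[OF v] T_partial_sum_measurable[OF w]
  extension_measurable[OF u] extension_measurable[OF v] extension_measurable[OF w]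
 note L2 = partial_sum_L2[OF u] partial_sum_L2[OF v] partial_sum_L2[OF w]
 have "AL x. cmod (extension w x - (a * extension u x + b * extension v x)) <= 0"
 proof (rule AE_nonpos_of_lincomb_limit[OF u v w w_def, where D = "%N x. cmod (T (?S w N) x - (a * T (?S u N) x + b * T (?S v N) x))"])
  show "AL x. (%N. cmod (T (?S w N) x - (a * T (?S u N) x + b * T (?S v N) x))) ~~> cmod (extension w x - (a * extension u x + b * extension v x))"
   using extension_tendsto[OF u] extension_tendsto[OF v] extension_tendsto[OF w] by eventually_elim (intro tendsto_intros, auto)
  show "AL x. cmod (T (?S w N) x - (a * T (?S u N) x + b * T (?S v N) x)) <= cmod (T (%y. ?S w N y - (a * ?S u N y + b * ?S v N y)) x)" for N
   using cmod_operator_diff_le[OF T L2(3) L2_lincomb[OF L2(1,2)], of N a N b N] linear_L2_lincomb[OF lin L2(1,2), of a N b N]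
   by eventually_elim simp
 qed measurable
 thus ?thesis unfolding w_def[symmetric] by eventually_elim simp
qed

lemma extension_sublinear:
 assumes sub: "pos_sublinear_L2 T" and u: "u:Hphi phi" and v: "v:Hphi phi"
 shows "AL x. Re (extension (%psi. a * u psi + b * v psi) x) <= cmod a * Re (extension u x) + cmod b * Re (extension v x)"
proof -
 define w where "w = (%psi. a * u psi + b * v psi)"
 have w: "w:Hphi phi" unfolding w_def by (rule Hphi_lincomb[OF u v])
 let ?S = "%u N. partial_sum u N" and ?k = "cmod a" and ?l = "cmod b"
 note [measurable] = T_partial_sum_measurable[OF u] T_partial_sum_measurable[OF v] T_partial_sum_measurable[OF w]
  extension_measurable[OF u] extension_measurable[OF v] extension_measurable[OF w]
 note L2 = partial_sum_L2[OF u] partial_sum_L2[OF v] partial_sum_L2[OF w]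
 have "AL x. Re (extension w x) - (?k * Re (extension u x) + ?l * Re (extension v x)) <= 0"
 proof (rule AE_nonpos_of_lincomb_limit[OF u v w w_def, where D = "%N x. Re (T (?S w N) x) - (?k * Re (T (?S u N) x) + ?l * Re (T (?S v N) x))"])
  show "AL x. (%N. Re (T (?S w N) x) - (?k * Re (T (?S u N) x) + ?l * Re (T (?S v N) x))) ~~> Re (extension w x) - (?k * Re (extension u x) + ?l * Re (extension v x))"
   using extension_tendsto[OF u] extension_tendsto[OF v] extension_tendsto[OF w] by eventually_elim (intro tendsto_intros, auto)
  show "AL x. Re (T (?S w N) x) - (?k * Re (T (?S u N) x) + ?l * Re (T (?S v N) x)) <= cmod (T (%y. ?S w N y - (a * ?S u N y + b * ?S v N y)) x)" for N
   using cmod_operator_diff_le[OF T L2(3) L2_lincomb[OF L2(1,2)], of N a N b N]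
  proof eventually_elim
   case (elim x)
   thus ?case using pos_sublinear_L2_lincomb[OF sub L2(1,2), of a N b N x]
    complex_Re_le_cmod[of "T (?S w N) x - T (%y. a * ?S u N y + b * ?S v N y) x"] by simp
  qed
 qed measurable
 thus ?thesis unfolding w_def[symmetric] by eventually_elim simp
qed

lemma extension_nonneg:
 assumes sub: "pos_sublinear_L2 T" and u: "u:Hphi phi"
 shows "AL x. Im (extension u x) = 0 & Re (extension u x) >= 0"
 using extension_tendsto[OF u]
proof eventually_elim
 case (elim x)
 note signs = pos_sublinear_L2D(1,2)[OF sub partial_sum_L2[OF u]]
 have lim: "(%N. Im (T (partial_sum u N) x)) ~~> Im (extension u x)" "(%N. Re (T (partial_sum u N) x)) ~~> Re (extension u x)"
  using elim by (auto intro: tendsto_Im tendsto_Re)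
 have "Im (extension u x) = 0" using lim(1) by (simp add: signs(1) LIMSEQ_const_iff)
 moreover have "0 <= Re (extension u x)" by (rule LIMSEQ_le_const[OF lim(2)]) (use signs(2) in auto)
 ultimately show ?case by simp
qed

lemma extension_Lphi:
 assumes u: "u:Hphi phi" shows "Lphi phi (extension u)"
proof -
 note [measurable] = extension_measurable[OF u]
 have "en extension_const * modular (%x. gmax u x / en 1) < \<infinity>" using u by (simp add: Hphi_iff ennreal_mult_less_top del: ennreal_1)
 with extension_modular_bound[OF u, of 1] have "modular (%x. en (cmod (extension u x))) < \<infinity>" by (simp add: le_less_trans del: ennreal_1)
 thus ?thesis unfolding Lphi_def Lphi_E_iff by simp
qed

lemma extension_norm_bound: "EX C. ALL u:Hphi phi. Lphi_norm phi (extension u) <= C * Hphi_norm phi u"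
proof -
 obtain M where M: "ALL f g. f:bml --> Lphi_E phi g --> (ALL lam>0. modular (%x. f x / en lam) <= en extension_const * modular (%x. g x / en lam)) --> Lnorm_E phi f <= M * Lnorm_E phi g" using Lnorm_E_comparison[OF extension_const_nonneg] by blast
 have "Lphi_norm phi (extension u) <= M * Hphi_norm phi u" if u: "u:Hphi phi" for u
  unfolding Lphi_norm_def Hphi_norm_def
  by (rule M[rule_format]) (use u extension_measurable[OF u] extension_modular_bound[OF u] in "auto simp: Hphi_def")
 thus ?thesis by blast
qed

theorem bounded_extension_extension: "bounded_extension phi T extension"
 unfolding bounded_extension_def
proof (intro conjI impI allI ballI)
 have add: "dist_add u v = (%psi. 1 * u psi + 1 * v psi)" and scale: "dist_scale k u = (%psi. k * u psi + 0 * u psi)" for u v :: "'n fn => complex" and k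
  by (auto simp: dist_add_def dist_scale_def)
 show "AL x. extension (dist_add u v) x = extension u x + extension v x" if "linear_L2 T" "u:Hphi phi" "v:Hphi phi" for u v
  using extension_linear[OF that, of 1 1] unfolding add by simp
 show "AL x. extension (dist_scale k u) x = k * extension u x" if "linear_L2 T" "u:Hphi phi" for k u
  using extension_linear[OF that that(2), of k 0] unfolding scale by simp
 show "AL x. Re (extension (dist_scale k u) x) <= cmod k * Re (extension u x)" if "pos_sublinear_L2 T" "u:Hphi phi" for k u
  using extension_sublinear[OF that that(2), of k 0] unfolding scale by simp
 show "AL x. Re (extension (dist_add u v) x) <= Re (extension u x) + Re (extension v x)" if "pos_sublinear_L2 T" "u:Hphi phi" "v:Hphi phi" for u v
  using extension_sublinear[OF that, of 1 1] unfolding add by simp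
qed (use extension_agrees extension_Lphi extension_norm_bound extension_nonneg in auto)

lemma bounded_extension_remainder_null:
 assumes T': "bounded_extension phi T T'" and u: "u:Hphi phi"
 shows "(%N. modular (%x. en (cmod (T' (remainder u N) x)))) ~~> 0"
proof (rule Phi_modular_tendsto_0)
 obtain C where C: "!!u. u:Hphi phi ==> Lphi_norm phi (T' u) <= C * Hphi_norm phi u" using bounded_extensionD(3)[OF T'] by blast
 show E: "Lphi_E phi (%x. en (cmod (T' (remainder u N) x)))" for N
  using bounded_extensionD(2)[OF T' remainder_Hphi[OF u]] by (simp add: Lphi_def)
 have "(%N. Hphi_norm phi (remainder u N)) ~~> 0"
  unfolding Hphi_norm_def using remainder_Hphi[OF u] by (intro Lnorm_E_tendsto_0 remainder_modular(1)[OF u]) (auto simp: Hphi_def)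
 hence lim: "(%N. C * Hphi_norm phi (remainder u N)) ~~> 0" by (rule tendsto_mult_right_zero)
 show "(%N. Lnorm_E phi (%x. en (cmod (T' (remainder u N) x)))) ~~> 0"
  by (rule tendsto_sandwich[OF always_eventually always_eventually tendsto_const lim])
  (intro allI Lnorm_E_nonneg E C[OF remainder_Hphi[OF u], unfolded Lphi_norm_def])+
qed

theorem extension_unique:
 assumes T': "bounded_extension phi T T'" and u: "u:Hphi phi"
 shows "AL x. T' u x = extension u x"
proof -
 let ?S = "%N. partial_sum u N"
 have "T' u:bml" using bounded_extensionD(2)[OF T' u] by (simp add: Lphi_def)
 note [measurable] = this extension_measurable[OF u] T_partial_sum_measurable[OF u]
 have "AL x. cmod (T' u x - T (?S N) x) <= cmod (T' (remainder u N) x)" for N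
 proof -
  have "dist_scale (- 1) (remainder u N):Hphi phi"
   using Hphi_lincomb[OF remainder_Hphi[OF u] remainder_Hphi[OF u], of "-1" N 0 N] by (simp add: dist_scale_def)
  hence "AL x. cmod (T' u x - T' (dist_of (?S N)) x) <= cmod (T' (remainder u N) x)"
   by (intro cmod_bounded_extension_diff_le[OF T T' u partial_sum_Hphi[OF u]] remainder_Hphi u)
   (auto simp: remainder_def dist_add_def dist_scale_def)
  with bounded_extensionD(1)[OF T' partial_sum_L2[OF u, of N] partial_sum_Hphi[OF u, of N]] show ?thesis by eventually_elim simp
 qed
 hence "AL x. cmod (T' u x - extension u x) <= 0"
 proof (rule AE_nonpos_of_modular_null[rotated 3])
  show "AL x. (%N. cmod (T' u x - T (?S N) x)) ~~> cmod (T' u x - extension u x)"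
   using extension_tendsto[OF u] by eventually_elim (intro tendsto_intros, auto)
  show "(%N. modular (%x. en (cmod (T' (remainder u N) x)))) ~~> 0" by (rule bounded_extension_remainder_null[OF T' u])
 qed measurable
 thus ?thesis by eventually_elim simp
qed

end

lemma admissible_exponent_cases:
 assumes "growth_function phi" "admissible phi q s" shows "q = \<infinity> | (EX q'>0. q = ereal q')"
proof -
 have "q_phi phi >= 1"
  unfolding q_phi_def using assms(1) by (intro cInf_greatest) (auto simp: growth_function_def A_infty_def)
 thus ?thesis using assms(2) by (cases q) (auto simp: admissible_def)
qed

theorem theorem3p11:
  fixes \<phi> :: "real^'n \<Rightarrow> real \<Rightarrow> real"
    and q :: ereal and s :: nat
    and T :: "(real^'n \<Rightarrow> complex) \<Rightarrow> (real^'n \<Rightarrow> complex)"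
  assumes "growth_function \<phi>"
    and "admissible \<phi> q s"
    and "linear_L2 T \<or> pos_sublinear_L2 T"
    and "bounded_L2 T"
    and "\<exists>C>0. \<forall>lam>0. \<forall>a B c. atom \<phi> q s a B \<longrightarrow> L2 (\<lambda>x. c * a x) \<longrightarrow>
           (\<integral>\<^sup>+ x. ennreal (\<phi> x (cmod (T (\<lambda>y. c * a y) x) / lam)) \<partial>lebesgue)
             \<le> ennreal (C * phi_set \<phi> B (Lq_phi_norm \<phi> q B (\<lambda>y. c * a y) / lam))"
  shows "\<exists>Tt. bounded_extension \<phi> T Tt \<and>
           (\<forall>T'. bounded_extension \<phi> T T' \<longrightarrow>
              (\<forall>u \<in> Hphi \<phi>. AE x in lebesgue. T' u x = Tt u x))"
proof -
 obtain K p q0 where "growth \<phi> K p q0" using growth_locale_exists[OF assms(1)] by blast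
 then interpret growth \<phi> K p q0 .
 obtain theta :: "('n => nat) => 'n fn" and dual_bound where "dual_bound > 0"
  and dual: "!!mu. sum mu UNIV <= s ==> theta mu:borel_measurable borel & (ALL x. cmod (theta mu x) <= dual_bound) & (ALL x. x~:ball 0 1 --> theta mu x = 0) & (ALL nu. sum nu UNIV <= s --> (LI x. theta mu x * monom_fn nu x) = (if mu = nu then 1 else 0))"
  using moment_dual_functions_exist[of s, where 'n = 'n] by blast
 obtain C where C: "C > 0" and atoms: "!!lam a B c. lam > 0 ==> atom \<phi> q s a B ==> L2 (%x. c * a x) ==> (NN x. en (\<phi> x (cmod (T (%y. c * a y) x) / lam))) <= en (C * phi_set \<phi> B (Lq_phi_norm \<phi> q B (%y. c * a y) / lam))"
  using assms(5) by blast
 note bound = bounded_atom_operator_bound[OF atoms admissible_exponent_cases[OF assms(1,2)] less_imp_le[OF C]]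
 interpret atom_bounded_operator \<phi> K p q0 s theta dual_bound T "C*(2*K)"
  by unfold_locales (use assms \<open>dual_bound > 0\<close> dual bound C K_ge_1 in "auto simp: admissible_def")
 show ?thesis using bounded_extension_extension extension_unique by blast
qed

end
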